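(* Let $X$ be a cocompact Kobayashi hyperbolic complex manifold, and let $F=(f_1,\dots,f_k)$, $k\ge1$, be a $k$-tuple of commuting holomorphic self-maps of $X$. Then there exists a canonical Kobayashi hyperbolic semi-model (CSM) $(Z,\ell,T)$ for $F$, where $Z$ is a holomorphic retract of $X$. Moreover, for all $N\in\mathbb{N}^k$, $$\lim_{M\to\infty}(F^M)^*k_X=(T^{-N}\circ\ell)^*k_Z,\qquad \lim_{M\to\infty}(F^M)^*\kappa_X=(T^{-N}\circ\ell)^*\kappa_Z.$$
   Context: Complex manifolds are connected. $k_X$ is the Kobayashi pseudodistance and $\kappa_X$ the Kobayashi pseudometric of $X$; $X$ is Kobayashi hyperbolic if $k_X$ is a distance. $X$ is cocompact if $X/\mathrm{aut}(X)$ is compact. For a holomorphic map $f\colon X\to Y$: $f^*k_Y(x,y)=k_Y(f(x),f(y))$ and $f^*\kappa_Y(x,v)=\kappa_Y(f(x),d_xf(v))$, $v\in T_xX$. $\mathbb{N}^k$ (with $0\in\mathbb{N}$) is ordered componentwise; for a $k$-sequence $(a_M)_{M\in\mathbb{N}^k}$, $\lim_{M\to\infty}a_M=a$ means that for each neighborhood $W$ of $a$ there is $M_0$ with $a_M\in W$ for all $M\ge M_0$ (limits of functions are pointwise). For $N=(n_1,\dots,n_k)$, $F^N=f_1^{n_1}\circ\dots\circ f_k^{n_k}$; for a tuple of commuting automorphisms, $T^{-N}=(T^N)^{-1}$. A quasi-model for $F$ is a triple $(\Lambda,h,\Phi)$ with $\Lambda$ a complex manifold, $h\colon X\to\Lambda$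 holomorphic, $\Phi=(\varphi_1,\dots,\varphi_k)$ a $k$-tuple of commuting automorphisms of $\Lambda$ with $h\circ f_j=\varphi_j\circ h$ for all $j$. It is a semi-model if moreover $\bigcup_{N\in\mathbb{N}^k}\Phi^{-N}(h(X))=\Lambda$. A morphism $(Z,\ell,T)\to(\Lambda,h,\Phi)$, $T=(\tau_1,\dots,\tau_k)$, is a holomorphic map $\eta\colon Z\to\Lambda$ with $\eta\circ\ell=h$ and $\eta\circ\tau_j=\varphi_j\circ\eta$ for all $j$. A canonical Kobayashi hyperbolic semi-model (CSM) for $F$ is a semi-model $(Z,\ell,T)$ with $Z$ Kobayashi hyperbolic such that for every semi-model $(\Lambda,h,\Phi)$ with $\Lambda$ Kobayashi hyperbolic there is a morphism $(Z,\ell,T)\to(\Lambda,h,\Phi)$. A holomorphic retract of $X$ is the image of a holomorphic map $\rho\colon X\to X$ with $\rho\circ\rho=\rho$. *)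

theory Defs
  imports "HOL-Complex_Analysis.Complex_Analysis"
begin

section \<open>Holomorphic maps between open subsets of complex coordinate spaces\<close>

text \<open>
  The space \<open>\<complex>\<^sup>n\<close> is realised, like \<^const>\<open>Euclidean_space\<close> over the reals, as the set of sequences
  that vanish from index \<open>n\<close> on, so that \<open>n\<close> can vary inside a formula.
\<close>

definition Complex_space :: "nat \<Rightarrow> (nat \<Rightarrow> complex) topology" where
  "Complex_space n = top_of_set {z. \<forall>i\<ge>n. z i = 0}"

text \<open>
  For \<open>W\<close> open in \<open>\<complex>\<^sup>n\<close>: the first \<open>m\<close> components of \<open>g\<close> are continuous and holomorphic in each
  of the \<open>n\<close> variables.
\<close>

definition holomorphic_coord ::
    "nat \<Rightarrow> nat \<Rightarrow> ((nat \<Rightarrow> complex) \<Rightarrow> nat \<Rightarrow> complex) \<Rightarrow> (nat \<Rightarrow> complex) set \<Rightarrow> bool" where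
  "holomorphic_coord n m g W \<longleftrightarrow>
     (\<forall>i<m. continuous_on W (\<lambda>z. g z i) \<and>
        (\<forall>z\<in>W. \<forall>j<n. (\<lambda>t. g (z(j := t)) i) holomorphic_on {t. z(j := t) \<in> W}))"

definition jacobian_mult ::
    "nat \<Rightarrow> ((nat \<Rightarrow> complex) \<Rightarrow> nat \<Rightarrow> complex) \<Rightarrow> (nat \<Rightarrow> complex) \<Rightarrow> (nat \<Rightarrow> complex) \<Rightarrow> nat \<Rightarrow> complex" where
  "jacobian_mult n g z v = (\<lambda>i. \<Sum>j<n. deriv (\<lambda>t. g (z(j := t)) i) (z j) * v j)"


section \<open>Complex manifolds\<close>

text \<open>
  A chart is a pair of its domain and its coordinate map.  The underlying set of a manifold is
  the \<open>topspace\<close> of its topology; maps between manifolds are HOL functions of which only the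
  restriction to that set is relevant.
\<close>

type_synonym 'a chart = "'a set \<times> ('a \<Rightarrow> nat \<Rightarrow> complex)"

record 'a cmanifold =
  mtop :: "'a topology"
  mdim :: nat
  atlas :: "'a chart set"

abbreviation pts :: "'a cmanifold \<Rightarrow> 'a set" where
  "pts X \<equiv> topspace (mtop X)"

definition complex_manifold :: "'a cmanifold \<Rightarrow> bool" where
  "complex_manifold X \<longleftrightarrow>
     pts X \<noteq> {} \<and> connected_space (mtop X) \<and> Hausdorff_space (mtop X) \<and> second_countable (mtop X) \<and>
     (\<Union>(U, \<phi>)\<in>atlas X. U) = pts X \<and>
     (\<forall>(U, \<phi>)\<in>atlas X. openin (mtop X) U \<and> openin (Complex_space (mdim X)) (\<phi> ` U) \<and>
        homeomorphic_map (subtopology (mtop X) U) (subtopology (Complex_space (mdim X)) (\<phi> ` U)) \<phi>) \<and>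
     (\<forall>(U, \<phi>)\<in>atlas X. \<forall>(V, \<psi>)\<in>atlas X.
        holomorphic_coord (mdim X) (mdim X) (\<psi> \<circ> inv_into U \<phi>) (\<phi> ` (U \<inter> V)))"

definition holomorphic_map :: "'a cmanifold \<Rightarrow> 'b cmanifold \<Rightarrow> ('a \<Rightarrow> 'b) \<Rightarrow> bool" where
  "holomorphic_map X Y f \<longleftrightarrow>
     continuous_map (mtop X) (mtop Y) f \<and>
     (\<forall>(U, \<phi>)\<in>atlas X. \<forall>(V, \<psi>)\<in>atlas Y.
        holomorphic_coord (mdim X) (mdim Y) (\<psi> \<circ> f \<circ> inv_into U \<phi>) (\<phi> ` {x \<in> U. f x \<in> V}))"

definition automorphism :: "'a cmanifold \<Rightarrow> ('a \<Rightarrow> 'a) \<Rightarrow> bool" where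
  "automorphism X g \<longleftrightarrow>
     bij_betw g (pts X) (pts X) \<and> holomorphic_map X X g \<and> holomorphic_map X X (inv_into (pts X) g)"


section \<open>Tangent vectors and differentials\<close>

text \<open>
  A tangent vector at \<open>x\<close> is the family of its coordinate vectors in all charts around \<open>x\<close>, related
  by the Jacobians of the coordinate changes.  It is set to 0 on all other pairs, so that
  equality of tangent vectors is equality of functions.
\<close>

type_synonym 'a tangent_vector = "'a chart \<Rightarrow> nat \<Rightarrow> complex"

definition charts_at :: "'a cmanifold \<Rightarrow> 'a \<Rightarrow> 'a chart set" where
  "charts_at X x = {c \<in> atlas X. x \<in> fst c}"

definition tangent_space :: "'a cmanifold \<Rightarrow> 'a \<Rightarrow> 'a tangent_vector set" where
  "tangent_space X x =
     {v. (\<forall>c. c \<notin> charts_at X x \<longrightarrow> v c = (\<lambda>_. 0)) \<and>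
         (\<forall>c\<in>charts_at X x. v c \<in> topspace (Complex_space (mdim X))) \<and>
         (\<forall>(U, \<phi>)\<in>charts_at X x. \<forall>(V, \<psi>)\<in>charts_at X x.
            v (V, \<psi>) = jacobian_mult (mdim X) (\<psi> \<circ> inv_into U \<phi>) (\<phi> x) (v (U, \<phi>)))}"

text \<open>
  \<open>d\<^sub>xf(v)\<close> in the chart \<open>(V, \<psi>)\<close> of \<open>Y\<close>, computed in some chart of \<open>X\<close> around \<open>x\<close>; for
  holomorphic \<open>f\<close> and \<open>v \<in> T\<^sub>xX\<close> the choice of this chart is irrelevant by the chain rule.
\<close>

definition differential ::
    "'a cmanifold \<Rightarrow> 'b cmanifold \<Rightarrow> ('a \<Rightarrow> 'b) \<Rightarrow> 'a \<Rightarrow> 'a tangent_vector \<Rightarrow> 'b tangent_vector" where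
  "differential X Y f x v = (\<lambda>(V, \<psi>).
     if (V, \<psi>) \<in> charts_at Y (f x)
     then let (U, \<phi>) = (SOME c. c \<in> charts_at X x)
          in jacobian_mult (mdim X) (\<psi> \<circ> f \<circ> inv_into U \<phi>) (\<phi> x) (v (U, \<phi>))
     else (\<lambda>_. 0))"


section \<open>Submanifolds and holomorphic retracts\<close>

text \<open>
  Embedded submanifolds: the inclusion is a holomorphic immersion and a homeomorphism onto its
  image.  This determines the complex structure on the subset.
\<close>

definition complex_submanifold :: "'a cmanifold \<Rightarrow> 'a cmanifold \<Rightarrow> bool" where
  "complex_submanifold Z X \<longleftrightarrow>
     complex_manifold Z \<and> pts Z \<subseteq> pts X \<and> mtop Z = subtopology (mtop X) (pts Z) \<and>
     holomorphic_map Z X (\<lambda>z. z) \<and>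
     (\<forall>z\<in>pts Z. inj_on (differential Z X (\<lambda>z. z) z) (tangent_space Z z))"

definition holomorphic_retract :: "'a cmanifold \<Rightarrow> 'a cmanifold \<Rightarrow> bool" where
  "holomorphic_retract Z X \<longleftrightarrow>
     complex_submanifold Z X \<and>
     (\<exists>\<rho>. holomorphic_map X X \<rho> \<and> (\<forall>x\<in>pts X. \<rho> (\<rho> x) = \<rho> x) \<and> \<rho> ` pts X = pts Z)"


section \<open>Kobayashi pseudodistance and pseudometric\<close>

definition disc_chart :: "complex chart" where
  "disc_chart = (ball 0 1, \<lambda>z i. if i = 0 then z else 0)"

definition unit_disc :: "complex cmanifold" where
  "unit_disc = \<lparr>mtop = top_of_set (ball 0 1), mdim = 1, atlas = {disc_chart}\<rparr>"

definition disc_vector :: "complex \<Rightarrow> complex tangent_vector" where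
  "disc_vector \<xi> = (\<lambda>c i. if c = disc_chart \<and> i = 0 then \<xi> else 0)"

text \<open>
  The Poincare distance is normalised as the integrated form of \<open>\<bar>dz\<bar> / (1 - \<bar>z\<bar>\<^sup>2)\<close>, which makes
  it consistent with the normalisation of the Kobayashi pseudometric below.
\<close>

definition poincare_dist :: "complex \<Rightarrow> complex \<Rightarrow> real" where
  "poincare_dist a b = artanh (cmod ((a - b) / (1 - cnj a * b)))"

definition kobayashi_dist :: "'a cmanifold \<Rightarrow> 'a \<Rightarrow> 'a \<Rightarrow> real" where
  "kobayashi_dist X x y =
     (if x \<in> pts X \<and> y \<in> pts X
      then Inf {\<Sum>j<m. poincare_dist (a j) (b j) | m a b p \<phi>.
             1 \<le> m \<and> p 0 = x \<and> p m = y \<and>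
             (\<forall>j<m. holomorphic_map unit_disc X (\<phi> j) \<and> a j \<in> ball 0 1 \<and> b j \<in> ball 0 1 \<and>
                    \<phi> j (a j) = p j \<and> \<phi> j (b j) = p (Suc j))}
      else 0)"

definition kobayashi_metric :: "'a cmanifold \<Rightarrow> 'a \<Rightarrow> 'a tangent_vector \<Rightarrow> real" where
  "kobayashi_metric X x v =
     Inf {cmod \<xi> | \<xi> \<phi>. holomorphic_map unit_disc X \<phi> \<and> \<phi> 0 = x \<and>
            differential unit_disc X \<phi> 0 (disc_vector \<xi>) = v}"

definition kobayashi_hyperbolic :: "'a cmanifold \<Rightarrow> bool" where
  "kobayashi_hyperbolic X \<longleftrightarrow> Metric_space (pts X) (kobayashi_dist X)"


section \<open>Cocompactness\<close>

definition aut_orbit :: "'a cmanifold \<Rightarrow> 'a \<Rightarrow> 'a set" where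
  "aut_orbit X x = {g x | g. automorphism X g}"

definition orbit_space :: "'a cmanifold \<Rightarrow> 'a set topology" where
  "orbit_space X = topology (\<lambda>S. S \<subseteq> aut_orbit X ` pts X \<and> openin (mtop X) {x \<in> pts X. aut_orbit X x \<in> S})"

lemma openin_orbit_space:
  "openin (orbit_space X) S \<longleftrightarrow>
     S \<subseteq> aut_orbit X ` pts X \<and> openin (mtop X) {x \<in> pts X. aut_orbit X x \<in> S}"
proof -
  have "istopology (\<lambda>S. S \<subseteq> aut_orbit X ` pts X \<and> openin (mtop X) {x \<in> pts X. aut_orbit X x \<in> S})"
    unfolding istopology_def
  proof (intro conjI allI impI; (elim conjE)?)
    fix S T
    assume "openin (mtop X) {x \<in> pts X. aut_orbit X x \<in> S}"
      and "openin (mtop X) {x \<in> pts X. aut_orbit X x \<in> T}"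
    then have "openin (mtop X) ({x \<in> pts X. aut_orbit X x \<in> S} \<inter> {x \<in> pts X. aut_orbit X x \<in> T})"
      by blast
    moreover have "{x \<in> pts X. aut_orbit X x \<in> S} \<inter> {x \<in> pts X. aut_orbit X x \<in> T} =
        {x \<in> pts X. aut_orbit X x \<in> S \<inter> T}"
      by blast
    ultimately show "openin (mtop X) {x \<in> pts X. aut_orbit X x \<in> S \<inter> T}"
      by simp
  next
    fix K
    assume K: "\<forall>S\<in>K. S \<subseteq> aut_orbit X ` pts X \<and> openin (mtop X) {x \<in> pts X. aut_orbit X x \<in> S}"
    have "openin (mtop X) (\<Union>S\<in>K. {x \<in> pts X. aut_orbit X x \<in> S})"
      using K by blast
    moreover have "(\<Union>S\<in>K. {x \<in> pts X. aut_orbit X x \<in> S}) = {x \<in> pts X. aut_orbit X x \<in> \<Union>K}"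
      by blast
    ultimately show "openin (mtop X) {x \<in> pts X. aut_orbit X x \<in> \<Union>K}"
      by simp
  qed auto
  then show ?thesis
    by (simp add: orbit_space_def)
qed

definition cocompact :: "'a cmanifold \<Rightarrow> bool" where
  "cocompact X \<longleftrightarrow> compact_space (orbit_space X)"


section \<open>Tuples of commuting maps\<close>

text \<open>A \<open>k\<close>-tuple of maps is a sequence of which only the entries with index less than \<open>k\<close> matter.\<close>

definition multi_indices :: "nat \<Rightarrow> (nat \<Rightarrow> nat) set" where
  "multi_indices k = {N. \<forall>j\<ge>k. N j = 0}"

definition multi_at_top :: "nat \<Rightarrow> (nat \<Rightarrow> nat) filter" where
  "multi_at_top k = (INF M\<^sub>0\<in>multi_indices k. principal {M \<in> multi_indices k. M\<^sub>0 \<le> M})"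

lemma eventually_multi_at_top:
  "eventually P (multi_at_top k) \<longleftrightarrow>
     (\<exists>M\<^sub>0\<in>multi_indices k. \<forall>M\<in>multi_indices k. M\<^sub>0 \<le> M \<longrightarrow> P M)"
proof -
  have "eventually P (multi_at_top k) \<longleftrightarrow>
      (\<exists>M\<^sub>0\<in>multi_indices k. eventually P (principal {M \<in> multi_indices k. M\<^sub>0 \<le> M}))"
    unfolding multi_at_top_def
  proof (rule eventually_INF_base)
    show "multi_indices k \<noteq> {}"
      by (auto simp: multi_indices_def)
    fix A B
    assume "A \<in> multi_indices k" "B \<in> multi_indices k"
    then show "\<exists>C\<in>multi_indices k. principal {M \<in> multi_indices k. C \<le> M} \<le>
        inf (principal {M \<in> multi_indices k. A \<le> M}) (principal {M \<in> multi_indices k. B \<le> M})"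
      by (intro bexI[of _ "sup A B"]) (auto simp: multi_indices_def)
  qed
  then show ?thesis
    by (auto simp: eventually_principal)
qed

primrec tuple_pow :: "(nat \<Rightarrow> 'a \<Rightarrow> 'a) \<Rightarrow> (nat \<Rightarrow> nat) \<Rightarrow> nat \<Rightarrow> 'a \<Rightarrow> 'a" where
  "tuple_pow f N 0 = id"
| "tuple_pow f N (Suc k) = tuple_pow f N k \<circ> (f k ^^ N k)"

definition commuting_on :: "'a set \<Rightarrow> nat \<Rightarrow> (nat \<Rightarrow> 'a \<Rightarrow> 'a) \<Rightarrow> bool" where
  "commuting_on A k f \<longleftrightarrow> (\<forall>i<k. \<forall>j<k. \<forall>x\<in>A. f i (f j x) = f j (f i x))"

text \<open>\<open>T\<^bsup>-N\<^esup>\<close> for a tuple of automorphisms of \<open>Z\<close>.\<close>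

definition tuple_pow_inv :: "'a cmanifold \<Rightarrow> (nat \<Rightarrow> 'a \<Rightarrow> 'a) \<Rightarrow> (nat \<Rightarrow> nat) \<Rightarrow> nat \<Rightarrow> 'a \<Rightarrow> 'a" where
  "tuple_pow_inv Z T N k = inv_into (pts Z) (tuple_pow T N k)"


section \<open>Semi-models\<close>

definition quasi_model ::
    "'a cmanifold \<Rightarrow> nat \<Rightarrow> (nat \<Rightarrow> 'a \<Rightarrow> 'a) \<Rightarrow> 'b cmanifold \<Rightarrow> ('a \<Rightarrow> 'b) \<Rightarrow> (nat \<Rightarrow> 'b \<Rightarrow> 'b) \<Rightarrow> bool" where
  "quasi_model X k f L h \<Phi> \<longleftrightarrow>
     complex_manifold L \<and> holomorphic_map X L h \<and>
     (\<forall>j<k. automorphism L (\<Phi> j)) \<and> commuting_on (pts L) k \<Phi> \<and>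
     (\<forall>j<k. \<forall>x\<in>pts X. h (f j x) = \<Phi> j (h x))"

definition semi_model ::
    "'a cmanifold \<Rightarrow> nat \<Rightarrow> (nat \<Rightarrow> 'a \<Rightarrow> 'a) \<Rightarrow> 'b cmanifold \<Rightarrow> ('a \<Rightarrow> 'b) \<Rightarrow> (nat \<Rightarrow> 'b \<Rightarrow> 'b) \<Rightarrow> bool" where
  "semi_model X k f L h \<Phi> \<longleftrightarrow>
     quasi_model X k f L h \<Phi> \<and>
     (\<Union>N\<in>multi_indices k. tuple_pow_inv L \<Phi> N k ` h ` pts X) = pts L"

definition model_morphism ::
    "'a cmanifold \<Rightarrow> nat \<Rightarrow> 'b cmanifold \<Rightarrow> ('a \<Rightarrow> 'b) \<Rightarrow> (nat \<Rightarrow> 'b \<Rightarrow> 'b) \<Rightarrow>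
     'c cmanifold \<Rightarrow> ('a \<Rightarrow> 'c) \<Rightarrow> (nat \<Rightarrow> 'c \<Rightarrow> 'c) \<Rightarrow> ('b \<Rightarrow> 'c) \<Rightarrow> bool" where
  "model_morphism X k Z l T L h \<Phi> \<eta> \<longleftrightarrow>
     holomorphic_map Z L \<eta> \<and> (\<forall>x\<in>pts X. \<eta> (l x) = h x) \<and>
     (\<forall>j<k. \<forall>z\<in>pts Z. \<eta> (T j z) = \<Phi> j (\<eta> z))"

text \<open>
  HOL cannot quantify over types inside a formula, so the type \<open>'c\<close> of the points of the competing
  semi-models is a parameter.  It does not restrict them: a complex manifold has at most continuum
  many points, hence a copy whose points are real numbers, and the lemma \<open>csm_carrier\<close> below
  shows that the property for \<open>'c = real\<close> implies it for every type, with the same \<open>(Z, l, T)\<close>.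
\<close>

definition csm ::
    "'c itself \<Rightarrow> 'a cmanifold \<Rightarrow> nat \<Rightarrow> (nat \<Rightarrow> 'a \<Rightarrow> 'a) \<Rightarrow>
     'b cmanifold \<Rightarrow> ('a \<Rightarrow> 'b) \<Rightarrow> (nat \<Rightarrow> 'b \<Rightarrow> 'b) \<Rightarrow> bool" where
  "csm _ X k f Z l T \<longleftrightarrow>
     semi_model X k f Z l T \<and> kobayashi_hyperbolic Z \<and>
     (\<forall>(L :: 'c cmanifold) h \<Phi>. semi_model X k f L h \<Phi> \<and> kobayashi_hyperbolic L \<longrightarrow>
        (\<exists>\<eta>. model_morphism X k Z l T L h \<Phi> \<eta>))"


section \<open>Independence of the type of points of the competing semi-models\<close>

lemma holomorphic_coord_cong:
  assumes "holomorphic_coord n m g W" "\<And>z. z \<in> W \<Longrightarrow> g z = g' z"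
  shows "holomorphic_coord n m g' W"
  unfolding holomorphic_coord_def
proof (intro allI impI conjI ballI)
  fix i assume i: "i < m"
  show "continuous_on W (\<lambda>z. g' z i)"
  proof (rule continuous_on_eq)
    show "continuous_on W (\<lambda>z. g z i)"
      using assms(1) i unfolding holomorphic_coord_def by blast
  qed (simp add: assms(2))
  fix z j assume z: "z \<in> W" and j: "j < n"
  have "(\<lambda>t. g (z(j := t)) i) holomorphic_on {t. z(j := t) \<in> W}"
    using assms i z j unfolding holomorphic_coord_def by blast
  then show "(\<lambda>t. g' (z(j := t)) i) holomorphic_on {t. z(j := t) \<in> W}"
    by (rule holomorphic_transform) (use assms in auto)
qed

lemma chart_ok:
  assumes L: "complex_manifold L" and c: "(U, \<phi>) \<in> atlas L"
  shows "U \<subseteq> pts L \<and> inj_on \<phi> U"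
proof -
  have o: "openin (mtop L) U" and
    h: "homeomorphic_map (subtopology (mtop L) U) (subtopology (Complex_space (mdim L)) (\<phi> ` U)) \<phi>"
    using L c unfolding complex_manifold_def by auto
  have "U \<subseteq> pts L" using o by (rule openin_subset)
  then show ?thesis
    using homeomorphic_imp_injective_map[OF h] by (simp add: Int_absorb1)
qed

lemma holomorphic_map_cong:
  assumes A: "complex_manifold A" and f: "holomorphic_map A B f"
    and eq: "\<And>x. x \<in> pts A \<Longrightarrow> f x = f' x"
  shows "holomorphic_map A B f'"
proof -
  have "continuous_map (mtop A) (mtop B) f'"
    using f eq unfolding holomorphic_map_def by (blast intro: continuous_map_eq)
  moreover have "holomorphic_coord (mdim A) (mdim B) (\<psi> \<circ> f' \<circ> inv_into U \<phi>) (\<phi> ` {x \<in> U. f' x \<in> V})"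
    if c: "(U, \<phi>) \<in> atlas A" "(V, \<psi>) \<in> atlas B" for U \<phi> V \<psi>
  proof -
    have eq': "{x \<in> U. f' x \<in> V} = {x \<in> U. f x \<in> V}"
      using chart_ok[OF A c(1)] eq by (metis (mono_tags, lifting) subset_iff)
    have "holomorphic_coord (mdim A) (mdim B) (\<psi> \<circ> f \<circ> inv_into U \<phi>) (\<phi> ` {x \<in> U. f x \<in> V})"
      using f c unfolding holomorphic_map_def by blast
    then show ?thesis
      unfolding eq'
    proof (rule holomorphic_coord_cong)
      fix z assume "z \<in> \<phi> ` {x \<in> U. f x \<in> V}"
      then obtain x where "x \<in> U" "z = \<phi> x"
        by blast
      then show "(\<psi> \<circ> f \<circ> inv_into U \<phi>) z = (\<psi> \<circ> f' \<circ> inv_into U \<phi>) z"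
        using chart_ok[OF A c(1)] eq by (simp add: inv_into_f_f subset_iff)
    qed
  qed
  ultimately show ?thesis
    unfolding holomorphic_map_def by blast
qed

lemma manifold_inj_real:
  fixes L :: "'c cmanifold"
  assumes L: "complex_manifold L"
  shows "\<exists>g :: 'c \<Rightarrow> real. inj_on g (pts L)"
proof -
  have "second_countable (mtop L)" and haus: "Hausdorff_space (mtop L)"
    using L unfolding complex_manifold_def by blast+
  then obtain \<B> where \<B>: "countable \<B>"
    "\<forall>U x. openin (mtop L) U \<and> x \<in> U \<longrightarrow> (\<exists>V\<in>\<B>. x \<in> V \<and> V \<subseteq> U)"
    unfolding second_countable_def by metis
  define s where "s = (\<lambda>x. to_nat_on \<B> ` {V \<in> \<B>. x \<in> V})"
  have "inj_on s (pts L)"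
  proof (rule inj_onI, rule ccontr)
    fix x y assume xy: "x \<in> pts L" "y \<in> pts L" "s x = s y" "x \<noteq> y"
    then obtain U V where "openin (mtop L) U" "x \<in> U" "y \<in> V" "disjnt U V"
      using haus unfolding Hausdorff_space_def by metis
    then obtain V where V: "V \<in> \<B>" "x \<in> V" "y \<notin> V"
      using \<B>(2) unfolding disjnt_iff by (metis subsetD)
    then have "to_nat_on \<B> V \<in> s y"
      using xy(3) unfolding s_def by blast
    then obtain V' where "V' \<in> \<B>" "y \<in> V'" "to_nat_on \<B> V = to_nat_on \<B> V'"
      unfolding s_def by blast
    then show False
      using V \<B>(1) by (metis to_nat_on_inj)
  qed
  moreover obtain r :: "nat set \<Rightarrow> real" where "inj r"
    using nat_sets_eqpoll_reals unfolding eqpoll_def bij_betw_def by blast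
  ultimately have "inj_on (r \<circ> s) (pts L)"
    by (rule comp_inj_on[OF _ inj_on_subset]) simp
  then show ?thesis by blast
qed

text \<open>The copy of \<open>L\<close> along a map \<open>g\<close> that is injective on its points.\<close>

definition transport :: "('a \<Rightarrow> 'b) \<Rightarrow> 'a cmanifold \<Rightarrow> 'b cmanifold" where
  "transport g L =
     \<lparr>mtop = pullback_topology (g ` pts L) (inv_into (pts L) g) (mtop L), mdim = mdim L,
      atlas = (\<lambda>(U, \<phi>). (g ` U, \<phi> \<circ> inv_into (pts L) g)) ` atlas L\<rparr>"

context
  fixes L :: "'b cmanifold" and g :: "'b \<Rightarrow> 'd"
  assumes L: "complex_manifold L" and g: "inj_on g (pts L)"
begin

abbreviation (input) "gi \<equiv> inv_into (pts L) g"
abbreviation (input) "L' \<equiv> transport g L"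

lemma gi: "x \<in> pts L \<Longrightarrow> gi (g x) = x"
  using g by (rule inv_into_f_f)

lemma pts_tr: "pts L' = g ` pts L"
  unfolding transport_def by (auto simp: topspace_pullback_topology inv_into_into)

lemma homeo: "homeomorphic_maps (mtop L) (mtop L') g gi"
proof -
  have "continuous_map (mtop L') (mtop L) gi"
    unfolding transport_def by (simp add: continuous_map_pullback[of "mtop L" "mtop L" id, simplified])
  moreover have "continuous_map (mtop L) (mtop L') g"
    unfolding transport_def
    by simp (rule continuous_map_pullback', auto intro: continuous_map_eq[OF continuous_map_id] simp: gi)
  ultimately show ?thesis
    unfolding homeomorphic_maps_def by (auto simp: pts_tr gi)
qed

lemma chart_sub:
  assumes "(U, \<phi>) \<in> atlas L" shows "U \<subseteq> pts L" "inj_on \<phi> U"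
  using chart_ok[OF L assms] by auto

lemma inv_chart:
  assumes c: "(U, \<phi>) \<in> atlas L" and S: "S \<subseteq> U" and z: "z \<in> \<phi> ` S"
  shows "inv_into (g ` U) (\<phi> \<circ> gi) z = g (inv_into U \<phi> z)"
proof -
  obtain x where x: "x \<in> S" "z = \<phi> x" using z by blast
  have xU: "x \<in> U" using x S by blast
  have "inj_on (\<phi> \<circ> gi) (g ` U)"
    using chart_sub[OF c] unfolding inj_on_def by (auto simp: gi subset_iff)
  moreover have "(\<phi> \<circ> gi) (g x) = z" using x xU chart_sub[OF c] by (auto simp: gi subset_iff)
  ultimately have "inv_into (g ` U) (\<phi> \<circ> gi) z = g x"
    using xU by (metis imageI inv_into_f_f)
  then show ?thesis using x xU chart_sub[OF c] by simp
qed


lemma image_tr: "U \<subseteq> pts L \<Longrightarrow> (\<phi> \<circ> gi) ` g ` U = \<phi> ` U"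
  unfolding image_comp by (rule image_cong) (simp_all add: gi subset_iff)

lemma ball_atlas_tr:
  "(\<forall>(V, \<psi>)\<in>atlas L'. P V \<psi>) \<longleftrightarrow> (\<forall>(V, \<psi>)\<in>atlas L. P (g ` V) (\<psi> \<circ> gi))"
  unfolding transport_def by auto

lemma mdim_tr: "mdim L' = mdim L"
  by (simp add: transport_def)

lemma hol_to:
  assumes A: "\<And>U \<phi>. (U, \<phi>) \<in> atlas A \<Longrightarrow> U \<subseteq> pts A \<and> inj_on \<phi> U"
    and h: "holomorphic_map A L h"
  shows "holomorphic_map A L' (g \<circ> h)"
proof -
  have "continuous_map (mtop A) (mtop L') (g \<circ> h)"
    using h homeo unfolding holomorphic_map_def homeomorphic_maps_def
    by (blast intro: continuous_map_compose)
  moreover have hp: "h \<in> pts A \<rightarrow> pts L"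
    using h unfolding holomorphic_map_def continuous_map_def by blast
  have "holomorphic_coord (mdim A) (mdim L) (\<psi> \<circ> gi \<circ> (g \<circ> h) \<circ> inv_into U \<phi>)
      (\<phi> ` {x \<in> U. (g \<circ> h) x \<in> g ` V})"
    if c: "(U, \<phi>) \<in> atlas A" "(V, \<psi>) \<in> atlas L" for U \<phi> V \<psi>
  proof -
    have eq: "{x \<in> U. (g \<circ> h) x \<in> g ` V} = {x \<in> U. h x \<in> V}"
    proof (intro Collect_cong conj_cong refl)
      fix x assume "x \<in> U"
      then have "h x \<in> pts L"
        using A[OF c(1)] hp by blast
      then show "((g \<circ> h) x \<in> g ` V) = (h x \<in> V)"
        using inj_on_image_mem_iff[OF g _ chart_sub(1)[OF c(2)]] by simp
    qed
    have "holomorphic_coord (mdim A) (mdim L) (\<psi> \<circ> h \<circ> inv_into U \<phi>) (\<phi> ` {x \<in> U. h x \<in> V})"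
      using h c unfolding holomorphic_map_def by blast
    then show ?thesis
      unfolding eq
    proof (rule holomorphic_coord_cong)
      fix z assume "z \<in> \<phi> ` {x \<in> U. h x \<in> V}"
      then obtain x where "x \<in> U" "z = \<phi> x"
        by blast
      moreover from this have "h x \<in> pts L"
        using A[OF c(1)] hp by blast
      ultimately show "(\<psi> \<circ> h \<circ> inv_into U \<phi>) z = (\<psi> \<circ> gi \<circ> (g \<circ> h) \<circ> inv_into U \<phi>) z"
        using A[OF c(1)] by (simp add: gi inv_into_f_f)
    qed
  qed
  ultimately show ?thesis
    unfolding holomorphic_map_def ball_atlas_tr mdim_tr by blast
qed

lemma hol_from:
  assumes A: "\<And>U \<phi>. (U, \<phi>) \<in> atlas A \<Longrightarrow> U \<subseteq> pts A \<and> inj_on \<phi> U"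
    and h: "holomorphic_map A L' h"
  shows "holomorphic_map A L (gi \<circ> h)"
proof -
  have "continuous_map (mtop A) (mtop L) (gi \<circ> h)"
    using h homeo unfolding holomorphic_map_def homeomorphic_maps_def
    by (blast intro: continuous_map_compose)
  moreover have hp: "h \<in> pts A \<rightarrow> g ` pts L"
    using h unfolding holomorphic_map_def continuous_map_def pts_tr by blast
  have "holomorphic_coord (mdim A) (mdim L) (\<psi> \<circ> (gi \<circ> h) \<circ> inv_into U \<phi>)
      (\<phi> ` {x \<in> U. (gi \<circ> h) x \<in> V})"
    if c: "(U, \<phi>) \<in> atlas A" "(V, \<psi>) \<in> atlas L" for U \<phi> V \<psi>
  proof -
    have "(gi y \<in> V) = (y \<in> g ` V)" if "y \<in> g ` pts L" for y
    proof -
      from that obtain x where "x \<in> pts L" "y = g x"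
        by blast
      then show ?thesis
        using inj_on_image_mem_iff[OF g _ chart_sub(1)[OF c(2)]] by (simp add: gi)
    qed
    moreover have "h x \<in> g ` pts L" if "x \<in> U" for x
      using that A[OF c(1)] hp by blast
    ultimately have eq: "{x \<in> U. (gi \<circ> h) x \<in> V} = {x \<in> U. h x \<in> g ` V}"
      by (intro Collect_cong conj_cong refl) simp
    have "holomorphic_coord (mdim A) (mdim L) ((\<psi> \<circ> gi) \<circ> h \<circ> inv_into U \<phi>) (\<phi> ` {x \<in> U. h x \<in> g ` V})"
      using h c unfolding holomorphic_map_def ball_atlas_tr mdim_tr by blast
    then show ?thesis
      unfolding eq by (simp add: comp_assoc)
  qed
  ultimately show ?thesis
    unfolding holomorphic_map_def by blast
qed

lemma hol_source:
  assumes h: "holomorphic_map L B h" shows "holomorphic_map L' B (h \<circ> gi)"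
proof -
  have "continuous_map (mtop L') (mtop B) (h \<circ> gi)"
    using h homeo unfolding holomorphic_map_def homeomorphic_maps_def
    by (blast intro: continuous_map_compose)
  moreover have "holomorphic_coord (mdim L) (mdim B) (\<psi> \<circ> (h \<circ> gi) \<circ> inv_into (g ` U) (\<phi> \<circ> gi))
      ((\<phi> \<circ> gi) ` {y \<in> g ` U. (h \<circ> gi) y \<in> V})"
    if c: "(U, \<phi>) \<in> atlas L" "(V, \<psi>) \<in> atlas B" for U \<phi> V \<psi>
  proof -
    have sub: "U \<subseteq> pts L" "inj_on \<phi> U"
      using chart_sub[OF c(1)] .
    have "gi (g x) = x" if "x \<in> U" for x
      using that sub gi by blast
    then have "{y \<in> g ` U. (h \<circ> gi) y \<in> V} = g ` {x \<in> U. h x \<in> V}"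
      by auto
    moreover have "{x \<in> U. h x \<in> V} \<subseteq> pts L"
      using sub by blast
    ultimately have eq: "(\<phi> \<circ> gi) ` {y \<in> g ` U. (h \<circ> gi) y \<in> V} = \<phi> ` {x \<in> U. h x \<in> V}"
      by (simp only: image_tr)
    have "holomorphic_coord (mdim L) (mdim B) (\<psi> \<circ> h \<circ> inv_into U \<phi>) (\<phi> ` {x \<in> U. h x \<in> V})"
      using h c unfolding holomorphic_map_def by blast
    then show ?thesis
      unfolding eq
    proof (rule holomorphic_coord_cong)
      fix z assume z: "z \<in> \<phi> ` {x \<in> U. h x \<in> V}"
      then have "inv_into U \<phi> z \<in> pts L"
        using sub by (blast intro: subsetD[OF sub(1)] inv_into_into)
      then show "(\<psi> \<circ> h \<circ> inv_into U \<phi>) z = (\<psi> \<circ> (h \<circ> gi) \<circ> inv_into (g ` U) (\<phi> \<circ> gi)) z"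
        using inv_chart[OF c(1) _ z] by (simp add: gi)
    qed
  qed
  ultimately show ?thesis
    unfolding holomorphic_map_def ball_atlas_tr mdim_tr by blast
qed

lemma manifold_tr: "complex_manifold L'"
proof -
  have hs: "mtop L homeomorphic_space mtop L'"
    using homeo unfolding homeomorphic_space_def by blast
  have gm: "homeomorphic_map (mtop L') (mtop L) gi"
    using homeo homeomorphic_maps_map homeomorphic_maps_sym by blast
  have gm': "homeomorphic_map (mtop L) (mtop L') g"
    using homeo homeomorphic_maps_map by blast
  have cov: "(\<Union>(U, \<phi>)\<in>atlas L'. U) = pts L'"
  proof -
    have "(\<Union>(U, \<phi>)\<in>atlas L'. U) = g ` (\<Union>(U, \<phi>)\<in>atlas L. U)"
      unfolding transport_def by force
    then show ?thesis
      using L unfolding complex_manifold_def pts_tr by simp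
  qed
  have "openin (mtop L') (g ` U)" "openin (Complex_space (mdim L)) ((\<phi> \<circ> gi) ` (g ` U))"
    "homeomorphic_map (subtopology (mtop L') (g ` U))
       (subtopology (Complex_space (mdim L)) ((\<phi> \<circ> gi) ` (g ` U))) (\<phi> \<circ> gi)"
    if c: "(U, \<phi>) \<in> atlas L" for U \<phi>
  proof -
    have sub: "U \<subseteq> pts L" using chart_sub(1)[OF c] .
    have U: "openin (mtop L) U" "openin (Complex_space (mdim L)) (\<phi> ` U)"
      and h: "homeomorphic_map (subtopology (mtop L) U) (subtopology (Complex_space (mdim L)) (\<phi> ` U)) \<phi>"
      using L c unfolding complex_manifold_def by auto
    show "openin (mtop L') (g ` U)"
      using homeomorphic_map_openness[OF gm' sub] U by simp
    have eq: "(\<phi> \<circ> gi) ` (g ` U) = \<phi> ` U"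
      by (rule image_tr[OF sub])
    show "openin (Complex_space (mdim L)) ((\<phi> \<circ> gi) ` (g ` U))"
      unfolding eq by (rule U)
    have "homeomorphic_map (subtopology (mtop L') (g ` U)) (subtopology (mtop L) U) gi"
      by (rule homeomorphic_map_subtopologies[OF gm])
        (use sub image_tr[OF sub, of id] in \<open>simp_all add: pts_tr inf_absorb2 image_mono\<close>)
    then show "homeomorphic_map (subtopology (mtop L') (g ` U))
       (subtopology (Complex_space (mdim L)) ((\<phi> \<circ> gi) ` (g ` U))) (\<phi> \<circ> gi)"
      unfolding eq using h by (rule homeomorphic_map_compose)
  qed
  moreover have "holomorphic_coord (mdim L) (mdim L) ((\<psi> \<circ> gi) \<circ> inv_into (g ` U) (\<phi> \<circ> gi))
      ((\<phi> \<circ> gi) ` (g ` U \<inter> g ` V))"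
    if c: "(U, \<phi>) \<in> atlas L" "(V, \<psi>) \<in> atlas L" for U \<phi> V \<psi>
  proof -
    have sub: "U \<subseteq> pts L" "inj_on \<phi> U" "V \<subseteq> pts L"
      using chart_sub[OF c(1)] chart_sub[OF c(2)] by auto
    have "g ` U \<inter> g ` V = g ` (U \<inter> V)"
      using sub g by (simp add: inj_on_image_Int)
    moreover have "U \<inter> V \<subseteq> pts L"
      using sub by blast
    ultimately have eq: "(\<phi> \<circ> gi) ` (g ` U \<inter> g ` V) = \<phi> ` (U \<inter> V)"
      by (simp only: image_tr)
    have "holomorphic_coord (mdim L) (mdim L) (\<psi> \<circ> inv_into U \<phi>) (\<phi> ` (U \<inter> V))"
      using L c unfolding complex_manifold_def by blast
    then show ?thesis
      unfolding eq
    proof (rule holomorphic_coord_cong)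
      fix z assume z: "z \<in> \<phi> ` (U \<inter> V)"
      then have "inv_into U \<phi> z \<in> pts L"
        using sub by (blast intro: subsetD[OF sub(1)] inv_into_into)
      then show "(\<psi> \<circ> inv_into U \<phi>) z = (\<psi> \<circ> gi \<circ> inv_into (g ` U) (\<phi> \<circ> gi)) z"
        using inv_chart[OF c(1) _ z] by (simp add: gi)
    qed
  qed
  ultimately show ?thesis
    using L homeomorphic_connected_space[OF hs] homeomorphic_Hausdorff_space[OF hs]
      homeomorphic_space_second_countability[OF hs] cov
    unfolding complex_manifold_def ball_atlas_tr mdim_tr by (auto simp: pts_tr split: prod.splits)
qed

lemma aut_tr:
  assumes u: "automorphism L u" shows "automorphism L' (g \<circ> u \<circ> gi)"
proof -
  let ?v = "inv_into (pts L) u"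
  have bij: "bij_betw u (pts L) (pts L)"
    using u unfolding automorphism_def by blast
  have hol: "holomorphic_map L' L' (g \<circ> w \<circ> gi)" if "holomorphic_map L L w" for w
    by (rule hol_source[OF hol_to[OF _ that]]) (use chart_sub in blast)
  have bij': "bij_betw (g \<circ> u \<circ> gi) (pts L') (pts L')"
  proof -
    have b: "bij_betw g (pts L) (g ` pts L)"
      using g by (rule inj_on_imp_bij_betw)
    show ?thesis
      unfolding pts_tr using bij_betw_trans[OF bij_betw_inv_into[OF b] bij_betw_trans[OF bij b]]
      by (simp only: comp_assoc)
  qed
  have eq: "(g \<circ> ?v \<circ> gi) y = inv_into (pts L') (g \<circ> u \<circ> gi) y" if y: "y \<in> pts L'" for y
  proof -
    obtain x where x: "x \<in> pts L" "y = g x"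
      using y unfolding pts_tr by blast
    have "?v x \<in> pts L" "u (?v x) = x"
      using bij_betw_apply[OF bij_betw_inv_into[OF bij] x(1)] bij_betw_inv_into_right[OF bij x(1)] .
    then have v: "(g \<circ> u \<circ> gi) (g (?v x)) = y" "g (?v x) \<in> pts L'"
      using x by (simp_all add: gi pts_tr)
    have "inv_into (pts L') (g \<circ> u \<circ> gi) y = g (?v x)"
      using inv_into_f_eq[OF bij_betw_imp_inj_on[OF bij'] v(2) v(1)] .
    then show ?thesis
      using x by (simp add: gi)
  qed
  have "holomorphic_map L' L' (g \<circ> ?v \<circ> gi)"
    using u unfolding automorphism_def by (blast intro: hol)
  then have "holomorphic_map L' L' (inv_into (pts L') (g \<circ> u \<circ> gi))"
    by (rule holomorphic_map_cong[OF manifold_tr _ eq])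
  moreover have "holomorphic_map L' L' (g \<circ> u \<circ> gi)"
    using u unfolding automorphism_def by (blast intro: hol)
  ultimately show ?thesis
    using bij' unfolding automorphism_def by blast
qed

lemma dist_tr:
  assumes "x \<in> pts L" "y \<in> pts L"
  shows "kobayashi_dist L' (g x) (g y) = kobayashi_dist L x y"
proof -
  have A: "\<And>U \<phi>. (U, \<phi>) \<in> atlas unit_disc \<Longrightarrow> U \<subseteq> pts unit_disc \<and> inj_on \<phi> U"
    unfolding unit_disc_def disc_chart_def by (auto simp: inj_on_def fun_eq_iff)
  have pd: "pts unit_disc = ball 0 1"
    by (simp add: unit_disc_def)
  have "(\<exists>m a b p \<phi>. s = (\<Sum>j<m. poincare_dist (a j) (b j)) \<and> 1 \<le> (m::nat) \<and> p 0 = g x \<and> p m = g y \<and>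
    (\<forall>j<m. holomorphic_map unit_disc L' (\<phi> j) \<and> a j \<in> ball 0 1 \<and> b j \<in> ball 0 1 \<and>
       \<phi> j (a j) = p j \<and> \<phi> j (b j) = p (Suc j))) \<longleftrightarrow>
    (\<exists>m a b p \<phi>. s = (\<Sum>j<m. poincare_dist (a j) (b j)) \<and> 1 \<le> (m::nat) \<and> p 0 = x \<and> p m = y \<and>
    (\<forall>j<m. holomorphic_map unit_disc L (\<phi> j) \<and> a j \<in> ball 0 1 \<and> b j \<in> ball 0 1 \<and>
       \<phi> j (a j) = p j \<and> \<phi> j (b j) = p (Suc j)))"
    (is "?l = ?r") for s
  proof
    assume ?l
    then obtain m :: nat and a b p \<phi> where *: "s = (\<Sum>j<m. poincare_dist (a j) (b j))" "1 \<le> m"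
      "p 0 = g x" "p m = g y" and d: "\<And>j. j < m \<Longrightarrow> holomorphic_map unit_disc L' (\<phi> j) \<and> a j \<in> ball 0 1 \<and>
       b j \<in> ball 0 1 \<and> \<phi> j (a j) = p j \<and> \<phi> j (b j) = p (Suc j)"
      by blast
    show ?r
      by (intro exI[of _ m] exI[of _ a] exI[of _ b] exI[of _ "gi \<circ> p"] exI[of _ "\<lambda>j. gi \<circ> \<phi> j"])
        (use * d assms hol_from[OF A] in \<open>auto simp: gi\<close>)
  next
    assume ?r
    then obtain m :: nat and a b p \<phi> where *: "s = (\<Sum>j<m. poincare_dist (a j) (b j))" "1 \<le> m"
      "p 0 = x" "p m = y" and d: "\<And>j. j < m \<Longrightarrow> holomorphic_map unit_disc L (\<phi> j) \<and> a j \<in> ball 0 1 \<and>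
       b j \<in> ball 0 1 \<and> \<phi> j (a j) = p j \<and> \<phi> j (b j) = p (Suc j)"
      by blast
    show ?l
      by (intro exI[of _ m] exI[of _ a] exI[of _ b] exI[of _ "g \<circ> p"] exI[of _ "\<lambda>j. g \<circ> \<phi> j"])
        (use * d assms hol_to[OF A] in auto)
  qed
  then show ?thesis
    using assms unfolding kobayashi_dist_def pts_tr by simp
qed

lemma hyperbolic_tr:
  assumes "kobayashi_hyperbolic L" shows "kobayashi_hyperbolic L'"
proof -
  interpret Metric_space "pts L" "kobayashi_dist L"
    using assms unfolding kobayashi_hyperbolic_def .
  have out: "kobayashi_dist L' x y = 0" if "\<not> (x \<in> pts L' \<and> y \<in> pts L')" for x y
    using that unfolding kobayashi_dist_def by auto
  show ?thesis
    unfolding kobayashi_hyperbolic_def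
  proof
    fix x y
    show "0 \<le> kobayashi_dist L' x y"
      using out[of x y] dist_tr nonneg by (fastforce simp: pts_tr)
    show "kobayashi_dist L' x y = kobayashi_dist L' y x"
    proof (cases "x \<in> pts L' \<and> y \<in> pts L'")
      case True
      then show ?thesis by (auto simp: pts_tr dist_tr commute)
    qed (use out in auto)
  next
    fix x y z
    assume "x \<in> pts L'" "y \<in> pts L'"
    then obtain a b where ab: "a \<in> pts L" "b \<in> pts L" "x = g a" "y = g b"
      unfolding pts_tr by blast
    then show "(kobayashi_dist L' x y = 0) = (x = y)"
      using g by (auto simp: dist_tr inj_on_def)
    assume "z \<in> pts L'"
    then obtain c where "c \<in> pts L" "z = g c"
      unfolding pts_tr by blast
    then show "kobayashi_dist L' x z \<le> kobayashi_dist L' x y + kobayashi_dist L' y z"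
      using ab by (simp add: dist_tr triangle)
  qed
qed

lemma semi_model_tr:
  assumes X: "complex_manifold X" and s: "semi_model X k f L h \<Phi>"
  shows "semi_model X k f L' (g \<circ> h) (\<lambda>j. g \<circ> \<Phi> j \<circ> gi)"
proof -
  let ?\<Psi> = "\<lambda>j. g \<circ> \<Phi> j \<circ> gi"
  have q: "holomorphic_map X L h" "\<And>j. j < k \<Longrightarrow> automorphism L (\<Phi> j)" "commuting_on (pts L) k \<Phi>"
    "\<And>j x. j < k \<Longrightarrow> x \<in> pts X \<Longrightarrow> h (f j x) = \<Phi> j (h x)"
    and un: "(\<Union>N\<in>multi_indices k. tuple_pow_inv L \<Phi> N k ` h ` pts X) = pts L"
    using s unfolding semi_model_def quasi_model_def by auto
  have hp: "h x \<in> pts L" if "x \<in> pts X" for x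
    using q(1) that unfolding holomorphic_map_def continuous_map_def by blast
  have bij: "bij_betw (\<Phi> j) (pts L) (pts L)" if "j < k" for j
    using q(2)[OF that] unfolding automorphism_def by blast
  have \<Phi>: "\<Phi> j z \<in> pts L" if "j < k" "z \<in> pts L" for j z
    using bij_betw_apply[OF bij[OF that(1)] that(2)] .
  have "holomorphic_map X L' (g \<circ> h)"
    by (rule hol_to[OF _ q(1)]) (rule chart_ok[OF X])
  moreover have "commuting_on (pts L') k ?\<Psi>"
    using q(3) \<Phi> unfolding commuting_on_def by (auto simp: pts_tr gi)
  moreover have "(g \<circ> h) (f j x) = ?\<Psi> j ((g \<circ> h) x)" if "j < k" "x \<in> pts X" for j x
    using that q(4) hp by (simp add: gi)
  ultimately have qm: "quasi_model X k f L' (g \<circ> h) ?\<Psi>"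
    using manifold_tr aut_tr q(2) unfolding quasi_model_def by blast
  have itb: "bij_betw (\<Phi> j ^^ n) (pts L) (pts L)" if "j < k" for j n
    using bij_betw_funpow[OF bij[OF that]] .
  have it: "(?\<Psi> j ^^ n) (g z) = g ((\<Phi> j ^^ n) z)" if "j < k" "z \<in> pts L" for j n z
  proof (induction n)
    case (Suc n)
    have "(\<Phi> j ^^ n) z \<in> pts L"
      using bij_betw_apply[OF itb[OF that(1)] that(2)] .
    then show ?case
      using Suc by (simp add: gi)
  qed simp
  have tpb: "bij_betw (tuple_pow \<Phi> N i) (pts L) (pts L)" if "i \<le> k" for N i
    using that
  proof (induction i)
    case (Suc i)
    then have "i < k" "bij_betw (tuple_pow \<Phi> N i) (pts L) (pts L)"
      by simp_all
    then show ?case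
      unfolding tuple_pow.simps by (rule bij_betw_trans[OF itb])
  qed simp
  have tp: "tuple_pow ?\<Psi> N i (g z) = g (tuple_pow \<Phi> N i z)" if "i \<le> k" "z \<in> pts L" for N i z
    using that
  proof (induction i arbitrary: z)
    case (Suc i)
    have "(\<Phi> i ^^ N i) z \<in> pts L"
      using bij_betw_apply[OF itb] Suc.prems by simp
    then show ?case
      using Suc it[of i] by (simp del: comp_apply add: comp_def)
  qed simp
  have inv: "tuple_pow_inv L' ?\<Psi> N k (g z) = g (tuple_pow_inv L \<Phi> N k z)" if z: "z \<in> pts L" for N z
  proof -
    let ?w = "inv_into (pts L) (tuple_pow \<Phi> N k) z"
    have w: "?w \<in> pts L" "tuple_pow \<Phi> N k ?w = z"
      using bij_betw_apply[OF bij_betw_inv_into[OF tpb] z] bij_betw_inv_into_right[OF tpb z] by simp_all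
    have inj: "inj_on (tuple_pow ?\<Psi> N k) (g ` pts L)"
    proof (rule inj_onI, elim imageE)
      fix u v a b
      assume uv: "tuple_pow ?\<Psi> N k u = tuple_pow ?\<Psi> N k v"
        and ab: "u = g a" "a \<in> pts L" "v = g b" "b \<in> pts L"
      then have "g (tuple_pow \<Phi> N k a) = g (tuple_pow \<Phi> N k b)"
        by (simp only: tp order_refl)
      then have "tuple_pow \<Phi> N k a = tuple_pow \<Phi> N k b"
        by (rule inj_onD[OF g]) (use bij_betw_apply[OF tpb[of k N]] ab in simp_all)
      then have "a = b"
        by (rule inj_onD[OF bij_betw_imp_inj_on[OF tpb[of k N]], rotated]) (use ab in simp_all)
      then show "u = v"
        using ab by simp
    qed
    have "tuple_pow ?\<Psi> N k (g ?w) = g z"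
      using tp[OF order_refl w(1)] w(2) by (simp only:)
    from inv_into_f_eq[OF inj imageI[OF w(1)] this] show ?thesis
      unfolding tuple_pow_inv_def pts_tr .
  qed
  have "(\<Union>N\<in>multi_indices k. tuple_pow_inv L' ?\<Psi> N k ` (g \<circ> h) ` pts X) =
      g ` (\<Union>N\<in>multi_indices k. tuple_pow_inv L \<Phi> N k ` h ` pts X)"
    by (simp add: image_UN image_image inv hp)
  then show ?thesis
    using qm un unfolding semi_model_def pts_tr by simp
qed

end

hide_const (open) gi L'

lemma csm_carrier:
  fixes X :: "'a cmanifold" and Z :: "'b cmanifold"
  assumes X: "complex_manifold X" and c: "csm TYPE(real) X k f Z l T"
  shows "csm TYPE('c) X k f Z l T"
  unfolding csm_def
proof (intro conjI allI impI; (elim conjE)?)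
  show "semi_model X k f Z l T" "kobayashi_hyperbolic Z"
    using c unfolding csm_def by auto
  have Z: "complex_manifold Z"
    using c unfolding csm_def semi_model_def quasi_model_def by blast
  fix L :: "'c cmanifold" and h \<Phi>
  assume s: "semi_model X k f L h \<Phi>" and hyp: "kobayashi_hyperbolic L"
  then have L: "complex_manifold L"
    unfolding semi_model_def quasi_model_def by blast
  obtain g :: "'c \<Rightarrow> real" where g: "inj_on g (pts L)"
    using manifold_inj_real[OF L] by blast
  let ?gi = "inv_into (pts L) g"
  obtain \<eta> where \<eta>: "model_morphism X k Z l T (transport g L) (g \<circ> h) (\<lambda>j. g \<circ> \<Phi> j \<circ> ?gi) \<eta>"
    using c semi_model_tr[OF L g X s] hyperbolic_tr[OF L g hyp] unfolding csm_def by blast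
  have hp: "h x \<in> pts L" if "x \<in> pts X" for x
    using s that unfolding semi_model_def quasi_model_def holomorphic_map_def continuous_map_def by blast
  have "\<eta> z \<in> g ` pts L" if "z \<in> pts Z" for z
    using \<eta> that pts_tr[OF L g] unfolding model_morphism_def holomorphic_map_def continuous_map_def by blast
  then have gi: "?gi (\<eta> z) \<in> pts L" if "z \<in> pts Z" for z
    using that by (blast intro: inv_into_into)
  have \<Phi>: "\<Phi> j y \<in> pts L" if "j < k" "y \<in> pts L" for j y
    using s that unfolding semi_model_def quasi_model_def automorphism_def bij_betw_def by blast
  have "holomorphic_map Z L (?gi \<circ> \<eta>)"
    by (rule hol_from[OF L g chart_ok[OF Z]]) (use \<eta> in \<open>auto simp: model_morphism_def\<close>)
  moreover have "(?gi \<circ> \<eta>) (l x) = h x" if "x \<in> pts X" for x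
    using \<eta> that hp g unfolding model_morphism_def by (simp add: inv_into_f_f)
  moreover have "(?gi \<circ> \<eta>) (T j z) = \<Phi> j ((?gi \<circ> \<eta>) z)" if "j < k" "z \<in> pts Z" for j z
    using \<eta> that gi \<Phi> g unfolding model_morphism_def by (simp add: inv_into_f_f)
  ultimately show "\<exists>\<eta>. model_morphism X k Z l T L h \<Phi> \<eta>"
    unfolding model_morphism_def by blast
qed

end

theory Submission
 imports Defs
begin

text \<open>
 Let \<open>U\<close> be an ultrafilter finer than \<open>M \<rightarrow> \<infinity>\<close> and let \<open>a\<^sub>M\<close> be automorphisms that send \<open>F\<^sup>M x\<^sub>0\<close> into a fixed compact set.
 Holomorphic maps contract \<open>k\<^sub>X\<close> and balls of a fixed radius are relatively compact, so along \<open>U\<close> the limits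
 \<open>\<beta>\<^sub>N = lim a\<^sub>M F\<^bsup>M-N\<^esup>\<close> exist and are holomorphic, and \<open>\<beta>\<^sub>M a\<^sub>M\<^sup>-\<^sup>1\<close> tends to a retraction \<open>\<rho>\<close> with \<open>\<rho> \<beta>\<^sub>N = \<beta>\<^sub>N\<close>.
 On \<open>Z = \<rho>(X)\<close> these maps are close to the identity, hence locally onto, so \<open>Z\<close> is the union of the sets
 \<open>\<beta>\<^sub>N(X)\<close>.  A family \<open>G\<^sub>N\<close> with \<open>G\<^bsub>N+P\<^esub> F\<^sup>P = G\<^sub>N\<close> into a hyperbolic manifold factors through the \<open>\<beta>\<^sub>N\<close>; this gives
 \<open>T\<close> with \<open>T\<^bsup>-N\<^esup> \<beta>\<^sub>0 = \<beta>\<^sub>N\<close> and the universal property.  As \<open>\<beta>\<^sub>N = \<beta>\<^bsub>N+M\<^esub> F\<^sup>M\<close>, the pullbacks of \<open>k\<^sub>X\<close> and \<open>\<kappa>\<^sub>X\<close> by \<open>F\<^sup>M\<close>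
 decrease and stay above those of \<open>k\<^sub>Z\<close> and \<open>\<kappa>\<^sub>Z\<close> by \<open>\<beta>\<^sub>N\<close>; equality in the limit follows from continuity of \<open>k\<^sub>X\<close>
 and upper semicontinuity of \<open>\<kappa>\<^sub>X\<close>.  For the latter a disc is changed smoothly near its centre to have
 the prescribed 1-jet, and the failure of holomorphy is removed chart by chart with an integral operator that inverts
 \<open>\<partial>\<close>-bar and is small in suitable weighted norms.
\<close>

section \<open>Holomorphic functions of several variables\<close>

text \<open>Composing with the automorphisms \<open>a M\<close> replaces the compactness that
  \<open>X\<close> lacks, and an ultrafilter makes the limits for all \<open>N\<close> and all
  points exist at once, without diagonal extraction over the directed set of multi-indices. One
  radius valid at every point carries convergence from one point to all of \<open>X\<close>. The
  factorisation is a single estimate: \<open>a M (F (M - N) x)\<close> is close to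
  \<open>\<beta> N x\<close>, so \<open>G M\<close> maps the \<open>a M\<close>-preimage of
  \<open>\<beta> N x\<close> close to \<open>G M (F (M - N) x) = G N x\<close>. The ultrafilter
  leaves no trace in the two limit formulas, because monotonicity in \<open>M\<close> reduces them
  to finding one good index for each error bound. The infinitesimal formula is harder, since a disc
  in a manifold cannot be moved by adding a vector. It is moved in charts; each repair in one chart
  disturbs the overlapping ones by fixed constants. The weight exp(s^2 |z|^2) gives the solution
  operator a norm of order 1/s, so a large s beats these constants and every round of repairs halves
  the error. The price is a displacement bound containing exp(s^2), which a small initial
  perturbation absorbs.\<close>

definition CS :: "nat => (nat => complex) set" where
 "CS n = {z. ALL i>=n. z i = 0}"

abbreviation copen :: "nat => (nat => complex) set => bool" where
 "copen n == openin (top_of_set (CS n))"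

definition pdisc :: "nat => (nat => complex) => real => (nat => complex) set" where
 "pdisc n z e = {w \<in> CS n. ALL i<n. dist (w i) (z i) < e}"

text \<open>One component of \<open>holomorphic_coord\<close>, phrased by differentiability at
  points instead of holomorphy on slices; \<open>holomorphic_coord_iff\<close> links the two on open
  sets.\<close>

definition chol :: "nat => ((nat => complex) => complex) => (nat => complex) set => bool" where
 "chol n f W \<longleftrightarrow> continuous_on W f & (ALL z:W. ALL j<n. (%t. f (z(j := t))) field_differentiable at (z j))"

definition pd :: "nat => ((nat => complex) => complex) => (nat => complex) => complex" where
 "pd j f z = deriv (%t. f (z(j := t))) (z j)"

lemma Complex_space_CS: "Complex_space n = top_of_set (CS n)"
 by (simp add: Complex_space_def CS_def)

lemma topspace_Complex_space [simp]: "topspace (Complex_space n) = CS n"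
 by (simp add: Complex_space_CS)

lemma continuous_on_coord: "continuous_on S (%w::nat => complex. w i)"
 by (rule continuous_on_product_then_coordinatewise[OF continuous_on_id])

lemma open_coord_dist: "open {w::nat => complex. dist (w i) a < e}"
 by (intro open_Collect_less continuous_on_dist continuous_on_const continuous_on_coord)

lemma openin_pdisc: "copen n (pdisc n z e)"
proof -
 have "pdisc n z e = CS n Int (\<Inter>i<n. {w. dist (w i) (z i) < e})"
  unfolding pdisc_def by auto
 then show ?thesis
  by (simp add: openin_open_Int open_INT open_coord_dist)
qed

lemma pdisc_center: "z \<in> CS n ==> e > 0 ==> z \<in> pdisc n z e"
 by (simp add: pdisc_def)

lemma pdisc_mono: "d <= e ==> pdisc n z d \<subseteq> pdisc n z e"
 by (fastforce simp: pdisc_def)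

lemma CS_upd: "z \<in> CS n ==> j < n ==> z(j := t) \<in> CS n"
 by (auto simp: CS_def)

text \<open>A basic neighbourhood of the product topology restricts each coordinate separately. Only
  the finitely many coordinates below \<open>n\<close> vary in \<open>CS n\<close>, so a minimum
  over them is a positive radius.\<close>

lemma openin_contains_pdisc:
 assumes W: "copen n W" and z: "z \<in> W"
 obtains e where "e > 0" "pdisc n z e \<subseteq> W"
proof -
 obtain T where T: "open T" "W = CS n Int T"
  using W by (auto simp: openin_open)
 have "openin (product_topology (%i. euclidean) UNIV) T"
  using T(1) by (simp add: open_fun_def)
 from product_topology_open_contains_basis[OF this, of z] obtain X where X: "z \<in> (\<Pi>\<^sub>E i\<in>UNIV. X i)"
  "!!i. openin euclidean (X i)" "(\<Pi>\<^sub>E i\<in>UNIV. X i) \<subseteq> T"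
  using T z by blast
 have "EX e>0. ALL w. dist w (z i) < e --> w \<in> X i" for i
 proof -
  have "z i \<in> X i" using X(1) by auto
  then show ?thesis using X(2)[of i] unfolding open_openin[symmetric] open_dist by blast
 qed
 then obtain E where E: "!!i. E i > 0" "!!i w. dist w (z i) < E i ==> w \<in> X i"
  by metis
 \<comment> \<open>The inserted 1 keeps the minimum meaningful in dimension 0; the same device
   recurs in later minima.\<close>
 define e where "e = Min (insert 1 (E ` {..<n}))"
 have e: "e > 0" "!!i. i < n ==> e <= E i"
  unfolding e_def using E(1) by (auto simp: Min_gr_iff)
 have "w i \<in> X i" if "w \<in> pdisc n z e" for w i
 proof (cases "i < n")
  case True
  then show ?thesis using that e E(2)[of "w i" i] by (fastforce simp: pdisc_def)
 next
  case False
  then have "w i = z i"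
   using that z T by (auto simp: pdisc_def CS_def)
  then show ?thesis using X(1) by auto
 qed
 then have "pdisc n z e \<subseteq> W"
  using X(3) T(2) by (auto simp: pdisc_def)
 with e(1) show ?thesis by (rule that)
qed

lemma slice_open:
 assumes W: "copen n W" and j: "j < n" and z: "z \<in> CS n"
 shows "open {t. z(j := t) \<in> W}"
proof -
 obtain T where T: "open T" "W = CS n Int T"
  using W by (auto simp: openin_open)
 have "continuous_on UNIV (%t. z(j := t))"
 proof (intro continuous_on_coordinatewise_then_product)
  show "continuous_on UNIV (%t. (z(j := t)) i)" for i
   by (cases "i = j") auto
 qed
 then have "open ((%t. z(j := t)) -` T)"
  using T(1) by (auto intro: open_vimage)
 then show ?thesis
  using CS_upd[OF z j] T(2) by (auto simp: vimage_def)
qed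

lemma holomorphic_coord_iff:
 assumes W: "copen n W"
 shows "holomorphic_coord n m g W \<longleftrightarrow> (ALL i<m. chol n (%z. g z i) W)"
proof -
 have WC: "W \<subseteq> CS n"
  using W by (auto dest: openin_imp_subset)
 have "(ALL z:W. ALL j<n. (%t. h (z(j := t))) holomorphic_on {t. z(j := t) \<in> W}) \<longleftrightarrow>
   (ALL z:W. ALL j<n. (%t. h (z(j := t))) field_differentiable at (z j))" (is "?l \<longleftrightarrow> ?r") for h :: "_ => complex"
 proof
  assume l: ?l
  show ?r
  proof (intro ballI allI impI)
   fix z j assume z: "z \<in> W" "j < n"
   then have "open {t. z(j := t) \<in> W}" "z j \<in> {t. z(j := t) \<in> W}"
    using slice_open[OF W] WC by auto
   then show "(%t. h (z(j := t))) field_differentiable at (z j)"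
    using l z holomorphic_on_imp_differentiable_at by blast
  qed
 next
  assume r: ?r
  show ?l
  proof (intro ballI allI impI)
   fix z j assume z: "z \<in> W" "j < n"
   show "(%t. h (z(j := t))) holomorphic_on {t. z(j := t) \<in> W}"
    unfolding holomorphic_on_def
   proof
    fix t assume "t \<in> {t. z(j := t) \<in> W}"
    then have "(%u. h ((z(j := t))(j := u))) field_differentiable at ((z(j := t)) j)"
     using r z by blast
    then show "(%t. h (z(j := t))) field_differentiable at t within {t. z(j := t) \<in> W}"
     by (simp add: field_differentiable_at_within)
   qed
  qed
 qed
 from this[of "%z. g z i" for i] show ?thesis
  unfolding holomorphic_coord_def chol_def by simp
qed

lemma chol_slice_holomorphic:
 assumes f: "chol n f W" and j: "j < n" and S: "!!t. t \<in> S ==> z(j := t) \<in> W"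
 shows "(%t. f (z(j := t))) holomorphic_on S"
 unfolding holomorphic_on_def
proof
 fix t assume "t \<in> S"
 then have "(%u. f ((z(j := t))(j := u))) field_differentiable at ((z(j := t)) j)"
  using f j S unfolding chol_def by blast
 then show "(%t. f (z(j := t))) field_differentiable at t within S"
  by (simp add: field_differentiable_at_within)
qed

lemma chol_continuous: "chol n f W ==> continuous_on W f"
 by (simp add: chol_def)

lemma chol_subset: "chol n f W ==> V \<subseteq> W ==> chol n f V"
 unfolding chol_def using continuous_on_subset by blast

lemma chol_DERIV:
 assumes "chol n f W" "z \<in> W" "j < n"
 shows "((%t. f (z(j := t))) has_field_derivative pd j f z) (at (z j))"
 using assms unfolding chol_def pd_def by (simp add: DERIV_deriv_iff_field_differentiable)

lemma upd_continuous_on: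
 "continuous_on S (%(v::nat => complex, t). v(j := v j + t))"
proof (intro continuous_on_coordinatewise_then_product)
 fix i
 show "continuous_on S (%x. (case x of (v, t) => v(j := v j + t)) i)"
  by (cases "i = j") (auto simp: case_prod_unfold intro!: continuous_on_add
    continuous_on_snd continuous_on_id continuous_on_compose2[OF continuous_on_coord continuous_on_fst])
qed

section \<open>Strict differentiability and the chain rule\<close>

text \<open>Translating the slice through \<open>v\<close> to the origin makes all slices functions
  of \<open>t\<close> on one disc. By compactness of a closed disc they depend on \<open>v\<close>
  uniformly in \<open>t\<close>, and uniform limits of holomorphic functions can be
  differentiated.\<close>

lemma pd_continuous_on:
 assumes W: "copen n W" and f: "chol n f W" and j: "j < n"
 shows "continuous_on W (pd j f)"
 unfolding continuous_on_eq_continuous_within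
proof
 fix z assume z: "z \<in> W"
 obtain e where e: "e > 0" "pdisc n z e \<subseteq> W"
  using openin_contains_pdisc[OF W z] .
 have zC: "z \<in> CS n" using z W by (auto dest: openin_imp_subset)
 define U where "U = pdisc n z (e/2)"
 have upd: "v(j := v j + t) \<in> W" if "v \<in> U" "t \<in> cball 0 (e/4)" for v t
 proof -
  have "dist (v j + t) (z j) < e"
  proof -
   have "dist (v j + t) (z j) <= dist (v j) (z j) + norm t"
    by (metis (no_types, opaque_lifting) add.commute add_diff_eq dist_norm norm_triangle_ineq)
   then show ?thesis using that j e unfolding U_def pdisc_def
    by (auto dest!: spec[of _ j])
  qed
  moreover have "dist (v i) (z i) < e" if "i < n" for i
   using \<open>v \<in> U\<close> that e unfolding U_def pdisc_def by force
  ultimately have "v(j := v j + t) \<in> pdisc n z e"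
   using that j unfolding U_def pdisc_def by (auto simp: CS_def)
  then show ?thesis using e by blast
 qed
 let ?g = "%v t. f (v(j := v j + t))"
 have cont: "continuous_on (U \<times> cball 0 (e/4)) (%(v, t). ?g v t)"
 proof -
  have "continuous_on (U \<times> cball 0 (e/4)) (f \<circ> (%(v, t). v(j := v j + t)))"
   using upd by (intro continuous_on_compose upd_continuous_on continuous_on_subset[OF chol_continuous[OF f]]) auto
  then show ?thesis by (simp add: comp_def case_prod_unfold)
 qed
 have zU: "z \<in> U" unfolding U_def using e zC by (simp add: pdisc_center)
 have ev: "\<forall>\<^sub>F v in at z within W. v \<in> U"
 proof -
  have "U \<subseteq> W"
   using pdisc_mono[of "e/2" e n z] e unfolding U_def by auto
  then have "openin (top_of_set W) U"
   using openin_subset_trans[of "CS n" U W] openin_imp_subset[OF W] openin_pdisc[of n z "e/2"] unfolding U_def by blast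
  then obtain T where "open T" "U = W Int T" by (auto simp: openin_open)
  then show ?thesis using zU by (auto simp: eventually_at_topological)
 qed
 have ulim: "uniform_limit (ball 0 (e/4)) ?g (?g z) (at z within W)"
 proof (rule uniform_limitI)
  fix d :: real assume d: "d > 0"
  then obtain X0 where X0: "z \<in> X0" "open X0"
    "ALL x:X0 Int U. ALL t:cball 0 (e/4). dist ((%(v, t). ?g v t) (x, t)) ((%(v, t). ?g v t) (z, t)) <= d/2"
   by (rule continuous_on_prod_compactE[OF cont compact_cball zU half_gt_zero])
  have "\<forall>\<^sub>F v in at z within W. v \<in> X0"
   using X0 by (auto simp: eventually_at_topological)
  with ev show "\<forall>\<^sub>F v in at z within W. ALL t:ball 0 (e/4). dist (?g v t) (?g z t) < d"
  proof eventually_elim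
   case (elim v)
   then have "dist (?g v t) (?g z t) <= d/2" if "t \<in> ball 0 (e/4)" for t
    using X0(3) that by auto
   then show ?case using d by fastforce
  qed
 qed
 have D: "deriv (?g v) 0 = pd j f v" for v
 proof -
  have "deriv (%t. f (v(j := t))) (v j) = deriv ((%t. f (v(j := t))) \<circ> (+) (v j)) 0"
   by (rule deriv_shift_0)
  then show ?thesis
   unfolding pd_def by (simp add: o_def)
 qed
 have hol: "\<forall>\<^sub>F v in at z within W. ?g v holomorphic_on ball 0 (e/4)"
  using ev
 proof eventually_elim
  case (elim v)
  have h: "(%t. f (v(j := t))) holomorphic_on ((+) (v j) ` ball 0 (e/4))"
  proof (rule chol_slice_holomorphic[OF f j])
   fix t assume "t \<in> (+) (v j) ` ball 0 (e/4)"
   then obtain s where "s \<in> ball 0 (e/4)" "t = v j + s" by blast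
   then show "v(j := t) \<in> W" using upd[OF elim, of s] by simp
  qed
  have "(%t. f (v(j := t))) \<circ> (+) (v j) holomorphic_on ball 0 (e/4)"
   by (rule holomorphic_on_compose[OF _ h]) (intro holomorphic_intros)
  then show ?case by (simp add: o_def)
 qed
 show "continuous (at z within W) (pd j f)"
 proof (cases "at z within W = bot")
  case False
  have "((%v. (deriv ^^ 1) (?g v) 0) \<longlongrightarrow> (deriv ^^ 1) (?g z) 0) (at z within W)"
   by (rule higher_deriv_complex_uniform_limit[OF ulim hol False]) (use e in auto)
  then show ?thesis
   by (simp add: D continuous_within)
 qed simp
qed

text \<open>The coordinates of \<open>w'\<close> are exchanged for those of \<open>w\<close> one at
  a time. A polydisc is a product, so all intermediate points \<open>h j\<close> stay inside, and
  the one-variable mean value estimate applies to each exchange.\<close>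

lemma pdisc_mean_value:
 assumes f: "chol n f (pdisc n z d)"
  and b: "!!j v. j < n ==> v \<in> pdisc n z d ==> cmod (pd j f v - c j) <= K"
  and w: "w \<in> pdisc n z d" "w' \<in> pdisc n z d"
 shows "cmod (f w - f w' - (\<Sum>j<n. c j * (w j - w' j))) <= K * (\<Sum>j<n. cmod (w j - w' j))"
proof -
 define h where "h = (%j i. if i < j then w i else w' i)"
 have h0: "h 0 = w'" by (simp add: h_def)
 have hn: "h n = w"
  using w by (auto simp: h_def pdisc_def CS_def fun_eq_iff)
 have hS: "h (Suc j) = (h j)(j := w j)" for j
  by (auto simp: h_def fun_eq_iff)
 have hj: "h j = (h j)(j := w' j)" for j
  by (auto simp: h_def fun_eq_iff)
 have hd: "(h j)(j := t) \<in> pdisc n z d" if "dist t (z j) < d" "j < n" for j t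
  using that w unfolding h_def pdisc_def CS_def by auto
 have step: "cmod (f (h (Suc j)) - f (h j) - c j * (w j - w' j)) <= K * cmod (w j - w' j)" if j: "j < n" for j
 proof -
  let ?g = "%t. f ((h j)(j := t)) - c j * t"
  have "cmod (?g (w j) - ?g (w' j)) <= K * cmod (w j - w' j)"
  proof (rule field_differentiable_bound[where S="ball (z j) d"])
   fix t assume t: "t \<in> ball (z j) d"
   then have in': "(h j)(j := t) \<in> pdisc n z d"
    using hd j by (simp add: dist_commute)
   have "((%u. f (((h j)(j := t))(j := u))) has_field_derivative pd j f ((h j)(j := t))) (at (((h j)(j := t)) j))"
    by (rule chol_DERIV[OF f in' j])
   then have "((%u. f ((h j)(j := u))) has_field_derivative pd j f ((h j)(j := t))) (at t)"
    by simp
   then show "(?g has_field_derivative (pd j f ((h j)(j := t)) - c j)) (at t within ball (z j) d)"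
    by (intro has_field_derivative_at_within[OF DERIV_diff[OF _ DERIV_cmult_Id]])
   show "cmod (pd j f ((h j)(j := t)) - c j) <= K"
    using b[OF j in'] .
  qed (use w j in \<open>auto simp: pdisc_def dist_commute\<close>)
  moreover have "?g (w j) - ?g (w' j) = f (h (Suc j)) - f (h j) - c j * (w j - w' j)"
   using hS[of j] hj[of j] by (simp add: algebra_simps)
  ultimately show ?thesis by simp
 qed
 have "f w - f w' = (\<Sum>j<n. f (h (Suc j)) - f (h j))"
  using sum_lessThan_telescope[of "%j. f (h j)" n] by (simp add: h0 hn)
 then have "f w - f w' - (\<Sum>j<n. c j * (w j - w' j)) = (\<Sum>j<n. f (h (Suc j)) - f (h j) - c j * (w j - w' j))"
  by (simp add: sum_subtractf)
 also have "cmod ... <= (\<Sum>j<n. K * cmod (w j - w' j))"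
  by (rule sum_norm_le) (simp add: step)
 finally show ?thesis by (simp add: sum_distrib_left)
qed

text \<open>Both points vary, so this is strict differentiability: by continuity of the partial
  derivatives they differ from their values at \<open>z\<close> by at most \<open>e\<close> on a
  small polydisc. The second free point is what later gives injectivity of the slice
  coordinates.\<close>

lemma chol_strict_diff:
 assumes W: "copen n W" and f: "chol n f W" and z: "z \<in> W" and e: "e > 0"
 obtains d where "d > 0" "pdisc n z d \<subseteq> W"
  "!!w w'. w \<in> pdisc n z d ==> w' \<in> pdisc n z d ==>
    cmod (f w - f w' - (\<Sum>j<n. pd j f z * (w j - w' j))) <= e * (\<Sum>j<n. cmod (w j - w' j))"
proof -
 have "EX d>0. pdisc n z d \<subseteq> {v\<in>W. dist (pd j f v) (pd j f z) < e}" if j: "j < n" for j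
 proof -
  have "openin (top_of_set W) (W Int pd j f -` ball (pd j f z) e)"
   using pd_continuous_on[OF W f j] by (intro continuous_openin_preimage_gen) auto
  then have "copen n (W Int pd j f -` ball (pd j f z) e)"
   using W openin_trans by blast
  moreover have "z \<in> W Int pd j f -` ball (pd j f z) e"
   using z e by simp
  ultimately obtain d where "d > 0" "pdisc n z d \<subseteq> W Int pd j f -` ball (pd j f z) e"
   by (rule openin_contains_pdisc)
  then show ?thesis
   by (intro exI[of _ d]) (auto simp: dist_commute)
 qed
 then have "ALL j:{..<n}. EX d>0. pdisc n z d \<subseteq> {v\<in>W. dist (pd j f v) (pd j f z) < e}"
  by simp
 from bchoice[OF this] obtain D where D: "!!j. j < n ==> D j > 0"
  "!!j. j < n ==> pdisc n z (D j) \<subseteq> {v\<in>W. dist (pd j f v) (pd j f z) < e}"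
  by (force simp del: Collect_conj_eq)
 obtain d0 where d0: "d0 > 0" "pdisc n z d0 \<subseteq> W"
  using openin_contains_pdisc[OF W z] .
 define d where "d = Min (insert d0 (D ` {..<n}))"
 have d: "d > 0" "d <= d0" "!!j. j < n ==> d <= D j"
  unfolding d_def using D(1) d0(1) by (auto simp: Min_gr_iff)
 have dW: "pdisc n z d \<subseteq> W"
  using pdisc_mono[OF d(2)] d0(2) by blast
 have pdb: "cmod (pd j f v - pd j f z) <= e" if "j < n" "v \<in> pdisc n z d" for j v
 proof -
  have "v \<in> pdisc n z (D j)"
   using that pdisc_mono[OF d(3)] by blast
  then show ?thesis using D(2)[OF that(1)] by (auto simp: dist_norm)
 qed
 have "cmod (f w - f w' - (\<Sum>j<n. pd j f z * (w j - w' j))) <= e * (\<Sum>j<n. cmod (w j - w' j))"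
  if w: "w \<in> pdisc n z d" "w' \<in> pdisc n z d" for w w'
  by (rule pdisc_mean_value[OF chol_subset[OF f dW] pdb w])
 with d(1) dW show ?thesis by (rule that)
qed

text \<open>The sequence space carries a topology but no norm, so differentiability of
  \<open>\<gamma>\<close> is assumed coordinate by coordinate. It is real differentiability: the
  lemma must cover the maps that are not yet holomorphic when discs are perturbed.\<close>

lemma has_derivative_chol_compose:
 fixes \<gamma> :: "'e::real_normed_vector => nat => complex"
 assumes W: "copen n W" and f: "chol n f W" and x: "\<gamma> x \<in> W"
  and ev: "\<forall>\<^sub>F y in at x within S. \<gamma> y \<in> CS n"
  and der: "!!j. j < n ==> ((%y. \<gamma> y j) has_derivative \<gamma>' j) (at x within S)"
 shows "((%y. f (\<gamma> y)) has_derivative (%h. \<Sum>j<n. pd j f (\<gamma> x) * \<gamma>' j h)) (at x within S)"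
proof -
 let ?c = "%j. pd j f (\<gamma> x)"
 define R where "R = (%y. f (\<gamma> y) - f (\<gamma> x) - (\<Sum>j<n. ?c j * (\<gamma> y j - \<gamma> x j)))"
 have "ALL j:{..<n}. EX K>0. \<forall>\<^sub>F y in at x within S. cmod (\<gamma> y j - \<gamma> x j) <= K * norm (y - x)"
 proof
  fix j assume j: "j \<in> {..<n}"
  then have bl: "bounded_linear (\<gamma>' j)"
   and al: "ALL e>0. EX d>0. ALL y:S. norm (y - x) < d --> norm (\<gamma> y j - \<gamma> x j - \<gamma>' j (y - x)) <= e * norm (y - x)"
   using der[of j] unfolding has_derivative_within_alt by auto
  obtain K where K: "K > 0" "!!h. norm (\<gamma>' j h) <= norm h * K"
   using bounded_linear.pos_bounded[OF bl] by blast
  obtain d where d: "d > 0" "!!y. y \<in> S ==> norm (y - x) < d ==> norm (\<gamma> y j - \<gamma> x j - \<gamma>' j (y - x)) <= 1 * norm (y - x)"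
   using al[rule_format, of 1] by auto
  have "cmod (\<gamma> y j - \<gamma> x j) <= (K + 1) * norm (y - x)" if "y \<in> S" "norm (y - x) < d" for y
  proof -
   have "cmod (\<gamma> y j - \<gamma> x j) <= cmod (\<gamma> y j - \<gamma> x j - \<gamma>' j (y - x)) + cmod (\<gamma>' j (y - x))"
    by (metis diff_add_cancel norm_triangle_ineq)
   then show ?thesis using d(2)[OF that] K(2)[of "y - x"] by (simp add: algebra_simps)
  qed
  then have "\<forall>\<^sub>F y in at x within S. cmod (\<gamma> y j - \<gamma> x j) <= (K + 1) * norm (y - x)"
   using d(1) by (auto simp: eventually_at dist_norm)
  then show "EX K>0. \<forall>\<^sub>F y in at x within S. cmod (\<gamma> y j - \<gamma> x j) <= K * norm (y - x)"
   using K(1) by (intro exI[of _ "K + 1"]) auto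
 qed
 from bchoice[OF this] obtain K where K: "!!j. j < n ==> K j > 0"
  "!!j. j < n ==> \<forall>\<^sub>F y in at x within S. cmod (\<gamma> y j - \<gamma> x j) <= K j * norm (y - x)"
  by force
 define B where "B = 1 + (\<Sum>j<n. K j)"
 have B: "B > 0"
  unfolding B_def using K(1) by (intro add_pos_nonneg sum_nonneg) (auto intro: less_imp_le)
 have sumle: "\<forall>\<^sub>F y in at x within S. (\<Sum>j<n. cmod (\<gamma> y j - \<gamma> x j)) <= B * norm (y - x)"
 proof -
  have "\<forall>\<^sub>F y in at x within S. ALL j:{..<n}. cmod (\<gamma> y j - \<gamma> x j) <= K j * norm (y - x)"
   using K(2) by (intro eventually_ball_finite) auto
  then show ?thesis
  proof eventually_elim
   case (elim y)
   then have "(\<Sum>j<n. cmod (\<gamma> y j - \<gamma> x j)) <= (\<Sum>j<n. K j * norm (y - x))"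
    by (intro sum_mono) auto
   then show ?case by (simp add: B_def algebra_simps sum_distrib_left sum_distrib_right add_increasing)
  qed
 qed
 have "(R has_derivative (%h. 0)) (at x within S)"
  unfolding has_derivative_within_alt
 proof (intro conjI allI impI)
  fix e :: real assume e: "e > 0"
  obtain d where d: "d > 0" "pdisc n (\<gamma> x) d \<subseteq> W" "!!w w'. w \<in> pdisc n (\<gamma> x) d ==> w' \<in> pdisc n (\<gamma> x) d ==>
    cmod (f w - f w' - (\<Sum>j<n. ?c j * (w j - w' j))) <= (e/B) * (\<Sum>j<n. cmod (w j - w' j))"
   using chol_strict_diff[OF W f x, of "e/B"] e B by auto
  have xin: "\<gamma> x \<in> pdisc n (\<gamma> x) d"
   using x d(1) openin_imp_subset[OF W] by (intro pdisc_center) auto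
  have "\<forall>\<^sub>F y in at x within S. dist (\<gamma> y j) (\<gamma> x j) < d" if "j < n" for j
   using has_derivative_continuous[OF der[OF that]] d(1) unfolding continuous_within tendsto_iff by blast
  then have "\<forall>\<^sub>F y in at x within S. ALL j:{..<n}. dist (\<gamma> y j) (\<gamma> x j) < d"
   by (intro eventually_ball_finite) auto
  with ev sumle have "\<forall>\<^sub>F y in at x within S. norm (R y) <= e * norm (y - x)"
  proof eventually_elim
   case (elim y)
   then have "\<gamma> y \<in> pdisc n (\<gamma> x) d"
    unfolding pdisc_def by auto
   then have "cmod (R y) <= (e/B) * (\<Sum>j<n. cmod (\<gamma> y j - \<gamma> x j))"
    unfolding R_def by (rule d(3)[OF _ xin])
   also have "... <= (e/B) * (B * norm (y - x))"
    using elim e B by (intro mult_left_mono) auto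
   finally show ?case using B by simp
  qed
  then obtain r where r: "r > 0" "!!y. y \<in> S ==> y ~= x ==> dist y x < r ==> norm (R y) <= e * norm (y - x)"
   unfolding eventually_at by blast
  have "R x = 0" by (simp add: R_def)
  then show "EX d>0. ALL y:S. norm (y - x) < d --> norm (R y - R x - 0) <= e * norm (y - x)"
   using r by (intro exI[of _ r]) (metis diff_zero dist_norm norm_zero order_refl right_minus_eq mult_zero_right)
 qed simp
 then have "((%y. R y + f (\<gamma> x) + (\<Sum>j<n. ?c j * (\<gamma> y j - \<gamma> x j))) has_derivative
   (%h. 0 + 0 + (\<Sum>j<n. ?c j * (\<gamma>' j h - 0)))) (at x within S)"
  by (intro has_derivative_add has_derivative_sum has_derivative_mult_right has_derivative_diff has_derivative_const der) auto
 then show ?thesis by (simp add: R_def)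
qed

lemma has_field_derivative_chol_compose:
 fixes \<gamma> :: "complex => nat => complex"
 assumes W: "copen n W" and f: "chol n f W" and x: "\<gamma> x \<in> W"
  and ev: "\<forall>\<^sub>F y in at x within S. \<gamma> y \<in> CS n"
  and der: "!!j. j < n ==> ((%y. \<gamma> y j) has_field_derivative \<gamma>' j) (at x within S)"
 shows "((%y. f (\<gamma> y)) has_field_derivative (\<Sum>j<n. pd j f (\<gamma> x) * \<gamma>' j)) (at x within S)"
proof -
 have "((%y. f (\<gamma> y)) has_derivative (%h. \<Sum>j<n. pd j f (\<gamma> x) * (\<gamma>' j * h))) (at x within S)"
  using has_derivative_chol_compose[OF W f x ev, of "%j h. \<gamma>' j * h"] der
  unfolding has_field_derivative_def by blast
 moreover have "(%h. \<Sum>j<n. pd j f (\<gamma> x) * (\<gamma>' j * h)) = (*) (\<Sum>j<n. pd j f (\<gamma> x) * \<gamma>' j)"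
  by (simp add: fun_eq_iff sum_distrib_right mult.assoc)
 ultimately show ?thesis
  unfolding has_field_derivative_def by simp
qed

lemma continuous_on_into_CS:
 assumes "!!i. i < n ==> continuous_on V (%z. g z i)" and "!!z. z \<in> V ==> g z \<in> CS n"
 shows "continuous_on V g"
proof (rule continuous_on_coordinatewise_then_product)
 fix i
 show "continuous_on V (%z. g z i)"
 proof (cases "i < n")
  case False
  then have "!!z. z \<in> V ==> g z i = 0"
   using assms(2) by (auto simp: CS_def)
  then show ?thesis by (metis (no_types, lifting) continuous_on_cong continuous_on_const)
 qed (use assms in auto)
qed

lemma chol_compose:
 assumes W: "copen n W" and f: "chol n f W"
  and V: "copen m V" and g: "!!i. i < n ==> chol m (%z. g z i) V"
  and gW: "!!z. z \<in> V ==> g z \<in> W"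
 shows "chol m (%z. f (g z)) V"
  and "z \<in> V ==> j < m ==> pd j (%z. f (g z)) z = (\<Sum>l<n. pd l f (g z) * pd j (%z. g z l) z)"
proof -
 have WC: "W \<subseteq> CS n" and VC: "V \<subseteq> CS m" using W V by (auto dest: openin_imp_subset)
 have D: "((%t. f (g (z(j := t)))) has_field_derivative (\<Sum>l<n. pd l f (g z) * pd j (%z. g z l) z)) (at (z j))"
  if z: "z \<in> V" "j < m" for z j
 proof -
  have o: "open {t. z(j := t) \<in> V}" "z j \<in> {t. z(j := t) \<in> V}"
   using slice_open[OF V z(2)] z VC by auto
  have "\<forall>\<^sub>F t in at (z j). g (z(j := t)) \<in> CS n"
   using eventually_at_topological[of "%t. g (z(j := t)) \<in> CS n" "z j" UNIV] o gW WC by blast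
  then have "((%t. f (g (z(j := t)))) has_field_derivative (\<Sum>l<n. pd l f (g (z(j := z j))) * pd j (%z. g z l) z)) (at (z j))"
   using z gW by (intro has_field_derivative_chol_compose[OF W f] chol_DERIV[OF g]) auto
  then show ?thesis by simp
 qed
 have "continuous_on V g"
  using g gW WC by (intro continuous_on_into_CS[of n]) (auto intro: chol_continuous)
 then have "continuous_on V (%z. f (g z))"
  using gW by (intro continuous_on_compose2[OF chol_continuous[OF f]]) auto
 with D show "chol m (%z. f (g z)) V"
  unfolding chol_def field_differentiable_def by blast
 show "pd j (%z. f (g z)) z = (\<Sum>l<n. pd l f (g z) * pd j (%z. g z l) z)" if "z \<in> V" "j < m"
  unfolding pd_def[of j "%z. f (g z)"] using D[OF that] by (rule DERIV_imp_deriv)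
qed


section \<open>Cauchy estimates and locally bounded limits\<close>

lemma deriv_bound_ball:
 assumes "f holomorphic_on ball a R" "!!t. t \<in> ball a R ==> cmod (f t) <= B" "dist a u + s < R" "s > 0"
 shows "cmod (deriv f u) <= B / s"
proof -
 have sub: "cball u s \<subseteq> ball a R"
 proof
  fix x assume "x \<in> cball u s"
  then show "x \<in> ball a R"
   using assms(3) dist_triangle[of a x u] by simp
 qed
 then have "ball u s \<subseteq> ball a R"
  by (meson ball_subset_cball subset_trans)
 then have "cmod ((deriv ^^ 1) f u) <= fact 1 * B / s ^ 1"
  using sub assms by (intro Cauchy_inequality)
   (auto intro: holomorphic_on_subset holomorphic_on_imp_continuous_on continuous_on_subset simp: subset_iff dist_norm)
 then show ?thesis by simp
qed

text \<open>Vitali's theorem for pointwise limits: the uniform bound gives equicontinuity.\<close>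

lemma holomorphic_bounded_limit:
 assumes F: "F ~= bot"
  and hol: "\<forall>\<^sub>F k in F. f k holomorphic_on ball a R & (ALL t:ball a R. cmod (f k t) <= B)"
  and lim: "!!t. t \<in> ball a R ==> ((%k. f k t) \<longlongrightarrow> g t) F"
 shows "g holomorphic_on ball a R"
  and "t \<in> ball a R ==> ((%k. deriv (f k) t) \<longlongrightarrow> deriv g t) F"
proof -
 have main: "EX s>0. g holomorphic_on ball t0 s & ((%k. deriv (f k) t0) \<longlongrightarrow> deriv g t0) F" if t0: "t0 \<in> ball a R" for t0
 proof -
  define s where "s = (R - dist a t0) / 4"
  have s: "s > 0" using t0 by (simp add: s_def)
  have sub: "cball t0 s \<subseteq> ball a R"
  proof
   fix x assume "x \<in> cball t0 s"
   then show "x \<in> ball a R"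
    using s dist_triangle[of a x t0] by (simp add: s_def)
  qed
  \<comment> \<open>The Cauchy bound for the derivatives on \<open>cball t0 s\<close>, from circles
    of radius \<open>s\<close> that still lie in \<open>ball a R\<close>. It is one Lipschitz
    constant for eventually all \<open>f k\<close>, and it passes to \<open>g\<close>.\<close>
  define L where "L = \<bar>B\<bar> / s"
  have L0: "L >= 0" using s by (simp add: L_def)
  have lip: "\<forall>\<^sub>F k in F. ALL u:cball t0 s. ALL v:cball t0 s. cmod (f k u - f k v) <= L * cmod (u - v)"
   using hol
  proof eventually_elim
   case (elim k)
   show ?case
   proof (intro ballI)
    fix u v assume uv: "u \<in> cball t0 s" "v \<in> cball t0 s"
    show "cmod (f k u - f k v) <= L * cmod (u - v)"
    proof (rule field_differentiable_bound[OF convex_cball _ _ uv])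
     fix z assume z: "z \<in> cball t0 s"
     then show "(f k has_field_derivative deriv (f k) z) (at z within cball t0 s)"
      using elim sub holomorphic_derivI[OF _ open_ball, of "f k" a R z] has_field_derivative_at_within by blast
     show "cmod (deriv (f k) z) <= L"
      unfolding L_def
     proof (rule deriv_bound_ball[of "f k" a R])
      have "dist a z <= dist a t0 + dist t0 z" by (rule dist_triangle)
      moreover have "dist t0 z <= s" "4 * s = R - dist a t0" using z by (simp_all add: s_def)
      ultimately show "dist a z + s < R" using s by linarith
      show "cmod (f k t) <= \<bar>B\<bar>" if "t \<in> ball a R" for t using elim that by force
     qed (use elim s in auto)
    qed
   qed
  qed
  have glip: "cmod (g u - g v) <= L * cmod (u - v)" if uv: "u \<in> cball t0 s" "v \<in> cball t0 s" for u v
  proof (rule tendsto_upperbound[OF _ _ F])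
   show "((%k. cmod (f k u - f k v)) \<longlongrightarrow> cmod (g u - g v)) F"
    using uv sub by (intro tendsto_norm tendsto_diff lim) auto
   show "\<forall>\<^sub>F k in F. cmod (f k u - f k v) <= L * cmod (u - v)"
    using lip by eventually_elim (use uv in auto)
  qed
  have ul: "uniform_limit (cball t0 s) f g F"
  proof (rule uniform_limitI)
   fix e :: real assume e: "e > 0"
   define d where "d = e / (4 * (L + 1))"
   have d: "d > 0" using e L0 by (simp add: d_def)
   have Ld: "L * d <= e / 4"
   proof -
    have "L * d <= (L + 1) * d" using d by simp
    also have "... = e / 4" unfolding d_def using L0 by (simp add: field_simps)
    finally show ?thesis .
   qed
   obtain C where C: "finite C" "C \<subseteq> cball t0 s" "cball t0 s \<subseteq> (\<Union>c\<in>C. ball c d)"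
    by (rule compactE_image[OF compact_cball, of "cball t0 s" "%c. ball c d" t0 s]) (use d in auto)
   have "\<forall>\<^sub>F k in F. ALL c:C. dist (f k c) (g c) < e / 4"
    using C sub e by (intro eventually_ball_finite ballI tendstoD lim) auto
   with lip show "\<forall>\<^sub>F k in F. ALL x:cball t0 s. dist (f k x) (g x) < e"
   proof eventually_elim
    case (elim k)
    show ?case
    proof
     fix x assume x: "x \<in> cball t0 s"
     then obtain c where c: "c \<in> C" "dist c x < d" using C by auto
     then have cs: "c \<in> cball t0 s" using C by auto
     have "L * cmod (x - c) <= e / 4"
      using Ld L0 c mult_left_mono[of "cmod (x - c)" d L] by (simp add: dist_norm norm_minus_commute)
     have "cmod (f k x - f k c) <= L * cmod (x - c)" using elim(1) x cs by blast
     with \<open>L * cmod (x - c) <= e / 4\<close> have "dist (f k x) (f k c) <= e / 4" "dist (g c) (g x) <= e / 4"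
      using glip[OF x cs] by (simp_all add: dist_norm norm_minus_commute)
     moreover have "dist (f k c) (g c) < e / 4"
      using elim(2) c by blast
     moreover have "dist (f k x) (g x) <= dist (f k x) (f k c) + (dist (f k c) (g c) + dist (g c) (g x))"
      by (meson add_left_mono dist_triangle order_trans)
     ultimately show "dist (f k x) (g x) < e" using e by linarith
    qed
   qed
  qed
  have bs: "ball t0 s \<subseteq> ball a R" using sub by (meson ball_subset_cball subset_trans)
  have holk: "\<forall>\<^sub>F k in F. continuous_on (cball t0 s) (f k) & f k holomorphic_on ball t0 s"
   using hol by eventually_elim
    (use sub bs in \<open>auto intro: holomorphic_on_subset holomorphic_on_imp_continuous_on continuous_on_subset\<close>)
  have gh: "g holomorphic_on ball t0 s"
   using holomorphic_uniform_limit[OF holk ul] F by auto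
  have "((%k. (deriv ^^ 1) (f k) t0) \<longlongrightarrow> (deriv ^^ 1) g t0) F"
  proof (rule higher_deriv_complex_uniform_limit[where A="ball t0 s"])
   show "uniform_limit (ball t0 s) f g F"
    using ul by (rule uniform_limit_on_subset) (rule ball_subset_cball)
   show "\<forall>\<^sub>F k in F. f k holomorphic_on ball t0 s"
    using holk by eventually_elim auto
  qed (use F s in auto)
  with gh s show ?thesis by auto
 qed
 show "g holomorphic_on ball a R"
  unfolding holomorphic_on_open[OF open_ball]
 proof
  fix t assume "t \<in> ball a R"
  then obtain s where "s > 0" "g holomorphic_on ball t s" using main by blast
  then show "EX f'. (g has_field_derivative f') (at t)"
   by (auto simp: holomorphic_on_open)
 qed
 show "((%k. deriv (f k) t) \<longlongrightarrow> deriv g t) F" if "t \<in> ball a R"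
  using main[OF that] by blast
qed

lemma chol_pdisc_pd_bound:
 assumes f: "chol n f (pdisc n z R)" and B: "!!w. w \<in> pdisc n z R ==> cmod (f w) <= B"
  and v: "v \<in> pdisc n z (R/2)" and j: "j < n"
 shows "cmod (pd j f v) <= 4 * B / R"
proof -
 have d: "dist (v j) (z j) < R / 2" using v j by (auto simp: pdisc_def)
 then have R: "R > 0" by (metis dist_not_less_zero half_gt_zero_iff linorder_less_linear order_less_trans)
 have upd: "v(j := t) \<in> pdisc n z R" if "t \<in> ball (v j) (R/2)" for t
 proof -
  have "dist t (z j) < R"
   using d that dist_triangle[of t "z j" "v j"] by (simp add: dist_commute)
  moreover have "dist (v i) (z i) < R" if "i < n" for i
   using v R that unfolding pdisc_def by force
  ultimately show ?thesis using v j by (auto simp: pdisc_def CS_def)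
 qed
 have "cmod (deriv (%t. f (v(j := t))) (v j)) <= B / (R/4)"
  using R by (intro deriv_bound_ball[of _ "v j" "R/2"] chol_slice_holomorphic[OF f j]) (auto intro!: upd B)
 then show ?thesis by (simp add: pd_def field_simps)
qed

lemma chol_pdisc_lipschitz:
 assumes f: "chol n f (pdisc n z R)" and B: "!!w. w \<in> pdisc n z R ==> cmod (f w) <= B"
  and w: "w \<in> pdisc n z (R/2)" "w' \<in> pdisc n z (R/2)" and R: "R > 0"
 shows "cmod (f w - f w') <= 4 * B / R * (\<Sum>j<n. cmod (w j - w' j))"
proof -
 have "chol n f (pdisc n z (R/2))"
  by (rule chol_subset[OF f pdisc_mono]) (use R in simp)
 from pdisc_mean_value[OF this _ w, of "%_. 0" "4 * B / R"] chol_pdisc_pd_bound[OF f B]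
 show ?thesis by simp
qed

text \<open>Slices reduce differentiability and the convergence of derivatives to one variable.
  Joint continuity comes from the Lipschitz estimate on the half polydisc, which is uniform in
  \<open>k\<close> and therefore survives the limit.\<close>

lemma chol_bounded_limit:
 assumes F: "F ~= bot" and W: "copen n W"
  and bd: "!!z. z \<in> W ==> EX e>0. EX B. pdisc n z e \<subseteq> W &
   (\<forall>\<^sub>F k in F. chol n (f k) (pdisc n z e) & (ALL w:pdisc n z e. cmod (f k w) <= B))"
  and lim: "!!z. z \<in> W ==> ((%k. f k z) \<longlongrightarrow> g z) F"
 shows "chol n g W" and "z \<in> W ==> j < n ==> ((%k. pd j (f k) z) \<longlongrightarrow> pd j g z) F"
proof -
 have WC: "W \<subseteq> CS n" using W by (rule openin_imp_subset)
 have slice: "(%t. g (z(j := t))) field_differentiable at (z j) & ((%k. pd j (f k) z) \<longlongrightarrow> pd j g z) F"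
  if z: "z \<in> W" and j: "j < n" for z j
 proof -
  obtain e B where e: "e > 0" "pdisc n z e \<subseteq> W"
   "\<forall>\<^sub>F k in F. chol n (f k) (pdisc n z e) & (ALL w:pdisc n z e. cmod (f k w) <= B)"
   using bd[OF z] by blast
  have upd: "z(j := t) \<in> pdisc n z e" if "t \<in> ball (z j) e" for t
   using that e(1) z WC j by (auto simp: pdisc_def dist_commute CS_def)
  have h: "\<forall>\<^sub>F k in F. (%t. f k (z(j := t))) holomorphic_on ball (z j) e &
    (ALL t:ball (z j) e. cmod (f k (z(j := t))) <= B)"
   using e(3) by eventually_elim (auto intro!: chol_slice_holomorphic[OF _ j] upd)
  have l: "((%k. f k (z(j := t))) \<longlongrightarrow> g (z(j := t))) F" if "t \<in> ball (z j) e" for t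
   using upd[OF that] e(2) by (intro lim) auto
  have "(%t. g (z(j := t))) holomorphic_on ball (z j) e"
   by (rule holomorphic_bounded_limit(1)[OF F h l])
  moreover have "((%k. deriv (%t. f k (z(j := t))) (z j)) \<longlongrightarrow> deriv (%t. g (z(j := t))) (z j)) F"
   using e(1) by (intro holomorphic_bounded_limit(2)[OF F h l]) auto
  ultimately show ?thesis
   using e(1) unfolding pd_def by (auto simp: holomorphic_on_imp_differentiable_at)
 qed
 have "continuous (at z within W) g" if z: "z \<in> W" for z
 proof -
  obtain e B where e: "e > 0" "pdisc n z e \<subseteq> W"
   "\<forall>\<^sub>F k in F. chol n (f k) (pdisc n z e) & (ALL w:pdisc n z e. cmod (f k w) <= B)"
   using bd[OF z] by blast
  have zin: "z \<in> pdisc n z (e/2)" using z WC e(1) by (intro pdisc_center) auto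
  have lip: "cmod (g w - g z) <= 4 * B / e * (\<Sum>j<n. cmod (w j - z j))" if w: "w \<in> pdisc n z (e/2)" for w
  proof (rule tendsto_upperbound[OF _ _ F])
   have "w \<in> W" using w e pdisc_mono[of "e/2" e n z] by auto
   then show "((%k. cmod (f k w - f k z)) \<longlongrightarrow> cmod (g w - g z)) F"
    using z by (intro tendsto_norm tendsto_diff lim)
   show "\<forall>\<^sub>F k in F. cmod (f k w - f k z) <= 4 * B / e * (\<Sum>j<n. cmod (w j - z j))"
    using e(3)
   proof eventually_elim
    case (elim k)
    show ?case by (rule chol_pdisc_lipschitz[of n "f k" z e B]) (use elim w zin e(1) in auto)
   qed
  qed
  have "((%w. 4 * B / e * (\<Sum>j<n. cmod (w j - z j))) \<longlongrightarrow> 4 * B / e * (\<Sum>j<n. cmod (z j - z j))) (at z within W)"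
  proof -
   have "((%w. w j) \<longlongrightarrow> z j) (at z within W)" for j
    using continuous_on_coord[of UNIV j] tendsto_within_subset[of _ _ z UNIV W]
    by (auto simp: continuous_on_def)
   then show ?thesis by (intro tendsto_intros)
  qed
  then have t0: "((%w. 4 * B / e * (\<Sum>j<n. cmod (w j - z j))) \<longlongrightarrow> 0) (at z within W)"
   by simp
  have "\<forall>\<^sub>F w in at z within W. w \<in> pdisc n z (e/2)"
  proof -
   obtain T where "open T" "pdisc n z (e/2) = CS n Int T"
    using openin_pdisc[of n z "e/2"] by (auto simp: openin_open)
   then show ?thesis using zin WC by (auto simp: eventually_at_topological)
  qed
  then have "\<forall>\<^sub>F w in at z within W. norm (g w - g z) <= 4 * B / e * (\<Sum>j<n. cmod (w j - z j))"
   by eventually_elim (rule lip)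
  from Lim_null_comparison[OF this t0] show ?thesis
   by (simp add: continuous_within LIM_zero_iff)
 qed
 then have "continuous_on W g"
  by (simp add: continuous_on_eq_continuous_within)
 with slice show "chol n g W"
  unfolding chol_def by blast
 show "((%k. pd j (f k) z) \<longlongrightarrow> pd j g z) F" if "z \<in> W" "j < n"
  using slice[OF that] by blast
qed

text \<open>A partial derivative is the limit of the difference quotients \<open>q h\<close>, which
  are holomorphic in all variables and, by strict differentiability, locally bounded uniformly in
  \<open>h\<close>.\<close>

lemma chol_pd:
 assumes W: "copen n W" and f: "chol n f W" and j: "j < n"
 shows "chol n (pd j f) W"
proof -
 have WC: "W \<subseteq> CS n" using W by (rule openin_imp_subset)
 define q where "q = (%h z. (f (z(j := z j + h)) - f z) / h)"
 have nb: "EX e>0. EX B. pdisc n z e \<subseteq> W &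
   (\<forall>\<^sub>F h in at 0. chol n (q h) (pdisc n z e) & (ALL w:pdisc n z e. cmod (q h w) <= B))" if z: "z \<in> W" for z
 proof -
  obtain d where d: "d > 0" "pdisc n z d \<subseteq> W" "!!w w'. w \<in> pdisc n z d ==> w' \<in> pdisc n z d ==>
    cmod (f w - f w' - (\<Sum>j<n. pd j f z * (w j - w' j))) <= 1 * (\<Sum>j<n. cmod (w j - w' j))"
   using chol_strict_diff[OF W f z zero_less_one] by auto
  have sub: "pdisc n z (d/2) \<subseteq> pdisc n z d" using d(1) by (intro pdisc_mono) auto
  have shift: "w(j := w j + h) \<in> pdisc n z d" if "w \<in> pdisc n z (d/2)" "cmod h < d/2" for w h
  proof -
   have "dist (w j + h) (z j) <= dist (w j) (z j) + cmod h"
    by (metis (no_types, opaque_lifting) add.commute add_diff_eq dist_norm norm_triangle_ineq)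
   moreover have "dist (w j) (z j) < d/2" using that(1) j by (auto simp: pdisc_def)
   ultimately have "dist (w j + h) (z j) < d" using that(2) by linarith
   then show ?thesis using that(1) sub j by (auto simp: pdisc_def CS_def)
  qed
  have "chol n (q h) (pdisc n z (d/2)) & (ALL w:pdisc n z (d/2). cmod (q h w) <= cmod (pd j f z) + 1)"
   if h: "h ~= 0" "cmod h < d/2" for h
  proof
   have g: "chol n (%w. (w(j := w j + h)) i) (pdisc n z (d/2))" if "i < n" for i
    unfolding chol_def
   proof (intro conjI ballI allI impI)
    show "continuous_on (pdisc n z (d/2)) (%w. (w(j := w j + h)) i)"
     by (cases "i = j") (auto intro!: continuous_on_add continuous_on_coord)
    show "(%t. ((w(l := t))(j := (w(l := t)) j + h)) i) field_differentiable at (w l)" for w l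
     by (cases "i = j"; cases "i = l") (auto intro!: derivative_intros field_differentiable_add)
   qed
   have c: "chol n (%w. f (w(j := w j + h))) (pdisc n z (d/2))"
    by (rule chol_compose(1)[OF W f openin_pdisc g]) (use shift[OF _ h(2)] d(2) in blast)+
   have c': "chol n f (pdisc n z (d/2))"
    using f sub d by (auto intro: chol_subset)
   show "chol n (q h) (pdisc n z (d/2))"
    using c c' h unfolding q_def chol_def
    by (auto intro!: continuous_on_divide continuous_on_diff field_differentiable_divide field_differentiable_diff)
   show "ALL w:pdisc n z (d/2). cmod (q h w) <= cmod (pd j f z) + 1"
   proof
    fix w assume w: "w \<in> pdisc n z (d/2)"
    let ?w = "w(j := w j + h)"
    have s: "(\<Sum>l<n. c l * (?w l - w l)) = c j * h" for c :: "nat => complex"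
    proof -
     have "(\<Sum>l<n. c l * (?w l - w l)) = (\<Sum>l<n. if l = j then c l * h else 0)"
      by (intro sum.cong) auto
     then show ?thesis using j by (simp add: sum.delta)
    qed
    have s': "(\<Sum>l<n. cmod (?w l - w l)) = cmod h"
    proof -
     have "(\<Sum>l<n. cmod (?w l - w l)) = (\<Sum>l<n. if l = j then cmod h else 0)"
      by (intro sum.cong) auto
     then show ?thesis using j by (simp add: sum.delta)
    qed
    have "cmod (f ?w - f w - pd j f z * h) <= cmod h"
     using d(3)[of ?w w] shift[OF w h(2)] w sub by (simp only: s s' mult_1 subset_iff)
    then have "cmod (f ?w - f w) <= cmod (pd j f z * h) + cmod h"
     using norm_triangle_ineq2[of "f ?w - f w" "pd j f z * h"] by linarith
    then show "cmod (q h w) <= cmod (pd j f z) + 1"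
     using h by (simp add: q_def norm_divide norm_mult divide_le_eq algebra_simps)
   qed
  qed
  then have "\<forall>\<^sub>F h in at 0. chol n (q h) (pdisc n z (d/2)) & (ALL w:pdisc n z (d/2). cmod (q h w) <= cmod (pd j f z) + 1)"
   using d(1) by (auto simp: eventually_at intro!: exI[of _ "d/2"])
  then show ?thesis
   using d sub by (intro exI[of _ "d/2"] conjI exI[of _ "cmod (pd j f z) + 1"]) auto
 qed
 show ?thesis
 proof (rule chol_bounded_limit(1)[where F="at (0::complex)" and f=q, OF _ W nb])
  show "((%h. q h z) \<longlongrightarrow> pd j f z) (at 0)" if "z \<in> W" for z
   using chol_DERIV[OF f that j] by (simp add: DERIV_def q_def)
 qed auto
qed


section \<open>Locality and closure properties of holomorphic functions\<close>

lemma chol_local: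
 assumes W: "copen n W"
  and loc: "!!z. z \<in> W ==> EX V. copen n V & z \<in> V & V \<subseteq> W & chol n f V"
 shows "chol n f W"
proof -
 have WC: "W \<subseteq> CS n" using W by (rule openin_imp_subset)
 have "continuous (at z within W) f & (ALL j<n. (%t. f (z(j := t))) field_differentiable at (z j))" if z: "z \<in> W" for z
 proof -
  obtain V where V: "copen n V" "z \<in> V" "V \<subseteq> W" "chol n f V"
   using loc[OF z] by blast
  then obtain T where T: "open T" "V = CS n Int T" by (auto simp: openin_open)
  have "at z within W = at z within V"
   by (rule at_within_nhd[of z T]) (use T V WC in auto)
  then show ?thesis
   using V unfolding chol_def continuous_on_eq_continuous_within by auto
 qed
 then show ?thesis
  unfolding chol_def continuous_on_eq_continuous_within by blast
qed

lemma chol_cong: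
 assumes W: "copen n W" and f: "chol n f W" and eq: "!!z. z \<in> W ==> f z = g z"
 shows "chol n g W"
 unfolding chol_def
proof (intro conjI ballI allI impI)
 show "continuous_on W g"
  using chol_continuous[OF f] eq by (simp cong: continuous_on_cong)
 fix z j assume z: "z \<in> W" "j < n"
 have "z \<in> CS n" using z openin_imp_subset[OF W] by blast
 then have o: "open {t. z(j := t) \<in> W}" "z j \<in> {t. z(j := t) \<in> W}"
  using slice_open[OF W z(2)] z by auto
 have "((%t. g (z(j := t))) has_field_derivative pd j f z) (at (z j))"
  by (rule has_field_derivative_transform_within_open[OF chol_DERIV[OF f z] o]) (use eq in auto)
 then show "(%t. g (z(j := t))) field_differentiable at (z j)"
  unfolding field_differentiable_def by blast
qed

lemma pd_cong:
 assumes W: "copen n W" and eq: "!!z. z \<in> W ==> f z = g z" and z: "z \<in> W" and j: "j < n"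
 shows "pd j f z = pd j g z"
proof -
 have "z \<in> CS n" using z openin_imp_subset[OF W] by blast
 then have "\<forall>\<^sub>F t in nhds (z j). z(j := t) \<in> W"
  using slice_open[OF W j] z eventually_nhds_in_open[of "{t. z(j := t) \<in> W}" "z j"] by auto
 then have "\<forall>\<^sub>F t in nhds (z j). f (z(j := t)) = g (z(j := t))"
  by eventually_elim (rule eq)
 then show ?thesis unfolding pd_def by (intro deriv_cong_ev) auto
qed

lemma chol_coord: "i < n ==> chol n (%z. z i) W"
 unfolding chol_def
proof (intro conjI ballI allI impI)
 show "(%t. (z(j := t)) i) field_differentiable at (z j)" for z :: "nat => complex" and j
  by (cases "i = j") auto
qed (rule continuous_on_coord)

lemma pd_coord: "pd j (%z. z i) z = (if i = j then 1 else 0)"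
 unfolding pd_def by (auto simp: fun_upd_def)

lemma chol_const: "chol n (%z. c) W"
 unfolding chol_def by auto

lemma chol_add: "chol n f W ==> chol n g W ==> chol n (%z. f z + g z) W"
 unfolding chol_def by (auto intro!: continuous_on_add field_differentiable_add)

lemma chol_diff: "chol n f W ==> chol n g W ==> chol n (%z. f z - g z) W"
 unfolding chol_def by (auto intro!: continuous_on_diff field_differentiable_diff)

lemma chol_mult: "chol n f W ==> chol n g W ==> chol n (%z. f z * g z) W"
 unfolding chol_def by (auto intro!: continuous_on_mult field_differentiable_mult)

lemma chol_sum: "(!!i. i \<in> I ==> chol n (f i) W) ==> chol n (%z. \<Sum>i\<in>I. f i z) W"
 by (induction I rule: infinite_finite_induct) (auto intro: chol_const chol_add)

text \<open>The inverse is the fixed point of \<open>y \<mapsto> x - (E y - y)\<close>; the Cauchy estimates make this map a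
 contraction.\<close>

lemma near_identity_inverse:
 assumes E: "!!i. i < n ==> chol n (%y. E y i) (pdisc n y0 R)" and R: "R > 0" and y0: "y0 \<in> CS n"
  and near: "!!y i. y \<in> pdisc n y0 R ==> i < n ==> cmod (E y i - y i) <= \<eta>"
  and \<eta>: "32 * (real n + 1) * \<eta> <= R"
 obtains G where "!!i. i < n ==> chol n (%x. G x i) (pdisc n y0 (R/4))"
  "!!x. x \<in> pdisc n y0 (R/4) ==> G x \<in> pdisc n y0 (R/2)"
  "!!x i. x \<in> pdisc n y0 (R/4) ==> i < n ==> E (G x) i = x i"
  "!!y y'. y \<in> pdisc n y0 (R/2) ==> y' \<in> pdisc n y0 (R/2) ==> (!!i. i < n ==> E y i = E y' i) ==> y = y'"
proof -
 define w where "w = (%i y. E y i - y i)"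
 have wh: "chol n (w i) (pdisc n y0 R)" if "i < n" for i
  unfolding w_def using that by (intro chol_diff E chol_coord)
 have wb: "cmod (w i y) <= \<bar>\<eta>\<bar>" if "i < n" "y \<in> pdisc n y0 R" for i y
  using near[OF that(2,1)] by (simp add: w_def)
 define S :: "(nat => complex) => (nat => complex) => real" where "S y y' = (\<Sum>j<n. cmod (y j - y' j))" for y y'
 \<comment> \<open>The assumption \<open>32 * (real n + 1) * \<eta> <= R\<close> turns the Cauchy
   constant \<open>4 * \<eta> / R\<close> into at most \<open>\<kappa>\<close>; summing over the
   \<open>n\<close> coordinates leaves the contraction factor
   \<open>n * \<kappa> <= 1/8\<close>.\<close>
 define \<kappa> where "\<kappa> = 1 / (8 * (real n + 1))"
 have eta1: "\<bar>\<eta>\<bar> <= R / 32" if "0 < n"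
 proof -
  have "\<eta> >= 0" using near[OF pdisc_center[OF y0 R] that] by (meson norm_ge_zero order_trans)
  then have "32 * \<eta> <= 32 * (real n + 1) * \<eta>" by (simp add: mult_right_mono algebra_simps)
  then show ?thesis using \<eta> \<open>\<eta> >= 0\<close> by simp
 qed
 have lip: "cmod (w i y - w i y') <= \<kappa> * S y y'" if "i < n" "y \<in> pdisc n y0 (R/2)" "y' \<in> pdisc n y0 (R/2)" for i y y'
 proof -
  have "\<eta> >= 0" using near[OF pdisc_center[OF y0 R] that(1)] by (meson norm_ge_zero order_trans)
  then have "4 * \<bar>\<eta>\<bar> / R <= \<kappa>"
   using \<eta> R by (simp add: \<kappa>_def field_simps)
  moreover have "cmod (w i y - w i y') <= 4 * \<bar>\<eta>\<bar> / R * S y y'"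
   unfolding S_def by (rule chol_pdisc_lipschitz[OF wh[OF that(1)] wb[OF that(1)] that(2,3) R])
  moreover have "S y y' >= 0" by (simp add: S_def sum_nonneg)
  ultimately show ?thesis by (meson mult_right_mono order_trans)
 qed
 have nk: "real n * \<kappa> <= 1 / 8"
  by (simp add: \<kappa>_def field_simps)
 have inj: "y = y'" if y: "y \<in> pdisc n y0 (R/2)" "y' \<in> pdisc n y0 (R/2)" and eq: "!!i. i < n ==> E y i = E y' i" for y y'
 proof -
  have "S y y' <= (\<Sum>i<n. \<kappa> * S y y')"
   unfolding S_def[of y y']
  proof (rule sum_mono)
   fix i assume "i \<in> {..<n}"
   then have i: "i < n" by simp
   have "y i - y' i = w i y' - w i y" using eq[OF i] by (simp add: w_def algebra_simps)
   then show "cmod (y i - y' i) <= \<kappa> * (\<Sum>j<n. cmod (y j - y' j))"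
    using lip[OF i y] by (simp add: S_def norm_minus_commute)
  qed
  then have "S y y' <= real n * \<kappa> * S y y'" by simp
  moreover have "real n * \<kappa> * S y y' <= 1/8 * S y y'"
   by (rule mult_right_mono[OF nk]) (simp add: S_def sum_nonneg)
  moreover have "S y y' >= 0" by (simp add: S_def sum_nonneg)
  ultimately have "S y y' = 0" by linarith
  then have "ALL j:{..<n}. cmod (y j - y' j) = 0"
   unfolding S_def by (subst (asm) sum_nonneg_eq_0_iff) auto
  then show "y = y'"
   using y by (auto simp: pdisc_def CS_def fun_eq_iff) (metis linorder_not_le lessThan_iff)
 qed
 define P where "P = pdisc n y0 (R/4)"
 define G where "G = rec_nat (%x. x) (%k g x i. if i < n then x i - w i (g x) else 0)"
 have G0: "G 0 x = x" and GS: "G (Suc k) x i = (if i < n then x i - w i (G k x) else 0)" for k x i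
  by (simp_all add: G_def)
 \<comment> \<open>The iterates start within \<open>R/4\<close> of \<open>y0\<close> and are
   displaced by at most \<open>R/32\<close>. The closed bound \<open>3 * R / 8\<close> survives the
   limit and is still strictly below \<open>R/2\<close>.\<close>
 have Gin: "ALL i<n. dist (G k x i) (y0 i) <= 3 * R / 8 & G k x \<in> CS n" and Gin': "G k x \<in> pdisc n y0 (R/2)"
  if x: "x \<in> P" for k x
 proof -
  have "(ALL i<n. dist (G k x i) (y0 i) <= 3 * R / 8) & G k x \<in> CS n"
  proof (induction k)
   case 0
   then show ?case using x R by (force simp: G0 P_def pdisc_def)
  next
   case (Suc k)
   then have "G k x \<in> pdisc n y0 R" using R by (fastforce simp: pdisc_def)
   then have f1: "cmod (w i (G k x)) <= R / 32" if "i < n" for i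
    using wb[OF that] eta1 that by fastforce
   have f2: "dist (x i) (y0 i) < R / 4" if "i < n" for i
    using x that by (auto simp: P_def pdisc_def)
   have f3: "dist (x i - w i (G k x)) (y0 i) <= dist (x i) (y0 i) + cmod (w i (G k x))" for i
    using norm_triangle_ineq4[of "x i - y0 i" "w i (G k x)"] by (simp add: dist_norm algebra_simps)
   have "dist (G (Suc k) x i) (y0 i) <= 3 * R / 8" if "i < n" for i
   proof -
    have "G (Suc k) x i = x i - w i (G k x)" using that by (simp add: GS)
    then show ?thesis using f1[OF that] f2[OF that] f3[of i] R by simp
   qed
   then show ?case by (auto simp: GS CS_def)
  qed
  then show "ALL i<n. dist (G k x i) (y0 i) <= 3 * R / 8 & G k x \<in> CS n" "G k x \<in> pdisc n y0 (R/2)"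
   using R by (auto simp: pdisc_def intro: order.strict_trans1)
 qed
 have Gh: "ALL i<n. chol n (%x. G k x i) P" for k
 proof (induction k)
  case 0
  then show ?case by (auto simp: G0 intro: chol_coord)
 next
  case (Suc k)
  have "chol n (%x. w i (G k x)) P" if "i < n" for i
  proof (rule chol_compose(1)[OF openin_pdisc[of n y0 R] wh[OF that]])
   show "copen n P" unfolding P_def by (rule openin_pdisc)
   show "G k z \<in> pdisc n y0 R" if "z \<in> P" for z
    using Gin'[OF that] pdisc_mono[of "R/2" R n y0] R by auto
  qed (use Suc in auto)
  then show ?case by (auto simp: GS intro!: chol_diff chol_coord)
 qed
 have step: "S (G (Suc (Suc k)) x) (G (Suc k) x) <= 1/2 * S (G (Suc k) x) (G k x)" if x: "x \<in> P" for k x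
 proof -
  have "S (G (Suc (Suc k)) x) (G (Suc k) x) <= (\<Sum>i<n. \<kappa> * S (G (Suc k) x) (G k x))"
   unfolding S_def[of "G (Suc (Suc k)) x"]
  proof (rule sum_mono)
   fix i assume "i \<in> {..<n}"
   then have i: "i < n" by simp
   have "G (Suc (Suc k)) x i - G (Suc k) x i = - (w i (G (Suc k) x) - w i (G k x))"
    using i by (simp add: GS[of "Suc k"] GS[of k])
   then show "cmod (G (Suc (Suc k)) x i - G (Suc k) x i) <= \<kappa> * S (G (Suc k) x) (G k x)"
    using lip[OF i Gin'[OF x] Gin'[OF x], of "Suc k" k] by (simp only: norm_minus_cancel)
  qed
  also have "... = (real n * \<kappa>) * S (G (Suc k) x) (G k x)" by simp
  also have "... <= 1/2 * S (G (Suc k) x) (G k x)"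
   using nk by (intro mult_right_mono) (auto simp: S_def sum_nonneg)
  finally show ?thesis .
 qed
 have conv: "EX l. (%k. G k x i) \<longlonglongrightarrow> l" if x: "x \<in> P" for x i
 proof (cases "i < n")
  case True
  define C where "C = S (G (Suc 0) x) (G 0 x)"
  have geo: "S (G (Suc k) x) (G k x) <= C * (1/2) ^ k" for k
  proof (induction k)
   case (Suc k)
   then show ?case using step[OF x, of k] by simp
  qed (simp add: C_def)
  have "cmod (G (Suc k) x i - G k x i) <= C * (1/2) ^ k" for k
  proof -
   have "cmod (G (Suc k) x i - G k x i) <= S (G (Suc k) x) (G k x)"
    unfolding S_def using True by (intro member_le_sum) auto
   then show ?thesis using geo[of k] by linarith
  qed
  moreover have "summable (%k. C * (1/2 :: real) ^ k)"
   by (rule summable_mult) (rule summable_geometric, simp)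
  ultimately have "summable (%k. G (Suc k) x i - G k x i)"
   by (blast intro: summable_comparison_test')
  then obtain l where "(%m. \<Sum>k<m. G (Suc k) x i - G k x i) \<longlonglongrightarrow> l"
   unfolding summable_def sums_def by blast
  then have "(%m. (G m x i - G 0 x i) + G 0 x i) \<longlonglongrightarrow> l + G 0 x i"
   by (intro tendsto_add tendsto_const) (simp add: sum_lessThan_telescope[of "%k. G k x i"])
  then show ?thesis by auto
 next
  case False
  have "G k x \<in> CS n" for k
   using Gin'[OF x, of k] by (auto simp: pdisc_def)
  then have "G k x i = 0" for k
   using False by (simp add: CS_def)
  then show ?thesis by auto
 qed
 define H where "H = (%x i. lim (%k. G k x i))"
 have H: "(%k. G k x i) \<longlonglongrightarrow> H x i" if "x \<in> P" for x i
  using conv[OF that, of i] unfolding H_def convergent_LIMSEQ_iff[symmetric] convergent_def[symmetric] .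
 have HC: "H x \<in> CS n" if x: "x \<in> P" for x
 proof -
  have "H x i = 0" if "i >= n" for i
  proof -
   have "G k x i = 0" for k using Gin'[OF x, of k] that by (auto simp: pdisc_def CS_def)
   then show ?thesis using H[OF x, of i] by (simp add: LIMSEQ_const_iff)
  qed
  then show ?thesis by (simp add: CS_def)
 qed
 have Hin: "H x \<in> pdisc n y0 (R/2)" if x: "x \<in> P" for x
 proof -
  have "dist (H x i) (y0 i) <= 3 * R / 8" if "i < n" for i
   by (rule tendsto_upperbound[OF tendsto_dist[OF H[OF x, of i] tendsto_const]])
    (use Gin[OF x] that in auto)
  then show ?thesis using HC[OF x] R by (force simp: pdisc_def)
 qed
 have EH: "E (H x) i = x i" if x: "x \<in> P" and i: "i < n" for x i
 proof -
  have HR: "H x \<in> pdisc n y0 R" and GR: "G k x \<in> pdisc n y0 R" for k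
   using Hin[OF x] Gin'[OF x, of k] pdisc_mono[of "R/2" R n y0] R by auto
  have "(%k. cmod (w i (G k x) - w i (H x))) \<longlonglongrightarrow> 0"
  proof (rule Lim_null_comparison)
   show "\<forall>\<^sub>F k in sequentially. norm (cmod (w i (G k x) - w i (H x))) <= \<kappa> * S (G k x) (H x)"
    using lip[OF i Gin'[OF x] Hin[OF x]] by simp
   have "(%k. \<kappa> * S (G k x) (H x)) \<longlonglongrightarrow> \<kappa> * (\<Sum>j<n. cmod (H x j - H x j))"
    unfolding S_def by (intro tendsto_intros H[OF x])
   then show "(%k. \<kappa> * S (G k x) (H x)) \<longlonglongrightarrow> 0" by simp
  qed
  then have "(%k. w i (G k x)) \<longlonglongrightarrow> w i (H x)"
   by (simp add: tendsto_norm_zero_iff LIM_zero_iff)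
  then have "(%k. x i - w i (G k x)) \<longlonglongrightarrow> x i - w i (H x)"
   by (intro tendsto_intros)
  moreover have "(%k. x i - w i (G k x)) \<longlonglongrightarrow> H x i"
   using LIMSEQ_Suc[OF H[OF x, of i]] i by (simp add: GS)
  ultimately have "x i - w i (H x) = H x i"
   by (rule LIMSEQ_unique)
  then show ?thesis by (simp add: w_def algebra_simps)
 qed
 have Hh: "chol n (%x. H x i) P" if i: "i < n" for i
 proof (rule chol_bounded_limit(1)[where F=sequentially and f="%k x. G k x i"])
  show oP: "copen n P" unfolding P_def by (rule openin_pdisc)
  show "EX e>0. EX B. pdisc n z e \<subseteq> P & (\<forall>\<^sub>F k in sequentially. chol n (%x. G k x i) (pdisc n z e) &
    (ALL w:pdisc n z e. cmod (G k w i) <= B))" if zP: "z \<in> P" for z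
  proof -
   obtain e where e: "e > 0" "pdisc n z e \<subseteq> P"
    using openin_contains_pdisc[OF oP zP] .
   have "cmod (G k u i) <= cmod (y0 i) + 3 * R / 8" if "u \<in> P" for k u
   proof -
    have "cmod (G k u i) <= cmod (y0 i) + dist (G k u i) (y0 i)"
     by (metis add.commute dist_norm norm_triangle_sub)
    then show ?thesis using Gin[OF that, of k] i by fastforce
   qed
   then show ?thesis
    using e Gh i chol_subset[OF _ e(2)]
    by (rule_tac x = e in exI, rule_tac conjI[OF e(1)], rule_tac x = "cmod (y0 i) + 3 * R / 8" in exI)
     (intro conjI always_eventually allI ballI, auto)
  qed
 qed (use H in auto)
 show ?thesis
  by (rule that[of H]) (use Hh Hin EH inj in \<open>auto simp: P_def\<close>)
qed

section \<open>Holomorphic maps between manifolds\<close>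

lemma chart_exists:
 assumes "complex_manifold X" "x \<in> pts X"
 obtains U \<phi> where "(U, \<phi>) \<in> atlas X" "x \<in> U"
 using assms unfolding complex_manifold_def by blast

lemma chart_open:
 assumes "complex_manifold X" "(U, \<phi>) \<in> atlas X"
 shows "openin (mtop X) U" and "copen (mdim X) (\<phi> ` U)"
  and "homeomorphic_map (subtopology (mtop X) U) (top_of_set (\<phi> ` U)) \<phi>"
proof -
 show U: "openin (mtop X) U" and I: "copen (mdim X) (\<phi> ` U)"
  using assms unfolding complex_manifold_def Complex_space_CS by auto
 have "homeomorphic_map (subtopology (mtop X) U) (subtopology (top_of_set (CS (mdim X))) (\<phi> ` U)) \<phi>"
  using assms unfolding complex_manifold_def Complex_space_CS by auto
 moreover have "CS (mdim X) Int \<phi> ` U = \<phi> ` U"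
  using openin_imp_subset[OF I] by blast
 ultimately show "homeomorphic_map (subtopology (mtop X) U) (top_of_set (\<phi> ` U)) \<phi>"
  by (simp add: subtopology_subtopology)
qed

lemma chart_subset: "complex_manifold X ==> (U, \<phi>) \<in> atlas X ==> U \<subseteq> pts X"
 and chart_inj: "complex_manifold X ==> (U, \<phi>) \<in> atlas X ==> inj_on \<phi> U"
 using chart_ok by blast+

lemma chart_CS: "complex_manifold X ==> (U, \<phi>) \<in> atlas X ==> x \<in> U ==> \<phi> x \<in> CS (mdim X)"
 using chart_open(2) openin_imp_subset by blast

lemma chart_inv:
 assumes "complex_manifold X" "(U, \<phi>) \<in> atlas X" "x \<in> U"
 shows "inv_into U \<phi> (\<phi> x) = x"
 using assms chart_inj by (metis inv_into_f_f)

lemma chart_image_open: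
 assumes "complex_manifold X" "(U, \<phi>) \<in> atlas X" "openin (mtop X) S" "S \<subseteq> U"
 shows "copen (mdim X) (\<phi> ` S)"
proof -
 have "openin (subtopology (mtop X) U) S"
  using assms(3,4) by (simp add: openin_subtopology_alt) (metis Int_absorb1 image_eqI mem_Collect_eq)
 then have "openin (top_of_set (\<phi> ` U)) (\<phi> ` S)"
  using homeomorphic_map_openness[OF chart_open(3)[OF assms(1,2)], of S] chart_subset[OF assms(1,2)] assms(4)
  by (simp add: inf_absorb2)
 then show ?thesis
  using chart_open(2)[OF assms(1,2)] openin_trans by blast
qed

lemma chart_continuous:
 assumes "complex_manifold X" "(U, \<phi>) \<in> atlas X"
 shows "continuous_map (subtopology (mtop X) U) (top_of_set (CS (mdim X))) \<phi>"
  and "continuous_map (top_of_set (\<phi> ` U)) (mtop X) (inv_into U \<phi>)"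
proof -
 have hm: "homeomorphic_map (subtopology (mtop X) U) (top_of_set (\<phi> ` U)) \<phi>"
  by (rule chart_open(3)[OF assms])
 then have c: "continuous_map (subtopology (mtop X) U) (top_of_set (\<phi> ` U)) \<phi>"
  by (rule homeomorphic_imp_continuous_map)
 show "continuous_map (subtopology (mtop X) U) (top_of_set (CS (mdim X))) \<phi>"
  using openin_imp_subset[OF chart_open(2)[OF assms]] c by (auto simp: continuous_map_in_subtopology)
 obtain g where g: "homeomorphic_maps (subtopology (mtop X) U) (top_of_set (\<phi> ` U)) \<phi> g"
  using hm homeomorphic_map_maps by blast
 then have gc: "continuous_map (top_of_set (\<phi> ` U)) (mtop X) g"
  by (simp add: homeomorphic_maps_def continuous_map_in_subtopology)
 have "g z = inv_into U \<phi> z" if z: "z \<in> \<phi> ` U" for z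
 proof -
  obtain x where x: "x \<in> U" "z = \<phi> x" using z by blast
  then have "g (\<phi> x) = x"
   using g chart_subset[OF assms] by (auto simp: homeomorphic_maps_def)
  then show ?thesis using x chart_inv[OF assms] by simp
 qed
 then show "continuous_map (top_of_set (\<phi> ` U)) (mtop X) (inv_into U \<phi>)"
  using gc by (auto intro: continuous_map_eq)
qed

lemma chart_preimage_open:
 assumes "complex_manifold X" "(U, \<phi>) \<in> atlas X" "copen (mdim X) W"
 shows "openin (mtop X) {x \<in> U. \<phi> x \<in> W}"
proof -
 have "openin (subtopology (mtop X) U) {x \<in> topspace (subtopology (mtop X) U). \<phi> x \<in> W}"
  by (rule openin_continuous_map_preimage[OF chart_continuous(1)[OF assms(1,2)] assms(3)])
 moreover have "{x \<in> topspace (subtopology (mtop X) U). \<phi> x \<in> W} = {x \<in> U. \<phi> x \<in> W}"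
  using chart_subset[OF assms(1,2)] by auto
 ultimately show ?thesis
  using chart_open(1)[OF assms(1,2)] openin_trans_full by metis
qed

lemma hol_pts: "holomorphic_map X Y f ==> x \<in> pts X ==> f x \<in> pts Y"
 unfolding holomorphic_map_def continuous_map_def by blast

lemma hol_continuous: "holomorphic_map X Y f ==> continuous_map (mtop X) (mtop Y) f"
 unfolding holomorphic_map_def by blast

lemma openin_chart_preimage:
 assumes X: "complex_manifold X" and c: "(U, \<phi>) \<in> atlas X" and f: "continuous_map (mtop X) (mtop Y) f"
  and V: "openin (mtop Y) V"
 shows "openin (mtop X) {x \<in> U. f x \<in> V}"
proof -
 have "{x \<in> U. f x \<in> V} = U Int {x \<in> topspace (mtop X). f x \<in> V}"
  using chart_subset[OF X c] by auto
 then show ?thesis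
  using chart_open(1)[OF X c] openin_continuous_map_preimage[OF f V] by auto
qed

lemma holomorphic_mapD:
 assumes X: "complex_manifold X" and Y: "complex_manifold Y" and f: "holomorphic_map X Y f"
  and c: "(U, \<phi>) \<in> atlas X" and d: "(V, \<psi>) \<in> atlas Y"
 shows "copen (mdim X) (\<phi> ` {x \<in> U. f x \<in> V})"
  and "i < mdim Y ==> chol (mdim X) (%z. \<psi> (f (inv_into U \<phi> z)) i) (\<phi> ` {x \<in> U. f x \<in> V})"
proof -
 show o: "copen (mdim X) (\<phi> ` {x \<in> U. f x \<in> V})"
  by (rule chart_image_open[OF X c openin_chart_preimage[OF X c hol_continuous[OF f] chart_open(1)[OF Y d]]]) auto
 have "holomorphic_coord (mdim X) (mdim Y) (\<psi> \<circ> f \<circ> inv_into U \<phi>) (\<phi> ` {x \<in> U. f x \<in> V})"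
  using f c d unfolding holomorphic_map_def by blast
 then show "chol (mdim X) (%z. \<psi> (f (inv_into U \<phi> z)) i) (\<phi> ` {x \<in> U. f x \<in> V})" if "i < mdim Y"
  using that unfolding holomorphic_coord_iff[OF o] by simp
qed

lemma transition_chol:
 assumes X: "complex_manifold X" and c: "(U, \<phi>) \<in> atlas X" and d: "(V, \<psi>) \<in> atlas X"
 shows "copen (mdim X) (\<phi> ` (U Int V))"
  and "i < mdim X ==> chol (mdim X) (%z. \<psi> (inv_into U \<phi> z) i) (\<phi> ` (U Int V))"
proof -
 show o: "copen (mdim X) (\<phi> ` (U Int V))"
  by (rule chart_image_open[OF X c]) (use chart_open(1)[OF X c] chart_open(1)[OF X d] in auto)
 have "holomorphic_coord (mdim X) (mdim X) (\<psi> \<circ> inv_into U \<phi>) (\<phi> ` (U Int V))"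
  using X c d unfolding complex_manifold_def by blast
 then show "chol (mdim X) (%z. \<psi> (inv_into U \<phi> z) i) (\<phi> ` (U Int V))" if "i < mdim X"
  using that unfolding holomorphic_coord_iff[OF o] by simp
qed

text \<open>The definition quantifies over all pairs of charts. Because the coordinate changes are
  holomorphic, one pair and one small neighbourhood at each point suffice.\<close>

lemma holomorphic_mapI:
 assumes X: "complex_manifold X" and Y: "complex_manifold Y" and f: "continuous_map (mtop X) (mtop Y) f"
  and loc: "!!x. x \<in> pts X ==> EX U \<phi> V \<psi> N. (U, \<phi>) \<in> atlas X & (V, \<psi>) \<in> atlas Y & x \<in> U &
    copen (mdim X) N & \<phi> x \<in> N & N \<subseteq> \<phi> ` {x \<in> U. f x \<in> V} &
    (ALL i<mdim Y. chol (mdim X) (%z. \<psi> (f (inv_into U \<phi> z)) i) N)"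
 shows "holomorphic_map X Y f"
 unfolding holomorphic_map_def
proof (intro conjI f ballI, clarify)
 fix U' \<phi>' V' \<psi>' assume c': "(U', \<phi>') \<in> atlas X" and d': "(V', \<psi>') \<in> atlas Y"
 let ?n = "mdim X" and ?m = "mdim Y"
 have o: "copen ?n (\<phi>' ` {x \<in> U'. f x \<in> V'})"
  by (rule chart_image_open[OF X c' openin_chart_preimage[OF X c' f chart_open(1)[OF Y d']]]) auto
 have "chol ?n (%z. \<psi>' (f (inv_into U' \<phi>' z)) i) (\<phi>' ` {x \<in> U'. f x \<in> V'})" if i: "i < ?m" for i
 proof (rule chol_local[OF o])
  fix z assume "z \<in> \<phi>' ` {x \<in> U'. f x \<in> V'}"
  then obtain x where x: "x \<in> U'" "f x \<in> V'" "z = \<phi>' x" by blast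
  then have "x \<in> pts X" using chart_subset[OF X c'] by blast
  from loc[OF this] obtain U \<phi> V \<psi> N where L: "(U, \<phi>) \<in> atlas X" "(V, \<psi>) \<in> atlas Y" "x \<in> U"
    "copen ?n N" "\<phi> x \<in> N" "N \<subseteq> \<phi> ` {x \<in> U. f x \<in> V}"
    "!!i. i < ?m ==> chol ?n (%z. \<psi> (f (inv_into U \<phi> z)) i) N" by blast
  define S where "S = {x \<in> U. \<phi> x \<in> N} Int {x \<in> U'. f x \<in> V'}"
  have S: "openin (mtop X) S" "S \<subseteq> U" "S \<subseteq> U'" "x \<in> S"
   unfolding S_def using chart_preimage_open[OF X L(1,4)] openin_chart_preimage[OF X c' f chart_open(1)[OF Y d']] L x
   by auto
  have fV: "f y \<in> V Int V'" if "y \<in> S" for y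
   using that L(6) chart_inj[OF X L(1)] unfolding S_def inj_on_def by blast
  have o': "copen ?n (\<phi>' ` S)" and oN: "copen ?n (\<phi> ` S)"
   using chart_image_open[OF X c' S(1,3)] chart_image_open[OF X L(1) S(1,2)] .
  have inv': "inv_into U' \<phi>' w \<in> S" "\<phi>' (inv_into U' \<phi>' w) = w" if "w \<in> \<phi>' ` S" for w
   using that S chart_inv[OF X c'] by auto
  \<comment> \<open>\<open>c1\<close> to \<open>c4\<close> assemble the map in the charts of
    \<open>U'\<close> and \<open>V'\<close> from the change from \<open>U'\<close> to
    \<open>U\<close>, the map in the given charts, and the change from \<open>V\<close> to
    \<open>V'\<close>, all on \<open>S\<close>.\<close>
  have c1: "chol ?n (%w. \<phi> (inv_into U' \<phi>' w) j) (\<phi>' ` S)" if "j < ?n" for j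
   by (rule chol_subset[OF transition_chol(2)[OF X c' L(1) that]]) (use S in blast)
  have c2: "chol ?n (%w. \<psi> (f (inv_into U \<phi> (\<phi> (inv_into U' \<phi>' w)))) j) (\<phi>' ` S)" if "j < ?m" for j
   by (rule chol_compose(1)[OF L(4) L(7)[OF that] o' c1]) (use inv' in \<open>auto simp: S_def\<close>)
  have c3: "chol ?n (%w. \<psi> (f (inv_into U' \<phi>' w)) j) (\<phi>' ` S)" if "j < ?m" for j
   by (rule chol_cong[OF o' c2[OF that]]) (use inv'(1) S(2) chart_inv[OF X L(1)] in force)
  have c4: "chol ?n (%w. \<psi>' (inv_into V \<psi> (\<psi> (f (inv_into U' \<phi>' w)))) i) (\<phi>' ` S)"
   by (rule chol_compose(1)[OF transition_chol(1)[OF Y L(2) d'] transition_chol(2)[OF Y L(2) d' i] o' c3])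
    (auto intro!: imageI fV[OF inv'(1), THEN IntD1] fV[OF inv'(1), THEN IntD2])
  have "chol ?n (%w. \<psi>' (f (inv_into U' \<phi>' w)) i) (\<phi>' ` S)"
   by (rule chol_cong[OF o' c4]) (use fV inv'(1) chart_inv[OF Y L(2)] in force)
  then show "EX Va. copen ?n Va & z \<in> Va & Va \<subseteq> \<phi>' ` {x \<in> U'. f x \<in> V'} &
    chol ?n (%z. \<psi>' (f (inv_into U' \<phi>' z)) i) Va"
   using o' S x by (intro exI[of _ "\<phi>' ` S"]) (auto simp: S_def)
 qed
 then show "holomorphic_coord ?n ?m (\<psi>' \<circ> f \<circ> inv_into U' \<phi>') (\<phi>' ` {x \<in> U'. f x \<in> V'})"
  unfolding holomorphic_coord_iff[OF o] by simp
qed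

text \<open>The last part is the chain rule for partial derivatives through a chart \<open>V\<close>
  of the middle manifold; the multiplicativity of the Jacobians rests on it.\<close>

lemma compose_in_charts:
 assumes A: "complex_manifold A" and B: "complex_manifold B" and C: "complex_manifold C"
  and f: "holomorphic_map A B f" and g: "holomorphic_map B C g"
  and c: "(U, \<phi>) \<in> atlas A" and d: "(V, \<psi>) \<in> atlas B" and e: "(W, \<theta>) \<in> atlas C"
 shows "copen (mdim A) (\<phi> ` {x \<in> U. f x \<in> V & g (f x) \<in> W})"
  and "i < mdim C ==> chol (mdim A) (%z. \<theta> (g (f (inv_into U \<phi> z))) i) (\<phi> ` {x \<in> U. f x \<in> V & g (f x) \<in> W})"
  and "x \<in> U ==> f x \<in> V ==> g (f x) \<in> W ==> i < mdim C ==> j < mdim A ==>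
   pd j (%z. \<theta> (g (f (inv_into U \<phi> z))) i) (\<phi> x) =
   (\<Sum>l<mdim B. pd l (%z. \<theta> (g (inv_into V \<psi> z)) i) (\<psi> (f x)) * pd j (%z. \<psi> (f (inv_into U \<phi> z)) l) (\<phi> x))"
proof -
 let ?N = "\<phi> ` {x \<in> U. f x \<in> V & g (f x) \<in> W}"
 note gf = hol_continuous[OF f] continuous_map_compose[OF hol_continuous[OF f] hol_continuous[OF g]]
 have "{x \<in> U. f x \<in> V & g (f x) \<in> W} = {x \<in> U. f x \<in> V} Int {x \<in> U. (g \<circ> f) x \<in> W}"
  by auto
 then have "openin (mtop A) {x \<in> U. f x \<in> V & g (f x) \<in> W}"
  using openin_chart_preimage[OF A c gf(1) chart_open(1)[OF B d]]
   openin_chart_preimage[OF A c gf(2) chart_open(1)[OF C e]] by auto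
 then show o: "copen (mdim A) ?N"
  by (rule chart_image_open[OF A c]) auto
 have inv: "inv_into U \<phi> w \<in> {x \<in> U. f x \<in> V & g (f x) \<in> W}" if "w \<in> ?N" for w
  using that chart_inv[OF A c] by auto
 have c1: "chol (mdim A) (%z. \<psi> (f (inv_into U \<phi> z)) l) ?N" if "l < mdim B" for l
  by (rule chol_subset[OF holomorphic_mapD(2)[OF A B f c d that]]) auto
 have im: "\<psi> (f (inv_into U \<phi> z)) \<in> \<psi> ` {y \<in> V. g y \<in> W}" if "z \<in> ?N" for z
  using inv[OF that] by blast
 have eq: "\<theta> (g (inv_into V \<psi> (\<psi> (f (inv_into U \<phi> z))))) i = \<theta> (g (f (inv_into U \<phi> z))) i" if "z \<in> ?N" for z i
  using inv[OF that] chart_inv[OF B d] by force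
 note cc = chol_compose[OF holomorphic_mapD(1)[OF B C g d e] holomorphic_mapD(2)[OF B C g d e] o c1 im]
 show "chol (mdim A) (%z. \<theta> (g (f (inv_into U \<phi> z))) i) ?N" if "i < mdim C"
  by (rule chol_cong[OF o cc(1)[OF that] eq]) auto
 show "pd j (%z. \<theta> (g (f (inv_into U \<phi> z))) i) (\<phi> x) =
   (\<Sum>l<mdim B. pd l (%z. \<theta> (g (inv_into V \<psi> z)) i) (\<psi> (f x)) * pd j (%z. \<psi> (f (inv_into U \<phi> z)) l) (\<phi> x))"
  if "x \<in> U" "f x \<in> V" "g (f x) \<in> W" "i < mdim C" "j < mdim A"
 proof -
  have x: "\<phi> x \<in> ?N" using that by blast
  have "pd j (%z. \<theta> (g (f (inv_into U \<phi> z))) i) (\<phi> x) = pd j (%z. \<theta> (g (inv_into V \<psi> (\<psi> (f (inv_into U \<phi> z))))) i) (\<phi> x)"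
   by (rule pd_cong[OF o eq[symmetric] x that(5)])
  also have "... = (\<Sum>l<mdim B. pd l (%z. \<theta> (g (inv_into V \<psi> z)) i) (\<psi> (f (inv_into U \<phi> (\<phi> x)))) * pd j (%z. \<psi> (f (inv_into U \<phi> z)) l) (\<phi> x))"
   by (rule cc(2)[OF that(4) _ _ x that(5)]) auto
  finally show ?thesis using chart_inv[OF A c that(1)] by simp
 qed
qed

lemma holomorphic_map_compose:
 assumes A: "complex_manifold A" and B: "complex_manifold B" and C: "complex_manifold C"
  and f: "holomorphic_map A B f" and g: "holomorphic_map B C g"
 shows "holomorphic_map A C (%x. g (f x))"
proof (rule holomorphic_mapI[OF A C])
 show "continuous_map (mtop A) (mtop C) (%x. g (f x))"
  using continuous_map_compose[OF hol_continuous[OF f] hol_continuous[OF g]] by (simp add: o_def)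
 fix x assume x: "x \<in> pts A"
 obtain U \<phi> where c: "(U, \<phi>) \<in> atlas A" "x \<in> U" using chart_exists[OF A x] .
 obtain V \<psi> where d: "(V, \<psi>) \<in> atlas B" "f x \<in> V" using chart_exists[OF B hol_pts[OF f x]] .
 obtain W \<theta> where e: "(W, \<theta>) \<in> atlas C" "g (f x) \<in> W" using chart_exists[OF C hol_pts[OF g hol_pts[OF f x]]] .
 show "EX U \<phi> V \<psi> N. (U, \<phi>) \<in> atlas A & (V, \<psi>) \<in> atlas C & x \<in> U &
    copen (mdim A) N & \<phi> x \<in> N & N \<subseteq> \<phi> ` {x \<in> U. g (f x) \<in> V} &
    (ALL i<mdim C. chol (mdim A) (%z. \<psi> (g (f (inv_into U \<phi> z))) i) N)"
  by (rule exI[of _ U], rule exI[of _ \<phi>], rule exI[of _ W], rule exI[of _ \<theta>],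
    rule exI[of _ "\<phi> ` {x \<in> U. f x \<in> V & g (f x) \<in> W}"])
   (use c d e compose_in_charts(1,2)[OF A B C f g c(1) d(1) e(1)] in auto)
qed

lemma holomorphic_map_id:
 assumes X: "complex_manifold X" shows "holomorphic_map X X (%x. x)"
proof (rule holomorphic_mapI[OF X X])
 fix x assume x: "x \<in> pts X"
 obtain U \<phi> where c: "(U, \<phi>) \<in> atlas X" "x \<in> U" using chart_exists[OF X x] .
 have "chol (mdim X) (%z. \<phi> (inv_into U \<phi> z) i) (\<phi> ` (U Int U))" if "i < mdim X" for i
  by (rule transition_chol(2)[OF X c(1) c(1) that])
 then show "EX U \<phi> V \<psi> N. (U, \<phi>) \<in> atlas X & (V, \<psi>) \<in> atlas X & x \<in> U &
    copen (mdim X) N & \<phi> x \<in> N & N \<subseteq> \<phi> ` {x \<in> U. x \<in> V} &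
    (ALL i<mdim X. chol (mdim X) (%z. \<psi> (inv_into U \<phi> z) i) N)"
  using c chart_open(2)[OF X c(1)]
  by (rule_tac x=U in exI, rule_tac x=\<phi> in exI, rule_tac x=U in exI, rule_tac x=\<phi> in exI,
    rule_tac x="\<phi> ` U" in exI) simp
qed simp

section \<open>Differentials\<close>

lemma jacobian_mult_pd: "jacobian_mult n g z v i = (\<Sum>j<n. pd j (%z. g z i) z * v j)"
 by (simp add: jacobian_mult_def pd_def)

text \<open>Coordinates with index at least the dimension vanish identically on \<open>CS\<close>.
  \<open>jacobian_mult\<close> is computed for every index, so these components must be seen to be 0
  before two coordinate vectors can be equal as functions.\<close>

lemma pd_chart_zero:
 assumes A: "complex_manifold A" and B: "complex_manifold B" and f: "holomorphic_map A B f"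
  and c: "(U, \<phi>) \<in> atlas A" "x \<in> U" and d: "(V, \<psi>) \<in> atlas B" "f x \<in> V"
  and i: "\<not> i < mdim B" and j: "j < mdim A"
 shows "pd j (%z. \<psi> (f (inv_into U \<phi> z)) i) (\<phi> x) = 0"
proof -
 have "pd j (%z. \<psi> (f (inv_into U \<phi> z)) i) (\<phi> x) = pd j (%z. 0) (\<phi> x)"
 proof (rule pd_cong[OF holomorphic_mapD(1)[OF A B f c(1) d(1)] _ _ j])
  fix z assume "z \<in> \<phi> ` {x \<in> U. f x \<in> V}"
  then have "f (inv_into U \<phi> z) \<in> V" using chart_inv[OF A c(1)] by auto
  then show "\<psi> (f (inv_into U \<phi> z)) i = 0"
   using chart_CS[OF B d(1)] i by (auto simp: CS_def)
 qed (use c d in auto)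
 then show ?thesis by (simp add: pd_def)
qed

lemma jacobian_mult_compose:
 assumes A: "complex_manifold A" and B: "complex_manifold B" and C: "complex_manifold C"
  and f: "holomorphic_map A B f" and g: "holomorphic_map B C g"
  and c: "(U, \<phi>) \<in> atlas A" "x \<in> U" and d: "(V, \<psi>) \<in> atlas B" "f x \<in> V" and e: "(W, \<theta>) \<in> atlas C" "g (f x) \<in> W"
 shows "jacobian_mult (mdim A) (\<theta> \<circ> (%x. g (f x)) \<circ> inv_into U \<phi>) (\<phi> x) v =
  jacobian_mult (mdim B) (\<theta> \<circ> g \<circ> inv_into V \<psi>) (\<psi> (f x)) (jacobian_mult (mdim A) (\<psi> \<circ> f \<circ> inv_into U \<phi>) (\<phi> x) v)"
proof
 fix i
 note gf = holomorphic_map_compose[OF A B C f g]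
 show "jacobian_mult (mdim A) (\<theta> \<circ> (%x. g (f x)) \<circ> inv_into U \<phi>) (\<phi> x) v i =
  jacobian_mult (mdim B) (\<theta> \<circ> g \<circ> inv_into V \<psi>) (\<psi> (f x)) (jacobian_mult (mdim A) (\<psi> \<circ> f \<circ> inv_into U \<phi>) (\<phi> x) v) i"
 proof (cases "i < mdim C")
  case True
  have "(\<Sum>j<mdim A. pd j (%z. \<theta> (g (f (inv_into U \<phi> z))) i) (\<phi> x) * v j) =
   (\<Sum>j<mdim A. \<Sum>l<mdim B. pd l (%z. \<theta> (g (inv_into V \<psi> z)) i) (\<psi> (f x)) * (pd j (%z. \<psi> (f (inv_into U \<phi> z)) l) (\<phi> x) * v j))"
   using compose_in_charts(3)[OF A B C f g c(1) d(1) e(1) c(2) d(2) e(2) True]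
   by (intro sum.cong) (auto simp: sum_distrib_right mult.assoc)
  also have "... = (\<Sum>l<mdim B. pd l (%z. \<theta> (g (inv_into V \<psi> z)) i) (\<psi> (f x)) * (\<Sum>j<mdim A. pd j (%z. \<psi> (f (inv_into U \<phi> z)) l) (\<phi> x) * v j))"
   by (subst sum.swap) (simp add: sum_distrib_left)
  finally show ?thesis by (simp add: jacobian_mult_pd)
 next
  case False
  then show ?thesis
   using pd_chart_zero[OF A C gf c _ _ False] pd_chart_zero[OF B C g d _ _ False] e
   by (simp add: jacobian_mult_pd)
 qed
qed

lemma jacobian_mult_id:
 assumes X: "complex_manifold X" and c: "(U, \<phi>) \<in> atlas X" "x \<in> U" and v: "v \<in> CS (mdim X)"
 shows "jacobian_mult (mdim X) (\<phi> \<circ> (%x. x) \<circ> inv_into U \<phi>) (\<phi> x) v = v"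
proof
 fix i
 show "jacobian_mult (mdim X) (\<phi> \<circ> (%x. x) \<circ> inv_into U \<phi>) (\<phi> x) v i = v i"
 proof (cases "i < mdim X")
  case True
  have "pd j (%z. \<phi> (inv_into U \<phi> z) i) (\<phi> x) = (if i = j then 1 else 0)" if "j < mdim X" for j
  proof -
   have "pd j (%z. \<phi> (inv_into U \<phi> z) i) (\<phi> x) = pd j (%z. z i) (\<phi> x)"
    by (rule pd_cong[OF chart_open(2)[OF X c(1)] _ _ that]) (use c in \<open>auto simp: f_inv_into_f\<close>)
   then show ?thesis by (simp add: pd_coord)
  qed
  then have "jacobian_mult (mdim X) (\<phi> \<circ> (%x. x) \<circ> inv_into U \<phi>) (\<phi> x) v i = (\<Sum>j<mdim X. if i = j then v j else 0)"
   unfolding jacobian_mult_pd by (intro sum.cong) auto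
  then show ?thesis using True by simp
 next
  case False
  then show ?thesis
   using pd_chart_zero[OF X X holomorphic_map_id[OF X] c c False] v by (simp add: jacobian_mult_pd CS_def)
 qed
qed

lemma jacobian_mult_CS:
 assumes A: "complex_manifold A" and B: "complex_manifold B" and f: "holomorphic_map A B f"
  and c: "(U, \<phi>) \<in> atlas A" "x \<in> U" and d: "(V, \<psi>) \<in> atlas B" "f x \<in> V"
 shows "jacobian_mult (mdim A) (\<psi> \<circ> f \<circ> inv_into U \<phi>) (\<phi> x) v \<in> CS (mdim B)"
 using pd_chart_zero[OF A B f c d] by (auto simp: CS_def jacobian_mult_pd)

lemma charts_at_iff: "(U, \<phi>) \<in> charts_at X x \<longleftrightarrow> (U, \<phi>) \<in> atlas X & x \<in> U"
 by (simp add: charts_at_def)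

text \<open>The identity map is inserted into the coordinate change so that it has the shape of a
  map in charts and \<open>jacobian_mult_compose\<close> applies to it.\<close>

lemma tangent_spaceD:
 assumes "v \<in> tangent_space X x"
 shows "(U, \<phi>) \<in> charts_at X x ==> v (U, \<phi>) \<in> CS (mdim X)"
  and "(U, \<phi>) \<in> charts_at X x ==> (V, \<psi>) \<in> charts_at X x ==>
    v (V, \<psi>) = jacobian_mult (mdim X) (\<psi> \<circ> (%x. x) \<circ> inv_into U \<phi>) (\<phi> x) (v (U, \<phi>))"
  and "c \<notin> charts_at X x ==> v c = (%_. 0)"
proof -
 have a: "!!c. c \<notin> charts_at X x ==> v c = (%_. 0)" "!!c. c \<in> charts_at X x ==> v c \<in> CS (mdim X)"
  and b: "ALL (U, \<phi>):charts_at X x. ALL (V, \<psi>):charts_at X x.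
   v (V, \<psi>) = jacobian_mult (mdim X) (\<psi> \<circ> inv_into U \<phi>) (\<phi> x) (v (U, \<phi>))"
  using assms unfolding tangent_space_def topspace_Complex_space by blast+
 show "(U, \<phi>) \<in> charts_at X x ==> v (U, \<phi>) \<in> CS (mdim X)" and "c \<notin> charts_at X x ==> v c = (%_. 0)"
  by (rule a, assumption)+
 assume "(U, \<phi>) \<in> charts_at X x" "(V, \<psi>) \<in> charts_at X x"
 then have "v (V, \<psi>) = jacobian_mult (mdim X) (\<psi> \<circ> inv_into U \<phi>) (\<phi> x) (v (U, \<phi>))"
  using b by blast
 then show "v (V, \<psi>) = jacobian_mult (mdim X) (\<psi> \<circ> (%x. x) \<circ> inv_into U \<phi>) (\<phi> x) (v (U, \<phi>))"
  by (simp add: comp_def)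
qed

lemma tangent_eqI:
 assumes v: "v \<in> tangent_space X x" and w: "w \<in> tangent_space X x"
  and c: "(U, \<phi>) \<in> charts_at X x" and eq: "v (U, \<phi>) = w (U, \<phi>)"
 shows "v = w"
proof
 fix d :: "'a chart"
 obtain V \<psi> where d: "d = (V, \<psi>)" by (cases d)
 show "v d = w d"
  using tangent_spaceD(2)[OF v c, of V \<psi>] tangent_spaceD(2)[OF w c, of V \<psi>]
   tangent_spaceD(3)[OF v, of d] tangent_spaceD(3)[OF w, of d] eq
  by (cases "d \<in> charts_at X x") (auto simp: d)
qed

text \<open>\<open>differential\<close> uses an arbitrarily chosen chart at \<open>x\<close>.
  Factoring \<open>f\<close> through the identity and applying the chain rule passes from the chosen
  chart to any other one.\<close>

lemma differential_chart:
 assumes A: "complex_manifold A" and B: "complex_manifold B" and f: "holomorphic_map A B f"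
  and x: "x \<in> pts A" and v: "v \<in> tangent_space A x"
  and c: "(U, \<phi>) \<in> charts_at A x" and d: "(V, \<psi>) \<in> charts_at B (f x)"
 shows "differential A B f x v (V, \<psi>) = jacobian_mult (mdim A) (\<psi> \<circ> f \<circ> inv_into U \<phi>) (\<phi> x) (v (U, \<phi>))"
proof -
 obtain U' \<phi>' where s: "(SOME c. c \<in> charts_at A x) = (U', \<phi>')" by (meson surj_pair)
 have c': "(U', \<phi>') \<in> charts_at A x"
  using someI[of "%c. c \<in> charts_at A x", OF c] by (simp add: s)
 have "differential A B f x v (V, \<psi>) = jacobian_mult (mdim A) (\<psi> \<circ> f \<circ> inv_into U' \<phi>') (\<phi>' x) (v (U', \<phi>'))"
  unfolding differential_def using d by (simp add: s)
 also have "... = jacobian_mult (mdim A) (\<psi> \<circ> f \<circ> inv_into U' \<phi>') (\<phi>' x)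
   (jacobian_mult (mdim A) (\<phi>' \<circ> (%x. x) \<circ> inv_into U \<phi>) (\<phi> x) (v (U, \<phi>)))"
  using tangent_spaceD(2)[OF v c c'] by simp
 also have "... = jacobian_mult (mdim A) (\<psi> \<circ> (%x. f x) \<circ> inv_into U \<phi>) (\<phi> x) (v (U, \<phi>))"
  using c c' d by (intro jacobian_mult_compose[OF A A B holomorphic_map_id[OF A] f, symmetric])
   (auto simp: charts_at_iff)
 finally show ?thesis by simp
qed

lemma differential_tangent:
 assumes A: "complex_manifold A" and B: "complex_manifold B" and f: "holomorphic_map A B f"
  and x: "x \<in> pts A" and v: "v \<in> tangent_space A x"
 shows "differential A B f x v \<in> tangent_space B (f x)"
proof -
 obtain U \<phi> where c: "(U, \<phi>) \<in> atlas A" "x \<in> U" using chart_exists[OF A x] .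
 then have c': "(U, \<phi>) \<in> charts_at A x" by (simp add: charts_at_iff)
 show ?thesis
  unfolding tangent_space_def
 proof (intro CollectI conjI allI impI ballI; (clarify?))
  show "differential A B f x v d = (%_. 0)" if "d \<notin> charts_at B (f x)" for d
   using that by (cases d) (simp add: differential_def)
  fix V \<psi> assume d: "(V, \<psi>) \<in> charts_at B (f x)"
  show "differential A B f x v (V, \<psi>) \<in> topspace (Complex_space (mdim B))"
   using d c by (auto simp: differential_chart[OF A B f x v c' d] charts_at_iff intro!: jacobian_mult_CS[OF A B f])
  fix V' \<psi>' assume d': "(V', \<psi>') \<in> charts_at B (f x)"
  have "jacobian_mult (mdim A) (\<psi>' \<circ> (%x. f x) \<circ> inv_into U \<phi>) (\<phi> x) (v (U, \<phi>)) =
   jacobian_mult (mdim B) (\<psi>' \<circ> (%x. x) \<circ> inv_into V \<psi>) (\<psi> (f x)) (jacobian_mult (mdim A) (\<psi> \<circ> f \<circ> inv_into U \<phi>) (\<phi> x) (v (U, \<phi>)))"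
   using c d d' by (intro jacobian_mult_compose[OF A B B f holomorphic_map_id[OF B]]) (auto simp: charts_at_iff)
  then show "differential A B f x v (V', \<psi>') = jacobian_mult (mdim B) (\<psi>' \<circ> inv_into V \<psi>) (\<psi> (f x)) (differential A B f x v (V, \<psi>))"
   by (simp add: differential_chart[OF A B f x v c' d] differential_chart[OF A B f x v c' d'] o_def)
 qed
qed

lemma differential_compose:
 assumes A: "complex_manifold A" and B: "complex_manifold B" and C: "complex_manifold C"
  and f: "holomorphic_map A B f" and g: "holomorphic_map B C g"
  and x: "x \<in> pts A" and v: "v \<in> tangent_space A x"
 shows "differential A C (%x. g (f x)) x v = differential B C g (f x) (differential A B f x v)"
proof -
 note gf = holomorphic_map_compose[OF A B C f g] and fx = hol_pts[OF f x]
 obtain U \<phi> where c: "(U, \<phi>) \<in> atlas A" "x \<in> U" using chart_exists[OF A x] .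
 obtain V \<psi> where d: "(V, \<psi>) \<in> atlas B" "f x \<in> V" using chart_exists[OF B fx] .
 obtain W \<theta> where e: "(W, \<theta>) \<in> atlas C" "g (f x) \<in> W" using chart_exists[OF C hol_pts[OF g fx]] .
 have cde: "(U, \<phi>) \<in> charts_at A x" "(V, \<psi>) \<in> charts_at B (f x)" "(W, \<theta>) \<in> charts_at C (g (f x))"
  using c d e by (auto simp: charts_at_iff)
 note dt = differential_tangent[OF A B f x v]
 show ?thesis
 proof (rule tangent_eqI[OF differential_tangent[OF A C gf x v] differential_tangent[OF B C g fx dt] cde(3)])
  show "differential A C (%x. g (f x)) x v (W, \<theta>) = differential B C g (f x) (differential A B f x v) (W, \<theta>)"
   by (simp add: differential_chart[OF A C gf x v cde(1,3)] differential_chart[OF B C g fx dt cde(2,3)]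
     differential_chart[OF A B f x v cde(1,2)] jacobian_mult_compose[OF A B C f g c d e])
 qed
qed

text \<open>The maps agree on the points only, not as HOL functions. Both differentials use the same
  chosen chart, and its image is open, so the partial derivatives see points alone.\<close>

lemma differential_cong:
 assumes A: "complex_manifold A" and x: "x \<in> pts A" and eq: "!!y. y \<in> pts A ==> f y = g y"
 shows "differential A B f x = differential A B g x"
proof -
 obtain U0 \<phi>0 where c0: "(U0, \<phi>0) \<in> charts_at A x"
  using chart_exists[OF A x] by (metis charts_at_iff)
 obtain U \<phi> where s: "(SOME c. c \<in> charts_at A x) = (U, \<phi>)" by (meson surj_pair)
 have c: "(U, \<phi>) \<in> atlas A" "x \<in> U"
  using someI[of "%c. c \<in> charts_at A x", OF c0] by (simp_all add: s charts_at_iff)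
 have "jacobian_mult (mdim A) (\<psi> \<circ> f \<circ> inv_into U \<phi>) (\<phi> x) v = jacobian_mult (mdim A) (\<psi> \<circ> g \<circ> inv_into U \<phi>) (\<phi> x) v" for \<psi> v
 proof
  fix i
  have "pd j (%z. \<psi> (f (inv_into U \<phi> z)) i) (\<phi> x) = pd j (%z. \<psi> (g (inv_into U \<phi> z)) i) (\<phi> x)" if "j < mdim A" for j
   by (rule pd_cong[OF chart_open(2)[OF A c(1)] _ _ that])
    (use c chart_subset[OF A c(1)] chart_inv[OF A c(1)] eq in \<open>auto simp: subset_iff\<close>)
  then show "jacobian_mult (mdim A) (\<psi> \<circ> f \<circ> inv_into U \<phi>) (\<phi> x) v i = jacobian_mult (mdim A) (\<psi> \<circ> g \<circ> inv_into U \<phi>) (\<phi> x) v i"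
   by (simp add: jacobian_mult_pd)
 qed
 then show ?thesis
  unfolding differential_def using eq[OF x] by (auto simp: s fun_eq_iff split: prod.splits)
qed

lemma differential_id:
 assumes A: "complex_manifold A" and x: "x \<in> pts A" and v: "v \<in> tangent_space A x"
  and eq: "!!y. y \<in> pts A ==> f y = y"
 shows "differential A A f x v = v"
proof -
 obtain U \<phi> where c: "(U, \<phi>) \<in> atlas A" "x \<in> U" using chart_exists[OF A x] .
 then have c': "(U, \<phi>) \<in> charts_at A x" by (simp add: charts_at_iff)
 have "differential A A (%x. x) x v = v"
  using differential_tangent[OF A A holomorphic_map_id[OF A] x v]
  by (intro tangent_eqI[OF _ v c'])
   (auto simp: differential_chart[OF A A holomorphic_map_id[OF A] x v c' c']
    jacobian_mult_id[OF A c tangent_spaceD(1)[OF v c']])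
 then show ?thesis using differential_cong[OF A x, of f "%x. x"] eq by simp
qed

section \<open>Holomorphic discs\<close>

abbreviation demb :: "complex => nat => complex" where
 "demb \<equiv> %z i. if i = 0 then z else 0"

abbreviation hdisc :: "'a cmanifold => (complex => 'a) => bool" where
 "hdisc \<equiv> holomorphic_map unit_disc"

lemma unit_disc_simps [simp]:
 "mtop unit_disc = top_of_set (ball 0 1)" "mdim unit_disc = 1" "atlas unit_disc = {(ball 0 1, demb)}"
 by (simp_all add: unit_disc_def disc_chart_def)

lemma demb_inj: "inj_on demb S"
 by (rule inj_onI) (metis (full_types))

lemma demb_inv [simp]: "t \<in> S ==> inv_into S demb (demb t) = t"
 by (rule inv_into_f_f[OF demb_inj])

lemma demb_ball: "demb ` ball 0 1 = pdisc 1 (%_. 0) 1"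
proof
 show "pdisc 1 (%_. 0) 1 \<subseteq> demb ` ball 0 1"
 proof
  fix z assume "z \<in> pdisc 1 (%_. 0) 1"
  then have "z = demb (z 0)" "z 0 \<in> ball 0 1"
   by (auto simp: pdisc_def CS_def fun_eq_iff)
  then show "z \<in> demb ` ball 0 1" by blast
 qed
qed (auto simp: pdisc_def CS_def)

lemma second_countable_euclidean: "second_countable (euclidean :: 'a::second_countable_topology topology)"
proof -
 obtain B :: "'a set set" where B: "countable B" "topological_basis B"
  using ex_countable_basis by blast
 have 1: "EX V:B. x \<in> V & V \<subseteq> U" if "open U" "x \<in> U" for U x
  by (rule topological_basisE[OF B(2) that]) blast
 have 2: "open V" if "V \<in> B" for V using topological_basis_open[OF B(2) that] .
 show ?thesis
  unfolding second_countable_def open_openin[symmetric] using B(1) 1 2 by blast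
qed

lemma complex_manifold_unit_disc: "complex_manifold unit_disc"
proof -
 have o: "copen 1 (demb ` ball 0 1)"
  unfolding demb_ball by (rule openin_pdisc)
 then have sub: "CS 1 Int demb ` ball 0 1 = demb ` ball 0 1"
  by (auto dest: openin_imp_subset)
 have "continuous_on (ball 0 1) demb"
 proof (intro continuous_on_coordinatewise_then_product)
  show "continuous_on (ball 0 1) (%x. demb x i)" for i by (cases "i = 0") auto
 qed
 then have "homeomorphic_maps (top_of_set (ball 0 1)) (top_of_set (demb ` ball 0 1)) demb (%w. w 0)"
  by (auto simp: homeomorphic_maps_def continuous_map_in_subtopology continuous_on_coord)
 then have h: "homeomorphic_map (top_of_set (ball 0 1)) (top_of_set (demb ` ball 0 1)) demb"
  using homeomorphic_maps_map by blast
 have "holomorphic_coord 1 1 (demb \<circ> inv_into (ball 0 1) demb) (demb ` ball 0 1)"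
  unfolding holomorphic_coord_iff[OF o]
  by (intro allI impI chol_cong[OF o chol_coord]) (auto simp: f_inv_into_f)
 moreover have "second_countable (top_of_set (ball (0::complex) 1))"
  by (simp add: second_countable_subtopology second_countable_euclidean)
 moreover have "connected_space (top_of_set (ball (0::complex) 1))"
  using connectedin_iff_connected[of "ball (0::complex) 1"] unfolding connectedin_def by simp
 ultimately show ?thesis
  using o h sub unfolding complex_manifold_def Complex_space_CS
  by (simp add: Hausdorff_space_subtopology subtopology_subtopology)
qed

lemma disc_mapD:
 assumes X: "complex_manifold X" and f: "hdisc X f" and c: "(V, \<psi>) \<in> atlas X" and i: "i < mdim X"
 shows "open {t \<in> ball 0 1. f t \<in> V}" and "(%t. \<psi> (f t) i) holomorphic_on {t \<in> ball 0 1. f t \<in> V}"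
proof -
 note D = complex_manifold_unit_disc
 have "openin (top_of_set (ball 0 1)) {t \<in> ball 0 1. f t \<in> V}"
  using openin_chart_preimage[OF D _ hol_continuous[OF f] chart_open(1)[OF X c], of "ball 0 1" demb] by simp
 then show "open {t \<in> ball 0 1. f t \<in> V}"
  by (simp add: openin_open_eq)
 have ch: "chol 1 (%z. \<psi> (f (inv_into (ball 0 1) demb z)) i) (demb ` {t \<in> ball 0 1. f t \<in> V})"
  using holomorphic_mapD(2)[OF D X f _ c i, of "ball 0 1" demb] by simp
 have e: "(%_. 0)(0 := t) = demb t" for t :: complex by auto
 have "(%t. \<psi> (f (inv_into (ball 0 1) demb ((%_. 0)(0 := t)))) i) holomorphic_on {t \<in> ball 0 1. f t \<in> V}"
  by (rule chol_slice_holomorphic[OF ch]) (auto simp: e)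
 then show "(%t. \<psi> (f t) i) holomorphic_on {t \<in> ball 0 1. f t \<in> V}"
  by (rule holomorphic_transform) (auto simp: e)
qed

text \<open>Continuity is derived here: the coordinates are holomorphic, hence continuous, and a
  chart is a homeomorphism onto its image.\<close>

lemma disc_mapI:
 assumes X: "complex_manifold X" and loc: "!!t. t \<in> ball 0 1 ==> EX V \<psi> S. (V, \<psi>) \<in> atlas X & open S & t \<in> S &
   S \<subseteq> ball 0 1 & f ` S \<subseteq> V & (ALL i<mdim X. (%s. \<psi> (f s) i) holomorphic_on S)"
 shows "hdisc X f"
proof (rule holomorphic_mapI[OF complex_manifold_unit_disc X])
 show "continuous_map (mtop unit_disc) (mtop X) f"
  unfolding continuous_map_def
 proof (intro conjI allI impI)
  show "f \<in> topspace (mtop unit_disc) \<rightarrow> topspace (mtop X)"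
   using loc chart_subset[OF X] by (fastforce simp: image_subset_iff)
  fix W assume W: "openin (mtop X) W"
  have "EX T. open T & t \<in> T & T \<subseteq> {t \<in> ball 0 1. f t \<in> W}" if t: "t \<in> ball 0 1" "f t \<in> W" for t
  proof -
   obtain V \<psi> S where S: "(V, \<psi>) \<in> atlas X" "open S" "t \<in> S" "S \<subseteq> ball 0 1" "f ` S \<subseteq> V"
    "!!i. i < mdim X ==> (%s. \<psi> (f s) i) holomorphic_on S"
    using loc[OF t(1)] by blast
   have c: "continuous_on S (%s. \<psi> (f s))"
    by (rule continuous_on_into_CS[of "mdim X"])
     (use S chart_CS[OF X S(1)] in \<open>auto intro: holomorphic_on_imp_continuous_on\<close>)
   have "copen (mdim X) (\<psi> ` (V Int W))"
    by (rule chart_image_open[OF X S(1)]) (use chart_open(1)[OF X S(1)] W in auto)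
   then obtain T where T: "open T" "\<psi> ` (V Int W) = CS (mdim X) Int T" by (auto simp: openin_open)
   have "open (S Int (%s. \<psi> (f s)) -` T)"
    using continuous_open_preimage[OF c S(2) T(1)] .
   moreover have "S Int (%s. \<psi> (f s)) -` T \<subseteq> {t \<in> ball 0 1. f t \<in> W}"
   proof
    fix s assume s: "s \<in> S Int (%s. \<psi> (f s)) -` T"
    then have "\<psi> (f s) \<in> \<psi> ` (V Int W)" using S chart_CS[OF X S(1), of "f s"] by (auto simp: T(2))
    then obtain w where w: "w \<in> V" "w \<in> W" "\<psi> (f s) = \<psi> w" by blast
    moreover have "f s \<in> V" using S s by blast
    ultimately have "f s \<in> W" using inj_onD[OF chart_inj[OF X S(1)] w(3)] by simp
    then show "s \<in> {t \<in> ball 0 1. f t \<in> W}" using s S by auto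
   qed
   moreover have "t \<in> S Int (%s. \<psi> (f s)) -` T" using S t T(2) by blast
   ultimately show ?thesis by blast
  qed
  then have "open {t \<in> ball 0 1. f t \<in> W}" by (subst open_subopen) blast
  then show "openin (mtop unit_disc) {x \<in> topspace (mtop unit_disc). f x \<in> W}"
   by (auto simp: openin_open_eq)
 qed
 fix t assume "t \<in> pts unit_disc"
 then have t: "t \<in> ball 0 1" by simp
 obtain V \<psi> S where S: "(V, \<psi>) \<in> atlas X" "open S" "t \<in> S" "S \<subseteq> ball 0 1" "f ` S \<subseteq> V"
  "!!i. i < mdim X ==> (%s. \<psi> (f s) i) holomorphic_on S"
  using loc[OF t] by blast
 have o: "copen 1 (demb ` S)"
  using chart_image_open[OF complex_manifold_unit_disc, of "ball 0 1" demb S] S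
  by (simp add: openin_open_eq)
 have "chol 1 (%z. \<psi> (f (inv_into (ball 0 1) demb z)) i) (demb ` S)" if i: "i < mdim X" for i
 proof (rule chol_cong[OF o])
  have "continuous_on (demb ` S) (%z. \<psi> (f (z 0)) i)"
   by (rule continuous_on_compose2[OF holomorphic_on_imp_continuous_on[OF S(6)[OF i]] continuous_on_coord]) auto
  then show "chol 1 (%z. \<psi> (f (z 0)) i) (demb ` S)"
   using S(6)[OF i] S(2) by (auto simp: chol_def holomorphic_on_imp_differentiable_at)
 qed (use S in auto)
 then show "EX U \<phi> V \<psi> N. (U, \<phi>) \<in> atlas unit_disc & (V, \<psi>) \<in> atlas X & t \<in> U &
    copen (mdim unit_disc) N & \<phi> t \<in> N & N \<subseteq> \<phi> ` {x \<in> U. f x \<in> V} &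
    (ALL i<mdim X. chol (mdim unit_disc) (%z. \<psi> (f (inv_into U \<phi> z)) i) N)"
  using S o t by (intro exI[of _ "ball 0 1"] exI[of _ demb] exI[of _ V] exI[of _ \<psi>] exI[of _ "demb ` S"])
   (auto intro!: imageI)
qed

lemma disc_vector_tangent: "disc_vector \<xi> \<in> tangent_space unit_disc 0"
proof -
 have d: "disc_chart = (ball 0 1, demb)" by (simp add: disc_chart_def)
 have v: "disc_vector \<xi> (ball 0 1, demb) = demb \<xi>"
  by (auto simp: disc_vector_def d fun_eq_iff)
 have C: "demb \<xi> \<in> CS (mdim unit_disc)" by (simp add: CS_def)
 have "disc_vector \<xi> c = (%_. 0)" if "c \<notin> charts_at unit_disc 0" for c
  using that by (auto simp: disc_vector_def d charts_at_def fun_eq_iff)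
 moreover have "jacobian_mult 1 (demb \<circ> inv_into (ball 0 1) demb) (demb 0) (demb \<xi>) = demb \<xi>"
  using jacobian_mult_id[OF complex_manifold_unit_disc _ _ C, of "ball 0 1" demb 0] by (simp add: comp_def)
 moreover have "charts_at unit_disc 0 = {(ball 0 1, demb)}" by (auto simp: charts_at_def)
 ultimately show ?thesis using C by (simp add: tangent_space_def v)
qed

lemma differential_disc:
 assumes X: "complex_manifold X" and f: "hdisc X f" and c: "(V, \<psi>) \<in> charts_at X (f 0)" and i: "i < mdim X"
 shows "differential unit_disc X f 0 (disc_vector \<xi>) (V, \<psi>) i = deriv (%t. \<psi> (f t) i) 0 * \<xi>"
proof -
 have v: "disc_vector \<xi> (ball 0 1, demb) 0 = \<xi>"
  by (simp add: disc_vector_def disc_chart_def)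
 have e: "(demb a)(0 := t) = demb t" for a t :: complex by (auto simp: fun_eq_iff)
 have "pd 0 (%z. \<psi> (f (inv_into (ball 0 1) demb z)) i) (demb 0) = deriv (%t. \<psi> (f t) i) 0"
  unfolding pd_def e
  by (rule deriv_cong_ev) (auto intro!: eventually_mono[OF eventually_nhds_in_open[of "ball 0 1"]])
 then show ?thesis
  using differential_chart[where U="ball 0 1" and \<phi>=demb and v="disc_vector \<xi>", OF complex_manifold_unit_disc X f _ disc_vector_tangent _ c] v
  by (simp add: charts_at_iff jacobian_mult_pd comp_def)
qed

lemma hdisc_reparam:
 assumes X: "complex_manifold X" and f: "hdisc X f" and g: "g holomorphic_on ball 0 1" "g ` ball 0 1 \<subseteq> ball 0 1"
 shows "hdisc X (%t. f (g t))"
proof -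
 have "hdisc unit_disc g"
  by (rule disc_mapI[OF complex_manifold_unit_disc])
   (rule exI[of _ "ball 0 1"], rule exI[of _ demb], rule exI[of _ "ball 0 1"], use g in auto)
 then show ?thesis
  by (rule holomorphic_map_compose[OF complex_manifold_unit_disc complex_manifold_unit_disc X _ f])
qed

section \<open>The Kobayashi pseudodistance\<close>

text \<open>Moebius maps normalise each disc of a chain to start at the centre.\<close>

inductive kchain :: "'a cmanifold => 'a => 'a => real => bool" for X where
 one: "hdisc X f ==> cmod c < 1 ==> kchain X (f 0) (f c) (artanh (cmod c))"
| trans: "kchain X x y L ==> kchain X y z L' ==> kchain X x z (L + L')"

abbreviation kd :: "'a cmanifold => 'a => 'a => real" where "kd \<equiv> kobayashi_dist"

lemma artanh_mono: "0 <= x ==> x <= y ==> y < 1 ==> artanh x <= artanh (y::real)"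
 by (simp add: artanh_def frac_le)

lemma artanh_nonneg: "0 <= x ==> x < 1 ==> 0 <= artanh (x::real)"
 using artanh_mono[of 0 x] by simp

lemma kchain_nonneg: "kchain X x y L ==> 0 <= L"
 by (induction rule: kchain.induct) (auto simp: artanh_nonneg)

lemma kchain_pts: "kchain X x y L ==> x \<in> pts X & y \<in> pts X"
 by (induction rule: kchain.induct) (auto intro: hol_pts)

lemma kchain_poincare:
 assumes X: "complex_manifold X" and f: "hdisc X f" and ab: "a \<in> ball 0 1" "b \<in> ball 0 1"
 shows "kchain X (f a) (f b) (poincare_dist a b)"
proof -
 let ?M = "Moebius_function 0 (-a)" and ?c = "Moebius_function 0 a b"
 have c: "cmod ?c < 1" using ab by (intro Moebius_function_norm_lt_1) auto
 have "hdisc X (%t. f (?M t))"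
  using ab by (intro hdisc_reparam[OF X f] Moebius_function_holomorphic) (auto intro!: Moebius_function_norm_lt_1)
 from kchain.one[OF this c] have "kchain X (f (?M 0)) (f (?M ?c)) (artanh (cmod ?c))" .
 moreover have "?M 0 = a" by (simp add: Moebius_function_of_zero)
 moreover have "?M ?c = b" using ab by (intro Moebius_function_compose) auto
 moreover have "cmod ?c = cmod ((a - b) / (1 - cnj a * b))"
  by (simp add: Moebius_function_simple norm_divide norm_minus_commute)
 ultimately show ?thesis by (simp add: poincare_dist_def)
qed

lemma kchain_sym:
 assumes X: "complex_manifold X" shows "kchain X x y L ==> kchain X y x L"
proof (induction rule: kchain.induct)
 case (one f c)
 then show ?case using kchain_poincare[OF X one(1), of c 0] by (simp add: poincare_dist_def)
next
 case (trans x y L z L')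
 then show ?case using kchain.trans[of X z y L' x L] by (simp add: add.commute)
qed

text \<open>Replaces chains given by indexed families with an inductive relation, so that later
  arguments are rule inductions. One direction is induction on the number of discs, which is at
  least 1; the other concatenates families.\<close>

lemma kobayashi_dist_Inf:
 assumes X: "complex_manifold X" and xy: "x \<in> pts X" "y \<in> pts X"
 shows "kd X x y = Inf {L. kchain X x y L}"
proof -
 let ?P = "%x y m a b p f. p 0 = x & p m = y & (ALL j<m. hdisc X (f j) & a j \<in> ball 0 1 &
   b j \<in> ball 0 1 & f j (a j) = p j & f j (b j) = p (Suc j))"
 have 1: "kchain X x y (\<Sum>j<Suc m. poincare_dist (a j) (b j))" if "?P x y (Suc m) a b p f" for m x y and a b p f
  using that
 proof (induction m arbitrary: y)
  case 0
  then show ?case using kchain_poincare[OF X, of "f 0" "a 0" "b 0"] by auto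
 next
  case (Suc m)
  have "kchain X x (p (Suc m)) (\<Sum>j<Suc m. poincare_dist (a j) (b j))"
   by (rule Suc.IH) (use Suc.prems in auto)
  moreover have "kchain X (p (Suc m)) y (poincare_dist (a (Suc m)) (b (Suc m)))"
   using Suc.prems kchain_poincare[OF X, of "f (Suc m)" "a (Suc m)" "b (Suc m)"] by auto
  ultimately show ?case using kchain.trans by fastforce
 qed
 have 2: "EX m a b p f. L = (\<Sum>j<m. poincare_dist (a j) (b j)) & 1 <= m & ?P x y m a b p f" if "kchain X x y L" for x y L
  using that
 proof (induction rule: kchain.induct)
  case (one f c)
  then show ?case
   by (intro exI[of _ 1] exI[of _ "%_. 0"] exI[of _ "%_. c"] exI[of _ "%j. if j = 0 then f 0 else f c"] exI[of _ "%_. f"])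
    (auto simp: poincare_dist_def)
 next
  case (trans x y L z L')
  obtain m a b p f where A: "L = (\<Sum>j<m. poincare_dist (a j) (b j))" "1 <= m" "?P x y m a b p f"
   using trans.IH(1) by blast
  obtain m' a' b' p' f' where B: "L' = (\<Sum>j<m'. poincare_dist (a' j) (b' j))" "1 <= m'" "?P y z m' a' b' p' f'"
   using trans.IH(2) by blast
  \<comment> \<open>Concatenation at position \<open>m\<close>, in three versions because
    parameters, discs and points have different types. At index \<open>m\<close> the points continue
    with \<open>p' 0\<close>, which equals \<open>p m\<close>.\<close>
  define c1 where "c1 = (%(u :: nat => complex) v j. if j < m then u j else v (j - m))"
  define c2 where "c2 = (%(u :: nat => complex => 'a) v j. if j < m then u j else v (j - m))"
  define c3 where "c3 = (%(u :: nat => 'a) v j. if j < m then u j else v (j - m))"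
  have s: "(\<Sum>j<m + k. h (c1 a a' j) (c1 b b' j)) = (\<Sum>j<m. h (a j) (b j)) + (\<Sum>j<k. h (a' j) (b' j))" for k and h :: "complex => complex => real"
   by (induction k) (auto simp: c1_def)
  have "?P x z (m + m') (c1 a a') (c1 b b') (c3 p p') (c2 f f')"
  proof (intro conjI allI impI)
   fix j assume j: "j < m + m'"
   consider "Suc j < m" | "Suc j = m" | "\<not> j < m" by linarith
   then show "hdisc X (c2 f f' j)" "c1 a a' j \<in> ball 0 1" "c1 b b' j \<in> ball 0 1"
    "c2 f f' j (c1 a a' j) = c3 p p' j" "c2 f f' j (c1 b b' j) = c3 p p' (Suc j)"
    using A B j by (cases; force simp: c1_def c2_def c3_def Suc_diff_le not_less)+
  qed (use A B in \<open>auto simp: c3_def\<close>)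
  moreover have "L + L' = (\<Sum>j<m + m'. poincare_dist (c1 a a' j) (c1 b b' j))"
   using A(1) B(1) s[where h=poincare_dist and k=m'] by simp
  moreover have "1 <= m + m'" using A(2) by simp
  ultimately show ?case by blast
 qed
 have "{\<Sum>j<m. poincare_dist (a j) (b j) | m a b p \<phi>. 1 <= m & p 0 = x & p m = y &
   (ALL j<m. hdisc X (\<phi> j) & a j \<in> ball 0 1 & b j \<in> ball 0 1 & \<phi> j (a j) = p j & \<phi> j (b j) = p (Suc j))} = {L. kchain X x y L}"
  (is "?A = ?B")
 proof (intro equalityI subsetI)
  fix L assume "L \<in> ?A"
  then obtain m a b p f where m: "L = (\<Sum>j<m. poincare_dist (a j) (b j))" "1 <= m" "?P x y m a b p f" by blast
  then obtain m' where "m = Suc m'" by (metis Suc_le_D One_nat_def)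
  then show "L \<in> ?B" using 1[OF m(3)[unfolded \<open>m = Suc m'\<close>]] m by simp
 next
  fix L assume "L \<in> ?B"
  then show "L \<in> ?A" using 2[of x y L] by blast
 qed
 then show ?thesis using xy by (simp only: kobayashi_dist_def if_True simp_thms)
qed

context
 fixes X :: "'a cmanifold" assumes X: "complex_manifold X"
begin

lemma kchain_refl: assumes x: "x \<in> pts X" shows "kchain X x x 0"
proof -
 obtain U \<phi> where c: "(U, \<phi>) \<in> atlas X" "x \<in> U" using chart_exists[OF X x] .
 have "hdisc X (%_. x)"
  by (rule disc_mapI[OF X]) (rule exI[of _ U], rule exI[of _ \<phi>], rule exI[of _ "ball 0 1"], use c in auto)
 from kchain.one[OF this, of 0] show ?thesis by simp
qed

text \<open>The disc is the complex line through \<open>\<phi> x\<close> and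
  \<open>\<phi> y\<close>, parametrised so that \<open>y\<close> is reached at the parameter
  \<open>t\<close>; since \<open>\<phi> y\<close> is within \<open>t * e\<close> of
  \<open>\<phi> x\<close>, the whole unit disc stays in the polydisc of radius
  \<open>e\<close>.\<close>

lemma kchain_chart:
 assumes c: "(U, \<phi>) \<in> atlas X" "x \<in> U" and e: "pdisc (mdim X) (\<phi> x) e \<subseteq> \<phi> ` U" and t: "0 < t" "t < 1"
  and y: "y \<in> U" "\<phi> y \<in> pdisc (mdim X) (\<phi> x) (t * e)"
 shows "kchain X x y (artanh t)"
proof -
 define g where "g = (%s i. \<phi> x i + (s / of_real t) * (\<phi> y i - \<phi> x i) :: complex)"
 have gin: "g s \<in> \<phi> ` U" if s: "s \<in> ball 0 1" for s
 proof -
  have "dist (g s i) (\<phi> x i) < e" if i: "i < mdim X" for i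
  proof -
   have d: "dist (\<phi> y i) (\<phi> x i) < t * e" using y i by (auto simp: pdisc_def)
   have "dist (g s i) (\<phi> x i) = cmod s / t * dist (\<phi> y i) (\<phi> x i)"
    using t by (simp add: g_def dist_norm norm_mult norm_divide)
   also have "... <= 1 / t * dist (\<phi> y i) (\<phi> x i)" using s t by (intro mult_right_mono divide_right_mono) auto
   also have "... < e" using d t by (simp add: field_simps)
   finally show ?thesis .
  qed
  moreover have "g s \<in> CS (mdim X)"
   using chart_CS[OF X c] chart_CS[OF X c(1) y(1)] by (simp add: CS_def g_def)
  ultimately show ?thesis using e by (auto simp: pdisc_def)
 qed
 let ?f = "%s. inv_into U \<phi> (g s)"
 have "hdisc X ?f"
 proof (rule disc_mapI[OF X], rule exI[of _ U], rule exI[of _ \<phi>], rule exI[of _ "ball 0 1"], intro conjI allI impI)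
  show "?f ` ball 0 1 \<subseteq> U" using gin by (auto intro: inv_into_into)
  show "(%s. \<phi> (?f s) i) holomorphic_on ball 0 1" for i
  proof (rule holomorphic_transform)
   show "(%s. g s i) holomorphic_on ball 0 1" unfolding g_def using t by (intro holomorphic_intros) auto
  qed (use gin in \<open>simp add: f_inv_into_f\<close>)
 qed (use c in auto)
 from kchain.one[OF this, of "of_real t"] have "kchain X (?f 0) (?f (of_real t)) (artanh t)" using t by simp
 moreover have "g 0 = \<phi> x" "g (of_real t) = \<phi> y" using t by (auto simp: g_def fun_eq_iff)
 ultimately show ?thesis using c y chart_inv[OF X c(1)] by simp
qed

lemma kchain_near:
 assumes x: "x \<in> pts X" and e: "e > 0"
 obtains N where "openin (mtop X) N" "x \<in> N" "!!y. y \<in> N ==> EX L<e. kchain X x y L"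
proof -
 obtain U \<phi> where c: "(U, \<phi>) \<in> atlas X" "x \<in> U" using chart_exists[OF X x] .
 then obtain d where d: "d > 0" "pdisc (mdim X) (\<phi> x) d \<subseteq> \<phi> ` U"
  using openin_contains_pdisc[OF chart_open(2)[OF X c(1)]] by blast
 define t where "t = tanh (e / 2)"
 have t: "0 < t" "t < 1" "artanh t < e" using e by (auto simp: t_def artanh_tanh_real tanh_real_lt_1)
 define N where "N = {y \<in> U. \<phi> y \<in> pdisc (mdim X) (\<phi> x) (t * d)}"
 show ?thesis
 proof (rule that[of N])
  show "openin (mtop X) N" unfolding N_def by (rule chart_preimage_open[OF X c(1) openin_pdisc])
  show "x \<in> N" using c t d chart_CS[OF X c] by (auto simp: N_def intro: pdisc_center)
  show "EX L<e. kchain X x y L" if "y \<in> N" for y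
   using kchain_chart[OF c d(2) t(1,2)] that t(3) by (auto simp: N_def)
 qed
qed

text \<open>The points reachable from \<open>x\<close> form an open set with open complement, and
  \<open>X\<close> is connected. Thus the infimum defining the distance is over a nonempty
  set.\<close>

lemma kchain_exists:
 assumes x: "x \<in> pts X" and y: "y \<in> pts X" shows "EX L. kchain X x y L"
proof -
 define R where "R = {z \<in> pts X. EX L. kchain X x z L}"
 have nb: "EX N. openin (mtop X) N & z \<in> N & (ALL w:N. EX L. kchain X z w L)" if "z \<in> pts X" for z
  by (rule kchain_near[OF that zero_less_one]) blast
 have "EX N. openin (mtop X) N & z \<in> N & N \<subseteq> R" if z: "z \<in> R" for z
 proof -
  have "z \<in> pts X" using z by (simp add: R_def)
  from nb[OF this] obtain N where N: "openin (mtop X) N" "z \<in> N" "!!w. w \<in> N ==> EX L. kchain X z w L"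
   by blast
  obtain L where "kchain X x z L" using z by (auto simp: R_def)
  have "w \<in> R" if w: "w \<in> N" for w
  proof -
   obtain L' where "kchain X z w L'" using N(3)[OF w] by blast
   from kchain.trans[OF \<open>kchain X x z L\<close> this] have "kchain X x w (L + L')" .
   then show ?thesis using kchain_pts[of X x w] unfolding R_def by blast
  qed
  then have "N \<subseteq> R" by blast
  then show ?thesis using N by blast
 qed
 then have o: "openin (mtop X) R" by (intro openin_subopen[THEN iffD2] ballI)
 have "EX N. openin (mtop X) N & z \<in> N & N \<subseteq> pts X - R" if z: "z \<in> pts X - R" for z
 proof -
  have "z \<in> pts X" using z by blast
  from nb[OF this] obtain N where N: "openin (mtop X) N" "z \<in> N" "!!w. w \<in> N ==> EX L. kchain X z w L"
   by blast
  have "w \<notin> R" if w: "w \<in> N" for w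
  proof
   assume "w \<in> R"
   then obtain L where L: "kchain X x w L" by (auto simp: R_def)
   obtain L' where "kchain X z w L'" using N(3)[OF w] by blast
   from kchain.trans[OF L kchain_sym[OF X this]] have "z \<in> R" using z by (auto simp: R_def)
   then show False using z by simp
  qed
  then have "N \<subseteq> pts X - R" using openin_subset[OF N(1)] by blast
  then show ?thesis using N by blast
 qed
 then have "openin (mtop X) (pts X - R)"
  by (intro openin_subopen[THEN iffD2] ballI)
 moreover have "R \<subseteq> pts X" by (auto simp: R_def)
 ultimately have "closedin (mtop X) R" by (simp only: closedin_def simp_thms)
 moreover have "x \<in> R" unfolding R_def using x kchain_refl[OF x] by blast
 moreover have "connected_space (mtop X)" using X by (simp add: complex_manifold_def)
 ultimately have "R = pts X" using o unfolding connected_space_clopen_in by blast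
 then show ?thesis using y by (auto simp: R_def)
qed

lemma kchain_bdd: "bdd_below {L. kchain X x y L}"
 by (rule bdd_belowI[of _ 0]) (simp add: kchain_nonneg)

lemma kd_le:
 assumes L: "kchain X x y L" shows "kd X x y <= L"
proof -
 have xy: "x \<in> pts X" "y \<in> pts X" using kchain_pts[OF L] by auto
 show ?thesis unfolding kobayashi_dist_Inf[OF X xy] by (rule cInf_lower[OF _ kchain_bdd]) (simp add: L)
qed

lemma kd_lessD:
 assumes "x \<in> pts X" "y \<in> pts X" "kd X x y < e"
 obtains L where "kchain X x y L" "L < e"
proof -
 have "Inf {L. kchain X x y L} < e" "{L. kchain X x y L} ~= {}"
  using assms kchain_exists by (auto simp: kobayashi_dist_Inf[OF X])
 then obtain L where "L \<in> {L. kchain X x y L}" "L < e" by (meson cInf_lessD)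
 then show ?thesis using that by blast
qed

lemma kd_nonneg: "0 <= kd X x y"
proof (cases "x \<in> pts X & y \<in> pts X")
 case True
 then have "{L. kchain X x y L} ~= {}" using kchain_exists[of x y] by blast
 then show ?thesis using True kchain_nonneg
  by (auto simp: kobayashi_dist_Inf[OF X] intro!: cInf_greatest)
qed (auto simp: kobayashi_dist_def)

lemma kd_refl: "kd X x x = 0"
proof (cases "x \<in> pts X")
 case True
 then show ?thesis using kd_le[OF kchain_refl] kd_nonneg[of x x] by fastforce
qed (simp add: kobayashi_dist_def)

lemma kd_sym: "kd X x y = kd X y x"
proof (cases "x \<in> pts X & y \<in> pts X")
 case True
 then show ?thesis using kchain_sym[OF X] by (auto simp: kobayashi_dist_Inf[OF X] intro: arg_cong[where f=Inf])
qed (auto simp: kobayashi_dist_def)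

lemma kd_triangle:
 assumes "x \<in> pts X" "y \<in> pts X" "z \<in> pts X"
 shows "kd X x z <= kd X x y + kd X y z"
proof (rule field_le_epsilon)
 fix e :: real assume "e > 0"
 obtain L where L: "kchain X x y L" "L < kd X x y + e / 2" by (rule kd_lessD[of x y]) (use assms \<open>e > 0\<close> in auto)
 obtain L' where L': "kchain X y z L'" "L' < kd X y z + e / 2" by (rule kd_lessD[of y z]) (use assms \<open>e > 0\<close> in auto)
 show "kd X x z <= kd X x y + kd X y z + e" using kd_le[OF kchain.trans[OF L(1) L'(1)]] L(2) L'(2) by simp
qed

lemma kd_near:
 assumes "x \<in> pts X" "e > 0"
 obtains N where "openin (mtop X) N" "x \<in> N" "!!y. y \<in> N ==> kd X x y < e"
 using kchain_near[OF assms] kd_le by (metis order.strict_trans1)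

text \<open>The radius from 0 to \<open>c\<close> maps to a connected set whose points are reached
  with no greater length. Gluing these along a chain joins any point of a Kobayashi ball to its
  centre inside the ball, so balls are connected.\<close>

lemma kchain_connected:
 assumes "kchain X x y L"
 shows "EX C. connectedin (mtop X) C & x \<in> C & y \<in> C & (ALL q:C. EX L'<=L. kchain X x q L')"
 using assms
proof (induction rule: kchain.induct)
 case (one f c)
 let ?I = "(%s. of_real s * c) ` {0..1}"
 have I: "?I \<subseteq> ball 0 1"
 proof clarify
  fix s :: real assume "s \<in> {0..1}"
  then have "s * cmod c <= cmod c" by (simp add: mult_left_le_one_le)
  then show "of_real s * c \<in> ball 0 1" using one(2) \<open>s \<in> {0..1}\<close> by (simp add: norm_mult)
 qed
 have "connected ?I" by (intro connected_continuous_image continuous_intros) auto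
 then have "connectedin (top_of_set (ball 0 1)) ?I" using I by (simp add: connectedin_subtopology)
 then have "connectedin (mtop X) (f ` ?I)"
  using connectedin_continuous_map_image[OF hol_continuous[OF one(1)]] by simp
 moreover have "EX L'<=artanh (cmod c). kchain X (f 0) q L'" if q: "q \<in> f ` ?I" for q
 proof -
  obtain s where s: "s \<in> {0..1}" "q = f (of_real s * c)" using q by blast
  then have l: "cmod (of_real s * c) <= cmod c" by (simp add: norm_mult mult_left_le_one_le)
  then have "kchain X (f 0) q (artanh (cmod (of_real s * c)))" unfolding s(2) using one by (intro kchain.one) auto
  then show ?thesis using artanh_mono[OF norm_ge_zero l one(2)] by blast
 qed
 moreover have "f 0 \<in> f ` ?I" "f c \<in> f ` ?I" by (force intro!: image_eqI[of _ f] image_eqI[of _ _ "0::real"], force intro!: image_eqI[of _ f] image_eqI[of _ _ "1::real"])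
 ultimately show ?case by blast
next
 case (trans x y L z L')
 obtain C where C: "connectedin (mtop X) C" "x \<in> C" "y \<in> C" "ALL q:C. EX K<=L. kchain X x q K" using trans.IH(1) by blast
 obtain C' where C': "connectedin (mtop X) C'" "y \<in> C'" "z \<in> C'" "ALL q:C'. EX K<=L'. kchain X y q K" using trans.IH(2) by blast
 have "connectedin (mtop X) (C \<union> C')" using C C' by (intro connectedin_Un) auto
 moreover have "EX K<=L + L'. kchain X x q K" if "q \<in> C \<union> C'" for q
 proof (cases "q \<in> C")
  case True
  then show ?thesis using C(4) kchain_nonneg[OF trans.hyps(2)] by (meson add_increasing2)
 next
  case False
  then show ?thesis using C'(4) that kchain.trans[OF trans.hyps(1)] by (metis UnE add_left_mono)
 qed
 ultimately show ?case using C C' by blast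
qed

lemma kball_connected: "connectedin (mtop X) {y \<in> pts X. kd X x y < r}" if x: "x \<in> pts X"
proof -
 let ?B = "{y \<in> pts X. kd X x y < r}"
 have "EX C. connectedin (mtop X) C & x \<in> C & y \<in> C & C \<subseteq> ?B" if y: "y \<in> ?B" for y
 proof -
  obtain L where L: "kchain X x y L" "L < r" by (rule kd_lessD[of x y]) (use x y in auto)
  from kchain_connected[OF L(1)] obtain C where C: "connectedin (mtop X) C" "x \<in> C" "y \<in> C"
   "!!q. q \<in> C ==> EX L'<=L. kchain X x q L'" by blast
  have "C \<subseteq> ?B"
  proof
   fix q assume "q \<in> C"
   then obtain K where "K <= L" "kchain X x q K" using C by blast
   then show "q \<in> ?B" using L(2) kd_le kchain_pts by fastforce
  qed
  then show ?thesis using C by blast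
 qed
 then have "ALL y:?B. EX C. connectedin (mtop X) C & x \<in> C & y \<in> C & C \<subseteq> ?B" by blast
 from bchoice[OF this] obtain C where C: "ALL y:?B. connectedin (mtop X) (C y) & x \<in> C y & y \<in> C y & C y \<subseteq> ?B" by blast
 then have "?B = \<Union> (C ` ?B)" by blast
 moreover have "connectedin (mtop X) (\<Union> (C ` ?B))"
  by (rule connectedin_Union) (use C in blast)+
 ultimately show ?thesis by simp
qed

end

lemma kd_contract:
 assumes X: "complex_manifold X" and Y: "complex_manifold Y" and f: "holomorphic_map X Y f" and x: "x \<in> pts X" "y \<in> pts X"
 shows "kd Y (f x) (f y) <= kd X x y"
proof -
 have "kchain Y (f x) (f y) L" if "kchain X x y L" for x y L
  using that
 proof (induction rule: kchain.induct)
  case (one g c)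
  then show ?case
   using kchain.one[OF holomorphic_map_compose[OF complex_manifold_unit_disc X Y one(1) f] one(2)] by simp
 qed (rule kchain.trans)
 then have "{L. kchain X x y L} \<subseteq> {L. kchain Y (f x) (f y) L}" by blast
 moreover have "{L. kchain X x y L} ~= {}" using kchain_exists[OF X x] by blast
 moreover have "bdd_below {L. kchain Y (f x) (f y) L}" using kchain_nonneg by (auto intro!: bdd_belowI)
 ultimately show ?thesis
  using x hol_pts[OF f] by (simp add: kobayashi_dist_Inf[OF X] kobayashi_dist_Inf[OF Y] cInf_superset_mono)
qed

section \<open>Hyperbolic manifolds and normal families\<close>

definition cpdisc :: "nat => (nat => complex) => real => (nat => complex) set" where
 "cpdisc n z e = {w \<in> CS n. ALL i<n. dist (w i) (z i) <= e}"

text \<open>As a product the set has the factor \<open>{0}\<close> in every coordinate from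
  \<open>n\<close> on, so compactness of products applies although the index set is
  infinite.\<close>

lemma compact_cpdisc: "compact (cpdisc n z e)"
proof -
 have "cpdisc n z e = (\<Pi>\<^sub>E i\<in>UNIV. if i < n then cball (z i) e else {0})"
  by (auto simp: cpdisc_def CS_def PiE_iff dist_commute not_less split: if_splits) (metis not_less)
 moreover have "compactin (product_topology (%i. euclidean) UNIV) (\<Pi>\<^sub>E i\<in>UNIV. if i < n then cball (z i) e else {0::complex})"
  unfolding compactin_PiE by auto
 ultimately show ?thesis by (simp add: euclidean_product_topology)
qed

lemma compactin_subcover:
 assumes K: "compactin T K" and N: "!!x. x \<in> I ==> openin T (N x)" "K \<subseteq> \<Union> (N ` I)"
 obtains C where "finite C" "C \<subseteq> I" "K \<subseteq> \<Union> (N ` C)"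
proof -
 have "EX \<F>. finite \<F> & \<F> \<subseteq> N ` I & K \<subseteq> \<Union> \<F>"
  by (rule compactinD[OF K]) (use N in auto)
 then obtain \<F> where F: "finite \<F>" "\<F> \<subseteq> N ` I" "K \<subseteq> \<Union> \<F>" by blast
 from finite_subset_image[OF F(1,2)] obtain C where "C \<subseteq> I" "finite C" "\<F> = N ` C" by blast
 then show ?thesis using that F by blast
qed

lemma locally_compact_nbhd:
 assumes X: "complex_manifold X" and O: "openin (mtop X) S" "x \<in> S"
 obtains U0 K where "openin (mtop X) U0" "compactin (mtop X) K" "x \<in> U0" "U0 \<subseteq> K" "K \<subseteq> S"
proof -
 have x: "x \<in> pts X" using O openin_subset by blast
 obtain U \<phi> where c: "(U, \<phi>) \<in> atlas X" "x \<in> U" using chart_exists[OF X x] .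
 have "copen (mdim X) (\<phi> ` (U Int S))"
  by (rule chart_image_open[OF X c(1)]) (use chart_open(1)[OF X c(1)] O in auto)
 then obtain e where e: "e > 0" "pdisc (mdim X) (\<phi> x) e \<subseteq> \<phi> ` (U Int S)"
  using openin_contains_pdisc[of "mdim X" "\<phi> ` (U Int S)" "\<phi> x"] c O by blast
 let ?C = "cpdisc (mdim X) (\<phi> x) (e/2)"
 have C: "?C \<subseteq> \<phi> ` (U Int S)" using e by (fastforce simp: cpdisc_def pdisc_def)
 define U0 where "U0 = {y \<in> U. \<phi> y \<in> pdisc (mdim X) (\<phi> x) (e/2)}"
 show ?thesis
 proof (rule that[of U0 "inv_into U \<phi> ` ?C"])
  show "openin (mtop X) U0" unfolding U0_def by (rule chart_preimage_open[OF X c(1) openin_pdisc])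
  have "compactin (top_of_set (\<phi> ` U)) ?C" using C by (auto simp: compactin_subtopology compact_cpdisc)
  then show "compactin (mtop X) (inv_into U \<phi> ` ?C)"
   by (rule image_compactin[OF _ chart_continuous(2)[OF X c(1)]])
  show "x \<in> U0" using c e chart_CS[OF X c] by (simp add: U0_def pdisc_center)
  show "U0 \<subseteq> inv_into U \<phi> ` ?C"
  proof
   fix y assume y: "y \<in> U0"
   then have "\<phi> y \<in> ?C" by (force simp: U0_def pdisc_def cpdisc_def)
   then show "y \<in> inv_into U \<phi> ` ?C"
    using y chart_inv[OF X c(1), of y] by (metis (no_types, lifting) U0_def image_eqI mem_Collect_eq)
  qed
  show "inv_into U \<phi> ` ?C \<subseteq> S"
  proof clarify
   fix w assume "w \<in> ?C"
   then obtain y where "y \<in> U" "y \<in> S" "w = \<phi> y" using C by blast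
   then show "inv_into U \<phi> w \<in> S" using chart_inv[OF X c(1)] by simp
  qed
 qed
qed

lemma kd_zero: "kobayashi_hyperbolic X ==> x \<in> pts X ==> y \<in> pts X ==> kd X x y = 0 \<longleftrightarrow> x = y"
 unfolding kobayashi_hyperbolic_def by (rule Metric_space.zero)

lemma hyperbolicI:
 assumes X: "complex_manifold X" and z: "!!x y. x \<in> pts X ==> y \<in> pts X ==> kd X x y = 0 ==> x = y"
 shows "kobayashi_hyperbolic X"
 unfolding kobayashi_hyperbolic_def
 by unfold_locales (use z kd_refl[OF X] kd_nonneg[OF X] kd_sym[OF X] kd_triangle[OF X] in auto)

text \<open>Barth's theorem: balls are connected, so a ball missing the compact set \<open>K - U0\<close> stays inside \<open>U0\<close>.\<close>

lemma kball_basis: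
 assumes X: "complex_manifold X" and h: "kobayashi_hyperbolic X" and S: "openin (mtop X) S" "x \<in> S"
 obtains r where "r > 0" "!!y. y \<in> pts X ==> kd X x y < r ==> y \<in> S"
proof -
 have x: "x \<in> pts X" using S openin_subset by blast
 obtain U0 K where UK: "openin (mtop X) U0" "compactin (mtop X) K" "x \<in> U0" "U0 \<subseteq> K" "K \<subseteq> S"
  using locally_compact_nbhd[OF X S] .
 \<comment> \<open>The compact set \<open>K - U0\<close> separates \<open>U0\<close> from the
   complement of \<open>K\<close>. By hyperbolicity each of its points has positive distance from
   \<open>x\<close>, and half of that distance persists nearby; finitely many such neighbourhoods
   give \<open>r\<close>.\<close>
 have "ALL s:K - U0. EX N. openin (mtop X) N & s \<in> N & (ALL y:N. kd X x s / 2 < kd X x y)"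
 proof
  fix s assume s: "s \<in> K - U0"
  then have sX: "s \<in> pts X" using compactin_subset_topspace[OF UK(2)] by blast
  then have "kd X x s ~= 0" using s UK(3) kd_zero[OF h x] by blast
  then have p: "kd X x s / 2 > 0" using kd_nonneg[OF X, of x s] by simp
  obtain N where N: "openin (mtop X) N" "s \<in> N" "!!y. y \<in> N ==> kd X s y < kd X x s / 2"
   by (rule kd_near[OF X sX p]) (rule that, assumption+)
  have "kd X x s / 2 < kd X x y" if y: "y \<in> N" for y
  proof -
   have "y \<in> pts X" using N(1) y openin_subset by blast
   then have "kd X x s <= kd X x y + kd X y s" by (rule kd_triangle[OF X x _ sX])
   then show ?thesis using N(3)[OF y] kd_sym[OF X, of s y] by linarith
  qed
  then show "EX N. openin (mtop X) N & s \<in> N & (ALL y:N. kd X x s / 2 < kd X x y)" using N by blast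
 qed
 from bchoice[OF this] obtain N where N: "ALL s:K - U0. openin (mtop X) (N s) & s \<in> N s & (ALL y:N s. kd X x s / 2 < kd X x y)"
  by blast
 have "compactin (mtop X) ((pts X - U0) Int K)"
  by (rule closed_Int_compactin) (use UK in auto)
 moreover have "(pts X - U0) Int K = K - U0" using compactin_subset_topspace[OF UK(2)] by blast
 ultimately have "compactin (mtop X) (K - U0)" by simp
 then obtain C where C: "finite C" "C \<subseteq> K - U0" "K - U0 \<subseteq> \<Union> (N ` C)"
  by (rule compactin_subcover[of _ _ "K - U0" N]) (use N in blast)+
 define r where "r = Min (insert 1 ((%s. kd X x s / 2) ` C))"
 have r: "r > 0"
 proof -
  have "kd X x s > 0" if "s \<in> C" for s
  proof -
   have "s \<in> K - U0" "s \<in> pts X" using that C(2) compactin_subset_topspace[OF UK(2)] by auto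
   then have "kd X x s ~= 0" using UK(3) kd_zero[OF h x] by blast
   then show ?thesis using kd_nonneg[OF X, of x s] by simp
  qed
  then show ?thesis unfolding r_def using C(1) by (subst Min_gr_iff) auto
 qed
 have rS: "r <= kd X x y" if y: "y \<in> K - U0" for y
 proof -
  obtain s where s: "s \<in> C" "y \<in> N s" using C(3) y by blast
  then have "kd X x s / 2 < kd X x y" using N C(2) by blast
  moreover have "r <= kd X x s / 2" unfolding r_def using C(1) s by (intro Min_le) auto
  ultimately show ?thesis by linarith
 qed
 let ?B = "{y \<in> pts X. kd X x y < r}"
 have B: "connectedin (mtop X) ?B" by (rule kball_connected[OF X x])
 have xB: "x \<in> ?B" using x r kd_refl[OF X] by simp
 have cl: "closedin (mtop X) K"
  using compactin_imp_closedin[OF _ UK(2)] X unfolding complex_manifold_def by blast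
 have cov: "?B \<subseteq> U0 \<union> (pts X - K)" using rS by fastforce
 have "?B Int (pts X - K) = {}"
 proof (rule ccontr)
  assume "?B Int (pts X - K) ~= {}"
  moreover have "openin (mtop X) (pts X - K)" using cl by blast
  moreover have "U0 Int (pts X - K) = {}" using UK by blast
  moreover have "U0 Int ?B ~= {}" using xB UK by blast
  ultimately show False
   using B UK(1) cov unfolding connectedin by blast
 qed
 then have "?B \<subseteq> S" using UK by blast
 then show ?thesis using that[OF r] by blast
qed

section \<open>Convergence in the Kobayashi distance\<close>

text \<open>Membership in \<open>pts X\<close> is demanded separately because
  \<open>kobayashi_dist\<close> is 0 as soon as one argument is not a point.\<close>

definition klim :: "'a cmanifold => ('i => 'a) => 'a => 'i filter => bool" where
 "klim X f l F \<longleftrightarrow> l \<in> pts X & (ALL e>0. \<forall>\<^sub>F n in F. f n \<in> pts X & kd X (f n) l < e)"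

lemma klim_pts: "klim X f l F ==> l \<in> pts X"
 by (simp add: klim_def)

lemma klimD: "klim X f l F ==> e > 0 ==> \<forall>\<^sub>F n in F. f n \<in> pts X & kd X (f n) l < e"
 by (simp add: klim_def)

lemma klim_eventually_open:
 assumes X: "complex_manifold X" and h: "kobayashi_hyperbolic X" and l: "klim X f l F"
  and S: "openin (mtop X) S" "l \<in> S"
 shows "\<forall>\<^sub>F n in F. f n \<in> S"
proof -
 obtain r where r: "r > 0" "!!y. y \<in> pts X ==> kd X l y < r ==> y \<in> S"
  by (rule kball_basis[OF X h S]) (rule that, assumption+)
 from klimD[OF l r(1)] show ?thesis
  by eventually_elim (use r(2) kd_sym[OF X] in metis)
qed

lemma klim_unique:
 assumes X: "complex_manifold X" and h: "kobayashi_hyperbolic X" and F: "F ~= bot"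
  and l: "klim X f l F" "klim X f m F"
 shows "l = m"
proof (rule ccontr)
 assume "l ~= m"
 have p: "l \<in> pts X" "m \<in> pts X" using klim_pts[OF l(1)] klim_pts[OF l(2)] by auto
 then have "kd X l m ~= 0" using kd_zero[OF h] \<open>l ~= m\<close> by blast
 then have e: "kd X l m / 2 > 0" using kd_nonneg[OF X, of l m] by simp
 have "\<forall>\<^sub>F n in F. False"
  using klimD[OF l(1) e] klimD[OF l(2) e]
 proof eventually_elim
  case (elim n)
  then show ?case using kd_triangle[OF X p(1) _ p(2), of "f n"] kd_sym[OF X, of l "f n"] by fastforce
 qed
 then show False using F by (simp add: trivial_limit_def)
qed

lemma klim_close:
 assumes X: "complex_manifold X" and l: "klim X f l F"
  and c: "((%n. u n) \<longlongrightarrow> 0) F" and g: "\<forall>\<^sub>F n in F. g n \<in> pts X & kd X (g n) (f n) <= u n"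
 shows "klim X g l F"
 unfolding klim_def
proof (intro conjI allI impI)
 show lp: "l \<in> pts X" by (rule klim_pts[OF l])
 fix e :: real assume e: "e > 0"
 have "\<forall>\<^sub>F n in F. u n < e / 2" using order_tendstoD(2)[OF c, of "e/2"] e by simp
 with klimD[OF l half_gt_zero[OF e]] g show "\<forall>\<^sub>F n in F. g n \<in> pts X & kd X (g n) l < e"
 proof eventually_elim
  case (elim n)
  then show ?case using kd_triangle[OF X _ _ lp, of "g n" "f n"] by fastforce
 qed
qed

lemma klim_const: "complex_manifold X ==> l \<in> pts X ==> (\<forall>\<^sub>F n in F. f n = l) ==> klim X f l F"
 unfolding klim_def by (auto elim!: eventually_mono simp: kd_refl)

lemma klim_kd_tendsto:
 assumes X: "complex_manifold X" and f: "klim X f l F" and g: "klim X g m F"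
 shows "((%n. kd X (f n) (g n)) \<longlongrightarrow> kd X l m) F"
proof (rule tendstoI)
 fix e :: real assume e: "e > 0"
 note p = klim_pts[OF f] klim_pts[OF g]
 from klimD[OF f half_gt_zero[OF e]] klimD[OF g half_gt_zero[OF e]]
 show "\<forall>\<^sub>F n in F. dist (kd X (f n) (g n)) (kd X l m) < e"
 proof eventually_elim
  case (elim n)
  then have q: "f n \<in> pts X" "g n \<in> pts X" by auto
  have "kd X (f n) (g n) <= kd X (f n) l + (kd X l m + kd X m (g n))"
   using kd_triangle[OF X q(1) p(1) q(2)] kd_triangle[OF X p(1) p(2) q(2)] by linarith
  moreover have "kd X l m <= kd X l (f n) + (kd X (f n) (g n) + kd X (g n) m)"
   using kd_triangle[OF X p(1) q(1) p(2)] kd_triangle[OF X q(1) q(2) p(2)] by linarith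
  ultimately show ?case
   using elim kd_sym[OF X, of l "f n"] kd_sym[OF X, of m "g n"] unfolding dist_real_def by linarith
 qed
qed

lemma klim_image:
 assumes X: "complex_manifold X" and Y: "complex_manifold Y" and g: "holomorphic_map X Y g" and f: "klim X f l F"
 shows "klim Y (%n. g (f n)) (g l) F"
 unfolding klim_def
proof (intro conjI allI impI)
 show "g l \<in> pts Y" using hol_pts[OF g klim_pts[OF f]] .
 fix e :: real assume "e > 0"
 from klimD[OF f this] show "\<forall>\<^sub>F n in F. g (f n) \<in> pts Y & kd Y (g (f n)) (g l) < e"
  by eventually_elim (use hol_pts[OF g] kd_contract[OF X Y g _ klim_pts[OF f]] in fastforce)
qed

lemma klim_chart:
 assumes X: "complex_manifold X" and h: "kobayashi_hyperbolic X" and l: "klim X f l F" and c: "(V, \<psi>) \<in> atlas X" "l \<in> V"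
 shows "\<forall>\<^sub>F n in F. f n \<in> V" and "i < mdim X ==> ((%n. \<psi> (f n) i) \<longlongrightarrow> \<psi> l i) F"
proof -
 show "\<forall>\<^sub>F n in F. f n \<in> V" by (rule klim_eventually_open[OF X h l chart_open(1)[OF X c(1)] c(2)])
 show "((%n. \<psi> (f n) i) \<longlongrightarrow> \<psi> l i) F" if i: "i < mdim X"
 proof (rule tendstoI)
  fix e :: real assume e: "e > 0"
  have "\<forall>\<^sub>F n in F. f n \<in> {v \<in> V. \<psi> v \<in> pdisc (mdim X) (\<psi> l) e}"
   by (rule klim_eventually_open[OF X h l chart_preimage_open[OF X c(1) openin_pdisc]])
    (use c e chart_CS[OF X c] pdisc_center in auto)
  then show "\<forall>\<^sub>F n in F. dist (\<psi> (f n) i) (\<psi> l i) < e"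
   by eventually_elim (use i in \<open>auto simp: pdisc_def\<close>)
 qed
qed

text \<open>Pointwise limits suffice because holomorphic maps contract the Kobayashi distances, and the
 balls of a hyperbolic target form a basis of its topology.\<close>

lemma holomorphic_limit:
 assumes A: "complex_manifold A" and B: "complex_manifold B" and h: "kobayashi_hyperbolic B" and F: "F ~= bot"
  and hol: "\<forall>\<^sub>F k in F. holomorphic_map A B (f k)" and lim: "!!x. x \<in> pts A ==> klim B (%k. f k x) (g x) F"
 shows "holomorphic_map A B g"
  and "x \<in> pts A ==> (U, \<phi>) \<in> atlas A ==> x \<in> U ==> (V, \<psi>) \<in> atlas B ==> g x \<in> V ==> i < mdim B ==> j < mdim A ==>
   ((%k. pd j (%z. \<psi> (f k (inv_into U \<phi> z)) i) (\<phi> x)) \<longlongrightarrow> pd j (%z. \<psi> (g (inv_into U \<phi> z)) i) (\<phi> x)) F"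
proof -
 have gp: "g x \<in> pts B" if "x \<in> pts A" for x using klim_pts[OF lim[OF that]] .
 have gc: "kd B (g x) (g y) <= kd A x y" if xy: "x \<in> pts A" "y \<in> pts A" for x y
 proof (rule tendsto_upperbound[OF klim_kd_tendsto[OF B lim[OF xy(1)] lim[OF xy(2)]] _ F])
  show "\<forall>\<^sub>F k in F. kd B (f k x) (f k y) <= kd A x y"
   using hol by eventually_elim (rule kd_contract[OF A B _ xy])
 qed
 \<comment> \<open>Equicontinuity: by contraction one neighbourhood of \<open>x\<close> serves
   \<open>g\<close> and eventually all \<open>f k\<close>.\<close>
 have eq: "EX N. openin (mtop A) N & x \<in> N & g ` N \<subseteq> S & (\<forall>\<^sub>F k in F. f k ` N \<subseteq> S)"
  if x: "x \<in> pts A" and S: "openin (mtop B) S" "g x \<in> S" for x S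
 proof -
  obtain r where r: "r > 0" "!!y. y \<in> pts B ==> kd B (g x) y < r ==> y \<in> S"
   by (rule kball_basis[OF B h S]) (rule that, assumption+)
  obtain N where N: "openin (mtop A) N" "x \<in> N" "!!y. y \<in> N ==> kd A x y < r / 2"
   by (rule kd_near[OF A x half_gt_zero[OF r(1)]]) (rule that, assumption+)
  have NA: "y \<in> pts A" if "y \<in> N" for y using that openin_subset[OF N(1)] by blast
  have "g ` N \<subseteq> S"
  proof clarify
   fix y assume y: "y \<in> N"
   have "kd B (g x) (g y) < r" using gc[OF x NA[OF y]] N(3)[OF y] r(1) by linarith
   then show "g y \<in> S" using r(2) gp NA[OF y] by blast
  qed
  moreover have "\<forall>\<^sub>F k in F. f k ` N \<subseteq> S"
   using hol klimD[OF lim[OF x] half_gt_zero[OF r(1)]]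
  proof eventually_elim
   case (elim k)
   show ?case
   proof clarify
    fix y assume y: "y \<in> N"
    have q: "f k y \<in> pts B" "f k x \<in> pts B" using hol_pts[OF elim(1)] NA[OF y] x by auto
    have "kd B (g x) (f k y) < r"
     using kd_triangle[OF B gp[OF x] q(2,1)] kd_contract[OF A B elim(1) x NA[OF y]] N(3)[OF y] elim(2)
      kd_sym[OF B, of "g x" "f k x"] by linarith
    then show "f k y \<in> S" using r(2) q by blast
   qed
  qed
  ultimately show ?thesis using N by blast
 qed
 have cont: "continuous_map (mtop A) (mtop B) g"
  unfolding continuous_map_def
 proof (intro conjI allI impI)
  show "g \<in> topspace (mtop A) \<rightarrow> topspace (mtop B)" using gp by blast
  fix S assume S: "openin (mtop B) S"
  show "openin (mtop A) {x \<in> topspace (mtop A). g x \<in> S}"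
  proof (intro openin_subopen[THEN iffD2] ballI)
   fix x assume x: "x \<in> {x \<in> topspace (mtop A). g x \<in> S}"
   then obtain N where N: "openin (mtop A) N" "x \<in> N" "g ` N \<subseteq> S" using eq[of x S] S by auto
   then have "N \<subseteq> {x \<in> topspace (mtop A). g x \<in> S}" using openin_subset[OF N(1)] by blast
   then show "EX T. openin (mtop A) T & x \<in> T & T \<subseteq> {x \<in> topspace (mtop A). g x \<in> S}" using N by blast
  qed
 qed
 have main: "EX W. copen (mdim A) W & \<phi> x \<in> W & W \<subseteq> \<phi> ` {x \<in> U. g x \<in> V} &
   (ALL i<mdim B. chol (mdim A) (%z. \<psi> (g (inv_into U \<phi> z)) i) W & (ALL j<mdim A.
    ((%k. pd j (%z. \<psi> (f k (inv_into U \<phi> z)) i) (\<phi> x)) \<longlongrightarrow> pd j (%z. \<psi> (g (inv_into U \<phi> z)) i) (\<phi> x)) F))"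
  if x: "x \<in> pts A" and c: "(U, \<phi>) \<in> atlas A" "x \<in> U" and d: "(V, \<psi>) \<in> atlas B" "g x \<in> V" for x U \<phi> V \<psi>
 proof -
  \<comment> \<open>Confining the values to coordinate distance 1 from \<open>g x\<close> supplies
    the uniform bound on coordinates that \<open>chol_bounded_limit\<close> requires.\<close>
  define S where "S = {v \<in> V. \<psi> v \<in> pdisc (mdim B) (\<psi> (g x)) 1}"
  have S: "openin (mtop B) S" "g x \<in> S"
   unfolding S_def using chart_preimage_open[OF B d(1) openin_pdisc] d chart_CS[OF B d] by (auto simp: pdisc_center)
  obtain N where N: "openin (mtop A) N" "x \<in> N" "g ` N \<subseteq> S" "\<forall>\<^sub>F k in F. f k ` N \<subseteq> S"
   using eq[OF x S] by blast
  define W where "W = \<phi> ` (U Int N)"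
  have oW: "copen (mdim A) W"
   unfolding W_def by (rule chart_image_open[OF A c(1)]) (use chart_open(1)[OF A c(1)] N in auto)
  have inv: "inv_into U \<phi> z \<in> U" "inv_into U \<phi> z \<in> N" if "z \<in> W" for z
   using that chart_inv[OF A c(1)] by (auto simp: W_def)
  have xW: "\<phi> x \<in> W" using c N by (simp add: W_def)
  have lim': "((%k. \<psi> (f k (inv_into U \<phi> z)) i) \<longlongrightarrow> \<psi> (g (inv_into U \<phi> z)) i) F" if z: "z \<in> W" and i: "i < mdim B" for z i
  proof (rule klim_chart(2)[OF B h lim d(1) _ i])
   show "inv_into U \<phi> z \<in> pts A" using inv[OF z] openin_subset[OF N(1)] by blast
   show "g (inv_into U \<phi> z) \<in> V" using inv[OF z] N(3) by (auto simp: S_def)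
  qed
  have bd: "EX e>0. EX K. pdisc (mdim A) z e \<subseteq> W & (\<forall>\<^sub>F k in F. chol (mdim A) (%z. \<psi> (f k (inv_into U \<phi> z)) i) (pdisc (mdim A) z e) &
    (ALL w:pdisc (mdim A) z e. cmod (\<psi> (f k (inv_into U \<phi> w)) i) <= K))" if z: "z \<in> W" and i: "i < mdim B" for z i
  proof -
   obtain e where e: "e > 0" "pdisc (mdim A) z e \<subseteq> W" using openin_contains_pdisc[OF oW z] .
   have "\<forall>\<^sub>F k in F. chol (mdim A) (%z. \<psi> (f k (inv_into U \<phi> z)) i) (pdisc (mdim A) z e) &
    (ALL w:pdisc (mdim A) z e. cmod (\<psi> (f k (inv_into U \<phi> w)) i) <= cmod (\<psi> (g x) i) + 1)"
    using hol N(4)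
   proof eventually_elim
    case (elim k)
    have fS: "f k (inv_into U \<phi> w) \<in> S" if "w \<in> W" for w using inv[OF that] elim(2) by blast
    have "pdisc (mdim A) z e \<subseteq> \<phi> ` {x \<in> U. f k x \<in> V}"
     using e(2) elim(2) by (force simp: W_def S_def)
    then have "chol (mdim A) (%z. \<psi> (f k (inv_into U \<phi> z)) i) (pdisc (mdim A) z e)"
     by (rule chol_subset[OF holomorphic_mapD(2)[OF A B elim(1) c(1) d(1) i]])
    moreover have "cmod (\<psi> (f k (inv_into U \<phi> w)) i) <= cmod (\<psi> (g x) i) + 1" if "w \<in> pdisc (mdim A) z e" for w
    proof -
     have "dist (\<psi> (f k (inv_into U \<phi> w)) i) (\<psi> (g x) i) < 1"
      using fS[of w] that e(2) i by (auto simp: S_def pdisc_def)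
     then show ?thesis using norm_triangle_ineq2[of "\<psi> (f k (inv_into U \<phi> w)) i" "\<psi> (g x) i"] by (simp add: dist_norm)
    qed
    ultimately show ?case by blast
   qed
   then show ?thesis using e by blast
  qed
  have "W \<subseteq> \<phi> ` {x \<in> U. g x \<in> V}" using N(3) by (auto simp: W_def S_def)
  moreover have "chol (mdim A) (%z. \<psi> (g (inv_into U \<phi> z)) i) W" if i: "i < mdim B" for i
   by (rule chol_bounded_limit(1)[OF F oW bd[OF _ i] lim'[OF _ i]])
  moreover have "((%k. pd j (%z. \<psi> (f k (inv_into U \<phi> z)) i) (\<phi> x)) \<longlongrightarrow> pd j (%z. \<psi> (g (inv_into U \<phi> z)) i) (\<phi> x)) F"
   if i: "i < mdim B" and j: "j < mdim A" for i j
   by (rule chol_bounded_limit(2)[OF F oW bd[OF _ i] lim'[OF _ i] xW j])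
  ultimately show ?thesis using oW xW by blast
 qed
 show "holomorphic_map A B g"
 proof (rule holomorphic_mapI[OF A B cont])
  fix x assume x: "x \<in> pts A"
  obtain U \<phi> where c: "(U, \<phi>) \<in> atlas A" "x \<in> U" using chart_exists[OF A x] .
  obtain V \<psi> where d: "(V, \<psi>) \<in> atlas B" "g x \<in> V" using chart_exists[OF B gp[OF x]] .
  from main[OF x c d] obtain W where W: "copen (mdim A) W" "\<phi> x \<in> W" "W \<subseteq> \<phi> ` {x \<in> U. g x \<in> V}"
   "ALL i<mdim B. chol (mdim A) (%z. \<psi> (g (inv_into U \<phi> z)) i) W" by blast
  show "EX U \<phi> V \<psi> N. (U, \<phi>) \<in> atlas A & (V, \<psi>) \<in> atlas B & x \<in> U &
    copen (mdim A) N & \<phi> x \<in> N & N \<subseteq> \<phi> ` {x \<in> U. g x \<in> V} &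
    (ALL i<mdim B. chol (mdim A) (%z. \<psi> (g (inv_into U \<phi> z)) i) N)"
   by (rule exI[of _ U], rule exI[of _ \<phi>], rule exI[of _ V], rule exI[of _ \<psi>], rule exI[of _ W]) (use c d W in blast)
 qed
 show "((%k. pd j (%z. \<psi> (f k (inv_into U \<phi> z)) i) (\<phi> x)) \<longlongrightarrow> pd j (%z. \<psi> (g (inv_into U \<phi> z)) i) (\<phi> x)) F"
  if "x \<in> pts A" "(U, \<phi>) \<in> atlas A" "x \<in> U" "(V, \<psi>) \<in> atlas B" "g x \<in> V" "i < mdim B" "j < mdim A"
  using main[OF that(1-5)] that(6,7) by blast
qed

section \<open>Ultrafilters and limits in compact sets\<close>

definition ultra :: "'i filter => bool" where
 "ultra U \<longleftrightarrow> U ~= bot & (ALL P. eventually P U \<or> eventually (%x. \<not> P x) U)"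

text \<open>Finer filters are smaller in the order, so Zorn's lemma is applied to the reversed order
  on the proper filters below \<open>F\<close>. Minimality decides every predicate: restricting to
  \<open>P\<close> gives either \<open>bot\<close> or the same filter.\<close>

lemma ultra_exists:
 assumes F: "F ~= (bot :: 'i filter)"
 obtains U where "ultra U" "U <= F"
proof -
 let ?A = "{G. G ~= bot & G <= F}" and ?R = "%G H. H <= (G :: 'i filter)"
 have "EX m:?A. ALL a:?A. ?R m a --> a = m"
 proof (rule predicate_Zorn)
  show "partial_order_on ?A (relation_of ?R ?A)"
   by (rule partial_order_on_relation_ofI) auto
  fix C assume "C \<in> Chains (relation_of ?R ?A)"
  then have C: "C \<subseteq> ?A" "!!G H. G \<in> C ==> H \<in> C ==> G <= H \<or> H <= G"
   unfolding Chains_def relation_of_def by auto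
  show "EX u:?A. ALL a:C. ?R a u"
  proof (cases "C = {}")
   case False
   \<comment> \<open>For a chain, an eventuality of the infimum already holds in some member; with
     \<open>P\<close> false this shows that the infimum is proper.\<close>
   have "eventually P (Inf C) \<longleftrightarrow> (EX b:C. eventually P b)" for P
   proof (rule eventually_Inf_base[OF False])
    fix G H assume GH: "G \<in> C" "H \<in> C"
    from C(2)[OF GH] show "EX x:C. x <= inf G H"
     using GH by (elim disjE) (auto intro: bexI[of _ G] bexI[of _ H])
   qed
   from this[of "%_. False"] have "Inf C ~= bot" using C(1) unfolding trivial_limit_def by blast
   moreover obtain c where "c \<in> C" using False by blast
   then have "Inf C <= F" using C(1) by (intro Inf_lower2[of c]) auto
   ultimately show ?thesis by (auto intro: Inf_lower)
  qed (use F in auto)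
 qed
 then obtain m where m: "m ~= bot" "m <= F" "!!a. a ~= bot ==> a <= m ==> a = m"
  by (auto intro: order_trans)
 have "eventually P m \<or> eventually (%x. \<not> P x) m" for P
 proof (cases "inf m (principal {x. P x}) = bot")
  case True
  then have "eventually (%x. \<not> P x) m" by (simp add: trivial_limit_def eventually_inf_principal)
  then show ?thesis by blast
 next
  case False
  from m(3)[OF False] have "inf m (principal {x. P x}) = m" by simp
  moreover have "eventually P (inf m (principal {x. P x}))" by (simp add: eventually_inf_principal)
  ultimately have "eventually P m" by simp
  then show ?thesis by blast
 qed
 then show ?thesis using that[of m] m by (simp add: ultra_def)
qed

text \<open>If no point of \<open>K\<close> were a limit, each would have a neighbourhood that
  \<open>f\<close> eventually avoids, since an ultrafilter decides the alternative. Finitely many of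
  these cover \<open>K\<close>, which contradicts \<open>f n\<close> being in
  \<open>K\<close>.\<close>

lemma ultra_klim:
 assumes X: "complex_manifold X" and U: "ultra U" and K: "compactin (mtop X) K" and ev: "\<forall>\<^sub>F n in U. f n \<in> K"
 shows "EX l. klim X f l U"
proof (rule ccontr)
 assume no: "\<nexists>l. klim X f l U"
 have KX: "K \<subseteq> pts X" using compactin_subset_topspace[OF K] .
 have "ALL l:K. EX N. openin (mtop X) N & l \<in> N & (\<forall>\<^sub>F n in U. f n \<notin> N)"
 proof
  fix l assume l: "l \<in> K"
  have "EX e>0. \<not> (\<forall>\<^sub>F n in U. f n \<in> pts X & kd X (f n) l < e)"
   using no l KX unfolding klim_def by blast
  then obtain e where e: "e > 0" "\<not> (\<forall>\<^sub>F n in U. f n \<in> pts X & kd X (f n) l < e)" by blast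
  have lX: "l \<in> pts X" using l KX by blast
  obtain N where N: "openin (mtop X) N" "l \<in> N" "!!y. y \<in> N ==> kd X l y < e"
   by (rule kd_near[OF X lX e(1)]) (rule that, assumption+)
  have "\<not> (\<forall>\<^sub>F n in U. f n \<in> N)"
  proof
   assume "\<forall>\<^sub>F n in U. f n \<in> N"
   then have "\<forall>\<^sub>F n in U. f n \<in> pts X & kd X (f n) l < e"
    by eventually_elim (use N openin_subset[OF N(1)] kd_sym[OF X] in fastforce)
   then show False using e(2) by blast
  qed
  then have "\<forall>\<^sub>F n in U. f n \<notin> N" using U unfolding ultra_def by blast
  then show "EX N. openin (mtop X) N & l \<in> N & (\<forall>\<^sub>F n in U. f n \<notin> N)" using N by blast
 qed
 from bchoice[OF this] obtain N where N: "ALL l:K. openin (mtop X) (N l) & l \<in> N l & (\<forall>\<^sub>F n in U. f n \<notin> N l)" by blast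
 obtain C where C: "finite C" "C \<subseteq> K" "K \<subseteq> \<Union> (N ` C)"
  by (rule compactin_subcover[OF K, of K N]) (use N in blast)+
 have "\<forall>\<^sub>F n in U. ALL l:C. f n \<notin> N l"
  by (rule eventually_ball_finite[OF C(1)]) (use N C in blast)
 with ev have "\<forall>\<^sub>F n in U. False" by eventually_elim (use C in blast)
 then show False using U by (simp add: ultra_def trivial_limit_def)
qed

section \<open>Automorphisms and cocompactness\<close>

lemma aut_hol: "automorphism X g ==> holomorphic_map X X g"
 and aut_bij: "automorphism X g ==> bij_betw g (pts X) (pts X)"
 by (auto simp: automorphism_def)

lemma aut_inv:
 assumes X: "complex_manifold X" and g: "automorphism X g"
 shows "automorphism X (inv_into (pts X) g)"
proof -
 note b = aut_bij[OF g]
 have "holomorphic_map X X (inv_into (pts X) (inv_into (pts X) g))"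
  by (rule holomorphic_map_cong[OF X aut_hol[OF g]]) (simp add: inv_into_inv_into_eq[OF b])
 then show ?thesis using g bij_betw_inv_into[OF b] by (auto simp: automorphism_def)
qed

lemma aut_inv_simps:
 assumes g: "automorphism X g" and x: "x \<in> pts X"
 shows "g (inv_into (pts X) g x) = x" "inv_into (pts X) g (g x) = x" "inv_into (pts X) g x \<in> pts X" "g x \<in> pts X"
 using bij_betw_inv_into_right[OF aut_bij[OF g] x] bij_betw_inv_into_left[OF aut_bij[OF g] x]
  bij_betw_apply[OF bij_betw_inv_into[OF aut_bij[OF g]] x] bij_betw_apply[OF aut_bij[OF g] x] by auto

lemma aut_compose:
 assumes X: "complex_manifold X" and g: "automorphism X g" and h: "automorphism X h"
 shows "automorphism X (%x. g (h x))"
proof -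
 have b: "bij_betw (%x. g (h x)) (pts X) (pts X)"
  using bij_betw_trans[OF aut_bij[OF h] aut_bij[OF g]] by (simp add: o_def)
 have "holomorphic_map X X (inv_into (pts X) (%x. g (h x)))"
 proof (rule holomorphic_map_cong[OF X holomorphic_map_compose[OF X X X aut_hol[OF aut_inv[OF X g]] aut_hol[OF aut_inv[OF X h]]]])
  fix x assume x: "x \<in> pts X"
  show "inv_into (pts X) h (inv_into (pts X) g x) = inv_into (pts X) (%x. g (h x)) x"
   by (rule inv_into_f_eq[OF bij_betw_imp_inj_on[OF b], symmetric])
    (use aut_inv_simps[OF g] aut_inv_simps[OF h] x in auto)
 qed
 then show ?thesis
  using b holomorphic_map_compose[OF X X X aut_hol[OF h] aut_hol[OF g]] by (simp add: automorphism_def)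
qed

lemma aut_id: "complex_manifold X ==> automorphism X (%x. x)"
 unfolding automorphism_def
 by (auto intro: holomorphic_map_id holomorphic_map_cong[OF _ holomorphic_map_id] simp: bij_betw_def inv_into_f_f)

lemma aut_kd:
 assumes X: "complex_manifold X" and g: "automorphism X g" and xy: "x \<in> pts X" "y \<in> pts X"
 shows "kd X (g x) (g y) = kd X x y"
 using kd_contract[OF X X aut_hol[OF g] xy] kd_contract[OF X X aut_hol[OF aut_inv[OF X g]], of "g x" "g y"]
  aut_inv_simps[OF g xy(1)] aut_inv_simps[OF g xy(2)] by simp

lemma aut_orbit_eq_iff:
 assumes X: "complex_manifold X" and y: "y \<in> pts X"
 shows "aut_orbit X y \<in> aut_orbit X ` S \<longleftrightarrow> (EX g. automorphism X g & g y \<in> S)"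
proof
 assume "aut_orbit X y \<in> aut_orbit X ` S"
 then obtain u where u: "u \<in> S" "aut_orbit X y = aut_orbit X u" by blast
 then have "u \<in> aut_orbit X y" using aut_id[OF X] by (auto simp: aut_orbit_def)
 then show "EX g. automorphism X g & g y \<in> S" using u by (auto simp: aut_orbit_def)
next
 assume "EX g. automorphism X g & g y \<in> S"
 then obtain g where g: "automorphism X g" "g y \<in> S" by blast
 have "aut_orbit X y = aut_orbit X (g y)"
 proof (intro equalityI subsetI)
  fix z assume "z \<in> aut_orbit X y"
  then obtain h where h: "automorphism X h" "z = h y" by (auto simp: aut_orbit_def)
  have "automorphism X (%x. h (inv_into (pts X) g x))" by (rule aut_compose[OF X h(1) aut_inv[OF X g(1)]])
  moreover have "z = h (inv_into (pts X) g (g y))" using h(2) aut_inv_simps(2)[OF g(1) y] by simp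
  ultimately show "z \<in> aut_orbit X (g y)"
   unfolding aut_orbit_def by (intro CollectI exI[of _ "%x. h (inv_into (pts X) g x)"]) simp
 next
  fix z assume "z \<in> aut_orbit X (g y)"
  then obtain h where h: "automorphism X h" "z = h (g y)" by (auto simp: aut_orbit_def)
  then show "z \<in> aut_orbit X y"
   using aut_compose[OF X h(1) g(1)] unfolding aut_orbit_def by (intro CollectI exI[of _ "%x. h (g x)"]) simp
 qed
 then show "aut_orbit X y \<in> aut_orbit X ` S" using g by blast
qed

text \<open>Finitely many relatively compact open sets have orbits covering the quotient, and their
  compact hulls form \<open>K0\<close>. The radius \<open>\<delta>\<close> is a Lebesgue number for
  \<open>K0\<close>; automorphisms are isometries and carry it to every point.\<close>

lemma cocompact_uniform:
 assumes X: "complex_manifold X" and co: "cocompact X" and h: "kobayashi_hyperbolic X"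
 obtains K0 \<delta> where "compactin (mtop X) K0" "!!x. x \<in> pts X ==> EX g. automorphism X g & g x \<in> K0" "\<delta> > 0"
  "!!x. x \<in> pts X ==> EX K. compactin (mtop X) K & {y \<in> pts X. kd X x y < \<delta>} \<subseteq> K"
proof -
 have "ALL x:pts X. EX p. openin (mtop X) (fst p) & compactin (mtop X) (snd p) & x \<in> fst p & fst p \<subseteq> snd p"
 proof
  fix x assume x: "x \<in> pts X"
  obtain U0 K where UK: "openin (mtop X) U0" "compactin (mtop X) K" "x \<in> U0" "U0 \<subseteq> K" "K \<subseteq> pts X"
   using locally_compact_nbhd[OF X openin_topspace x] .
  then show "EX p. openin (mtop X) (fst p) & compactin (mtop X) (snd p) & x \<in> fst p & fst p \<subseteq> snd p"
   by (intro exI[of _ "(U0, K)"]) auto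
 qed
 from bchoice[OF this] obtain P where P: "ALL x:pts X. openin (mtop X) (fst (P x)) & compactin (mtop X) (snd (P x)) &
  x \<in> fst (P x) & fst (P x) \<subseteq> snd (P x)" by blast
 let ?W = "%x. aut_orbit X ` fst (P x)"
 have top: "topspace (orbit_space X) = aut_orbit X ` pts X"
 proof
  show "topspace (orbit_space X) \<subseteq> aut_orbit X ` pts X"
   using openin_orbit_space[of X "topspace (orbit_space X)"] by simp
  have "{x \<in> pts X. aut_orbit X x \<in> aut_orbit X ` pts X} = pts X" by blast
  then have "openin (orbit_space X) (aut_orbit X ` pts X)" by (simp add: openin_orbit_space)
  then show "aut_orbit X ` pts X \<subseteq> topspace (orbit_space X)" by (rule openin_subset)
 qed
 have oW: "openin (orbit_space X) (?W x)" if x: "x \<in> pts X" for x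
  unfolding openin_orbit_space
 proof
  show "?W x \<subseteq> aut_orbit X ` pts X" using P x openin_subset by blast
  \<comment> \<open>The saturation of an open set is the union of its preimages under all
    automorphisms, hence open; so the orbits of \<open>fst (P x)\<close> form an open set of the
    quotient.\<close>
  have "{y \<in> pts X. aut_orbit X y \<in> ?W x} = \<Union> {{y \<in> topspace (mtop X). g y \<in> fst (P x)} | g. automorphism X g}"
  proof -
   have "{y \<in> pts X. aut_orbit X y \<in> ?W x} = {y \<in> pts X. EX g. automorphism X g & g y \<in> fst (P x)}"
    using aut_orbit_eq_iff[OF X, of _ "fst (P x)"] by (intro Collect_cong conj_cong) auto
   then show ?thesis by auto
  qed
  moreover have "openin (mtop X) {y \<in> topspace (mtop X). g y \<in> fst (P x)}" if "automorphism X g" for g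
   by (rule openin_continuous_map_preimage[OF hol_continuous[OF aut_hol[OF that]]]) (use P x in blast)
  ultimately show "openin (mtop X) {y \<in> pts X. aut_orbit X y \<in> ?W x}" by auto
 qed
 have "compactin (orbit_space X) (aut_orbit X ` pts X)"
  using co top unfolding cocompact_def compact_space_def by simp
 then obtain C where C: "finite C" "C \<subseteq> pts X" "aut_orbit X ` pts X \<subseteq> \<Union> (?W ` C)"
 proof (rule compactin_subcover[of _ _ "pts X" ?W])
  show "aut_orbit X ` pts X \<subseteq> \<Union> (?W ` pts X)"
  proof clarify
   fix x assume x: "x \<in> pts X"
   then have "x \<in> fst (P x)" using P by blast
   then have "aut_orbit X x \<in> ?W x" by (rule imageI)
   then show "aut_orbit X x \<in> \<Union> (?W ` pts X)" by (rule UnionI[OF imageI[OF x]])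
  qed
 qed (rule oW)
 define K0 where "K0 = \<Union> ((%x. snd (P x)) ` C)"
 have K0: "compactin (mtop X) K0"
  unfolding K0_def by (rule compactin_Union) (use C P in auto)
 have K0X: "K0 \<subseteq> pts X" using compactin_subset_topspace[OF K0] .
 have aut: "EX g. automorphism X g & g x \<in> K0" if x: "x \<in> pts X" for x
 proof -
  have "aut_orbit X x \<in> \<Union> (?W ` C)" using C(3) x by blast
  then obtain c where c: "c \<in> C" "aut_orbit X x \<in> ?W c" by blast
  then obtain g where "automorphism X g" "g x \<in> fst (P c)" using aut_orbit_eq_iff[OF X x] by blast
  then show ?thesis unfolding K0_def using P c C by blast
 qed
 \<comment> \<open>The radius is halved: a point \<open>q\<close> within \<open>snd (Q p)\<close> of
   \<open>p\<close> keeps its own ball of radius \<open>snd (Q p)\<close> inside the ball of twice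
   that radius around \<open>p\<close>.\<close>
 have "ALL p:K0. EX q. openin (mtop X) (fst q) & p \<in> fst q & snd q > 0 & (ALL y:fst q. kd X p y < snd q) &
   (EX K. compactin (mtop X) K & {y \<in> pts X. kd X p y < 2 * snd q} \<subseteq> K)"
 proof
  fix p assume p: "p \<in> K0"
  then have pX: "p \<in> pts X" using K0X by blast
  obtain r where r: "r > 0" "!!y. y \<in> pts X ==> kd X p y < r ==> y \<in> fst (P p)"
   by (rule kball_basis[OF X h, of "fst (P p)" p]) (use P pX in auto)
  obtain N where N: "openin (mtop X) N" "p \<in> N" "!!y. y \<in> N ==> kd X p y < r / 2"
   by (rule kd_near[OF X pX half_gt_zero[OF r(1)]]) (rule that, assumption+)
  have "{y \<in> pts X. kd X p y < 2 * (r/2)} \<subseteq> snd (P p)" using r(2) P pX by auto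
  then show "EX q. openin (mtop X) (fst q) & p \<in> fst q & snd q > 0 & (ALL y:fst q. kd X p y < snd q) &
   (EX K. compactin (mtop X) K & {y \<in> pts X. kd X p y < 2 * snd q} \<subseteq> K)"
   using N r P pX by (intro exI[of _ "(N, r/2)"]) auto
 qed
 from bchoice[OF this] obtain Q where Q: "ALL p:K0. openin (mtop X) (fst (Q p)) & p \<in> fst (Q p) & snd (Q p) > 0 &
   (ALL y:fst (Q p). kd X p y < snd (Q p)) & (EX K. compactin (mtop X) K & {y \<in> pts X. kd X p y < 2 * snd (Q p)} \<subseteq> K)"
  by blast
 obtain D where D: "finite D" "D \<subseteq> K0" "K0 \<subseteq> \<Union> ((%p. fst (Q p)) ` D)"
  by (rule compactin_subcover[OF K0, of K0 "%p. fst (Q p)"]) (use Q in blast)+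
 define \<delta> where "\<delta> = Min (insert 1 ((%p. snd (Q p)) ` D))"
 have \<delta>: "\<delta> > 0" unfolding \<delta>_def using D Q by (subst Min_gr_iff) auto
 have \<delta>K0: "EX K. compactin (mtop X) K & {y \<in> pts X. kd X q y < \<delta>} \<subseteq> K" if q: "q \<in> K0" for q
 proof -
  obtain p where p: "p \<in> D" "q \<in> fst (Q p)" using D(3) q by blast
  then have pK: "p \<in> K0" using D by blast
  obtain K where K: "compactin (mtop X) K" "{y \<in> pts X. kd X p y < 2 * snd (Q p)} \<subseteq> K" using Q pK by blast
  have "\<delta> <= snd (Q p)" unfolding \<delta>_def using D(1) p by (intro Min_le) auto
  moreover have "kd X p q < snd (Q p)" using Q pK p by blast
  ultimately have "{y \<in> pts X. kd X q y < \<delta>} \<subseteq> {y \<in> pts X. kd X p y < 2 * snd (Q p)}"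
   using kd_triangle[OF X, of p q] pK q K0X by fastforce
  then show ?thesis using K by blast
 qed
 have "EX K. compactin (mtop X) K & {y \<in> pts X. kd X x y < \<delta>} \<subseteq> K" if x: "x \<in> pts X" for x
 proof -
  obtain g where g: "automorphism X g" "g x \<in> K0" using aut[OF x] by blast
  obtain K where K: "compactin (mtop X) K" "{y \<in> pts X. kd X (g x) y < \<delta>} \<subseteq> K" using \<delta>K0[OF g(2)] by blast
  have "compactin (mtop X) (inv_into (pts X) g ` K)"
   by (rule image_compactin[OF K(1) hol_continuous[OF aut_hol[OF aut_inv[OF X g(1)]]]])
  moreover have "{y \<in> pts X. kd X x y < \<delta>} \<subseteq> inv_into (pts X) g ` K"
  proof clarify
   fix y assume y: "y \<in> pts X" "kd X x y < \<delta>"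
   then have "g y \<in> K" using K(2) aut_kd[OF X g(1) x y(1)] aut_inv_simps(4)[OF g(1) y(1)] by auto
   then show "y \<in> inv_into (pts X) g ` K" using aut_inv_simps(2)[OF g(1) y(1)] by (metis imageI)
  qed
  ultimately show ?thesis by blast
 qed
 then show ?thesis using that[OF K0 aut \<delta>] by blast
qed

text \<open>Where the limit exists at \<open>x\<close>, contraction puts the values at all points
  within \<open>\<delta> / 2\<close> eventually into a fixed compact set, so it exists there too. As
  this radius is the same everywhere, the set of points with a limit is both open and
  closed.\<close>

lemma ultra_limits:
 assumes A: "complex_manifold A" and X: "complex_manifold X" and U: "ultra U" and \<delta>: "\<delta> > 0"
  and loc: "!!x. x \<in> pts X ==> EX K. compactin (mtop X) K & {y \<in> pts X. kd X x y < \<delta>} \<subseteq> K"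
  and hol: "\<forall>\<^sub>F k in U. holomorphic_map A X (f k)" and p: "p \<in> pts A" "klim X (%k. f k p) l U"
  and x: "x \<in> pts A"
 shows "EX l. klim X (%k. f k x) l U"
proof -
 define S where "S = {x \<in> pts A. EX l. klim X (%k. f k x) l U}"
 have near: "y \<in> S" if x: "x \<in> S" and y: "y \<in> pts A" "kd A x y < \<delta> / 2" for x y
 proof -
  obtain m where m: "klim X (%k. f k x) m U" and xA: "x \<in> pts A" using x by (auto simp: S_def)
  obtain K where K: "compactin (mtop X) K" "{y \<in> pts X. kd X m y < \<delta>} \<subseteq> K" using loc[OF klim_pts[OF m]] by blast
  have "\<forall>\<^sub>F k in U. f k y \<in> K"
   using hol klimD[OF m half_gt_zero[OF \<delta>]]
  proof eventually_elim
   case (elim k)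
   have q: "f k y \<in> pts X" "f k x \<in> pts X" using hol_pts[OF elim(1)] y xA by auto
   have "kd X m (f k y) < \<delta>"
    using kd_triangle[OF X klim_pts[OF m] q(2,1)] kd_contract[OF A X elim(1) xA y(1)] y(2) elim(2)
     kd_sym[OF X, of m "f k x"] by linarith
   then show ?case using K(2) q by blast
  qed
  from ultra_klim[OF X U K(1) this] show ?thesis using y by (simp add: S_def)
 qed
 have "openin (mtop A) S"
 proof (intro openin_subopen[THEN iffD2] ballI)
  fix x assume x: "x \<in> S"
  then have "x \<in> pts A" by (simp add: S_def)
  obtain N where N: "openin (mtop A) N" "x \<in> N" "!!y. y \<in> N ==> kd A x y < \<delta> / 2"
   by (rule kd_near[OF A \<open>x \<in> pts A\<close> half_gt_zero[OF \<delta>]]) (rule that, assumption+)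
  then have "N \<subseteq> S" using near[OF x] openin_subset[OF N(1)] by blast
  then show "EX T. openin (mtop A) T & x \<in> T & T \<subseteq> S" using N by blast
 qed
 moreover have "openin (mtop A) (pts A - S)"
 proof (intro openin_subopen[THEN iffD2] ballI)
  fix x assume x: "x \<in> pts A - S"
  then have xA: "x \<in> pts A" by simp
  obtain N where N: "openin (mtop A) N" "x \<in> N" "!!y. y \<in> N ==> kd A x y < \<delta> / 2"
   by (rule kd_near[OF A \<open>x \<in> pts A\<close> half_gt_zero[OF \<delta>]]) (rule that, assumption+)
  have "y \<notin> S" if "y \<in> N" for y
   using near[of y x] N(3)[OF that] kd_sym[OF A, of x y] x by auto
  then have "N \<subseteq> pts A - S" using openin_subset[OF N(1)] by blast
  then show "EX T. openin (mtop A) T & x \<in> T & T \<subseteq> pts A - S" using N by blast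
 qed
 moreover have "S \<subseteq> pts A" by (auto simp: S_def)
 ultimately have "openin (mtop A) S" "closedin (mtop A) S" by (simp_all add: closedin_def)
 moreover have "connected_space (mtop A)" using A by (simp add: complex_manifold_def)
 moreover have "p \<in> S" using p by (auto simp: S_def)
 ultimately have "S = pts A" unfolding connected_space_clopen_in by blast
 then show ?thesis using x by (auto simp: S_def)
qed

section \<open>Holomorphic retracts are submanifolds\<close>

text \<open>In a factorisation of an idempotent matrix with the least number of terms, \<open>J\<close> is injective and \<open>Q\<close>
 is surjective, so that \<open>J Q J Q = J Q\<close> gives \<open>Q J = 1\<close>.\<close>

lemma idempotent_rank_factorization:
 fixes P :: "nat => nat => complex"
 assumes idem: "!!i j. i < n ==> j < n ==> P i j = (\<Sum>l<n. P i l * P l j)"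
 obtains r :: nat and J Q :: "nat => nat => complex"
 where "!!i j. i < n ==> j < n ==> P i j = (\<Sum>l<r. J i l * Q l j)"
  "!!l m. l < r ==> m < r ==> (\<Sum>i<n. Q l i * J i m) = (if l = m then 1 else (0::complex))"
proof -
 \<comment> \<open>The index set is an arbitrary finite set of numbers, so that one term can be
   deleted without renumbering the others.\<close>
 define fac where "fac S J Q \<longleftrightarrow> finite S & (ALL i<n. ALL j<n. P i j = (\<Sum>l\<in>S. J i l * Q l j))"
  for S :: "nat set" and J Q :: "nat => nat => complex"
 define r where "r = (LEAST r. EX S J Q. fac S J Q & card S = r)"
 have "P i j = (\<Sum>l<n. P i l * (if l = j then 1 else 0))" if "j < n" for i j
 proof -
  have "(\<Sum>l<n. P i l * (if l = j then 1 else 0)) = (\<Sum>l<n. if l = j then P i l else 0)"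
   by (intro sum.cong) auto
  then show ?thesis using that by simp
 qed
 then have "fac {..<n} P (%l j. if l = j then 1 else 0)" by (simp add: fac_def)
 then have ex: "EX r S J Q. fac S J Q & card S = r" by blast
 then have "EX S J Q. fac S J Q & card S = r" unfolding r_def by (rule LeastI_ex)
 then obtain S J0 Q0 where S: "fac S J0 Q0" "card S = r" by blast
 then have "finite S" by (simp add: fac_def)
 then obtain h where h: "bij_betw h {..<r} S"
  using S(2) by (metis atLeast0LessThan ex_bij_betw_nat_finite)
 define J where "J i l = J0 i (h l)" for i l
 define Q where "Q l j = Q0 (h l) j" for l j
 have PJQ: "P i j = (\<Sum>l<r. J i l * Q l j)" if "i < n" "j < n" for i j
  using S(1) that sum.reindex_bij_betw[OF h, of "%l. J0 i l * Q0 l j"] by (simp add: fac_def J_def Q_def)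
 have minimal: False if "fac T J' Q'" "card T < r" for T J' Q'
  using not_less_Least[of "card T" "%r. EX S J Q. fac S J Q & card S = r"] that unfolding r_def by blast
 have Jinj: "c l0 = 0" if c: "!!i. i < n ==> (\<Sum>l<r. J i l * c l) = 0" and l0: "l0 < r" for c l0
 proof (rule ccontr)
  assume nz: "c l0 ~= 0"
  let ?T = "{..<r} - {l0}"
  \<comment> \<open>A linear relation among the columns of \<open>J\<close> with \<open>c l0\<close>
    nonzero expresses column \<open>l0\<close> by the others; substituting it removes one term and
    contradicts minimality. The rows of \<open>Q\<close> are treated in the same way.\<close>
  have "P i j = (\<Sum>l\<in>?T. J i l * (Q l j - c l / c l0 * Q l0 j))" if ij: "i < n" "j < n" for i j
  proof -
   have e: "J i l0 * c l0 + (\<Sum>l\<in>?T. J i l * c l) = 0"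
    using c[OF ij(1)] l0 by (simp add: sum.remove[of "{..<r}" l0])
   have "(\<Sum>l\<in>?T. J i l * (Q l j - c l / c l0 * Q l0 j)) = (\<Sum>l\<in>?T. J i l * Q l j - (J i l * c l) * (Q l0 j / c l0))"
    by (intro sum.cong refl) (simp add: right_diff_distrib)
   also have "... = (\<Sum>l\<in>?T. J i l * Q l j) - (\<Sum>l\<in>?T. J i l * c l) * (Q l0 j / c l0)"
    by (simp add: sum_subtractf sum_distrib_right sum_divide_distrib)
   also have "(\<Sum>l\<in>?T. J i l * c l) = - (J i l0 * c l0)" using e by (simp add: eq_neg_iff_add_eq_0 add.commute)
   also have "(\<Sum>l\<in>?T. J i l * Q l j) - - (J i l0 * c l0) * (Q l0 j / c l0) = P i j"
    using nz l0 PJQ[OF ij] by (simp add: sum.remove[of "{..<r}" l0])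
   finally show ?thesis by simp
  qed
  then have "fac ?T J (%l j. Q l j - c l / c l0 * Q l0 j)" by (simp add: fac_def)
  then show False by (rule minimal) (use l0 in simp)
 qed
 have Qinj: "c l0 = 0" if c: "!!j. j < n ==> (\<Sum>l<r. c l * Q l j) = 0" and l0: "l0 < r" for c l0
 proof (rule ccontr)
  assume nz: "c l0 ~= 0"
  let ?T = "{..<r} - {l0}"
  have "P i j = (\<Sum>l\<in>?T. (J i l - c l / c l0 * J i l0) * Q l j)" if ij: "i < n" "j < n" for i j
  proof -
   have e: "c l0 * Q l0 j + (\<Sum>l\<in>?T. c l * Q l j) = 0"
    using c[OF ij(2)] l0 by (simp add: sum.remove[of "{..<r}" l0])
   have "(\<Sum>l\<in>?T. (J i l - c l / c l0 * J i l0) * Q l j) = (\<Sum>l\<in>?T. J i l * Q l j - (J i l0 / c l0) * (c l * Q l j))"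
    by (intro sum.cong refl) (simp add: left_diff_distrib)
   also have "... = (\<Sum>l\<in>?T. J i l * Q l j) - (J i l0 / c l0) * (\<Sum>l\<in>?T. c l * Q l j)"
    by (simp add: sum_subtractf sum_distrib_left sum_divide_distrib)
   also have "(\<Sum>l\<in>?T. c l * Q l j) = - (c l0 * Q l0 j)" using e by (simp add: eq_neg_iff_add_eq_0 add.commute)
   also have "(\<Sum>l\<in>?T. J i l * Q l j) - (J i l0 / c l0) * - (c l0 * Q l0 j) = P i j"
    using nz l0 PJQ[OF ij] by (simp add: sum.remove[of "{..<r}" l0])
   finally show ?thesis by simp
  qed
  then have "fac ?T (%i l. J i l - c l / c l0 * J i l0) Q" by (simp add: fac_def)
  then show False by (rule minimal) (use l0 in simp)
 qed
 \<comment> \<open>\<open>N\<close> is the product Q J. Idempotence gives J (N Q - Q) = 0, hence N Q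
   = Q by injectivity of \<open>J\<close>, and then N = 1 by independence of the rows of
   \<open>Q\<close>.\<close>
 define N where "N l m = (\<Sum>i<n. Q l i * J i m)" for l m
 have NQ: "(\<Sum>m<r. N l m * Q m j) - Q l j = 0" if lj: "l < r" "j < n" for l j
 proof (rule Jinj[of "%l. (\<Sum>m<r. N l m * Q m j) - Q l j", OF _ lj(1)])
  fix i assume i: "i < n"
  have "P i j = (\<Sum>k<n. P i k * P k j)" by (rule idem[OF i lj(2)])
  also have "... = (\<Sum>k<n. (\<Sum>l<r. J i l * Q l k) * (\<Sum>m<r. J k m * Q m j))"
   by (intro sum.cong refl) (simp add: PJQ[OF i] PJQ[OF _ lj(2)])
  also have "... = (\<Sum>k<n. \<Sum>l<r. \<Sum>m<r. J i l * (Q l k * J k m * Q m j))"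
   by (simp add: sum_product mult.assoc)
  also have "... = (\<Sum>l<r. \<Sum>m<r. \<Sum>k<n. J i l * (Q l k * J k m * Q m j))"
   by (subst sum.swap) (intro sum.cong refl sum.swap)
  also have "... = (\<Sum>l<r. J i l * (\<Sum>m<r. N l m * Q m j))"
   by (simp add: N_def sum_distrib_left sum_distrib_right)
  finally have "(\<Sum>l<r. J i l * (\<Sum>m<r. N l m * Q m j)) = (\<Sum>l<r. J i l * Q l j)" using PJQ[OF i lj(2)] by simp
  then show "(\<Sum>l<r. J i l * ((\<Sum>m<r. N l m * Q m j) - Q l j)) = 0"
   by (simp add: right_diff_distrib sum_subtractf)
 qed
 have "N l m = (if l = m then 1 else 0)" if lm: "l < r" "m < r" for l m
 proof -
  have "(%m. N l m - (if l = m then 1 else 0)) m = 0"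
  proof (rule Qinj[OF _ lm(2)])
   fix j assume j: "j < n"
   have "(\<Sum>m<r. (if l = m then 1 else 0) * Q m j) = (\<Sum>m<r. if l = m then Q m j else 0)"
    by (intro sum.cong) auto
   then have "(\<Sum>m<r. (if l = m then 1 else 0) * Q m j) = Q l j" using lm(1) by simp
   then show "(\<Sum>m<r. (N l m - (if l = m then 1 else 0)) * Q m j) = 0"
    using NQ[OF lm(1) j] by (simp add: left_diff_distrib sum_subtractf)
  qed
  then show ?thesis by simp
 qed
 then show ?thesis using PJQ by (intro that[where r=r and J=J and Q=Q]) (simp_all add: N_def)
qed

lemma chol_strict_diff_family:
 fixes m :: nat
 assumes W: "copen n W" and f: "!!i. i < m ==> chol n (f i) W" and z: "z \<in> W" and e: "e > 0"
 obtains d where "d > 0" "pdisc n z d \<subseteq> W"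
  "!!i w w'. i < m ==> w \<in> pdisc n z d ==> w' \<in> pdisc n z d ==>
    cmod (f i w - f i w' - (\<Sum>j<n. pd j (f i) z * (w j - w' j))) <= e * (\<Sum>j<n. cmod (w j - w' j))"
proof -
 let ?C = "%i d. ALL w:pdisc n z d. ALL w':pdisc n z d.
    cmod (f i w - f i w' - (\<Sum>j<n. pd j (f i) z * (w j - w' j))) <= e * (\<Sum>j<n. cmod (w j - w' j))"
 obtain d0 where d0: "d0 > 0" "pdisc n z d0 \<subseteq> W" using openin_contains_pdisc[OF W z] .
 have "ALL i:{..<m}. EX d>0. ?C i d"
 proof
  fix i assume "i \<in> {..<m}"
  then have i: "i < m" by simp
  obtain d where "d > 0" "?C i d" by (rule chol_strict_diff[OF W f[OF i] z e]) (rule that, auto)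
  then show "EX d>0. ?C i d" by blast
 qed
 from bchoice[OF this] obtain D where D: "ALL i:{..<m}. D i > 0 & ?C i (D i)" by blast
 define d where "d = Min (insert d0 (D ` {..<m}))"
 have d: "d > 0" unfolding d_def using D d0(1) by (subst Min_gr_iff) auto
 have d': "d <= d0" "!!i. i < m ==> d <= D i" unfolding d_def by (rule Min_le; simp)+
 show ?thesis
 proof (rule that[OF d])
  show "pdisc n z d \<subseteq> W" using pdisc_mono[OF d'(1)] d0(2) by blast
  fix i w w' assume "i < m" "w \<in> pdisc n z d" "w' \<in> pdisc n z d"
  then show "cmod (f i w - f i w' - (\<Sum>j<n. pd j (f i) z * (w j - w' j))) <= e * (\<Sum>j<n. cmod (w j - w' j))"
   using D pdisc_mono[OF d'(2)] by blast
 qed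
qed

section \<open>Slices as charts of a retract\<close>

text \<open>A chart of \<open>Z\<close> of dimension \<open>r\<close> given by ambient data:
  \<open>\<sigma>\<close> is holomorphic on the open subset \<open>Op\<close> of \<open>X\<close>,
  and its restriction to \<open>Op Int Z\<close> has a holomorphic inverse. The ambient extension
  makes it easy to recognise holomorphic maps into \<open>Z\<close>.\<close>

definition slice :: "'a cmanifold => 'a set => nat => 'a set => ('a => nat => complex) => 'a set => ('a => nat => complex) => bool" where
 "slice X Z r U \<phi> Op \<sigma> \<longleftrightarrow> (U, \<phi>) \<in> atlas X & openin (mtop X) Op & Op \<subseteq> U & \<sigma> ` Op \<subseteq> CS r &
   (ALL l<r. chol (mdim X) (%x. \<sigma> (inv_into U \<phi> x) l) (\<phi> ` Op)) & inj_on \<sigma> (Op Int Z) &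
   copen r (\<sigma> ` (Op Int Z)) &
   (ALL i<mdim X. chol r (%w. \<phi> (inv_into (Op Int Z) \<sigma> w) i) (\<sigma> ` (Op Int Z)))"

text \<open>The differential of \<open>\<rho>\<close> at the fixed point \<open>z0\<close> is
  idempotent and factors as J Q with Q J = 1. In coordinates, Q serves as the map
  \<open>\<sigma>\<close>. Its inverse on the retract is \<open>\<rho>\<close> applied to the affine
  plane with direction \<open>J\<close>, after a reparametrisation \<open>G\<close> that corrects
  the terms beyond first order.\<close>

lemma retract_slice_exists:
 assumes X: "complex_manifold X" and \<rho>: "holomorphic_map X X \<rho>" and idem: "!!x. x \<in> pts X ==> \<rho> (\<rho> x) = \<rho> x"
  and z0: "z0 \<in> \<rho> ` pts X"
 shows "EX r U \<phi> Op \<sigma>. slice X (\<rho> ` pts X) r U \<phi> Op \<sigma> & z0 \<in> Op"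
proof -
 let ?Z = "\<rho> ` pts X" and ?n = "mdim X"
 have fix_Z: "\<rho> z = z" if "z \<in> ?Z" for z using that idem by auto
 have z0X: "z0 \<in> pts X" using z0 hol_pts[OF \<rho>] by auto
 obtain U \<phi> where c: "(U, \<phi>) \<in> atlas X" "z0 \<in> U" using chart_exists[OF X z0X] .
 define R where "R i w = \<phi> (\<rho> (inv_into U \<phi> w)) i" for i w
 have Rabs: "R i = (%w. \<phi> (\<rho> (inv_into U \<phi> w)) i)" for i by (rule ext) (simp add: R_def)
 let ?D = "\<phi> ` {x \<in> U. \<rho> x \<in> U}"
 have oD: "copen ?n ?D" and Rh: "i < ?n ==> chol ?n (R i) ?D" for i
  using holomorphic_mapD[OF X X \<rho> c(1) c(1)] unfolding R_def by auto
 let ?a = "\<phi> z0"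
 have aD: "?a \<in> ?D" using c fix_Z[OF z0] by auto
 \<comment> \<open>The Jacobian of \<open>\<rho>\<close> at \<open>z0\<close>. Differentiating
   \<rho> \<rho> = \<rho> at a fixed point makes it idempotent, since both Jacobians in the chain
   rule are taken at the same point.\<close>
 define P where "P i j = pd j (R i) ?a" for i j
 have idemP: "P i j = (\<Sum>l<?n. P i l * P l j)" if ij: "i < ?n" "j < ?n" for i j
 proof -
  have o: "copen ?n (\<phi> ` {x \<in> U. \<rho> x \<in> U & \<rho> (\<rho> x) \<in> U})"
   by (rule compose_in_charts(1)[OF X X X \<rho> \<rho> c(1) c(1) c(1)])
  have "pd j (%w. \<phi> (\<rho> (\<rho> (inv_into U \<phi> w))) i) ?a = pd j (R i) ?a"
   unfolding R_def
  proof (rule pd_cong[OF o _ _ ij(2)])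
   fix w assume "w \<in> \<phi> ` {x \<in> U. \<rho> x \<in> U & \<rho> (\<rho> x) \<in> U}"
   then have "inv_into U \<phi> w \<in> pts X" using chart_inv[OF X c(1)] chart_subset[OF X c(1)] by auto
   then show "\<phi> (\<rho> (\<rho> (inv_into U \<phi> w))) i = \<phi> (\<rho> (inv_into U \<phi> w)) i" using idem by simp
  qed (use c fix_Z[OF z0] in auto)
  moreover have "pd j (%w. \<phi> (\<rho> (\<rho> (inv_into U \<phi> w))) i) ?a = (\<Sum>l<?n. P i l * P l j)"
   using compose_in_charts(3)[OF X X X \<rho> \<rho> c(1) c(1) c(1) c(2) _ _ ij] c(2) fix_Z[OF z0]
   by (simp add: P_def Rabs)
  ultimately show ?thesis by (simp add: P_def)
 qed
 obtain r :: nat and J Q :: "nat => nat => complex" where PJQ: "!!i j. i < ?n ==> j < ?n ==> P i j = (\<Sum>l<r. J i l * Q l j)"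
  and QJ: "!!l m. l < r ==> m < r ==> (\<Sum>i<?n. Q l i * J i m) = (if l = m then 1 else (0::complex))"
  by (rule idempotent_rank_factorization[of ?n P, OF idemP]) (assumption+, rule that, assumption+)
 define MQ where "MQ = 1 + (\<Sum>l<r. \<Sum>j<?n. cmod (Q l j))"
 define MJ where "MJ = 1 + (\<Sum>i<?n. \<Sum>l<r. cmod (J i l))"
 have M: "MQ >= 1" "MJ >= 1" unfolding MQ_def MJ_def by (simp_all add: sum_nonneg)
 \<comment> \<open>The tolerance for the linear approximation. It turns the error
   \<open>MQ * e * MJ * Rr\<close> of \<open>\<theta>\<close> into at most
   \<open>Rr / (32 * (real r + 1))\<close>, as \<open>near_identity_inverse\<close> demands, and
   makes \<open>n * e < 1\<close> for the injectivity of \<open>\<sigma>\<close>.\<close>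
 define e where "e = 1 / (32 * (real r + 1) * (real ?n + 1) * MQ * MJ)"
 have e: "e > 0" unfolding e_def using M by simp
 obtain d where d: "d > 0" "pdisc ?n ?a d \<subseteq> ?D"
  "!!i w w'. i < ?n ==> w \<in> pdisc ?n ?a d ==> w' \<in> pdisc ?n ?a d ==>
    cmod (R i w - R i w' - (\<Sum>j<?n. P i j * (w j - w' j))) <= e * (\<Sum>j<?n. cmod (w j - w' j))"
  by (rule chol_strict_diff_family[where f=R and m="mdim X", OF oD Rh aD e, folded P_def]) (assumption, rule that, assumption+)
 have aC: "?a \<in> CS ?n" using chart_CS[OF X c] .
 have Ra: "R i ?a = ?a i" for i using c chart_inv[OF X c(1)] fix_Z[OF z0] by (simp add: R_def)
 have "copen ?n (\<phi> ` {x \<in> {x \<in> U. \<rho> x \<in> U}. \<phi> (\<rho> x) \<in> pdisc ?n ?a d})"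
 proof (rule chart_image_open[OF X c(1)])
  have "openin (mtop X) {x \<in> U. \<rho> x \<in> {y \<in> U. \<phi> y \<in> pdisc ?n ?a d}}"
   by (rule openin_chart_preimage[OF X c(1) hol_continuous[OF \<rho>] chart_preimage_open[OF X c(1) openin_pdisc]])
  moreover have "{x \<in> U. \<rho> x \<in> {y \<in> U. \<phi> y \<in> pdisc ?n ?a d}} = {x \<in> {x \<in> U. \<rho> x \<in> U}. \<phi> (\<rho> x) \<in> pdisc ?n ?a d}" by auto
  ultimately show "openin (mtop X) {x \<in> {x \<in> U. \<rho> x \<in> U}. \<phi> (\<rho> x) \<in> pdisc ?n ?a d}" by simp
 qed auto
 then obtain d2 where d2: "d2 > 0" "pdisc ?n ?a d2 \<subseteq> \<phi> ` {x \<in> {x \<in> U. \<rho> x \<in> U}. \<phi> (\<rho> x) \<in> pdisc ?n ?a d}"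
  by (rule openin_contains_pdisc[where z="?a"]) (use c d aC fix_Z[OF z0] pdisc_center in auto)
 \<comment> \<open>On this polydisc the strict estimate holds, and \<open>\<rho>\<close> maps into
   the chart with coordinates still within \<open>d\<close>.\<close>
 define d3 where "d3 = min d d2"
 have d3: "d3 > 0" "pdisc ?n ?a d3 \<subseteq> pdisc ?n ?a d"
  "!!w. w \<in> pdisc ?n ?a d3 ==> w \<in> \<phi> ` {x \<in> {x \<in> U. \<rho> x \<in> U}. \<phi> (\<rho> x) \<in> pdisc ?n ?a d}"
  using d d2 pdisc_mono[of d3 d ?n ?a] pdisc_mono[of d3 d2 ?n ?a] unfolding d3_def by auto
 define Rr where "Rr = d3 / (2 * MJ)"
 have Rr: "Rr > 0" "MJ * Rr < d3" using d3(1) M by (auto simp: Rr_def)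
 define Qm where "Qm x = (%l. if l < r then \<Sum>j<?n. Q l j * x j else 0)" for x :: "nat => complex"
 let ?b = "Qm ?a"
 \<comment> \<open>The affine plane through \<open>\<phi> z0\<close> spanned by the columns of
   \<open>J\<close>; \<open>Rr\<close> is chosen so that it stays within \<open>d3 / 2\<close> of
   the centre.\<close>
 define xs where "xs y = (%i. if i < ?n then ?a i + (\<Sum>l<r. J i l * (y l - ?b l)) else 0)" for y :: "nat => complex"
 have QmC: "Qm x \<in> CS r" for x by (simp add: Qm_def CS_def)
 have xsum: "(\<Sum>i<?n. cmod (xs y i - ?a i)) <= MJ * Rr" if y: "y \<in> pdisc r ?b Rr" for y
 proof -
  have "(\<Sum>i<?n. cmod (xs y i - ?a i)) <= (\<Sum>i<?n. \<Sum>l<r. cmod (J i l) * Rr)"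
  proof (rule sum_mono)
   fix i assume "i \<in> {..<?n}"
   then have "cmod (xs y i - ?a i) = cmod (\<Sum>l<r. J i l * (y l - ?b l))" by (simp add: xs_def)
   also have "... <= (\<Sum>l<r. cmod (J i l) * Rr)"
    by (rule sum_norm_le) (use y in \<open>auto simp: norm_mult pdisc_def dist_norm intro!: mult_left_mono\<close>)
   finally show "cmod (xs y i - ?a i) <= (\<Sum>l<r. cmod (J i l) * Rr)" .
  qed
  also have "... = (MJ - 1) * Rr" by (simp add: MJ_def sum_distrib_right)
  finally show ?thesis using Rr(1) by (simp add: algebra_simps)
 qed
 have xin: "xs y \<in> pdisc ?n ?a d3" if y: "y \<in> pdisc r ?b Rr" for y
 proof -
  have "dist (xs y i) (?a i) < d3" if i: "i < ?n" for i
  proof -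
   have "cmod (xs y i - ?a i) <= (\<Sum>i<?n. cmod (xs y i - ?a i))" using i by (intro member_le_sum) auto
   then show ?thesis using xsum[OF y] Rr(2) by (simp add: dist_norm)
  qed
  then show ?thesis by (auto simp: pdisc_def CS_def xs_def)
 qed
 define \<theta> where "\<theta> y = Qm (%j. R j (xs y))" for y
 have xsh: "chol r (%y. xs y i) W" for i W
 proof (cases "i < ?n")
  case True
  have "chol r (%y. ?a i + (\<Sum>l<r. J i l * (y l - ?b l))) W"
   by (intro chol_add chol_const chol_sum chol_mult chol_diff chol_coord) auto
  then show ?thesis using True by (simp add: xs_def)
 qed (simp add: xs_def chol_const)
 have Rxh: "chol r (%y. R j (xs y)) (pdisc r ?b Rr)" if j: "j < ?n" for j
  by (rule chol_compose(1)[OF oD Rh[OF j] openin_pdisc xsh]) (use xin d3(2) d(2) in blast)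
 have \<theta>h: "chol r (%y. \<theta> y l) (pdisc r ?b Rr)" if l: "l < r" for l
 proof -
  have "chol r (%y. \<Sum>j<?n. Q l j * R j (xs y)) (pdisc r ?b Rr)"
   by (intro chol_sum chol_mult chol_const Rxh) auto
  then show ?thesis using l by (simp add: \<theta>_def Qm_def)
 qed
 \<comment> \<open>The linear part of \<open>\<theta>\<close> is Q P J = Q J Q J = 1, so
   \<open>\<theta>\<close> is close to the identity.\<close>
 have lin: "(\<Sum>j<?n. Q l j * (\<Sum>k<?n. P j k * (xs y k - ?a k))) = y l - ?b l" if l: "l < r" for l y
 proof -
  have dl: "(\<Sum>m<r. (if l = m then 1 else 0) * v m) = v l" if "l < r" for l and v :: "nat => complex"
  proof -
   have "(\<Sum>m<r. (if l = m then 1 else 0) * v m) = (\<Sum>m<r. if l = m then v m else 0)" by (intro sum.cong) auto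
   then show ?thesis using that by simp
  qed
  have 1: "(\<Sum>k<?n. Q m k * (xs y k - ?a k)) = y m - ?b m" if m: "m < r" for m
  proof -
   have "(\<Sum>k<?n. Q m k * (xs y k - ?a k)) = (\<Sum>k<?n. \<Sum>l<r. Q m k * J k l * (y l - ?b l))"
    by (intro sum.cong) (auto simp: xs_def sum_distrib_left mult.assoc)
   also have "... = (\<Sum>l<r. (\<Sum>k<?n. Q m k * J k l) * (y l - ?b l))"
    by (subst sum.swap) (simp add: sum_distrib_right)
   also have "... = (\<Sum>l<r. (if m = l then 1 else 0) * (y l - ?b l))" using QJ[OF m] by (intro sum.cong) auto
   finally show ?thesis using dl[OF m, of "%l. y l - ?b l"] by simp
  qed
  have "(\<Sum>j<?n. Q l j * (\<Sum>k<?n. P j k * (xs y k - ?a k))) = (\<Sum>j<?n. \<Sum>m<r. Q l j * J j m * (\<Sum>k<?n. Q m k * (xs y k - ?a k)))"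
  proof (rule sum.cong[OF refl])
   fix j assume "j \<in> {..<?n}"
   then have "(\<Sum>k<?n. P j k * (xs y k - ?a k)) = (\<Sum>k<?n. \<Sum>m<r. J j m * (Q m k * (xs y k - ?a k)))"
    using PJQ by (intro sum.cong) (auto simp: sum_distrib_right mult.assoc)
   also have "... = (\<Sum>m<r. J j m * (\<Sum>k<?n. Q m k * (xs y k - ?a k)))"
    by (subst sum.swap) (simp add: sum_distrib_left)
   finally show "Q l j * (\<Sum>k<?n. P j k * (xs y k - ?a k)) = (\<Sum>m<r. Q l j * J j m * (\<Sum>k<?n. Q m k * (xs y k - ?a k)))"
    by (simp add: sum_distrib_left mult.assoc)
  qed
  also have "... = (\<Sum>j<?n. \<Sum>m<r. Q l j * J j m * (y m - ?b m))" using 1 by (intro sum.cong) auto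
  also have "... = (\<Sum>m<r. (\<Sum>j<?n. Q l j * J j m) * (y m - ?b m))"
   by (subst sum.swap) (simp add: sum_distrib_right)
  also have "... = (\<Sum>m<r. (if l = m then 1 else 0) * (y m - ?b m))" using QJ[OF l] by (intro sum.cong) auto
  finally show ?thesis using dl[OF l, of "%m. y m - ?b m"] by simp
 qed
 have near: "cmod (\<theta> y l - y l) <= Rr / (32 * (real r + 1))" if y: "y \<in> pdisc r ?b Rr" and l: "l < r" for y l
 proof -
  have eq: "\<theta> y l - y l = (\<Sum>j<?n. Q l j * (R j (xs y) - R j ?a - (\<Sum>k<?n. P j k * (xs y k - ?a k))))"
   using lin[OF l, of y] l by (simp add: \<theta>_def Qm_def Ra right_diff_distrib sum_subtractf)
  have "cmod (\<theta> y l - y l) <= (\<Sum>j<?n. cmod (Q l j) * (e * (MJ * Rr)))"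
   unfolding eq
  proof (rule sum_norm_le)
   fix j assume "j \<in> {..<?n}"
   then have j: "j < ?n" by simp
   have "cmod (R j (xs y) - R j ?a - (\<Sum>k<?n. P j k * (xs y k - ?a k))) <= e * (\<Sum>k<?n. cmod (xs y k - ?a k))"
    by (rule d(3)[OF j]) (use xin[OF y] d3(2) pdisc_center[OF aC d(1)] in auto)
   also have "... <= e * (MJ * Rr)" using xsum[OF y] e by (intro mult_left_mono) auto
   finally show "cmod (Q l j * (R j (xs y) - R j ?a - (\<Sum>k<?n. P j k * (xs y k - ?a k)))) <= cmod (Q l j) * (e * (MJ * Rr))"
    by (simp add: norm_mult mult_left_mono)
  qed
  also have "... = (\<Sum>j<?n. cmod (Q l j)) * (e * (MJ * Rr))" by (simp add: sum_distrib_right)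
  also have "... <= MQ * (e * (MJ * Rr))"
  proof (rule mult_right_mono)
   have "(\<Sum>j<?n. cmod (Q l j)) <= (\<Sum>l<r. \<Sum>j<?n. cmod (Q l j))"
    using l by (intro member_le_sum[of l "{..<r}" "%l. \<Sum>j<?n. cmod (Q l j)"]) (auto simp: sum_nonneg)
   then show "(\<Sum>j<?n. cmod (Q l j)) <= MQ" by (simp add: MQ_def)
  qed (use e M Rr in simp)
  also have "... = Rr / (32 * (real r + 1)) / (real ?n + 1)"
  proof -
   have "MQ * (1 / (A * MQ * MJ) * (MJ * Rr)) = Rr / A" if "A > 0" for A
    using M that by (simp add: divide_simps)
   from this[of "32 * (real r + 1) * (real ?n + 1)"] show ?thesis by (simp add: e_def)
  qed
  also have "... <= Rr / (32 * (real r + 1))" using Rr(1) by (simp add: divide_le_eq)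
  finally show ?thesis .
 qed
 obtain G where G: "!!i. i < r ==> chol r (%x. G x i) (pdisc r ?b (Rr/4))"
  "!!x. x \<in> pdisc r ?b (Rr/4) ==> G x \<in> pdisc r ?b (Rr/2)"
  "!!x i. x \<in> pdisc r ?b (Rr/4) ==> i < r ==> \<theta> (G x) i = x i"
  by (rule near_identity_inverse[OF \<theta>h Rr(1) QmC near]) (use that in \<open>auto simp: field_simps\<close>)
 let ?W = "pdisc r ?b (Rr/4)"
 define s where "s y = \<rho> (inv_into U \<phi> (xs (G y)))" for y
 have GR: "G y \<in> pdisc r ?b Rr" if "y \<in> ?W" for y
  using G(2)[OF that] pdisc_mono[of "Rr/2" Rr r ?b] Rr(1) by auto
 have sy: "s y \<in> U" "\<phi> (s y) \<in> pdisc ?n ?a d" "s y \<in> ?Z" "!!i. \<phi> (s y) i = R i (xs (G y))" if y: "y \<in> ?W" for y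
 proof -
  obtain x where x: "x \<in> U" "\<rho> x \<in> U" "\<phi> (\<rho> x) \<in> pdisc ?n ?a d" "xs (G y) = \<phi> x"
   using d3(3)[OF xin[OF GR[OF y]]] by blast
  then have "s y = \<rho> x" unfolding s_def using chart_inv[OF X c(1)] by simp
  then show "s y \<in> U" "\<phi> (s y) \<in> pdisc ?n ?a d" "s y \<in> ?Z" using x chart_subset[OF X c(1)] by auto
  show "\<phi> (s y) i = R i (xs (G y))" for i by (simp add: s_def R_def)
 qed
 define \<sigma> where "\<sigma> x = Qm (\<phi> x)" for x
 have \<sigma>s: "\<sigma> (s y) = y" if y: "y \<in> ?W" for y
 proof
  fix l
  have "Qm (\<phi> (s y)) = \<theta> (G y)" using sy(4)[OF y] by (simp add: Qm_def \<theta>_def fun_eq_iff)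
  then show "\<sigma> (s y) l = y l"
   using G(3)[OF y, of l] y by (cases "l < r") (auto simp: \<sigma>_def Qm_def \<theta>_def pdisc_def CS_def)
 qed
 define Op where "Op = {x \<in> U. \<phi> x \<in> pdisc ?n ?a d & \<sigma> x \<in> ?W}"
 \<comment> \<open>On the retract \<open>\<rho>\<close> is the identity, and equal
   \<open>\<sigma>\<close> means that the difference of coordinates is killed by Q, hence by P = J
   Q. The strict estimate then bounds the difference by \<open>n * e < 1\<close> times
   itself.\<close>
 have inj: "x = x'" if x: "x \<in> Op Int ?Z" "x' \<in> Op Int ?Z" and eq: "\<sigma> x = \<sigma> x'" for x x'
 proof -
  let ?S = "\<Sum>j<?n. cmod (\<phi> x j - \<phi> x' j)"
  have xx: "x \<in> U" "x' \<in> U" "\<phi> x \<in> pdisc ?n ?a d" "\<phi> x' \<in> pdisc ?n ?a d" using x by (auto simp: Op_def)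
  have Rx: "R i (\<phi> x) = \<phi> x i" "R i (\<phi> x') = \<phi> x' i" for i
   using x fix_Z[of x] fix_Z[of x'] by (simp_all add: R_def chart_inv[OF X c(1)] xx)
  have "cmod (\<phi> x i - \<phi> x' i) <= e * ?S" if i: "i < ?n" for i
  proof -
   have "(\<Sum>j<?n. Q l j * (\<phi> x j - \<phi> x' j)) = 0" if "l < r" for l
    using fun_cong[OF eq, of l] that by (simp add: \<sigma>_def Qm_def right_diff_distrib sum_subtractf)
   moreover have "(\<Sum>j<?n. P i j * (\<phi> x j - \<phi> x' j)) = (\<Sum>j<?n. \<Sum>l<r. J i l * (Q l j * (\<phi> x j - \<phi> x' j)))"
    using PJQ[OF i] by (intro sum.cong) (auto simp: sum_distrib_right mult.assoc)
   moreover have "... = (\<Sum>l<r. J i l * (\<Sum>j<?n. Q l j * (\<phi> x j - \<phi> x' j)))"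
    by (subst sum.swap) (simp add: sum_distrib_left)
   ultimately have "(\<Sum>j<?n. P i j * (\<phi> x j - \<phi> x' j)) = 0" by simp
   then show ?thesis using d(3)[OF i xx(3,4)] by (simp add: Rx)
  qed
  then have "?S <= (\<Sum>i<?n. e * ?S)" by (intro sum_mono) auto
  then have S1: "?S <= (real ?n * e) * ?S" by simp
  have "real ?n * e < 1"
  proof -
   define B where "B = 32 * (real r + 1) * (real ?n + 1) * MQ * MJ"
   have "1 * 1 * (real ?n + 1) * 1 * 1 <= B"
    unfolding B_def using M by (intro mult_mono) auto
   then have "real ?n < B" by simp
   then show ?thesis unfolding e_def B_def[symmetric] by (simp add: divide_less_eq)
  qed
  moreover have "?S >= 0" by (simp add: sum_nonneg)
  ultimately have "?S = 0" using S1 by (metis antisym_conv mult_le_cancel_right1 not_less)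
  then have "ALL j:{..<?n}. cmod (\<phi> x j - \<phi> x' j) = 0" by (subst (asm) sum_nonneg_eq_0_iff) auto
  then have "\<phi> x = \<phi> x'"
   using xx(3,4) by (auto simp: pdisc_def CS_def fun_eq_iff) (metis linorder_not_le lessThan_iff)
  then show "x = x'" using chart_inj[OF X c(1)] xx by (auto simp: inj_on_def)
 qed
 have sO: "s y \<in> Op Int ?Z" if y: "y \<in> ?W" for y using sy[OF y] \<sigma>s[OF y] y by (simp add: Op_def)
 have img: "\<sigma> ` (Op Int ?Z) = ?W"
 proof
  show "?W \<subseteq> \<sigma> ` (Op Int ?Z)" using sO \<sigma>s by (metis imageI subsetI)
 qed (auto simp: Op_def)
 have \<sigma>h: "chol ?n (%x. \<sigma> (inv_into U \<phi> x) l) (\<phi> ` U)" if l: "l < r" for l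
 proof (rule chol_cong[OF chart_open(2)[OF X c(1)]])
  show "chol ?n (%x. \<Sum>j<?n. Q l j * x j) (\<phi> ` U)"
   by (intro chol_sum chol_mult chol_const chol_coord) auto
 qed (use l in \<open>auto simp: \<sigma>_def Qm_def f_inv_into_f\<close>)
 have oO: "openin (mtop X) Op"
 proof -
  let ?V = "\<phi> ` U Int pdisc ?n ?a d"
  have cont: "continuous_on (\<phi> ` U) (%x. \<sigma> (inv_into U \<phi> x))"
   by (rule continuous_on_into_CS[of r], rule chol_continuous[OF \<sigma>h], assumption) (simp add: \<sigma>_def QmC)
  obtain T where T: "open T" "?W = CS r Int T" using openin_pdisc[of r ?b "Rr/4"] by (auto simp: openin_open)
  have "openin (top_of_set (\<phi> ` U)) (\<phi> ` U Int (%x. \<sigma> (inv_into U \<phi> x)) -` T)"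
   by (rule continuous_openin_preimage_gen[OF cont T(1)])
  then have o1: "copen ?n (\<phi> ` U Int (%x. \<sigma> (inv_into U \<phi> x)) -` T)"
   using chart_open(2)[OF X c(1)] openin_trans by blast
  have "Op = {x \<in> U. \<phi> x \<in> (\<phi> ` U Int (%x. \<sigma> (inv_into U \<phi> x)) -` T) Int pdisc ?n ?a d}"
   unfolding Op_def T(2) using chart_inv[OF X c(1)] QmC by (auto simp: \<sigma>_def)
  then show ?thesis using chart_preimage_open[OF X c(1) openin_Int[OF o1 openin_pdisc]] by simp
 qed
 have "chol r (%w. \<phi> (inv_into (Op Int ?Z) \<sigma> w) i) (\<sigma> ` (Op Int ?Z))" if i: "i < ?n" for i
  unfolding img
 proof (rule chol_cong[OF openin_pdisc])
  show "chol r (%y. R i (xs (G y))) ?W"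
   by (rule chol_compose(1)[OF openin_pdisc Rxh[OF i] openin_pdisc G(1) GR])
  fix y assume y: "y \<in> ?W"
  have "inv_into (Op Int ?Z) \<sigma> (\<sigma> (s y)) = s y"
   by (rule inv_into_f_f[OF _ sO[OF y]]) (intro inj_onI inj)
  then have "inv_into (Op Int ?Z) \<sigma> y = s y" by (simp only: \<sigma>s[OF y])
  then show "R i (xs (G y)) = \<phi> (inv_into (Op Int ?Z) \<sigma> y) i" using sy(4)[OF y] by simp
 qed
 moreover have "inj_on \<sigma> (Op Int ?Z)" by (intro inj_onI inj)
 moreover have "chol ?n (%x. \<sigma> (inv_into U \<phi> x) l) (\<phi> ` Op)" if "l < r" for l
  by (rule chol_subset[OF \<sigma>h[OF that]]) (auto simp: Op_def)
 moreover have "z0 \<in> Op" using c aC d(1) Rr(1) by (simp add: Op_def \<sigma>_def pdisc_center QmC)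
 ultimately have "slice X ?Z r U \<phi> Op \<sigma> & z0 \<in> Op"
  unfolding slice_def using c oO img QmC openin_pdisc by (auto simp: Op_def \<sigma>_def)
 then show ?thesis by blast
qed


context
 fixes X :: "'a cmanifold" and Z :: "'a set"
 assumes X: "complex_manifold X" and ZX: "Z \<subseteq> pts X"
begin

lemma sliceD:
 assumes "slice X Z r U \<phi> Op \<sigma>"
 shows "(U, \<phi>) \<in> atlas X" "openin (mtop X) Op" "Op \<subseteq> U" "x \<in> Op ==> \<sigma> x \<in> CS r"
  "l < r ==> chol (mdim X) (%x. \<sigma> (inv_into U \<phi> x) l) (\<phi> ` Op)" "inj_on \<sigma> (Op Int Z)"
  "copen r (\<sigma> ` (Op Int Z))"
  "i < mdim X ==> chol r (%w. \<phi> (inv_into (Op Int Z) \<sigma> w) i) (\<sigma> ` (Op Int Z))"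
 using assms unfolding slice_def by auto

lemma slice_inv:
 assumes "slice X Z r U \<phi> Op \<sigma>"
 shows "x \<in> Op Int Z ==> inv_into (Op Int Z) \<sigma> (\<sigma> x) = x"
  "w \<in> \<sigma> ` (Op Int Z) ==> inv_into (Op Int Z) \<sigma> w \<in> Op Int Z"
  "w \<in> \<sigma> ` (Op Int Z) ==> \<sigma> (inv_into (Op Int Z) \<sigma> w) = w"
 by (rule inv_into_f_f[OF sliceD(6)[OF assms]], assumption) (rule inv_into_into, assumption, rule f_inv_into_f)

lemma slice_continuous:
 assumes s: "slice X Z r U \<phi> Op \<sigma>"
 shows "continuous_on (\<sigma> ` (Op Int Z)) (%w. \<phi> (inv_into (Op Int Z) \<sigma> w))"
  and "continuous_map (top_of_set (\<sigma> ` (Op Int Z))) (mtop X) (inv_into (Op Int Z) \<sigma>)"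
  and "continuous_map (subtopology (mtop X) Op) euclidean \<sigma>"
proof -
 note c = sliceD(1)[OF s] and OU = sliceD(3)[OF s]
 have sU: "inv_into (Op Int Z) \<sigma> w \<in> U" if "w \<in> \<sigma> ` (Op Int Z)" for w
  using slice_inv(2)[OF s that] OU by blast
 show c1: "continuous_on (\<sigma> ` (Op Int Z)) (%w. \<phi> (inv_into (Op Int Z) \<sigma> w))"
  by (rule continuous_on_into_CS[of "mdim X"], rule chol_continuous[OF sliceD(8)[OF s]], assumption)
   (rule chart_CS[OF X c sU])
 have "continuous_map (top_of_set (\<sigma> ` (Op Int Z))) (top_of_set (\<phi> ` U)) (%w. \<phi> (inv_into (Op Int Z) \<sigma> w))"
  using c1 sU by (simp add: continuous_map_in_subtopology image_subset_iff Pi_iff)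
 from continuous_map_compose[OF this chart_continuous(2)[OF X c]]
 show "continuous_map (top_of_set (\<sigma> ` (Op Int Z))) (mtop X) (inv_into (Op Int Z) \<sigma>)"
  by (rule continuous_map_eq) (use sU chart_inv[OF X c] in auto)
 have "continuous_on (\<phi> ` Op) (%x. \<sigma> (inv_into U \<phi> x))"
  by (rule continuous_on_into_CS[of r], rule chol_continuous[OF sliceD(5)[OF s]], assumption)
   (use sliceD(4)[OF s] chart_inv[OF X c] OU in auto)
 then have c2: "continuous_map (top_of_set (\<phi> ` Op)) euclidean (%x. \<sigma> (inv_into U \<phi> x))" by simp
 have "continuous_map (subtopology (mtop X) Op) (top_of_set (CS (mdim X))) \<phi>"
  using continuous_map_from_subtopology_mono[OF chart_continuous(1)[OF X c] OU] .
 then have "continuous_map (subtopology (mtop X) Op) (top_of_set (\<phi> ` Op)) \<phi>"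
  by (auto simp: continuous_map_in_subtopology)
 from continuous_map_compose[OF this c2] show "continuous_map (subtopology (mtop X) Op) euclidean \<sigma>"
  by (rule continuous_map_eq) (use OU chart_inv[OF X c] in auto)
qed

lemma slice_image_open:
 assumes s: "slice X Z r U \<phi> Op \<sigma>" and S: "openin (mtop X) S"
 shows "copen r (\<sigma> ` (Op Int Z Int S))"
proof -
 have "openin (top_of_set (\<sigma> ` (Op Int Z))) {w \<in> topspace (top_of_set (\<sigma> ` (Op Int Z))). inv_into (Op Int Z) \<sigma> w \<in> S}"
  by (rule openin_continuous_map_preimage[OF slice_continuous(2)[OF s] S])
 moreover have "{w \<in> topspace (top_of_set (\<sigma> ` (Op Int Z))). inv_into (Op Int Z) \<sigma> w \<in> S} = \<sigma> ` (Op Int Z Int S)"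
  using slice_inv(1)[OF s] by auto
 ultimately show ?thesis using openin_trans sliceD(7)[OF s] by metis
qed

lemma slice_chart_chol:
 assumes s: "slice X Z r U \<phi> Op \<sigma>" and c': "(U', \<phi>') \<in> atlas X" and i: "i < mdim X"
 shows "chol r (%w. \<phi>' (inv_into (Op Int Z) \<sigma> w) i) (\<sigma> ` (Op Int Z Int U'))"
proof -
 note c = sliceD(1)[OF s] and OU = sliceD(3)[OF s]
 have o: "copen r (\<sigma> ` (Op Int Z Int U'))" by (rule slice_image_open[OF s chart_open(1)[OF X c']])
 have sU: "inv_into (Op Int Z) \<sigma> w \<in> U Int U'" if "w \<in> \<sigma> ` (Op Int Z Int U')" for w
  using that slice_inv(1)[OF s] OU by auto
 have 1: "chol r (%w. \<phi>' (inv_into U \<phi> (\<phi> (inv_into (Op Int Z) \<sigma> w))) i) (\<sigma> ` (Op Int Z Int U'))"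
  by (rule chol_compose(1)[OF transition_chol(1)[OF X c c'] transition_chol(2)[OF X c c' i] o])
   (rule chol_subset[OF sliceD(8)[OF s]], auto intro!: imageI sU[THEN IntD1] sU[THEN IntD2])
 show ?thesis by (rule chol_cong[OF o 1]) (use sU chart_inv[OF X c] in auto)
qed

lemma slice_transition:
 assumes s: "slice X Z r U \<phi> Op \<sigma>" and s': "slice X Z r' U' \<phi>' Op' \<sigma>'"
 shows "copen r (\<sigma> ` (Op Int Z Int Op'))"
  and "l < r' ==> chol r (%w. \<sigma>' (inv_into (Op Int Z) \<sigma> w) l) (\<sigma> ` (Op Int Z Int Op'))"
proof -
 show o: "copen r (\<sigma> ` (Op Int Z Int Op'))" by (rule slice_image_open[OF s sliceD(2)[OF s']])
 note c' = sliceD(1)[OF s'] and OU' = sliceD(3)[OF s']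
 have sU: "inv_into (Op Int Z) \<sigma> w \<in> Op'" if "w \<in> \<sigma> ` (Op Int Z Int Op')" for w
  using that slice_inv(1)[OF s] by auto
 assume l: "l < r'"
 have "copen (mdim X) (\<phi>' ` Op')" by (rule chart_image_open[OF X c' sliceD(2)[OF s'] OU'])
 then have 1: "chol r (%w. \<sigma>' (inv_into U' \<phi>' (\<phi>' (inv_into (Op Int Z) \<sigma> w))) l) (\<sigma> ` (Op Int Z Int Op'))"
 proof (rule chol_compose(1)[OF _ sliceD(5)[OF s' l] o])
  show "chol r (%w. \<phi>' (inv_into (Op Int Z) \<sigma> w) i) (\<sigma> ` (Op Int Z Int Op'))" if "i < mdim X" for i
   by (rule chol_subset[OF slice_chart_chol[OF s c' that]]) (use OU' in blast)
 qed (intro imageI sU)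
 show "chol r (%w. \<sigma>' (inv_into (Op Int Z) \<sigma> w) l) (\<sigma> ` (Op Int Z Int Op'))"
  by (rule chol_cong[OF o 1]) (use sU OU' chart_inv[OF X c'] in \<open>auto simp: subset_iff\<close>)
qed

text \<open>The Jacobians of the two coordinate changes are inverse to each other, so their traces agree.\<close>

lemma slice_jacobian_inverse:
 assumes s: "slice X Z r U \<phi> Op \<sigma>" and s': "slice X Z r' U' \<phi>' Op' \<sigma>'" and z: "z \<in> Op Int Z Int Op'" and l: "l < r" and j: "j < r"
 shows "(\<Sum>m<r'. pd m (%w. \<sigma> (inv_into (Op' Int Z) \<sigma>' w) l) (\<sigma>' z) * pd j (%w. \<sigma>' (inv_into (Op Int Z) \<sigma> w) m) (\<sigma> z)) =
  (if l = j then 1 else 0)"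
proof -
 let ?t = "%w. \<sigma>' (inv_into (Op Int Z) \<sigma> w)"
 note o = slice_transition(1)[OF s s']
 have tin: "?t w \<in> \<sigma>' ` (Op' Int Z Int Op)" if "w \<in> \<sigma> ` (Op Int Z Int Op')" for w
  using that slice_inv(1)[OF s] by auto
 have zin: "\<sigma> z \<in> \<sigma> ` (Op Int Z Int Op')" using z by blast
 have tz: "?t (\<sigma> z) = \<sigma>' z" using slice_inv(1)[OF s, of z] z by auto
 have "pd j (%w. \<sigma> (inv_into (Op' Int Z) \<sigma>' (?t w)) l) (\<sigma> z) =
   (\<Sum>m<r'. pd m (%w. \<sigma> (inv_into (Op' Int Z) \<sigma>' w) l) (?t (\<sigma> z)) * pd j (%w. ?t w m) (\<sigma> z))"
  by (rule chol_compose(2)[OF slice_transition(1)[OF s' s] slice_transition(2)[OF s' s l] o slice_transition(2)[OF s s'] tin zin j])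
 moreover have "pd j (%w. \<sigma> (inv_into (Op' Int Z) \<sigma>' (?t w)) l) (\<sigma> z) = pd j (%w. w l) (\<sigma> z)"
  by (rule pd_cong[OF o _ zin j]) (use slice_inv(1)[OF s] slice_inv(1)[OF s'] in auto)
 ultimately show ?thesis by (simp add: pd_coord tz)
qed

lemma slice_dim_unique:
 assumes s: "slice X Z r U \<phi> Op \<sigma>" and s': "slice X Z r' U' \<phi>' Op' \<sigma>'" and z: "z \<in> Op Int Z Int Op'"
 shows "r = r'"
proof -
 let ?A = "%l m. pd m (%w. \<sigma> (inv_into (Op' Int Z) \<sigma>' w) l) (\<sigma>' z)"
 let ?B = "%m j. pd j (%w. \<sigma>' (inv_into (Op Int Z) \<sigma> w) m) (\<sigma> z)"
 have "of_nat r = (\<Sum>l<r. \<Sum>m<r'. ?A l m * ?B m l)"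
  using slice_jacobian_inverse[OF s s' z] by simp
 also have "... = (\<Sum>m<r'. \<Sum>l<r. ?B m l * ?A l m)" by (subst sum.swap) (simp add: mult.commute)
 also have "... = of_nat r'"
  using slice_jacobian_inverse[OF s' s, of z] z by (simp add: Int_ac)
 finally have "complex_of_nat r = complex_of_nat r'" .
 then show ?thesis by simp
qed

text \<open>The dimension of a slice is locally constant on \<open>Z\<close> by
  \<open>slice_dim_unique\<close>, and \<open>Z\<close> is connected. A single dimension is needed
  because \<open>mdim\<close> is one number for the whole manifold.\<close>

lemma slice_dim_constant:
 assumes con: "connectedin (mtop X) Z" and ex: "!!z. z \<in> Z ==> EX r U \<phi> Op \<sigma>. slice X Z r U \<phi> Op \<sigma> & z \<in> Op"
 shows "EX r. ALL z:Z. EX U \<phi> Op \<sigma>. slice X Z r U \<phi> Op \<sigma> & z \<in> Op"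
proof (cases "Z = {}")
 case False
 then obtain z1 where z1: "z1 \<in> Z" by blast
 obtain r U1 \<phi>1 O1 \<sigma>1 where s1: "slice X Z r U1 \<phi>1 O1 \<sigma>1" "z1 \<in> O1" using ex[OF z1] by blast
 define A where "A = {z \<in> Z. EX U \<phi> Op \<sigma>. slice X Z r U \<phi> Op \<sigma> & z \<in> Op}"
 let ?T = "subtopology (mtop X) Z"
 have "openin ?T A"
 proof (intro openin_subopen[THEN iffD2] ballI)
  fix z assume "z \<in> A"
  then obtain U \<phi> Op \<sigma> where s: "slice X Z r U \<phi> Op \<sigma>" "z \<in> Op" "z \<in> Z" by (auto simp: A_def)
  then have "openin ?T (Op Int Z)" using sliceD(2)[OF s(1)] by (auto simp: openin_subtopology)
  moreover have "Op Int Z \<subseteq> A" using s by (auto simp: A_def)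
  ultimately show "EX T. openin ?T T & z \<in> T & T \<subseteq> A" using s by blast
 qed
 moreover have "openin ?T (Z - A)"
 proof (intro openin_subopen[THEN iffD2] ballI)
  fix z assume z: "z \<in> Z - A"
  then obtain r' U \<phi> Op \<sigma> where s: "slice X Z r' U \<phi> Op \<sigma>" "z \<in> Op" using ex by blast
  then have "openin ?T (Op Int Z)" using sliceD(2)[OF s(1)] by (auto simp: openin_subtopology)
  moreover have "y \<notin> A" if y: "y \<in> Op Int Z" for y
  proof
   assume "y \<in> A"
   then obtain U' \<phi>' Op' \<sigma>' where s': "slice X Z r U' \<phi>' Op' \<sigma>'" "y \<in> Op'" by (auto simp: A_def)
   have "r' = r" using slice_dim_unique[OF s(1) s'(1), of y] s' y by blast
   then show False using s z by (auto simp: A_def)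
  qed
  ultimately show "EX T. openin ?T T & z \<in> T & T \<subseteq> Z - A" using s z by blast
 qed
 moreover have "topspace ?T = Z" using ZX by auto
 moreover have "A \<subseteq> Z" by (auto simp: A_def)
 moreover have "connected_space ?T" using con by (simp add: connectedin_def)
 ultimately have "openin ?T A" "closedin ?T A" and cT: "connected_space ?T" and tT: "topspace ?T = Z"
  by (simp_all add: closedin_def)
 then have "A = {} \<or> A = topspace ?T" using cT unfolding connected_space_clopen_in by blast
 then have "A = {} \<or> A = Z" unfolding tT .
 moreover have "z1 \<in> A" using z1 s1 by (auto simp: A_def)
 ultimately have "A = Z" by blast
 then show ?thesis unfolding A_def by blast
qed auto

text \<open>All slices of dimension \<open>r\<close> enter the atlas, so that no choice is made; any
  two of them are compatible by \<open>slice_transition\<close>.\<close>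

definition slice_manifold :: "nat => 'a cmanifold" where
 "slice_manifold r = \<lparr>mtop = subtopology (mtop X) Z, mdim = r,
   atlas = {(Op Int Z, \<sigma>) | Op \<sigma>. EX U \<phi>. slice X Z r U \<phi> Op \<sigma>}\<rparr>"

lemma slice_manifold_simps:
 "mtop (slice_manifold r) = subtopology (mtop X) Z" "mdim (slice_manifold r) = r" "pts (slice_manifold r) = Z"
 "(V, \<sigma>) \<in> atlas (slice_manifold r) \<longleftrightarrow> (EX U \<phi> Op. slice X Z r U \<phi> Op \<sigma> & V = Op Int Z)"
proof -
 show "mtop (slice_manifold r) = subtopology (mtop X) Z" "mdim (slice_manifold r) = r" "pts (slice_manifold r) = Z"
  using ZX by (simp_all add: slice_manifold_def Int_absorb1)
 show "(V, \<sigma>) \<in> atlas (slice_manifold r) \<longleftrightarrow> (EX U \<phi> Op. slice X Z r U \<phi> Op \<sigma> & V = Op Int Z)"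
  unfolding slice_manifold_def by simp blast
qed

context
 fixes r :: nat
 assumes con: "connectedin (mtop X) Z" and ne: "Z ~= {}"
  and ex: "!!z. z \<in> Z ==> EX U \<phi> Op \<sigma>. slice X Z r U \<phi> Op \<sigma> & z \<in> Op"
begin

lemma slice_manifold_manifold: "complex_manifold (slice_manifold r)"
 unfolding complex_manifold_def
proof (intro conjI; (intro ballI)?; (clarify)?; (intro conjI)?)
 note ms = slice_manifold_simps
 show "pts (slice_manifold r) = {} ==> False" using ne by (simp only: ms(3))
 show "connected_space (mtop (slice_manifold r))" using con by (simp add: ms connectedin_def)
 show "Hausdorff_space (mtop (slice_manifold r))" "second_countable (mtop (slice_manifold r))"
  using X by (simp_all add: ms complex_manifold_def Hausdorff_space_subtopology second_countable_subtopology)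
 show "(\<Union>(U, \<phi>)\<in>atlas (slice_manifold r). U) = pts (slice_manifold r)"
 proof
  show "pts (slice_manifold r) \<subseteq> (\<Union>(U, \<phi>)\<in>atlas (slice_manifold r). U)"
  proof
   fix z assume "z \<in> pts (slice_manifold r)"
   then have z: "z \<in> Z" by (simp add: ms)
   from ex[OF z] obtain U \<phi> Op \<sigma> where s: "slice X Z r U \<phi> Op \<sigma>" "z \<in> Op" by blast
   then have "(Op Int Z, \<sigma>) \<in> atlas (slice_manifold r)" by (auto simp: ms)
   then show "z \<in> (\<Union>(U, \<phi>)\<in>atlas (slice_manifold r). U)" using s z by blast
  qed
 qed (use ZX in \<open>auto simp: ms\<close>)
 fix V \<sigma> assume "(V, \<sigma>) \<in> atlas (slice_manifold r)"
 then obtain U \<phi> Op where s: "slice X Z r U \<phi> Op \<sigma>" and V: "V = Op Int Z" by (auto simp: ms)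
 show "openin (mtop (slice_manifold r)) V"
  using sliceD(2)[OF s] V by (auto simp: ms openin_subtopology)
 show "openin (Complex_space (mdim (slice_manifold r))) (\<sigma> ` V)"
  using sliceD(7)[OF s] V by (simp add: ms Complex_space_CS)
 have "CS r Int \<sigma> ` V = \<sigma> ` V" using openin_imp_subset[OF sliceD(7)[OF s]] V by blast
 moreover have "homeomorphic_maps (subtopology (mtop X) (Op Int Z)) (top_of_set (\<sigma> ` V)) \<sigma> (inv_into (Op Int Z) \<sigma>)"
  unfolding homeomorphic_maps_def
 proof (intro conjI ballI)
  show "continuous_map (subtopology (mtop X) (Op Int Z)) (top_of_set (\<sigma> ` V)) \<sigma>"
   using continuous_map_from_subtopology_mono[OF slice_continuous(3)[OF s], of "Op Int Z"] V
   by (auto simp: continuous_map_in_subtopology)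
  show "continuous_map (top_of_set (\<sigma> ` V)) (subtopology (mtop X) (Op Int Z)) (inv_into (Op Int Z) \<sigma>)"
   using slice_continuous(2)[OF s] slice_inv(2)[OF s] V by (auto simp: continuous_map_in_subtopology)
 qed (use slice_inv[OF s] V in auto)
 ultimately show "homeomorphic_map (subtopology (mtop (slice_manifold r)) V)
   (subtopology (Complex_space (mdim (slice_manifold r))) (\<sigma> ` V)) \<sigma>"
  using homeomorphic_maps_map V by (simp add: ms Complex_space_CS subtopology_subtopology Int_absorb1) blast
 fix V' \<sigma>' assume "(V', \<sigma>') \<in> atlas (slice_manifold r)"
 then obtain U' \<phi>' Op' where s': "slice X Z r U' \<phi>' Op' \<sigma>'" and V': "V' = Op' Int Z" by (auto simp: ms)
 have e: "V Int V' = Op Int Z Int Op'" using V V' by blast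
 show "holomorphic_coord (mdim (slice_manifold r)) (mdim (slice_manifold r)) (\<sigma>' \<circ> inv_into V \<sigma>) (\<sigma> ` (V Int V'))"
  unfolding ms e holomorphic_coord_iff[OF slice_transition(1)[OF s s']]
  using slice_transition(2)[OF s s'] V by simp
qed

lemma slice_manifold_inclusion: "holomorphic_map (slice_manifold r) X (%z. z)"
proof (rule holomorphic_mapI[OF slice_manifold_manifold X])
 note ms = slice_manifold_simps
 show "continuous_map (mtop (slice_manifold r)) (mtop X) (%z. z)"
  by (simp add: ms continuous_map_from_subtopology)
 fix z assume "z \<in> pts (slice_manifold r)"
 then have z: "z \<in> Z" by (simp add: ms)
 from ex[OF z] obtain U \<phi> Op \<sigma> where s: "slice X Z r U \<phi> Op \<sigma>" "z \<in> Op" by blast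
 show "EX U \<phi> V \<psi> N. (U, \<phi>) \<in> atlas (slice_manifold r) & (V, \<psi>) \<in> atlas X & z \<in> U &
    openin (top_of_set (CS (mdim (slice_manifold r)))) N & \<phi> z \<in> N & N \<subseteq> \<phi> ` {x \<in> U. x \<in> V} &
    (ALL i<mdim X. chol (mdim (slice_manifold r)) (%w. \<psi> (inv_into U \<phi> w) i) N)"
  by (rule exI[of _ "Op Int Z"], rule exI[of _ \<sigma>], rule exI[of _ U], rule exI[of _ \<phi>], rule exI[of _ "\<sigma> ` (Op Int Z)"])
   (use s z sliceD[OF s(1)] in \<open>auto simp: ms\<close>)
qed

text \<open>Since \<open>\<sigma>\<close> is defined and holomorphic on the ambient set
  \<open>Op\<close>, the coordinates of \<open>g\<close> in \<open>Z\<close> are a holomorphic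
  function of its coordinates in \<open>X\<close>.\<close>

lemma holomorphic_into_slice_manifold:
 assumes A: "complex_manifold A" and g: "holomorphic_map A X g" and gZ: "g ` pts A \<subseteq> Z"
 shows "holomorphic_map A (slice_manifold r) g"
proof (rule holomorphic_mapI[OF A slice_manifold_manifold])
 note ms = slice_manifold_simps
 show "continuous_map (mtop A) (mtop (slice_manifold r)) g"
  using hol_continuous[OF g] gZ by (auto simp: ms continuous_map_in_subtopology)
 fix x assume x: "x \<in> pts A"
 then have "g x \<in> Z" using gZ by blast
 from ex[OF this] obtain U \<phi> Op \<sigma> where s: "slice X Z r U \<phi> Op \<sigma>" "g x \<in> Op" by blast
 obtain U0 \<phi>0 where c: "(U0, \<phi>0) \<in> atlas A" "x \<in> U0" using chart_exists[OF A x] .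
 note c' = sliceD(1)[OF s(1)] and OU = sliceD(3)[OF s(1)] and cc = chart_inv[OF A c(1)]
 let ?N = "\<phi>0 ` {x \<in> U0. g x \<in> Op}"
 have oN: "copen (mdim A) ?N"
  by (rule chart_image_open[OF A c(1) openin_chart_preimage[OF A c(1) hol_continuous[OF g] sliceD(2)[OF s(1)]]]) auto
 have gN: "g (inv_into U0 \<phi>0 z) \<in> Op" if "z \<in> ?N" for z using that cc by auto
 have "chol (mdim A) (%z. \<sigma> (g (inv_into U0 \<phi>0 z)) i) ?N" if i: "i < r" for i
 proof (rule chol_cong[OF oN])
  show "chol (mdim A) (%z. \<sigma> (inv_into U \<phi> (\<phi> (g (inv_into U0 \<phi>0 z)))) i) ?N"
   by (rule chol_compose(1)[OF chart_image_open[OF X c' sliceD(2)[OF s(1)] OU] sliceD(5)[OF s(1) i] oN])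
    (use OU gN in \<open>auto intro!: chol_subset[OF holomorphic_mapD(2)[OF A X g c(1) c']]\<close>)
  show "\<sigma> (inv_into U \<phi> (\<phi> (g (inv_into U0 \<phi>0 z)))) i = \<sigma> (g (inv_into U0 \<phi>0 z)) i" if "z \<in> ?N" for z
   using gN[OF that] OU chart_inv[OF X c'] by auto
 qed
 then show "EX U \<phi> V \<psi> N. (U, \<phi>) \<in> atlas A & (V, \<psi>) \<in> atlas (slice_manifold r) & x \<in> U &
    copen (mdim A) N & \<phi> x \<in> N & N \<subseteq> \<phi> ` {x \<in> U. g x \<in> V} &
    (ALL i<mdim (slice_manifold r). chol (mdim A) (%z. \<psi> (g (inv_into U \<phi> z)) i) N)"
 proof (rule_tac x=U0 in exI, rule_tac x=\<phi>0 in exI, rule_tac x="Op Int Z" in exI, rule_tac x=\<sigma> in exI, rule_tac x="?N" in exI, intro conjI)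
  show "?N \<subseteq> \<phi>0 ` {x \<in> U0. g x \<in> Op Int Z}" using gZ chart_subset[OF A c(1)] by (intro image_mono) blast
 qed (use s c oN in \<open>auto simp: ms\<close>)
qed

text \<open>The ambient map \<open>\<sigma>\<close> composed with the inclusion is the identity in
  slice coordinates, so its Jacobian is a left inverse of the differential of the inclusion.\<close>

lemma slice_manifold_submanifold: "complex_submanifold (slice_manifold r) X"
 unfolding complex_submanifold_def
proof (intro conjI ballI)
 note ms = slice_manifold_simps and M = slice_manifold_manifold and inc = slice_manifold_inclusion
 show "complex_manifold (slice_manifold r)" "holomorphic_map (slice_manifold r) X (%z. z)" by (rule M inc)+
 show "pts (slice_manifold r) \<subseteq> pts X" unfolding ms(3) by (rule ZX)
 show "mtop (slice_manifold r) = subtopology (mtop X) (pts (slice_manifold r))" unfolding ms(3) by (rule ms(1))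
 fix z assume zp: "z \<in> pts (slice_manifold r)"
 then have z: "z \<in> Z" by (simp add: ms)
 from ex[OF z] obtain U \<phi> Op \<sigma> where s: "slice X Z r U \<phi> Op \<sigma>" "z \<in> Op" by blast
 note c = sliceD(1)[OF s(1)] and OU = sliceD(3)[OF s(1)]
 have cZ: "(Op Int Z, \<sigma>) \<in> charts_at (slice_manifold r) z" and cX: "(U, \<phi>) \<in> charts_at X z"
  using s c z OU by (auto simp: charts_at_iff ms)
 let ?s = "inv_into (Op Int Z) \<sigma>"
 have zin: "\<sigma> z \<in> \<sigma> ` (Op Int Z)" and sz: "?s (\<sigma> z) = z" using s z slice_inv(1)[OF s(1)] by auto
 have left: "(\<Sum>i<mdim X. pd i (%x. \<sigma> (inv_into U \<phi> x) l) (\<phi> z) * jacobian_mult r (\<phi> \<circ> (%z. z) \<circ> ?s) (\<sigma> z) u i) = u l"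
  if l: "l < r" for l u
 proof -
  have d: "(\<Sum>i<mdim X. pd i (%x. \<sigma> (inv_into U \<phi> x) l) (\<phi> z) * pd j (%w. \<phi> (?s w) i) (\<sigma> z)) = (if l = j then 1 else 0)" if j: "j < r" for j
  proof -
   have "pd j (%w. \<sigma> (inv_into U \<phi> (\<phi> (?s w))) l) (\<sigma> z) =
     (\<Sum>i<mdim X. pd i (%x. \<sigma> (inv_into U \<phi> x) l) (\<phi> (?s (\<sigma> z))) * pd j (%w. \<phi> (?s w) i) (\<sigma> z))"
    by (rule chol_compose(2)[OF chart_image_open[OF X c sliceD(2)[OF s(1)] OU] sliceD(5)[OF s(1) l] sliceD(7)[OF s(1)]
       sliceD(8)[OF s(1)] _ zin j]) (use slice_inv(2)[OF s(1)] in auto)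
   moreover have "pd j (%w. \<sigma> (inv_into U \<phi> (\<phi> (?s w))) l) (\<sigma> z) = pd j (%w. w l) (\<sigma> z)"
    by (rule pd_cong[OF sliceD(7)[OF s(1)] _ zin j]) (use slice_inv[OF s(1)] OU chart_inv[OF X c] in \<open>auto simp: subset_iff\<close>)
   ultimately show ?thesis by (simp add: pd_coord sz)
  qed
  have "(\<Sum>i<mdim X. pd i (%x. \<sigma> (inv_into U \<phi> x) l) (\<phi> z) * jacobian_mult r (\<phi> \<circ> (%z. z) \<circ> ?s) (\<sigma> z) u i) =
    (\<Sum>j<r. (\<Sum>i<mdim X. pd i (%x. \<sigma> (inv_into U \<phi> x) l) (\<phi> z) * pd j (%w. \<phi> (?s w) i) (\<sigma> z)) * u j)"
   unfolding jacobian_mult_pd by (simp add: sum_distrib_left sum_distrib_right mult.assoc) (rule sum.swap)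
  also have "... = (\<Sum>j<r. if l = j then u j else 0)" using d by (intro sum.cong) auto
  finally show ?thesis using l by simp
 qed
 show "inj_on (differential (slice_manifold r) X (%z. z) z) (tangent_space (slice_manifold r) z)"
 proof (rule inj_onI)
  fix v w assume v: "v \<in> tangent_space (slice_manifold r) z" and w: "w \<in> tangent_space (slice_manifold r) z"
   and eq: "differential (slice_manifold r) X (%z. z) z v = differential (slice_manifold r) X (%z. z) z w"
  have "jacobian_mult r (\<phi> \<circ> (%z. z) \<circ> ?s) (\<sigma> z) (v (Op Int Z, \<sigma>)) = jacobian_mult r (\<phi> \<circ> (%z. z) \<circ> ?s) (\<sigma> z) (w (Op Int Z, \<sigma>))"
   using differential_chart[OF M X inc zp v cZ cX] differential_chart[OF M X inc zp w cZ cX] eq by (simp add: ms)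
  then have e: "v (Op Int Z, \<sigma>) l = w (Op Int Z, \<sigma>) l" if "l < r" for l
   using left[OF that, of "v (Op Int Z, \<sigma>)"] left[OF that, of "w (Op Int Z, \<sigma>)"] by simp
  have "v (Op Int Z, \<sigma>) = w (Op Int Z, \<sigma>)"
   using e tangent_spaceD(1)[OF v cZ] tangent_spaceD(1)[OF w cZ]
   by (auto simp: ms CS_def fun_eq_iff) (metis linorder_not_le)
  then show "v = w" by (rule tangent_eqI[OF v w cZ])
 qed
qed

end

end

section \<open>Tuples of commuting maps\<close>

abbreviation mplus :: "(nat => nat) => (nat => nat) => nat => nat" where "mplus M N \<equiv> %i. M i + N i"
abbreviation mminus :: "(nat => nat) => (nat => nat) => nat => nat" where "mminus M N \<equiv> %i. M i - N i"
abbreviation munit :: "nat => nat => nat" where "munit j \<equiv> %i. if i = j then 1 else 0"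

lemma funpow_intertwine:
 assumes "!!x. x \<in> A ==> f x \<in> A" "!!x. x \<in> A ==> h (f x) = g (h x)" "x \<in> A"
 shows "(f ^^ n) x \<in> A & h ((f ^^ n) x) = (g ^^ n) (h x)"
 using assms by (induction n) auto

text \<open>One statement serves both purposes: with \<open>h = f j\<close> and \<open>g = f\<close>
  it is commutation with the powers, and with a model map \<open>h\<close> it is the intertwining
  relation for all multi-indices.\<close>

lemma tuple_pow_intertwine:
 assumes "!!j x. j < k ==> x \<in> A ==> f j x \<in> A" "!!j x. j < k ==> x \<in> A ==> h (f j x) = g j (h x)" "x \<in> A"
 shows "tuple_pow f N k x \<in> A & h (tuple_pow f N k x) = tuple_pow g N k (h x)"
 using assms
proof (induction k arbitrary: x)
 case (Suc k)
 have "(f k ^^ N k) x \<in> A & h ((f k ^^ N k) x) = (g k ^^ N k) (h x)"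
  by (rule funpow_intertwine[of A]) (use Suc.prems in auto)
 moreover have "tuple_pow f N k y \<in> A & h (tuple_pow f N k y) = tuple_pow g N k (h y)" if "y \<in> A" for y
  by (rule Suc.IH) (use Suc.prems that in auto)
 ultimately show ?case by simp
qed simp

context
 fixes A :: "'a set" and k :: nat and f :: "nat => 'a => 'a"
 assumes fA: "!!j x. j < k ==> x \<in> A ==> f j x \<in> A" and comm: "commuting_on A k f"
begin

lemma tuple_pow_commute: "j < k ==> x \<in> A ==> f j (tuple_pow f N k x) = tuple_pow f N k (f j x)"
 using tuple_pow_intertwine[of k A f "f j" f x N] fA comm unfolding commuting_on_def by simp

lemma tuple_pow_add:
 assumes x: "x \<in> A"
 shows "tuple_pow f (mplus M N) k x = tuple_pow f M k (tuple_pow f N k x)"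
proof -
 have "tuple_pow f (mplus M N) l x = tuple_pow f M l (tuple_pow f N l x)" if "l <= k" "x \<in> A" for l x
  using that
 proof (induction l arbitrary: x)
  case (Suc l)
  have fl: "!!j x. j < l ==> x \<in> A ==> f j x \<in> A" and cl: "!!j x. j < l ==> x \<in> A ==> f l (f j x) = f j (f l x)"
   using Suc.prems(1) fA comm unfolding commuting_on_def by auto
  have pow: "(f l ^^ m) x \<in> A" if "x \<in> A" for m x
   using funpow_intertwine[of A "f l" id "f l" x m] fA[of l] Suc.prems(1) that by auto
  have pc: "(f l ^^ m) (tuple_pow f N l y) = tuple_pow f N l ((f l ^^ m) y)" if y: "y \<in> A" for m y
  proof (induction m)
   case (Suc m)
   have "f l (tuple_pow f N l ((f l ^^ m) y)) = tuple_pow f N l (f l ((f l ^^ m) y))"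
    using tuple_pow_intertwine[of l A f "f l" f "(f l ^^ m) y" N] fl cl pow[OF y] by auto
   then show ?case using Suc by simp
  qed simp
  have "tuple_pow f (mplus M N) (Suc l) x = tuple_pow f M l (tuple_pow f N l ((f l ^^ M l) ((f l ^^ N l) x)))"
   using Suc.IH[OF _ pow[OF pow[OF Suc.prems(2)]]] Suc.prems(1) by (simp add: funpow_add)
  then show ?case using pc[OF pow[OF Suc.prems(2)]] by simp
 qed simp
 then show ?thesis using x by blast
qed

lemma tuple_pow_zero: "tuple_pow f (%_. 0) l = id"
 by (induction l) auto

lemma tuple_pow_munit: "j < k ==> tuple_pow f (munit j) k = f j"
proof -
 have "tuple_pow f (munit j) l = (if j < l then f j else id)" for l
  by (induction l) (auto simp: less_Suc_eq fun_eq_iff)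
 then show "j < k ==> tuple_pow f (munit j) k = f j" by simp
qed

lemma tuple_pow_bij: "(!!j. j < k ==> bij_betw (f j) A A) ==> bij_betw (tuple_pow f N k) A A"
proof -
 assume b: "!!j. j < k ==> bij_betw (f j) A A"
 have "bij_betw (tuple_pow f N l) A A" if "l <= k" for l
  using that
 proof (induction l)
  case (Suc l)
  then show ?case unfolding tuple_pow.simps
   by (intro bij_betw_trans[OF bij_betw_funpow[OF b]]) auto
 qed simp
 then show ?thesis by blast
qed

end

lemma tuple_pow_holomorphic:
 assumes X: "complex_manifold X" and f: "!!j. j < k ==> holomorphic_map X X (f j)"
 shows "holomorphic_map X X (tuple_pow f N k)"
 using f
proof (induction k)
 case 0
 then show ?case using holomorphic_map_id[OF X] by (simp add: id_def)
next
 case (Suc k)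
 have "holomorphic_map X X (f k ^^ n)" for n
 proof (induction n)
  case 0
  then show ?case using holomorphic_map_id[OF X] by (simp add: id_def)
 next
  case (Suc n)
  then show ?case using holomorphic_map_compose[OF X X X Suc \<open>!!j. j < Suc k ==> _\<close>[OF lessI]] by (simp add: o_def)
 qed
 then show ?case using holomorphic_map_compose[OF X X X _ Suc.IH] Suc.prems by (simp add: o_def)
qed

lemma mplus_indices: "M \<in> multi_indices k ==> N \<in> multi_indices k ==> mplus M N \<in> multi_indices k"
 and mminus_indices: "M \<in> multi_indices k ==> mminus M N \<in> multi_indices k"
 and munit_indices: "j < k ==> munit j \<in> multi_indices k"
 and zero_indices: "(%_. 0) \<in> multi_indices k"
 by (auto simp: multi_indices_def)

text \<open>\<open>mminus\<close> truncates at 0, hence the order assumptions; they hold eventually,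
  which is where these identities are used.\<close>

lemma mplus_mminus: "N <= M ==> mplus N (mminus M N) = M" and mminus_mplus: "mplus N P <= M ==> mplus (mminus M (mplus N P)) P = mminus M N"
 unfolding le_fun_def by (auto simp: fun_eq_iff)

lemma multi_at_top_nontrivial: "multi_at_top k ~= bot"
 unfolding trivial_limit_def eventually_multi_at_top by blast

text \<open>For a decreasing net with lower bound \<open>c\<close>, one index within
  \<open>e\<close> of \<open>c\<close> controls all later ones. The approximating index may
  therefore come from any finer filter.\<close>

lemma multi_at_top_limit:
 fixes q :: "(nat => nat) => real"
 assumes low: "!!M. M \<in> multi_indices k ==> c <= q M"
  and mono: "!!M M'. M \<in> multi_indices k ==> M' \<in> multi_indices k ==> M <= M' ==> q M' <= q M"
  and approx: "!!e. e > 0 ==> EX M:multi_indices k. q M < c + e"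
 shows "(q \<longlongrightarrow> c) (multi_at_top k)"
proof (rule tendstoI)
 fix e :: real assume "e > 0"
 then obtain M0 where M0: "M0 \<in> multi_indices k" "q M0 < c + e" using approx by blast
 have "dist (q M) c < e" if "M \<in> multi_indices k" "M0 <= M" for M
  using low[OF that(1)] mono[OF M0(1) that] M0(2) by (simp add: dist_real_def)
 then show "\<forall>\<^sub>F M in multi_at_top k. dist (q M) c < e"
  unfolding eventually_multi_at_top using M0 by blast
qed

section \<open>The canonical semi-model\<close>

text \<open>All choices are fixed here: the ultrafilter, the automorphisms, the compact set and the
  uniform radius. Cocompactness enters only through them.\<close>

locale iteration =
 fixes X :: "'a cmanifold" and k :: nat and f :: "nat => 'a => 'a" and U :: "(nat => nat) filter"
  and a :: "(nat => nat) => 'a => 'a" and \<delta> :: real and x0 :: 'a and K0 :: "'a set"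
 assumes X: "complex_manifold X" and hyp: "kobayashi_hyperbolic X"
  and fhol: "!!j. j < k ==> holomorphic_map X X (f j)" and comm: "commuting_on (pts X) k f"
  and U: "ultra U" and UM: "U <= multi_at_top k"
  and aut: "!!M. automorphism X (a M)" and x0: "x0 \<in> pts X" and K0: "compactin (mtop X) K0"
  and aK: "!!M. a M (tuple_pow f M k x0) \<in> K0" and \<delta>: "\<delta> > 0"
  and loc: "!!x. x \<in> pts X ==> EX K. compactin (mtop X) K & {y \<in> pts X. kd X x y < \<delta>} \<subseteq> K"
begin

abbreviation "F N \<equiv> tuple_pow f N k"
abbreviation "ainv M \<equiv> inv_into (pts X) (a M)"
abbreviation "MI \<equiv> multi_indices k"

lemma fX: "j < k ==> x \<in> pts X ==> f j x \<in> pts X" using hol_pts[OF fhol] .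
lemma Fhol: "holomorphic_map X X (F N)" by (rule tuple_pow_holomorphic[OF X fhol])
lemma FX: "x \<in> pts X ==> F N x \<in> pts X" using hol_pts[OF Fhol] .
lemma Fadd: "x \<in> pts X ==> F (mplus M N) x = F M (F N x)" by (rule tuple_pow_add[OF fX comm])
lemma Fcomm: "j < k ==> x \<in> pts X ==> f j (F N x) = F N (f j x)" by (rule tuple_pow_commute[OF fX comm])
lemma Ubot: "U ~= bot" using U by (simp add: ultra_def)

lemma ev_ge: "N \<in> MI ==> \<forall>\<^sub>F M in U. M \<in> MI & N <= M"
 by (rule filter_leD[OF UM]) (auto simp: eventually_multi_at_top)

lemma ev_MI: "\<forall>\<^sub>F M in U. M \<in> MI"
 using ev_ge[OF zero_indices] by eventually_elim simp

section \<open>The limit maps and the retraction\<close>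

text \<open>The difference of multi-indices is truncated, but it is a true difference for eventually
  all \<open>M\<close> in \<open>U\<close>. Uniqueness of limits makes the choice operator
  harmless.\<close>

definition \<beta> :: "(nat => nat) => 'a => 'a" where
 "\<beta> N x = (SOME l. klim X (%M. a M (F (mminus M N) x)) l U)"

text \<open>The point at which convergence is known first is \<open>F N x0\<close>, not
  \<open>x0\<close>: there the approximants equal \<open>a M (F M x0)\<close> and lie in
  \<open>K0\<close>. \<open>ultra_limits\<close> spreads it to all points.\<close>

lemma \<beta>_lim:
 assumes N: "N \<in> MI" and x: "x \<in> pts X"
 shows "klim X (%M. a M (F (mminus M N) x)) (\<beta> N x) U"
proof -
 have "\<forall>\<^sub>F M in U. a M (F (mminus M N) (F N x0)) \<in> K0"
  using ev_ge[OF N]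
 proof eventually_elim
  case (elim M)
  then have "mplus (mminus M N) N = M" using mplus_mminus[of N M] by (simp add: add.commute)
  then show ?case using aK[of M] Fadd[OF x0, of "mminus M N" N] by simp
 qed
 from ultra_klim[OF X U K0 this] obtain l where l: "klim X (%M. a M (F (mminus M N) (F N x0))) l U" by blast
 have "EX l. klim X (%M. a M (F (mminus M N) x)) l U"
  by (rule ultra_limits[where f="%M x. a M (F (mminus M N) x)", OF X X U \<delta> loc always_eventually FX[OF x0] l x])
   (auto intro: holomorphic_map_compose[OF X X X Fhol aut_hol[OF aut]])
 then show ?thesis unfolding \<beta>_def by (rule someI_ex)
qed

lemma \<beta>_hol: "N \<in> MI ==> holomorphic_map X X (\<beta> N)"
 by (rule holomorphic_limit(1)[OF X X hyp Ubot always_eventually \<beta>_lim])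
  (auto intro: holomorphic_map_compose[OF X X X Fhol aut_hol[OF aut]])

lemma \<beta>_X: "N \<in> MI ==> x \<in> pts X ==> \<beta> N x \<in> pts X" using hol_pts[OF \<beta>_hol] .

text \<open>For \<open>M >= N + P\<close> the two approximating families coincide. Thus the \<beta>
  themselves form a compatible family of the kind treated in \<open>klim_compatible\<close>.\<close>

lemma \<beta>_shift:
 assumes N: "N \<in> MI" and P: "P \<in> MI" and x: "x \<in> pts X"
 shows "\<beta> (mplus N P) (F P x) = \<beta> N x"
proof (rule klim_unique[OF X hyp Ubot \<beta>_lim[OF mplus_indices[OF N P] FX[OF x]]])
 have "\<forall>\<^sub>F M in U. a M (F (mminus M N) x) = a M (F (mminus M (mplus N P)) (F P x))"
  using ev_ge[OF mplus_indices[OF N P]]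
 proof eventually_elim
  case (elim M)
  then show ?case using Fadd[OF x, of "mminus M (mplus N P)" P] mminus_mplus[of N P M] by simp
 qed
 then have "\<forall>\<^sub>F M in U. a M (F (mminus M (mplus N P)) (F P x)) \<in> pts X &
   kd X (a M (F (mminus M (mplus N P)) (F P x))) (a M (F (mminus M N) x)) <= 0"
  by eventually_elim (use kd_refl[OF X] aut_inv_simps(4)[OF aut] FX x in auto)
 then show "klim X (%M. a M (F (mminus M (mplus N P)) (F P x))) (\<beta> N x) U"
  by (rule klim_close[OF X \<beta>_lim[OF N x] tendsto_const])
qed

text \<open>For large \<open>M\<close>, \<open>G N x\<close> is \<open>G M\<close> at the point
  F^(M-N) x, while the left side is \<open>G M\<close> at the \<open>a M\<close>-preimage of
  \<open>\<beta> N x\<close>. Contraction and the isometry \<open>a M\<close> bound their distance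
  by that of \<open>a M (F (mminus M N) x)\<close> from \<open>\<beta> N x\<close>, which tends to
  0.\<close>

lemma klim_compatible:
 assumes B: "complex_manifold B" and G: "!!N. N \<in> MI ==> holomorphic_map X B (G N)"
  and Gs: "!!N P x. N \<in> MI ==> P \<in> MI ==> x \<in> pts X ==> G (mplus N P) (F P x) = G N x"
  and N: "N \<in> MI" and x: "x \<in> pts X"
 shows "klim B (%M. G M (ainv M (\<beta> N x))) (G N x) U"
proof (rule klim_close[OF B])
 show "klim B (%M. G N x) (G N x) U"
  by (rule klim_const[OF B hol_pts[OF G[OF N] x]]) simp
 show "((%M. kd X (a M (F (mminus M N) x)) (\<beta> N x)) \<longlongrightarrow> 0) U"
  using klim_kd_tendsto[OF X \<beta>_lim[OF N x] klim_const[OF X \<beta>_X[OF N x]], of "%_. \<beta> N x"] kd_refl[OF X] by simp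
 show "\<forall>\<^sub>F M in U. G M (ainv M (\<beta> N x)) \<in> pts B & kd B (G M (ainv M (\<beta> N x))) (G N x) <= kd X (a M (F (mminus M N) x)) (\<beta> N x)"
  using ev_ge[OF N]
 proof eventually_elim
  case (elim M)
  let ?y = "F (mminus M N) x"
  have y: "?y \<in> pts X" using FX[OF x] .
  have b: "ainv M (\<beta> N x) \<in> pts X" using aut_inv_simps(3)[OF aut \<beta>_X[OF N x]] .
  have "G M ?y = G N x" using Gs[OF N mminus_indices x, of M N] elim mplus_mminus[of N M] by simp
  moreover have "kd B (G M (ainv M (\<beta> N x))) (G M ?y) <= kd X (ainv M (\<beta> N x)) ?y"
   using kd_contract[OF X B G b y] elim by blast
  moreover have "kd X (ainv M (\<beta> N x)) ?y = kd X (\<beta> N x) (a M ?y)"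
   using aut_kd[OF X aut b y, of M] aut_inv_simps(1)[OF aut \<beta>_X[OF N x], of M] by simp
  ultimately show ?case using hol_pts[OF G b] elim kd_sym[OF X] by simp
 qed
qed

definition \<rho> :: "'a => 'a" where
 "\<rho> x = (SOME l. klim X (%M. \<beta> M (ainv M x)) l U)"

lemma \<beta>_ainv_hol: "M \<in> MI ==> holomorphic_map X X (%x. \<beta> M (ainv M x))"
 by (rule holomorphic_map_compose[OF X X X aut_hol[OF aut_inv[OF X aut]] \<beta>_hol])

text \<open>Convergence starts at the point \<beta> 0 x0, where \<open>klim_compatible\<close>
  applied to the family \<beta> gives the limit explicitly.\<close>

lemma \<rho>_lim:
 assumes x: "x \<in> pts X" shows "klim X (%M. \<beta> M (ainv M x)) (\<rho> x) U"
proof -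
 have "EX l. klim X (%M. \<beta> M (ainv M x)) l U"
 proof (rule ultra_limits[OF X X U \<delta> loc _ _ _ x])
  show "\<forall>\<^sub>F M in U. holomorphic_map X X (%x. \<beta> M (ainv M x))"
   using ev_MI by eventually_elim (rule \<beta>_ainv_hol)
  show "klim X (%M. \<beta> M (ainv M (\<beta> (%_. 0) x0))) (\<beta> (%_. 0) x0) U"
   by (rule klim_compatible[OF X \<beta>_hol \<beta>_shift zero_indices x0])
 qed (use \<beta>_X[OF zero_indices x0] in auto)
 then show ?thesis unfolding \<rho>_def by (rule someI_ex)
qed

lemma \<rho>_hol: "holomorphic_map X X \<rho>"
 by (rule holomorphic_limit(1)[OF X X hyp Ubot _ \<rho>_lim]) (rule eventually_mono[OF ev_MI \<beta>_ainv_hol])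

lemma \<rho>_\<beta>: "N \<in> MI ==> x \<in> pts X ==> \<rho> (\<beta> N x) = \<beta> N x"
 by (rule klim_unique[OF X hyp Ubot \<rho>_lim[OF \<beta>_X] klim_compatible[OF X \<beta>_hol \<beta>_shift]])

text \<open>The approximants of \<open>\<rho> x\<close> are values of some \<open>\<beta> M\<close>,
  which \<open>\<rho>\<close> fixes exactly; continuity of \<open>\<rho>\<close> passes this to the
  limit.\<close>

lemma \<rho>_idem: assumes x: "x \<in> pts X" shows "\<rho> (\<rho> x) = \<rho> x"
proof (rule klim_unique[OF X hyp Ubot klim_image[OF X X \<rho>_hol \<rho>_lim[OF x]]])
 have "\<forall>\<^sub>F M in U. \<rho> (\<beta> M (ainv M x)) \<in> pts X & kd X (\<rho> (\<beta> M (ainv M x))) (\<beta> M (ainv M x)) <= 0"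
  using ev_MI by eventually_elim (use \<rho>_\<beta> aut_inv_simps(3)[OF aut x] \<beta>_X kd_refl[OF X] in auto)
 then show "klim X (%M. \<rho> (\<beta> M (ainv M x))) (\<rho> x) U"
  by (rule klim_close[OF X \<rho>_lim[OF x] tendsto_const])
qed

section \<open>The retract as a hyperbolic manifold\<close>

definition "Zs = \<rho> ` pts X"

lemma \<beta>_Z: "N \<in> MI ==> x \<in> pts X ==> \<beta> N x \<in> Zs"
 unfolding Zs_def using \<rho>_\<beta> \<beta>_X by (metis imageI)

lemma ZsX: "Zs \<subseteq> pts X" unfolding Zs_def using hol_pts[OF \<rho>_hol] by blast
lemma \<rho>_Z: "z \<in> Zs ==> \<rho> z = z" unfolding Zs_def using \<rho>_idem by auto

lemma Zs_connected: "connectedin (mtop X) Zs" "Zs ~= {}"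
proof -
 have "connectedin (mtop X) (pts X)" using X by (simp add: complex_manifold_def connectedin_topspace)
 then show "connectedin (mtop X) Zs"
  unfolding Zs_def by (rule connectedin_continuous_map_image[OF hol_continuous[OF \<rho>_hol]])
 show "Zs ~= {}" unfolding Zs_def using x0 by blast
qed

definition "rdim = (SOME r. ALL z:Zs. EX U \<phi> Op \<sigma>. slice X Zs r U \<phi> Op \<sigma> & z \<in> Op)"

lemma slices: "z \<in> Zs ==> EX U \<phi> Op \<sigma>. slice X Zs rdim U \<phi> Op \<sigma> & z \<in> Op"
proof -
 have "EX r. ALL z:Zs. EX U \<phi> Op \<sigma>. slice X Zs r U \<phi> Op \<sigma> & z \<in> Op"
  by (rule slice_dim_constant[OF X ZsX Zs_connected(1)])
   (unfold Zs_def, rule retract_slice_exists[OF X \<rho>_hol \<rho>_idem])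
 from someI_ex[OF this] show "z \<in> Zs ==> EX U \<phi> Op \<sigma>. slice X Zs rdim U \<phi> Op \<sigma> & z \<in> Op"
  unfolding rdim_def by blast
qed

definition "Z = slice_manifold X Zs rdim"

lemma Z_pts: "pts Z = Zs" and Z_dim: "mdim Z = rdim"
 and Z_atlas: "(V, \<sigma>) \<in> atlas Z \<longleftrightarrow> (EX U \<phi> Op. slice X Zs rdim U \<phi> Op \<sigma> & V = Op Int Zs)"
 unfolding Z_def by (rule slice_manifold_simps[OF X ZsX])+

lemma Z: "complex_manifold Z" and Z_sub: "complex_submanifold Z X" and Z_inc: "holomorphic_map Z X (%z. z)"
 unfolding Z_def using slice_manifold_manifold[OF X ZsX Zs_connected slices]
  slice_manifold_submanifold[OF X ZsX Zs_connected slices] slice_manifold_inclusion[OF X ZsX Zs_connected slices] by blast+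

lemma into_Z: "complex_manifold A ==> holomorphic_map A X g ==> g ` pts A \<subseteq> Zs ==> holomorphic_map A Z g"
 unfolding Z_def by (rule holomorphic_into_slice_manifold[OF X ZsX Zs_connected slices])

lemma \<beta>_hol_Z: "N \<in> MI ==> holomorphic_map X Z (\<beta> N)"
 by (rule into_Z[OF X \<beta>_hol]) (use \<beta>_Z in auto)

lemma Z_retract: "holomorphic_retract Z X"
 unfolding holomorphic_retract_def using Z_sub \<rho>_hol \<rho>_idem by (auto simp: Z_pts[unfolded Zs_def] simp del: Z_pts)

lemma kd_Z_ge: "x \<in> Zs ==> y \<in> Zs ==> kd X x y <= kd Z x y"
 using kd_contract[OF Z X Z_inc, of x y] by (simp add: Z_pts)

text \<open>The inclusion into \<open>X\<close> contracts, so points at distance 0 in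
  \<open>Z\<close> are at distance 0 in \<open>X\<close>.\<close>

lemma Z_hyp: "kobayashi_hyperbolic Z"
proof (rule hyperbolicI[OF Z])
 fix x y assume xy: "x \<in> pts Z" "y \<in> pts Z" "kd Z x y = 0"
 then have p: "x \<in> Zs" "y \<in> Zs" by (simp_all add: Z_pts)
 then have "kd X x y = 0" using kd_Z_ge[OF p] kd_nonneg[OF X, of x y] xy(3) by simp
 then show "x = y" using kd_zero[OF hyp] p ZsX by blast
qed

text \<open>On \<open>Z\<close> the maps \<open>\<beta> M\<close> after the inverse of
  \<open>a M\<close> tend to \<open>\<rho>\<close>, which is the identity there. In slice
  coordinates around \<open>z\<close> some such map is uniformly close to the identity on a
  polydisc, and \<open>near_identity_inverse\<close> then puts \<open>z\<close> in its
  image.\<close>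

lemma Z_covered:
 assumes z: "z \<in> Zs" shows "EX N:MI. EX x:pts X. z = \<beta> N x"
proof -
 obtain U0 \<phi> Op \<sigma> where s: "slice X Zs rdim U0 \<phi> Op \<sigma>" and zO: "z \<in> Op" using slices[OF z] by blast
 note sD = sliceD[OF X ZsX s] and sI = slice_inv[OF X ZsX s]
 let ?r = "rdim" and ?y0 = "\<sigma> z" and ?s = "inv_into (Op Int Zs) \<sigma>" and ?W = "\<sigma> ` (Op Int Zs)"
 let ?e = "%M x. \<beta> M (ainv M x)"
 obtain R' where R': "R' > 0" "pdisc ?r ?y0 R' \<subseteq> ?W" using openin_contains_pdisc[OF sD(7), of ?y0] z zO by blast
 \<comment> \<open>Halving makes the closed polydisc of radius \<open>R\<close> lie in the slice,
   which is needed for a compactness argument.\<close>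
 define R where "R = R' / 2"
 have "cpdisc ?r ?y0 R \<subseteq> pdisc ?r ?y0 R'"
  using R'(1) by (fastforce simp: R_def cpdisc_def pdisc_def)
 then have R: "R > 0" "cpdisc ?r ?y0 R \<subseteq> ?W" "pdisc ?r ?y0 R \<subseteq> cpdisc ?r ?y0 R"
  using R' by (auto simp: R_def cpdisc_def pdisc_def intro: less_imp_le)
 \<comment> \<open>The largest error that \<open>near_identity_inverse\<close> tolerates on a
   polydisc of radius \<open>R\<close>.\<close>
 define \<eta> where "\<eta> = R / (32 * (real ?r + 1))"
 have \<eta>: "\<eta> > 0" using R by (simp add: \<eta>_def)
 let ?good = "%M y. ?e M (?s y) \<in> Op & (ALL i<?r. cmod (\<sigma> (?e M (?s y)) i - y i) <= \<eta>)"
 \<comment> \<open>Convergence is known pointwise; contraction makes it hold on a neighbourhood for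
   the same eventual \<open>M\<close>. One half of \<eta> is spent on the motion of the image, the
   other on moving \<open>y\<close> to \<open>y'\<close>.\<close>
 have local: "EX V. copen ?r V & y \<in> V & (\<forall>\<^sub>F M in U. ALL y':V. ?good M y')" if y: "y \<in> ?W" for y
 proof -
  have sy: "?s y \<in> Op" "?s y \<in> Zs" "\<sigma> (?s y) = y" using sI(2,3)[OF y] by auto
  have syX: "?s y \<in> pts X" using sy ZsX by blast
  define S where "S = {x \<in> Op. ALL i<?r. dist (\<sigma> x i) (y i) < \<eta> / 2}"
  have S: "openin (mtop X) S"
  proof -
   have "open (\<Inter>i<?r. {w :: nat => complex. dist (w i) (y i) < \<eta> / 2})"
    by (intro open_INT ballI open_coord_dist) simp
   then have "openin (subtopology (mtop X) Op) {x \<in> topspace (subtopology (mtop X) Op). \<sigma> x \<in> (\<Inter>i<?r. {w. dist (w i) (y i) < \<eta> / 2})}"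
    by (intro openin_continuous_map_preimage[OF slice_continuous(3)[OF X ZsX s]]) simp
   moreover have "{x \<in> topspace (subtopology (mtop X) Op). \<sigma> x \<in> (\<Inter>i<?r. {w. dist (w i) (y i) < \<eta> / 2})} = S"
    unfolding S_def using openin_subset[OF sD(2)] by auto
   ultimately show ?thesis using openin_trans_full sD(2) by metis
  qed
  have sS: "?s y \<in> S" using sy \<eta> by (simp add: S_def)
  obtain t where t: "t > 0" "!!x. x \<in> pts X ==> kd X (?s y) x < t ==> x \<in> S"
   by (rule kball_basis[OF X hyp S sS]) (rule that, assumption+)
  obtain N where N: "openin (mtop X) N" "?s y \<in> N" "!!x. x \<in> N ==> kd X (?s y) x < t / 2"
   by (rule kd_near[OF X syX half_gt_zero[OF t(1)]]) (rule that, assumption+)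
  define V where "V = \<sigma> ` (Op Int Zs Int N) Int pdisc ?r y (\<eta> / 2)"
  have yC: "y \<in> CS ?r" using sD(4)[OF sy(1)] sy(3) by simp
  have "copen ?r V"
   unfolding V_def by (intro openin_Int slice_image_open[OF X ZsX s N(1)] openin_pdisc)
  moreover have "y \<in> \<sigma> ` (Op Int Zs Int N)" using sy N(2) by (metis IntI imageI)
  then have "y \<in> V" unfolding V_def using yC \<eta> by (simp add: pdisc_center)
  moreover have "\<forall>\<^sub>F M in U. ALL y':V. ?good M y'"
   using klimD[OF \<rho>_lim[OF syX] half_gt_zero[OF t(1)]] ev_MI
  proof eventually_elim
   case (elim M)
   show ?case
   proof
    fix y' assume y': "y' \<in> V"
    then obtain x where x: "x \<in> Op" "x \<in> Zs" "x \<in> N" "y' = \<sigma> x" by (auto simp: V_def)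
    then have sx: "?s y' = x" using sI(1) by simp
    have xX: "x \<in> pts X" using x ZsX by blast
    have q: "?e M x \<in> pts X" "?e M (?s y) \<in> pts X" using hol_pts[OF \<beta>_ainv_hol[OF elim(2)]] xX syX by auto
    have "kd X (?e M (?s y)) (?e M x) <= kd X (?s y) x" by (rule kd_contract[OF X X \<beta>_ainv_hol[OF elim(2)] syX xX])
    then have "kd X (?s y) (?e M x) < t"
     using kd_triangle[OF X syX q(2,1)] N(3)[OF x(3)] elim(1) kd_sym[OF X, of "?s y" "?e M (?s y)"] \<rho>_Z[OF sy(2)] by simp
    then have "?e M x \<in> S" by (rule t(2)[OF q(1)])
    then have "?e M x \<in> Op" "ALL i<?r. dist (\<sigma> (?e M x) i) (y i) < \<eta> / 2" by (auto simp: S_def)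
    moreover have "dist (y' i) (y i) < \<eta> / 2" if "i < ?r" for i using y' that by (auto simp: V_def pdisc_def)
    ultimately show "?good M y'"
     unfolding sx using dist_triangle_half_l[of "\<sigma> (?e M x) i" "y i" \<eta> "y' i" for i] by (force simp: dist_norm)
   qed
  qed
  ultimately show ?thesis by blast
 qed
 then have "ALL y:cpdisc ?r ?y0 R. EX V. copen ?r V & y \<in> V & (\<forall>\<^sub>F M in U. ALL y':V. ?good M y')"
  using local R(2) by (meson subsetD)
 from bchoice[OF this] obtain V where V: "ALL y:cpdisc ?r ?y0 R. copen ?r (V y) & y \<in> V y &
   (\<forall>\<^sub>F M in U. ALL y':V y. ?good M y')" by blast
 have "compactin (top_of_set (CS ?r)) (cpdisc ?r ?y0 R)"
  by (auto simp: compactin_subtopology compact_cpdisc) (auto simp: cpdisc_def)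
 then obtain C where C: "finite C" "C \<subseteq> cpdisc ?r ?y0 R" "cpdisc ?r ?y0 R \<subseteq> \<Union> (V ` C)"
  by (rule compactin_subcover[of _ _ "cpdisc ?r ?y0 R" V]) (use V in blast)+
 have "\<forall>\<^sub>F M in U. ALL y:C. ALL y':V y. ?good M y'"
  by (rule eventually_ball_finite[OF C(1)]) (use V C(2) in blast)
 then have "\<forall>\<^sub>F M in U. M \<in> MI & (ALL y:cpdisc ?r ?y0 R. ?good M y)"
  using ev_MI by eventually_elim (use C(3) in blast)
 then obtain M where M: "M \<in> MI" "!!y. y \<in> cpdisc ?r ?y0 R ==> ?good M y"
  using eventually_happens'[OF Ubot] by blast
 have eZ: "?e M x \<in> Zs" if "x \<in> pts X" for x using \<beta>_Z[OF M(1) aut_inv_simps(3)[OF aut that]] .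
 have "holomorphic_map Z Z (?e M)"
  by (rule into_Z[OF Z holomorphic_map_compose[OF Z X X Z_inc \<beta>_ainv_hol[OF M(1)]]])
   (use eZ ZsX in \<open>auto simp: Z_pts\<close>)
 moreover have ch: "(Op Int Zs, \<sigma>) \<in> atlas Z" using s by (auto simp: Z_atlas)
 ultimately have "chol ?r (%y. \<sigma> (?e M (?s y)) i) (\<sigma> ` {x \<in> Op Int Zs. ?e M x \<in> Op Int Zs})" if "i < ?r" for i
  using holomorphic_mapD(2)[OF Z Z _ ch ch, of "?e M" i] that by (simp add: Z_dim)
 moreover have "pdisc ?r ?y0 R \<subseteq> \<sigma> ` {x \<in> Op Int Zs. ?e M x \<in> Op Int Zs}"
 proof
  fix y assume "y \<in> pdisc ?r ?y0 R"
  then have y: "y \<in> cpdisc ?r ?y0 R" using R(3) by blast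
  then have "?s y \<in> Op Int Zs" "\<sigma> (?s y) = y" using R(2) sI(2,3) by blast+
  moreover have "?e M (?s y) \<in> Op Int Zs" using M(2)[OF y] eZ \<open>?s y \<in> Op Int Zs\<close> ZsX by blast
  ultimately show "y \<in> \<sigma> ` {x \<in> Op Int Zs. ?e M x \<in> Op Int Zs}" by (metis (mono_tags, lifting) image_eqI mem_Collect_eq)
 qed
 ultimately have E: "chol ?r (%y. \<sigma> (?e M (?s y)) i) (pdisc ?r ?y0 R)" if "i < ?r" for i
  using that chol_subset by blast
 have y0C: "?y0 \<in> CS ?r" using sD(4)[OF zO] .
 have near: "cmod (\<sigma> (?e M (?s y)) i - y i) <= \<eta>" if "y \<in> pdisc ?r ?y0 R" "i < ?r" for y i
  using M(2)[of y] R(3) that by blast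
 have e32: "32 * (real ?r + 1) * \<eta> <= R" by (simp add: \<eta>_def)
 obtain G where G: "!!x. x \<in> pdisc ?r ?y0 (R/4) ==> G x \<in> pdisc ?r ?y0 (R/2)"
  "!!x i. x \<in> pdisc ?r ?y0 (R/4) ==> i < ?r ==> \<sigma> (?e M (?s (G x))) i = x i"
  by (rule near_identity_inverse[where E="%y. \<sigma> (?e M (?s y))", OF E R(1) y0C near e32]) (assumption+, rule that, assumption+)
 have y04: "?y0 \<in> pdisc ?r ?y0 (R/4)" by (rule pdisc_center) (use y0C R(1) in simp_all)
 let ?w = "G ?y0"
 have "?w \<in> cpdisc ?r ?y0 R" using G(1)[OF y04] pdisc_mono[of "R/2" R ?r ?y0] R(1,3) by auto
 then have sy: "?s ?w \<in> Op Int Zs" "?e M (?s ?w) \<in> Op" using R(2) sI(2) M(2) by blast+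
 then have yX: "?s ?w \<in> pts X" using ZsX by blast
 have "\<sigma> (?e M (?s ?w)) = \<sigma> z"
 proof
  fix i
  show "\<sigma> (?e M (?s ?w)) i = \<sigma> z i"
   using G(2)[OF y04, of i] sD(4)[OF sy(2)] y0C by (cases "i < ?r") (auto simp: CS_def)
 qed
 then have "?e M (?s ?w) = z" using inj_onD[OF sD(6)] sy(2) eZ[OF yX] z zO by blast
 then show ?thesis using M(1) aut_inv_simps(3)[OF aut yX] by metis
qed

text \<open>By \<open>klim_compatible\<close> the limit of \<open>G M\<close> after the inverse of
  \<open>a M\<close> at \<open>\<beta> N x\<close> is \<open>G N x\<close>; this also shows that
  \<open>G N x\<close> depends only on the point \<open>\<beta> N x\<close>. By
  \<open>Z_covered\<close> the limit is thereby defined on all of \<open>Z\<close>.\<close>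

lemma extend_compatible:
 assumes B: "complex_manifold B" and hB: "kobayashi_hyperbolic B" and G: "!!N. N \<in> MI ==> holomorphic_map X B (G N)"
  and Gs: "!!N P x. N \<in> MI ==> P \<in> MI ==> x \<in> pts X ==> G (mplus N P) (F P x) = G N x"
 shows "EX \<eta>. holomorphic_map Z B \<eta> & (ALL N:MI. ALL x:pts X. \<eta> (\<beta> N x) = G N x)"
proof -
 define \<eta> where "\<eta> z = (SOME l. klim B (%M. G M (ainv M z)) l U)" for z
 have l: "klim B (%M. G M (ainv M (\<beta> N x))) (G N x) U" if "N \<in> MI" "x \<in> pts X" for N x
  by (rule klim_compatible[where G=G, OF B G Gs that])
 have eq: "\<eta> (\<beta> N x) = G N x" if "N \<in> MI" "x \<in> pts X" for N x
  unfolding \<eta>_def by (rule some_equality, rule l[OF that]) (rule klim_unique[OF B hB Ubot _ l[OF that]])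
 have "holomorphic_map Z B \<eta>"
 proof (rule holomorphic_limit(1)[OF Z B hB Ubot, where f="%M z. G M (ainv M z)"])
  show "\<forall>\<^sub>F M in U. holomorphic_map Z B (%z. G M (ainv M z))"
   using ev_MI
  proof eventually_elim
   case (elim M)
   show ?case by (rule holomorphic_map_compose[OF Z X B _ G[OF elim]])
    (rule holomorphic_map_compose[OF Z X X Z_inc aut_hol[OF aut_inv[OF X aut]]])
  qed
  fix z assume "z \<in> pts Z"
  then obtain N x where "N \<in> MI" "x \<in> pts X" "z = \<beta> N x" using Z_covered Z_pts by blast
  then show "klim B (%M. G M (ainv M z)) (\<eta> z) U" using l eq by simp
 qed
 with eq show ?thesis by blast
qed

section \<open>The automorphisms of \<open>Z\<close> and the universal property\<close>

text \<open>\<open>T j\<close> moves the argument by \<open>f j\<close>, whereas \<open>T' j\<close>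
  raises the index by one unit. They are mutually inverse because \<open>\<beta>_shift\<close> says
  that raising the index in coordinate \<open>j\<close> cancels \<open>f j\<close>.\<close>

definition "T j = (SOME \<eta>. holomorphic_map Z Z \<eta> & (ALL N:MI. ALL x:pts X. \<eta> (\<beta> N x) = \<beta> N (f j x)))"
definition "T' j = (SOME \<eta>. holomorphic_map Z Z \<eta> & (ALL N:MI. ALL x:pts X. \<eta> (\<beta> N x) = \<beta> (mplus N (munit j)) x))"
abbreviation "l \<equiv> \<beta> (%_. 0)"

lemma T:
 assumes j: "j < k" shows "holomorphic_map Z Z (T j) & (ALL N:MI. ALL x:pts X. T j (\<beta> N x) = \<beta> N (f j x))"
proof -
 have "EX \<eta>. holomorphic_map Z Z \<eta> & (ALL N:MI. ALL x:pts X. \<eta> (\<beta> N x) = \<beta> N (f j x))"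
 proof (rule extend_compatible[OF Z Z_hyp])
 show "holomorphic_map X Z (%x. \<beta> N (f j x))" if "N \<in> MI" for N
  by (rule holomorphic_map_compose[OF X X Z fhol[OF j] \<beta>_hol_Z[OF that]])
 show "\<beta> (mplus N P) (f j (F P x)) = \<beta> N (f j x)" if "N \<in> MI" "P \<in> MI" "x \<in> pts X" for N P x
  using \<beta>_shift[OF that(1,2) fX[OF j that(3)]] Fcomm[OF j that(3)] by simp
 qed
 then show ?thesis unfolding T_def by (rule someI_ex)
qed

lemma T':
 assumes j: "j < k" shows "holomorphic_map Z Z (T' j) & (ALL N:MI. ALL x:pts X. T' j (\<beta> N x) = \<beta> (mplus N (munit j)) x)"
proof -
 have "EX \<eta>. holomorphic_map Z Z \<eta> & (ALL N:MI. ALL x:pts X. \<eta> (\<beta> N x) = \<beta> (mplus N (munit j)) x)"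
 proof (rule extend_compatible[OF Z Z_hyp])
 show "holomorphic_map X Z (%x. \<beta> (mplus N (munit j)) x)" if "N \<in> MI" for N
  by (rule \<beta>_hol_Z[OF mplus_indices[OF that munit_indices[OF j]]])
 show "\<beta> (mplus (mplus N P) (munit j)) (F P x) = \<beta> (mplus N (munit j)) x" if "N \<in> MI" "P \<in> MI" "x \<in> pts X" for N P x
 proof -
  have "mplus (mplus N P) (munit j) = mplus (mplus N (munit j)) P" by (simp add: fun_eq_iff)
  then show ?thesis using \<beta>_shift[OF mplus_indices[OF that(1) munit_indices[OF j]] that(2,3)] by simp
 qed
 qed
 then show ?thesis unfolding T'_def by (rule someI_ex)
qed

lemma T_inverse:
 assumes j: "j < k" and z: "z \<in> Zs" shows "T j (T' j z) = z" "T' j (T j z) = z" "T j z \<in> Zs"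
proof -
 obtain N x where N: "N \<in> MI" "x \<in> pts X" "z = \<beta> N x" using Z_covered[OF z] by blast
 note e = mplus_indices[OF N(1) munit_indices[OF j]]
 have s: "\<beta> (mplus N (munit j)) (f j x) = \<beta> N x"
  using \<beta>_shift[OF N(1) munit_indices[OF j] N(2)] tuple_pow_munit[OF fX comm j] by simp
 show "T j (T' j z) = z" using T[OF j] T'[OF j] N e s by simp
 show "T' j (T j z) = z" using T[OF j] T'[OF j] N fX[OF j N(2)] s by simp
 show "T j z \<in> Zs" using T[OF j] N \<beta>_Z[OF N(1) fX[OF j N(2)]] by simp
qed

lemma T_aut: assumes j: "j < k" shows "automorphism Z (T j)"
proof -
 have T'Z: "T' j z \<in> Zs" if "z \<in> Zs" for z using hol_pts[of Z Z "T' j" z] T'[OF j] that by (simp add: Z_pts)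
 have b: "bij_betw (T j) (pts Z) (pts Z)"
  by (rule bij_betw_byWitness[of _ "T' j"]) (use T_inverse[OF j] T'Z in \<open>auto simp: Z_pts\<close>)
 have "holomorphic_map Z Z (inv_into (pts Z) (T j))"
 proof (rule holomorphic_map_cong[OF Z])
  show "holomorphic_map Z Z (T' j)" using T'[OF j] by blast
  fix z assume "z \<in> pts Z"
  then have z: "z \<in> Zs" by (simp add: Z_pts)
  show "T' j z = inv_into (pts Z) (T j) z"
   using inv_into_f_f[OF bij_betw_imp_inj_on[OF b], of "T' j z"] T_inverse(1)[OF j z] T'Z[OF z] by (simp add: Z_pts)
 qed
 then show ?thesis using b T[OF j] by (simp add: automorphism_def)
qed

lemma T_comm: "commuting_on (pts Z) k T"
 unfolding commuting_on_def
proof (intro allI impI ballI)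
 fix i j z assume ij: "i < k" "j < k" and "z \<in> pts Z"
 then obtain N x where N: "N \<in> MI" "x \<in> pts X" "z = \<beta> N x" using Z_covered Z_pts by blast
 then show "T i (T j z) = T j (T i z)"
  using T[OF ij(1)] T[OF ij(2)] fX[OF ij(1) N(2)] fX[OF ij(2) N(2)] comm ij by (simp add: commuting_on_def)
qed

text \<open>\<open>T\<close> to the power \<open>N\<close> sends \<open>\<beta> N x\<close> to
  \<open>\<beta> N (F N x)\<close>, which is \<open>l x\<close> by \<open>\<beta>_shift\<close>. So
  the maps in the limit formulas are just the \<open>\<beta> N\<close>.\<close>

lemma T_inv_l:
 assumes N: "N \<in> MI" and x: "x \<in> pts X" shows "tuple_pow_inv Z T N k (l x) = \<beta> N x"
proof -
 have TZ: "j < k ==> z \<in> pts Z ==> T j z \<in> pts Z" for j z using T_inverse(3) by (simp add: Z_pts)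
 have "\<beta> N (F N x) = tuple_pow T N k (\<beta> N x)"
  using tuple_pow_intertwine[of k "pts X" f "\<beta> N" T x N] fX T N x by auto
 then have "tuple_pow T N k (\<beta> N x) = l x"
  using \<beta>_shift[OF zero_indices N x] by simp
 moreover have "bij_betw (tuple_pow T N k) (pts Z) (pts Z)"
  by (rule tuple_pow_bij[OF TZ T_comm]) (use T_aut in \<open>auto simp: automorphism_def\<close>)
 ultimately show ?thesis
  unfolding tuple_pow_inv_def
  by (intro inv_into_f_eq) (use \<beta>_Z[OF N x] in \<open>auto simp: Z_pts bij_betw_def\<close>)
qed

lemma csm_Z: "csm TYPE('c) X k f Z l T"
 unfolding csm_def
proof (intro conjI allI impI; (elim conjE)?)
 have "quasi_model X k f Z l T"
  unfolding quasi_model_def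
  using Z \<beta>_hol_Z[OF zero_indices] T_aut T_comm T zero_indices by auto
 moreover have "(\<Union>N\<in>MI. tuple_pow_inv Z T N k ` l ` pts X) = pts Z"
 proof -
  have "tuple_pow_inv Z T N k ` l ` pts X = \<beta> N ` pts X" if "N \<in> MI" for N
   using T_inv_l[OF that] by (simp add: image_image cong: image_cong)
  moreover have "(\<Union>N\<in>MI. \<beta> N ` pts X) = Zs" using Z_covered \<beta>_Z by blast
  ultimately show ?thesis by (simp add: Z_pts)
 qed
 ultimately show "semi_model X k f Z l T" unfolding semi_model_def by blast
 show "kobayashi_hyperbolic Z" by (rule Z_hyp)
 fix L :: "'c cmanifold" and h \<Phi>
 assume s: "semi_model X k f L h \<Phi>" and hL: "kobayashi_hyperbolic L"
 then have L: "complex_manifold L" and h: "holomorphic_map X L h" and \<Phi>: "!!j. j < k ==> automorphism L (\<Phi> j)"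
  and \<Phi>c: "commuting_on (pts L) k \<Phi>" and h\<Phi>: "!!j x. j < k ==> x \<in> pts X ==> h (f j x) = \<Phi> j (h x)"
  unfolding semi_model_def quasi_model_def by auto
 have \<Phi>L: "\<Phi> j y \<in> pts L" if "j < k" "y \<in> pts L" for j y using aut_inv_simps(4)[OF \<Phi>[OF that(1)] that(2)] .
 let ?P = "%N. tuple_pow \<Phi> N k" and ?I = "%N. tuple_pow_inv L \<Phi> N k"
 have Pb: "bij_betw (?P N) (pts L) (pts L)" for N
  by (rule tuple_pow_bij[OF \<Phi>L \<Phi>c aut_bij[OF \<Phi>]])
 have PI: "?P N (?I N y) = y" "?I N y \<in> pts L" if "y \<in> pts L" for N y
  unfolding tuple_pow_inv_def using bij_betw_inv_into_right[OF Pb that] bij_betw_apply[OF bij_betw_inv_into[OF Pb] that] by auto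
 have Ieq: "?I N y = u" if "u \<in> pts L" "?P N u = y" for N y u
  unfolding tuple_pow_inv_def using inv_into_f_eq[OF bij_betw_imp_inj_on[OF Pb] that] .
 have Iaut: "holomorphic_map L L (?I N)" for N
 proof -
  have "automorphism L (tuple_pow \<Phi> N n)" if "n <= k" for n
   using that
  proof (induction n)
   case 0
   then show ?case using aut_id[OF L] by (simp add: id_def)
  next
   case (Suc n)
   have "automorphism L (\<Phi> n ^^ m)" for m
   proof (induction m)
    case 0
    then show ?case using aut_id[OF L] by (simp add: id_def)
   next
    case (Suc m)
    then show ?case using aut_compose[OF L \<Phi>[of n] Suc] \<open>Suc n <= k\<close> by (simp add: o_def)
   qed
   then show ?case using aut_compose[OF L Suc.IH] Suc.prems by (simp add: o_def)
  qed
  then show ?thesis unfolding tuple_pow_inv_def using aut_hol[OF aut_inv[OF L]] by blast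
 qed
 have hL': "h x \<in> pts L" if "x \<in> pts X" for x using hol_pts[OF h that] .
 have hF: "h (F P x) = ?P P (h x)" if "x \<in> pts X" for P x
  using tuple_pow_intertwine[of k "pts X" f h \<Phi> x P] fX h\<Phi> that by auto
 \<comment> \<open>The compatible family of a semi-model consists of the inverse powers of \<Phi>
   applied after \<open>h\<close>; \<open>h\<close> intertwines \<open>F P\<close> with the
   corresponding power of \<Phi>, which gives compatibility.\<close>
 have "EX \<eta>. holomorphic_map Z L \<eta> & (ALL N:MI. ALL x:pts X. \<eta> (\<beta> N x) = ?I N (h x))"
 proof (rule extend_compatible[OF L hL])
  show "holomorphic_map X L (%x. ?I N (h x))" for N by (rule holomorphic_map_compose[OF X L L h Iaut])
  show "?I (mplus N P) (h (F P x)) = ?I N (h x)" if x: "x \<in> pts X" for N P x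
  proof (rule Ieq[OF PI(2)[OF hL'[OF x]]])
   have "?P (mplus N P) (?I N (h x)) = ?P P (?P N (?I N (h x)))"
    using tuple_pow_add[OF \<Phi>L \<Phi>c PI(2)[OF hL'[OF x]], of P N N] by (simp add: add.commute)
   then show "?P (mplus N P) (?I N (h x)) = h (F P x)" using PI(1)[OF hL'[OF x]] hF[OF x] by simp
  qed
 qed
 then obtain \<eta> where \<eta>: "holomorphic_map Z L \<eta>" "!!N x. N \<in> MI ==> x \<in> pts X ==> \<eta> (\<beta> N x) = ?I N (h x)" by blast
 have "\<eta> (l x) = h x" if x: "x \<in> pts X" for x
  using \<eta>(2)[OF zero_indices x] Ieq[OF hL'[OF x], of "%_. 0"] tuple_pow_zero[OF \<Phi>L \<Phi>c] by simp
 moreover have "\<eta> (T j z) = \<Phi> j (\<eta> z)" if j: "j < k" and "z \<in> pts Z" for j z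
 proof -
  obtain N x where N: "N \<in> MI" "x \<in> pts X" "z = \<beta> N x" using Z_covered Z_pts \<open>z \<in> pts Z\<close> by blast
  have "\<eta> (T j z) = ?I N (\<Phi> j (h x))" using T[OF j] N \<eta>(2)[OF N(1) fX[OF j N(2)]] h\<Phi>[OF j N(2)] by simp
  also have "... = \<Phi> j (?I N (h x))"
   by (rule Ieq[OF \<Phi>L[OF j PI(2)[OF hL'[OF N(2)]]]])
    (use tuple_pow_commute[OF \<Phi>L \<Phi>c j PI(2)[OF hL'[OF N(2)]], of N N] PI(1)[OF hL'[OF N(2)]] in simp)
  finally show ?thesis using \<eta>(2)[OF N(1,2)] N(3) by simp
 qed
 ultimately show "EX \<eta>. model_morphism X k Z l T L h \<Phi> \<eta>" unfolding model_morphism_def using \<eta>(1) by blast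
qed

text \<open>The lower bound holds because \<open>\<beta> N\<close> factors through every
  \<open>F M\<close>. For the upper bound, the automorphisms drop out of the distance in the
  ultrafilter limit, which is the distance in \<open>X\<close> and hence at most the one in
  \<open>Z\<close>; the good index is of the form M - N.\<close>

lemma dist_limit:
 assumes N: "N \<in> MI" and x: "x \<in> pts X" "y \<in> pts X"
 shows "((%M. kd X (F M x) (F M y)) \<longlongrightarrow> kd Z (\<beta> N x) (\<beta> N y)) (multi_at_top k)"
proof (rule multi_at_top_limit)
 fix M assume M: "M \<in> MI"
 show "kd Z (\<beta> N x) (\<beta> N y) <= kd X (F M x) (F M y)"
  using kd_contract[OF X Z \<beta>_hol_Z[OF mplus_indices[OF N M]] FX[OF x(1), of M] FX[OF x(2), of M]]
   \<beta>_shift[OF N M x(1)] \<beta>_shift[OF N M x(2)] by simp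
next
 fix M M' :: "nat => nat" assume "M <= M'"
 then have e: "mplus (mminus M' M) M = M'" using mplus_mminus[of M M'] by (simp add: add.commute)
 have "F M' u = F (mminus M' M) (F M u)" if "u \<in> pts X" for u
  using Fadd[OF that, of "mminus M' M" M] e by simp
 then show "kd X (F M' x) (F M' y) <= kd X (F M x) (F M y)"
  using kd_contract[OF X X Fhol FX[OF x(1)] FX[OF x(2)]] x by simp
next
 fix e :: real assume e: "e > 0"
 have "((%M. kd X (a M (F (mminus M N) x)) (a M (F (mminus M N) y))) \<longlongrightarrow> kd X (\<beta> N x) (\<beta> N y)) U"
  by (rule klim_kd_tendsto[OF X \<beta>_lim[OF N x(1)] \<beta>_lim[OF N x(2)]])
 then have "((%M. kd X (F (mminus M N) x) (F (mminus M N) y)) \<longlongrightarrow> kd X (\<beta> N x) (\<beta> N y)) U"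
  using aut_kd[OF X aut FX[OF x(1)] FX[OF x(2)]] by simp
 moreover have "kd X (\<beta> N x) (\<beta> N y) < kd Z (\<beta> N x) (\<beta> N y) + e"
  using kd_Z_ge[OF \<beta>_Z[OF N x(1)] \<beta>_Z[OF N x(2)]] e by linarith
 ultimately have "\<forall>\<^sub>F M in U. kd X (F (mminus M N) x) (F (mminus M N) y) < kd Z (\<beta> N x) (\<beta> N y) + e"
  by (rule order_tendstoD(2))
 with ev_MI have "\<forall>\<^sub>F M in U. M \<in> MI & kd X (F (mminus M N) x) (F (mminus M N) y) < kd Z (\<beta> N x) (\<beta> N y) + e"
  by eventually_elim simp
 from eventually_happens'[OF Ubot this] show "EX M:MI. kd X (F M x) (F M y) < kd Z (\<beta> N x) (\<beta> N y) + e"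
  using mminus_indices by blast
qed

end

section \<open>Wirtinger derivatives and the inhomogeneous Cauchy-Riemann equation\<close>

definition dpar :: "(complex => complex) => complex => complex" where
 "dpar u z = (frechet_derivative u (at z) 1 - \<i> * frechet_derivative u (at z) \<i>) / 2"

definition dbar :: "(complex => complex) => complex => complex" where
 "dbar u z = (frechet_derivative u (at z) 1 + \<i> * frechet_derivative u (at z) \<i>) / 2"

definition c1 :: "complex set => (complex => complex) => bool" where
 "c1 S u \<longleftrightarrow> (ALL z:S. u differentiable at z) & continuous_on S (dpar u) & continuous_on S (dbar u)"

text \<open>Weaker than twice continuously differentiable: only the \<open>dbar\<close>-derivative
  has to be of class C^1, because it is what becomes the right-hand side of the next
  \<open>dbar\<close>-equation.\<close>

definition c2 :: "complex set => (complex => complex) => bool" where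
 "c2 S u \<longleftrightarrow> c1 S u & c1 S (dbar u)"

lemma wirtingerI:
 assumes "(u has_derivative (%v. p * v + g * cnj v)) (at z)"
 shows "dpar u z = p" "dbar u z = g"
proof -
 have "frechet_derivative u (at z) = (%v. p * v + g * cnj v)" using frechet_derivative_at[OF assms] by simp
 then show "dpar u z = p" "dbar u z = g" by (simp_all add: dpar_def dbar_def field_simps)
qed

lemma wirtingerD:
 assumes "u differentiable at z"
 shows "(u has_derivative (%v. dpar u z * v + dbar u z * cnj v)) (at z)"
proof -
 let ?D = "frechet_derivative u (at z)"
 have D: "(u has_derivative ?D) (at z)" using assms frechet_derivative_works by blast
 then have L: "linear ?D" by (rule has_derivative_linear)
 have "?D v = dpar u z * v + dbar u z * cnj v" for v
 proof -
  have "?D v = ?D (Re v *\<^sub>R 1 + Im v *\<^sub>R \<i>)" by (intro arg_cong[of _ _ ?D]) (simp add: complex_eq_iff)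
  also have "... = of_real (Re v) * ?D 1 + of_real (Im v) * ?D \<i>"
   by (simp only: linear_add[OF L] linear_scale[OF L]) (simp only: scaleR_conv_of_real)
  also have "... = dpar u z * v + dbar u z * cnj v"
   by (subst (3 4) complex_eq[of v]) (simp add: dpar_def dbar_def algebra_simps add_divide_distrib diff_divide_distrib)
  finally show ?thesis .
 qed
 then show ?thesis using D by (metis (no_types, lifting) ext)
qed

lemma c1I:
 assumes "!!z. z \<in> S ==> (u has_derivative (%v. p z * v + g z * cnj v)) (at z)"
  and "continuous_on S p" "continuous_on S g"
 shows "c1 S u"
 unfolding c1_def
proof (intro conjI ballI)
 show "u differentiable at z" if "z \<in> S" for z using assms(1)[OF that] by (rule differentiableI)
 have "dpar u z = p z" "dbar u z = g z" if "z \<in> S" for z using wirtingerI[OF assms(1)[OF that]] .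
 then show "continuous_on S (dpar u)" "continuous_on S (dbar u)"
  using assms(2,3) by (auto cong: continuous_on_cong)
qed

lemma c1D: "c1 S u ==> z \<in> S ==> (u has_derivative (%v. dpar u z * v + dbar u z * cnj v)) (at z)"
 unfolding c1_def by (blast intro: wirtingerD)

lemma c1_continuous: "c1 S u ==> continuous_on S u"
 by (intro continuous_at_imp_continuous_on ballI) (rule has_derivative_continuous[OF c1D])

lemma c1_subset: "c1 S u ==> T \<subseteq> S ==> c1 T u"
 unfolding c1_def using continuous_on_subset by blast

lemma c2_subset: "c2 S u ==> T \<subseteq> S ==> c2 T u"
 unfolding c2_def using c1_subset by blast

lemma c1_Un: "open S ==> open T ==> c1 S u ==> c1 T u ==> c1 (S \<union> T) u"
 unfolding c1_def using continuous_on_open_Un by blast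

lemma wirtinger_cong:
 assumes S: "open S" "z \<in> S" and e: "!!w. w \<in> S ==> u w = v w"
 shows "dbar u z = dbar v z" "dpar u z = dpar v z"
proof -
 have "frechet_derivative u (at z) = frechet_derivative v (at z)"
  unfolding frechet_derivative_def
  using has_derivative_transform_within_open[OF _ S, of u _ UNIV v] has_derivative_transform_within_open[OF _ S, of v _ UNIV u] e
  by (intro arg_cong[of _ _ Eps] ext) (metis (no_types, lifting))
 then show "dbar u z = dbar v z" "dpar u z = dpar v z" by (simp_all add: dbar_def dpar_def)
qed

lemma c1_cong:
 assumes S: "open S" and e: "!!w. w \<in> S ==> u w = v w" and u: "c1 S u"
 shows "c1 S v"
proof (rule c1I)
 show "(v has_derivative (%h. dpar u z * h + dbar u z * cnj h)) (at z)" if z: "z \<in> S" for z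
  using has_derivative_transform_within_open[OF c1D[OF u z] S z] e by blast
qed (use u in \<open>auto simp: c1_def\<close>)

lemma c2_cong:
 assumes S: "open S" and e: "!!w. w \<in> S ==> u w = v w" and u: "c2 S u"
 shows "c2 S v"
 unfolding c2_def
proof
 show "c1 S v" by (rule c1_cong[OF S, of u]) (use u e in \<open>auto simp: c2_def\<close>)
 show "c1 S (dbar v)"
 proof (rule c1_cong[OF S, of "dbar u"])
  show "dbar u w = dbar v w" if "w \<in> S" for w by (rule wirtinger_cong(1)[OF S that e])
 qed (use u in \<open>simp add: c2_def\<close>)
qed

lemma c2I:
 assumes S: "open S" and u: "c1 S u" and g: "!!z. z \<in> S ==> dbar u z = g z" "c1 S g"
 shows "c2 S u"
 unfolding c2_def using u c1_cong[OF S _ g(2), of "dbar u"] g(1) by simp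

lemma c1_compose_holomorphic:
 assumes S: "open S" and T: "open T" and u: "c1 S u" "u ` S \<subseteq> T" and f: "f holomorphic_on T"
 shows "c1 S (%z. f (u z))" "!!z. z \<in> S ==> dbar (%z. f (u z)) z = deriv f (u z) * dbar u z"
  "!!z. z \<in> S ==> dpar (%z. f (u z)) z = deriv f (u z) * dpar u z"
proof -
 have d: "((%z. f (u z)) has_derivative (%v. (deriv f (u z) * dpar u z) * v + (deriv f (u z) * dbar u z) * cnj v)) (at z)"
  if z: "z \<in> S" for z
 proof -
  have "(f has_derivative (%h. deriv f (u z) * h)) (at (u z))"
   using holomorphic_derivI[OF f T] u(2) z unfolding has_field_derivative_def by blast
  from has_derivative_compose[OF c1D[OF u(1) z] this] show ?thesis by (simp add: algebra_simps)
 qed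
 show "dbar (%z. f (u z)) z = deriv f (u z) * dbar u z" "dpar (%z. f (u z)) z = deriv f (u z) * dpar u z" if "z \<in> S" for z
  using wirtingerI[OF d[OF that]] by blast+
 have "continuous_on S (%z. deriv f (u z))"
  by (rule continuous_on_compose2[OF holomorphic_on_imp_continuous_on[OF holomorphic_deriv[OF f T]] c1_continuous[OF u(1)] u(2)])
 then show "c1 S (%z. f (u z))"
  using u(1) by (intro c1I[OF d] continuous_intros) (auto simp: c1_def)
qed

lemma holomorphic_c1: 
 assumes "open S" "f holomorphic_on S"
 shows "c1 S f" "!!z. z \<in> S ==> dbar f z = 0" "!!z. z \<in> S ==> dpar f z = deriv f z"
proof -
 have d: "(f has_derivative (%v. deriv f z * v + 0 * cnj v)) (at z)" if "z \<in> S" for z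
  using holomorphic_derivI[OF assms(2,1) that] unfolding has_field_derivative_def by simp
 show "dbar f z = 0" "dpar f z = deriv f z" if "z \<in> S" for z using wirtingerI[OF d[OF that]] by blast+
 show "c1 S f"
  by (rule c1I[OF d])
   (auto intro: holomorphic_on_imp_continuous_on[OF holomorphic_deriv[OF assms(2,1)]])
qed

lemma dbar_zero_holomorphic:
 assumes S: "open S" and u: "c1 S u" and z: "!!z. z \<in> S ==> dbar u z = 0"
 shows "u holomorphic_on S"
 unfolding holomorphic_on_open[OF S] has_field_derivative_def
proof
 show "EX f'. (u has_derivative (*) f') (at x)" if "x \<in> S" for x
  using c1D[OF u that] z[OF that] by (intro exI[of _ "dpar u x"]) simp
qed

lemma c1_add:
 assumes "c1 S u" "c1 S v"
 shows "c1 S (%z. u z + v z)" "!!z. z \<in> S ==> dbar (%z. u z + v z) z = dbar u z + dbar v z"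
  "!!z. z \<in> S ==> dpar (%z. u z + v z) z = dpar u z + dpar v z"
proof -
 have d: "((%z. u z + v z) has_derivative (%h. (dpar u z + dpar v z) * h + (dbar u z + dbar v z) * cnj h)) (at z)" if z: "z \<in> S" for z
  using has_derivative_add[OF c1D[OF assms(1) z] c1D[OF assms(2) z]] by (simp add: algebra_simps)
 show "c1 S (%z. u z + v z)" by (rule c1I[OF d]) (use assms in \<open>auto simp: c1_def intro!: continuous_intros\<close>)
 show "dbar (%z. u z + v z) z = dbar u z + dbar v z" "dpar (%z. u z + v z) z = dpar u z + dpar v z" if "z \<in> S" for z
  using wirtingerI[OF d[OF that]] by blast+
qed

lemma c1_mult:
 assumes "c1 S u" "c1 S v"
 shows "c1 S (%z. u z * v z)" "!!z. z \<in> S ==> dbar (%z. u z * v z) z = dbar u z * v z + u z * dbar v z"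
  "!!z. z \<in> S ==> dpar (%z. u z * v z) z = dpar u z * v z + u z * dpar v z"
proof -
 have d: "((%z. u z * v z) has_derivative (%h. (dpar u z * v z + u z * dpar v z) * h + (dbar u z * v z + u z * dbar v z) * cnj h)) (at z)" if z: "z \<in> S" for z
  using has_derivative_mult[OF c1D[OF assms(1) z] c1D[OF assms(2) z]] by (simp add: algebra_simps)
 show "c1 S (%z. u z * v z)"
  by (rule c1I[OF d]) (use assms c1_continuous[OF assms(1)] c1_continuous[OF assms(2)] in \<open>auto simp: c1_def intro!: continuous_intros\<close>)
 show "dbar (%z. u z * v z) z = dbar u z * v z + u z * dbar v z" "dpar (%z. u z * v z) z = dpar u z * v z + u z * dpar v z" if "z \<in> S" for z
  using wirtingerI[OF d[OF that]] by blast+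
qed

lemma c1_const: "c1 S (%_. c)" "dbar (%_. c) z = 0" "dpar (%_. c) z = 0"
 using holomorphic_c1[of UNIV "%_. c"] c1_subset[of UNIV "%_. c" S] by (auto simp: holomorphic_on_const)

lemma c1_sum:
 assumes "finite J" "!!j. j \<in> J ==> c1 S (u j)"
 shows "c1 S (%z. \<Sum>j\<in>J. u j z)"
 using assms by (induction J rule: finite_induct) (auto intro!: c1_const c1_add(1))

lemma c2_add: "open S ==> c2 S u ==> c2 S v ==> c2 S (%z. u z + v z)"
 by (rule c2I[of _ _ "%z. dbar u z + dbar v z"]) (auto simp: c2_def intro!: c1_add)

lemma c2_mult: "open S ==> c2 S u ==> c2 S v ==> c2 S (%z. u z * v z)"
 by (rule c2I[of _ _ "%z. dbar u z * v z + u z * dbar v z"]) (auto simp: c2_def intro!: c1_add(1) c1_mult)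

lemma holomorphic_c2: "open S ==> f holomorphic_on S ==> c2 S f"
 by (rule c2I[of _ _ "%_. 0"]) (auto intro: holomorphic_c1 c1_const)

lemma c2_inverse:
 assumes S: "open S" and u: "c2 S u" "!!z. z \<in> S ==> u z ~= 0"
 shows "c2 S (%z. inverse (u z))"
proof -
 have o: "open (- {0::complex})" "u ` S \<subseteq> - {0}" "inverse holomorphic_on (- {0::complex})"
  using u(2) by (auto intro!: holomorphic_intros)
 have u1: "c1 S u" using u by (simp add: c2_def)
 note i = c1_compose_holomorphic[OF S o(1) u1 o(2,3)]
 show ?thesis
 proof (rule c2I[OF S i(1)])
  show "c1 S (%z. deriv inverse (u z) * dbar u z)"
   by (rule c1_mult(1)[OF c1_compose_holomorphic(1)[OF S o(1) u1 o(2) holomorphic_deriv[OF o(3,1)]]]) (use u in \<open>simp add: c2_def\<close>)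
 qed (rule i(2))
qed

text \<open>A holomorphic \<open>f\<close> contributes no conjugate terms, so \<open>dbar\<close>
  errors transform linearly by its Jacobian. This is what makes errors in different charts
  comparable.\<close>

lemma c1_chol:
 assumes W: "copen n W" and f: "chol n f W" and S: "open S"
  and g: "!!z. z \<in> S ==> \<gamma> z \<in> W" "!!j. j < n ==> c1 S (%z. \<gamma> z j)"
 shows "c1 S (%z. f (\<gamma> z))"
  "!!z. z \<in> S ==> dbar (%z. f (\<gamma> z)) z = (\<Sum>j<n. pd j f (\<gamma> z) * dbar (%z. \<gamma> z j) z)"
proof -
 have WC: "W \<subseteq> CS n" using openin_imp_subset[OF W] .
 have d: "((%z. f (\<gamma> z)) has_derivative (%v. (\<Sum>j<n. pd j f (\<gamma> z) * dpar (%z. \<gamma> z j) z) * v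
   + (\<Sum>j<n. pd j f (\<gamma> z) * dbar (%z. \<gamma> z j) z) * cnj v)) (at z)" if z: "z \<in> S" and f: "chol n f W" for z f
 proof -
  have ev: "\<forall>\<^sub>F y in at z. \<gamma> y \<in> CS n"
   using eventually_at_in_open[OF S z] by eventually_elim (use g(1) WC in auto)
  have "((%z. f (\<gamma> z)) has_derivative (%v. \<Sum>j<n. pd j f (\<gamma> z) * (dpar (%z. \<gamma> z j) z * v + dbar (%z. \<gamma> z j) z * cnj v))) (at z)"
   by (rule has_derivative_chol_compose[where \<gamma>'="%j v. dpar (%z. \<gamma> z j) z * v + dbar (%z. \<gamma> z j) z * cnj v", OF W f g(1)[OF z] ev])
    (use c1D[OF g(2) z] in auto)
  moreover have "(\<Sum>j<n. pd j f (\<gamma> z) * (dpar (%z. \<gamma> z j) z * v + dbar (%z. \<gamma> z j) z * cnj v))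
   = (\<Sum>j<n. pd j f (\<gamma> z) * dpar (%z. \<gamma> z j) z) * v + (\<Sum>j<n. pd j f (\<gamma> z) * dbar (%z. \<gamma> z j) z) * cnj v" for v
   by (simp add: sum_distrib_right sum.distrib distrib_left mult.assoc)
  ultimately show ?thesis by simp
 qed
 have c: "continuous_on S (%z. f (\<gamma> z))" if "chol n f W" for f
  by (intro continuous_at_imp_continuous_on ballI) (rule has_derivative_continuous[OF d[OF _ that]])
 show "dbar (%z. f (\<gamma> z)) z = (\<Sum>j<n. pd j f (\<gamma> z) * dbar (%z. \<gamma> z j) z)" if "z \<in> S" for z
  using wirtingerI(2)[OF d[OF that f]] .
 show "c1 S (%z. f (\<gamma> z))"
  by (rule c1I[OF d[OF _ f]]) (use g(2) c[OF chol_pd[OF W f]] in \<open>auto simp: c1_def intro!: continuous_intros\<close>)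
qed

lemma c2_chol:
 assumes W: "copen n W" and f: "chol n f W" and S: "open S"
  and g: "!!z. z \<in> S ==> \<gamma> z \<in> W" "!!j. j < n ==> c2 S (%z. \<gamma> z j)"
 shows "c2 S (%z. f (\<gamma> z))"
proof -
 have g1: "c1 S (%z. \<gamma> z j)" if "j < n" for j using g(2)[OF that] by (simp add: c2_def)
 note c = c1_chol[OF W f S g(1) g1]
 show ?thesis
 proof (rule c2I[OF S c(1)])
  show "c1 S (%z. \<Sum>j<n. pd j f (\<gamma> z) * dbar (%z. \<gamma> z j) z)"
   by (intro c1_sum c1_mult(1) c1_chol(1)[OF W chol_pd[OF W f] S g(1) g1]) (use g(2) in \<open>auto simp: c2_def\<close>)
 qed (use c(2) in auto)
qed

section \<open>Cutoff functions\<close>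

text \<open>The exponent is at least 2, so the derivative of the power vanishes at 0 and fits the
  zero branch.\<close>

lemma DERIV_max_power:
 "((%x::real. max 0 x ^ Suc (Suc k)) has_real_derivative real (Suc (Suc k)) * max 0 x ^ Suc k) (at x)"
proof -
 consider "x > 0" | "x < 0" | "x = 0" by linarith
 then show ?thesis
 proof cases
  case 1
  have "((%x::real. x ^ Suc (Suc k)) has_real_derivative real (Suc (Suc k)) * x ^ Suc k) (at x)"
   by (rule derivative_eq_intros refl)+ simp
  then have "((%x::real. max 0 x ^ Suc (Suc k)) has_real_derivative real (Suc (Suc k)) * x ^ Suc k) (at x)"
   by (rule has_field_derivative_transform_within_open[of _ _ _ "{0<..}"]) (use 1 in auto)
  then show ?thesis using 1 by (simp add: max_def)
 next
  case 2
  have "((%x::real. 0) has_real_derivative 0) (at x)" by simp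
  then have "((%x::real. max 0 x ^ Suc (Suc k)) has_real_derivative 0) (at x)"
   by (rule has_field_derivative_transform_within_open[of _ _ _ "{..<0}"]) (use 2 in \<open>auto simp: max_def\<close>)
  then show ?thesis using 2 by (simp add: max_def)
 next
  case 3
  have "((%h::real. max 0 h ^ Suc k) \<longlongrightarrow> max 0 0 ^ Suc k) (at 0)" by (intro tendsto_intros)
  then have "((%h::real. max 0 h ^ Suc k) \<longlongrightarrow> 0) (at 0)" by simp
  then have "((%h::real. (max 0 (0 + h) ^ Suc (Suc k) - max 0 0 ^ Suc (Suc k)) / h) \<longlongrightarrow> 0) (at 0)"
   by (rule Lim_null_comparison[rotated]) (auto simp: eventually_at_filter max_def power_abs abs_mult divide_simps)
  then show ?thesis unfolding 3 DERIV_def by simp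
 qed
qed

lemma c1_max_power:
 fixes s t :: real and p :: complex
 defines "q \<equiv> %z. max 0 (s * (cmod (z - p))\<^sup>2 + t)"
 shows "c1 UNIV (%z. of_real (q z ^ Suc (Suc k)))"
  "dbar (%z. of_real (q z ^ Suc (Suc k))) z = of_nat (Suc (Suc k)) * of_real (q z ^ Suc k) * of_real s * (z - p)"
proof -
 have d: "((%z. complex_of_real (q z ^ Suc (Suc k))) has_derivative (%v. (of_nat (Suc (Suc k)) * of_real (q z ^ Suc k) * of_real s * cnj (z - p)) * v
   + (of_nat (Suc (Suc k)) * of_real (q z ^ Suc k) * of_real s * (z - p)) * cnj v)) (at z)" for z
 proof -
  have "((%z. s * (cmod (z - p))\<^sup>2 + t) has_derivative (%v. s * (2 * ((z - p) \<bullet> v)))) (at z)"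
   unfolding power2_norm_eq_inner by (auto intro!: derivative_eq_intros simp: inner_commute)
  from has_derivative_compose[OF this, of "%x. max 0 x ^ Suc (Suc k)"] DERIV_max_power[of k "s * (cmod (z - p))\<^sup>2 + t"]
  have "((%z. q z ^ Suc (Suc k)) has_derivative (%v. real (Suc (Suc k)) * q z ^ Suc k * (s * (2 * ((z - p) \<bullet> v))))) (at z)"
   unfolding q_def has_field_derivative_def by blast
  from bounded_linear.has_derivative[OF bounded_linear_of_real[where 'a=complex] this]
  have "((%z. complex_of_real (q z ^ Suc (Suc k))) has_derivative (%v. of_real (real (Suc (Suc k)) * q z ^ Suc k * (s * (2 * ((z - p) \<bullet> v)))))) (at z)" .
  moreover have "complex_of_real (2 * ((z - p) \<bullet> v)) = cnj (z - p) * v + (z - p) * cnj v" for v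
   by (simp add: complex_eq_iff inner_complex_def algebra_simps)
  ultimately show ?thesis by (simp only: of_real_mult of_real_of_nat_eq) (simp add: algebra_simps)
 qed
 show "dbar (%z. of_real (q z ^ Suc (Suc k))) z = of_nat (Suc (Suc k)) * of_real (q z ^ Suc k) * of_real s * (z - p)"
  using wirtingerI(2)[OF d] .
 show "c1 UNIV (%z. of_real (q z ^ Suc (Suc k)))"
  by (rule c1I[OF d]) (auto simp: q_def intro!: continuous_intros)
qed

text \<open>The third power is used because its \<open>dbar\<close>-derivative contains the square
  of the truncated function, which is still of class C^1.\<close>

lemma c2_max_cube: "c2 UNIV (%z. of_real (max 0 (s * (cmod (z - p))\<^sup>2 + t) ^ 3))"
proof (rule c2I[OF open_UNIV])
 show "c1 UNIV (%z. of_real (max 0 (s * (cmod (z - p))\<^sup>2 + t) ^ 3))" using c1_max_power(1)[of s p t 1] by (simp add: numeral_3_eq_3)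
 show "dbar (%z. of_real (max 0 (s * (cmod (z - p))\<^sup>2 + t) ^ 3)) z
   = (3 * of_real s) * (of_real (max 0 (s * (cmod (z - p))\<^sup>2 + t) ^ 2) * (z - p))" for z
  using c1_max_power(2)[of s p t 1 z] by (simp add: numeral_3_eq_3 numeral_2_eq_2)
 show "c1 UNIV (%z. (3 * of_real s) * (of_real (max 0 (s * (cmod (z - p))\<^sup>2 + t) ^ 2) * (z - p)))"
  using c1_max_power(1)[of s p t 0]
  by (intro c1_mult(1) c1_const) (auto simp: numeral_2_eq_2 intro!: holomorphic_c1(1) holomorphic_intros)
qed

text \<open>The quotient A / (A + B), where \<open>A\<close> vanishes outside radius
  \<open>b\<close> and \<open>B\<close> inside radius \<open>a\<close>. Since \<open>a < b\<close>,
  the two never vanish together.\<close>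

lemma bump_exists:
 assumes ab: "0 <= a" "a < b"
 obtains \<theta> where "c2 UNIV (%z. complex_of_real (\<theta> z))" "!!z. 0 <= \<theta> z & \<theta> z <= 1"
  "!!z. cmod (z - p) <= a ==> \<theta> z = 1" "!!z. cmod (z - p) >= b ==> \<theta> z = 0"
proof -
 define A where "A z = max 0 (- 1 * (cmod (z - p))\<^sup>2 + b\<^sup>2) ^ 3" for z
 define B where "B z = max 0 (1 * (cmod (z - p))\<^sup>2 + - a\<^sup>2) ^ 3" for z
 have lt: "a\<^sup>2 < b\<^sup>2" using ab by (intro power_strict_mono) auto
 have pos: "A z >= 0" "B z >= 0" "A z + B z > 0" for z
 proof -
  show 1: "A z >= 0" "B z >= 0" by (auto simp: A_def B_def)
  have "A z > 0 \<or> B z > 0" using lt by (auto simp: A_def B_def)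
  then show "A z + B z > 0" using 1 by auto
 qed
 have nz: "complex_of_real (A z) + of_real (B z) ~= 0" for z
  using pos(3)[of z] by (metis of_real_add of_real_eq_0_iff order_less_irrefl)
 have "c2 UNIV (%z. complex_of_real (A z) * inverse (of_real (A z) + of_real (B z)))"
  unfolding A_def B_def
  by (intro c2_mult c2_inverse c2_add c2_max_cube open_UNIV) (use nz in \<open>simp add: A_def B_def\<close>)
 then have c: "c2 UNIV (%z. complex_of_real (A z / (A z + B z)))" by (simp add: divide_inverse)
 show thesis
 proof (rule that[OF c])
  show "0 <= A z / (A z + B z) & A z / (A z + B z) <= 1" for z using pos[of z] by (simp add: divide_simps)
  show "A z / (A z + B z) = 1" if "cmod (z - p) <= a" for z
  proof -
   have "(cmod (z - p))\<^sup>2 <= a\<^sup>2" using that by (intro power_mono) auto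
   then have "B z = 0" by (simp add: B_def)
   then show ?thesis using pos(3)[of z] by simp
  qed
  show "A z / (A z + B z) = 0" if "cmod (z - p) >= b" for z
  proof -
   have "b\<^sup>2 <= (cmod (z - p))\<^sup>2" using that ab by (intro power_mono) auto
   then show ?thesis by (simp add: A_def)
  qed
 qed
qed

section \<open>A weighted Cauchy transform\<close>

text \<open>With w = z + r e^(it) this is the Cauchy transform of \<open>h\<close> with kernel
  exp(-2 s^2 cnj(w) (w - z)) / (w - z), written in polar coordinates around \<open>z\<close>, where
  the area element cancels the pole. The extra exponential is holomorphic in \<open>z\<close> and
  equals 1 at w = z, so \<open>dbar\<close> is still inverted. The radius 3 exceeds the diameter of
  the unit disc, in which \<open>h\<close> will be supported.\<close>

definition cop :: "real => (complex => complex) => complex => complex" where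
 "cop s h z = - of_real (1 / pi) * integral (cbox (0, 0) (3, 2 * pi))
   (%(r, t). h (z + of_real r * cis t) * exp (- 2 * of_real (s\<^sup>2) * (cnj z * (of_real r * cis t) + of_real (r\<^sup>2))) * cis (- t))"

text \<open>The real-linear map with Wirtinger coefficients \<open>a\<close> and \<open>b\<close>,
  packaged as a bounded linear function so that differentiation under the integral sign
  applies.\<close>

definition blc :: "complex => complex => complex \<Rightarrow>\<^sub>L complex" where
 "blc a b = blinfun_mult_right a + (blinfun_mult_right b o\<^sub>L Blinfun cnj)"

lemma blc_apply: "blinfun_apply (blc a b) v = a * v + b * cnj v"
 by (simp add: blc_def blinfun.add_left bounded_linear_Blinfun_apply[OF bounded_linear_cnj])

lemma continuous_on_blc: "continuous_on S a ==> continuous_on S b ==> continuous_on S (%x. blc (a x) (b x))"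
 unfolding blc_def
 by (intro continuous_on_add bounded_bilinear.continuous_on[OF bounded_bilinear_blinfun_compose] continuous_on_const
   bounded_linear.continuous_on[OF bounded_linear_blinfun_mult_right])

lemma c1_vector_derivative:
 assumes "h differentiable at (\<gamma> r)" "(\<gamma> has_vector_derivative \<gamma>') (at r)"
 shows "((%r. h (\<gamma> r)) has_vector_derivative (dpar h (\<gamma> r) * \<gamma>' + dbar h (\<gamma> r) * cnj \<gamma>')) (at r)"
 using has_derivative_compose[OF assms(2)[unfolded has_vector_derivative_def] wirtingerD[OF assms(1)]]
 unfolding has_vector_derivative_def by (simp add: scaleR_conv_of_real algebra_simps)

lemma exp_vector_derivative:
 fixes g :: "real => complex"
 assumes "(g has_vector_derivative g') (at r)"
 shows "((%r. exp (g r)) has_vector_derivative g' * exp (g r)) (at r)"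
 using field_vector_diff_chain_at[OF assms DERIV_exp] by (simp add: o_def)

lemma cis_vector_derivative: "(cis has_vector_derivative \<i> * cis t) (at t)"
proof -
 have "((%t. \<i> * complex_of_real t) has_vector_derivative \<i> * 1) (at t)"
  by (intro has_vector_derivative_mult_right) (simp add: has_vector_derivative_def scaleR_conv_of_real bounded_linear_imp_has_derivative)
 from exp_vector_derivative[OF this] show ?thesis by (simp add: cis_conv_exp[abs_def])
qed

context
 fixes h :: "complex => complex" and s :: real
 assumes h: "c1 UNIV h"
begin

abbreviation "ew z r t \<equiv> exp (- 2 * of_real (s\<^sup>2) * (cnj z * (of_real r * cis t) + of_real (r\<^sup>2)))"
abbreviation "pw z r t \<equiv> z + of_real r * cis t"

lemma h_cont: "continuous_on S h" "continuous_on S (dpar h)" "continuous_on S (dbar h)"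
 using h c1_continuous[OF h] continuous_on_subset[OF _ subset_UNIV] by (auto simp: c1_def)

lemma pw_cont: "continuous_on S g ==> continuous_on S a ==> continuous_on S b ==>
  continuous_on S (%x. h (pw (g x) (a x) (b x)))"
 "continuous_on S g ==> continuous_on S a ==> continuous_on S b ==>
  continuous_on S (%x. dpar h (pw (g x) (a x) (b x)))"
 "continuous_on S g ==> continuous_on S a ==> continuous_on S b ==>
  continuous_on S (%x. dbar h (pw (g x) (a x) (b x)))"
 by (rule continuous_on_compose2[OF h_cont(1)[of UNIV]] continuous_on_compose2[OF h_cont(2)[of UNIV]]
   continuous_on_compose2[OF h_cont(3)[of UNIV]]; auto intro!: continuous_intros)+

text \<open>In polar coordinates around \<open>z\<close> the integrand has no singularity and
  \<open>z\<close> enters through the argument of \<open>h\<close>, so differentiation under the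
  integral is legitimate.\<close>

lemma cop_derivative:
 "(cop s h has_derivative (%v.
   (- of_real (1 / pi) * integral (cbox (0, 0) (3, 2 * pi)) (%(r, t). dpar h (pw z r t) * ew z r t * cis (- t))) * v +
   (- of_real (1 / pi) * integral (cbox (0, 0) (3, 2 * pi))
    (%(r, t). (dbar h (pw z r t) - 2 * of_real (s\<^sup>2) * (of_real r * cis t) * h (pw z r t)) * ew z r t * cis (- t))) * cnj v)) (at z)"
proof -
 define a where "a z = (%(r, t). dpar h (pw z r t) * ew z r t * cis (- t))" for z
 define b where "b z = (%(r, t). (dbar h (pw z r t) - 2 * of_real (s\<^sup>2) * (of_real r * cis t) * h (pw z r t)) * ew z r t * cis (- t))" for z
 define k where "k z = (%(r, t). h (pw z r t) * ew z r t * cis (- t))" for z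
 let ?B = "cbox (0, 0) (3, 2 * pi)"
 have ab: "continuous_on S (%(z, x). a z x)" "continuous_on S (%(z, x). b z x)" for S
  unfolding a_def b_def split_beta by (intro continuous_intros pw_cont)+
 have abz: "continuous_on S (a z)" "continuous_on S (b z)" "continuous_on S (k z)" for S z
  unfolding a_def b_def k_def split_beta by (intro continuous_intros pw_cont)+
 have kd: "((%z. k z x) has_derivative blinfun_apply (blc (a z x) (b z x))) (at z)" for z x
 proof -
  obtain r t where x: "x = (r, t)" by (cases x)
  have 1: "((%z. h (pw z r t)) has_derivative (%v. dpar h (pw z r t) * v + dbar h (pw z r t) * cnj v)) (at z)"
   by (rule has_derivative_compose[where f="%z. pw z r t" and f'="%v. v", OF _ c1D[OF h UNIV_I]])
    (auto intro!: derivative_eq_intros)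
  have "((%z. - 2 * of_real (s\<^sup>2) * (cnj z * (of_real r * cis t) + of_real (r\<^sup>2))) has_derivative
    (%v. - 2 * of_real (s\<^sup>2) * (cnj v * (of_real r * cis t)))) (at z)"
   by (auto intro!: derivative_eq_intros)
  from has_derivative_compose[OF this DERIV_exp[unfolded has_field_derivative_def]]
  have 2: "((%z. ew z r t) has_derivative (%v. ew z r t * (- 2 * of_real (s\<^sup>2) * (cnj v * (of_real r * cis t))))) (at z)" .
  have "((%z. h (pw z r t) * ew z r t * cis (- t)) has_derivative (%v.
    (h (pw z r t) * (ew z r t * (- 2 * of_real (s\<^sup>2) * (cnj v * (of_real r * cis t)))) +
    (dpar h (pw z r t) * v + dbar h (pw z r t) * cnj v) * ew z r t) * cis (- t))) (at z)"
   by (rule has_derivative_mult_left[OF has_derivative_mult[OF 1 2]])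
  moreover have "(%v.
    (h (pw z r t) * (ew z r t * (- 2 * of_real (s\<^sup>2) * (cnj v * (of_real r * cis t)))) +
    (dpar h (pw z r t) * v + dbar h (pw z r t) * cnj v) * ew z r t) * cis (- t)) = blinfun_apply (blc (a z x) (b z x))"
   by (rule ext) (simp add: blc_apply a_def b_def x algebra_simps)
  ultimately show ?thesis unfolding k_def x by (simp only: prod.case)
 qed
 have "((%z. integral ?B (k z)) has_derivative blinfun_apply (integral ?B (%x. blc (a z x) (b z x)))) (at z within UNIV)"
 proof (rule leibniz_rule)
  show "continuous_on (UNIV \<times> ?B) (%(z, x). blc (a z x) (b z x))"
   unfolding split_beta by (rule continuous_on_blc) (use ab in \<open>simp_all add: split_beta\<close>)
 qed (use kd in \<open>auto intro!: integrable_continuous abz\<close>)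
 moreover have "blinfun_apply (integral ?B (%x. blc (a z x) (b z x))) = (%v. integral ?B (a z) * v + integral ?B (b z) * cnj v)"
 proof
  fix v
  show "blinfun_apply (integral ?B (%x. blc (a z x) (b z x))) v = integral ?B (a z) * v + integral ?B (b z) * cnj v"
  proof -
  have "(%x. blc (a z x) (b z x)) integrable_on ?B"
   by (intro integrable_continuous continuous_on_blc abz)
  then have "blinfun_apply (integral ?B (%x. blc (a z x) (b z x))) v = integral ?B (%x. a z x * v + b z x * cnj v)"
   by (simp add: blinfun_apply_integral blc_apply)
  also have "... = integral ?B (%x. a z x * v) + integral ?B (%x. b z x * cnj v)"
   by (intro integral_add integrable_continuous continuous_intros abz)
  finally show ?thesis by simp
  qed
 qed
 ultimately have "((%z. integral ?B (k z)) has_derivative (%v. integral ?B (a z) * v + integral ?B (b z) * cnj v)) (at z)"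
  by simp
 from has_derivative_mult_right[OF this, of "- of_real (1 / pi)"]
 show ?thesis unfolding cop_def[abs_def] k_def a_def b_def by (simp add: algebra_simps)
qed

lemma cop_c1: "c1 UNIV (cop s h)"
proof (rule c1I[OF cop_derivative])
 have c: "continuous_on UNIV (%z. integral (cbox (0, 0) (3, 2 * pi)) (f z))"
  if "continuous_on (UNIV \<times> cbox (0, 0) (3, 2 * pi)) (%(z, x). f z x)" for f :: "complex => real \<times> real => complex"
  by (rule integral_continuous_on_param[OF that])
 show "continuous_on UNIV (%z. - of_real (1 / pi) * integral (cbox (0, 0) (3, 2 * pi)) (%(r, t). dpar h (pw z r t) * ew z r t * cis (- t)))"
  by (intro continuous_on_mult continuous_on_const c) (unfold split_beta, intro continuous_intros pw_cont)
 show "continuous_on UNIV (%z. - of_real (1 / pi) * integral (cbox (0, 0) (3, 2 * pi))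
    (%(r, t). (dbar h (pw z r t) - 2 * of_real (s\<^sup>2) * (of_real r * cis t) * h (pw z r t)) * ew z r t * cis (- t)))"
  by (intro continuous_on_mult continuous_on_const c) (unfold split_beta, intro continuous_intros pw_cont)
qed

text \<open>The integrand of the \<open>dbar\<close>-derivative is half of
  \<open>Hr + \<i> * D\<close>, that is of (d/dr + (i/r) d/dt) H. The radial integral gives
  \<open>- h z\<close>, since \<open>H\<close> vanishes at radius 3; the angular integral vanishes
  by periodicity.\<close>

lemma dbar_cop:
 assumes supp: "!!w. cmod w >= 1 ==> h w = 0" and z: "cmod z < 1"
 shows "dbar (cop s h) z = h z"
proof -
 let ?B = "cbox (0, 0) (3, 2 * pi) :: (real \<times> real) set"
 define H where "H r t = h (pw z r t) * ew z r t" for r t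
 define Hr where "Hr r t = (dpar h (pw z r t) * cis t + dbar h (pw z r t) * cis (- t)
   + h (pw z r t) * (- 2 * of_real (s\<^sup>2) * (cnj z * cis t + 2 * of_real r))) * ew z r t" for r t
 \<comment> \<open>The angular derivative of \<open>H\<close> divided by \<open>r\<close>, in closed
   form, so that it is continuous across r = 0.\<close>
 define D where "D r t = (\<i> * dpar h (pw z r t) * cis t - \<i> * dbar h (pw z r t) * cis (- t)
   - 2 * \<i> * of_real (s\<^sup>2) * cnj z * cis t * h (pw z r t)) * ew z r t" for r t
 have hd: "h differentiable at w" for w using h by (simp add: c1_def)
 have cc: "cnj (cis t) = cis (- t)" for t by (simp add: cis_cnj)
 have dr: "((%r. H r t) has_vector_derivative Hr r t) (at r)" for r t
 proof -
  have 1: "((%r. pw z r t) has_vector_derivative cis t) (at r)"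
   by (auto intro!: derivative_eq_intros simp: scaleR_conv_of_real[symmetric] has_vector_derivative_def)
  have 2: "((%r. - 2 * of_real (s\<^sup>2) * (cnj z * (of_real r * cis t) + of_real (r\<^sup>2))) has_vector_derivative
    (- 2 * of_real (s\<^sup>2) * (cnj z * cis t + 2 * of_real r))) (at r)"
   by (auto intro!: derivative_eq_intros simp: scaleR_conv_of_real has_vector_derivative_def algebra_simps power2_eq_square)
  show ?thesis unfolding H_def Hr_def
   using has_vector_derivative_mult[OF c1_vector_derivative[OF hd 1] exp_vector_derivative[OF 2]]
   by (simp add: algebra_simps cc)
 qed
 have dt: "((%t. H r t) has_vector_derivative of_real r * D r t) (at t)" for r t
 proof -
  have 1: "((%t. pw z r t) has_vector_derivative of_real r * (\<i> * cis t)) (at t)"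
   using has_vector_derivative_add[OF has_vector_derivative_const[of z]
     has_vector_derivative_mult_right[OF cis_vector_derivative, of "of_real r" t]] by simp
  have 2: "((%t. - 2 * of_real (s\<^sup>2) * (cnj z * (of_real r * cis t) + of_real (r\<^sup>2))) has_vector_derivative
    (- 2 * of_real (s\<^sup>2) * (cnj z * (of_real r * (\<i> * cis t))))) (at t)"
   using has_vector_derivative_mult_right[OF has_vector_derivative_add[OF has_vector_derivative_mult_right[OF
    has_vector_derivative_mult_right[OF cis_vector_derivative, of "of_real r" t], of "cnj z"]
     has_vector_derivative_const[of "of_real (r\<^sup>2)"]], of "- 2 * of_real (s\<^sup>2)"] by simp
  show ?thesis unfolding H_def D_def
   using has_vector_derivative_mult[OF c1_vector_derivative[OF hd 1] exp_vector_derivative[OF 2]]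
   by (simp add: algebra_simps cc)
 qed
 have ci: "continuous_on S (%x. Hr (fst x) (snd x))" "continuous_on S (%x. D (fst x) (snd x))" for S
  unfolding Hr_def D_def by (intro continuous_intros pw_cont)+
 have ints: "(%x. Hr (fst x) (snd x)) integrable_on ?B" "(%x. D (fst x) (snd x)) integrable_on ?B"
  by (intro integrable_continuous ci)+
 have Ir: "integral {0..3} (%r. Hr r t) = - h z" for t
 proof -
  have "((%r. Hr r t) has_integral (H 3 t - H 0 t)) {0..3}"
   by (rule fundamental_theorem_of_calculus) (auto intro: has_vector_derivative_at_within dr)
  moreover have "H 3 t = 0"
  proof -
   have "3 <= cmod (pw z 3 t) + cmod z"
    using norm_triangle_ineq[of "pw z 3 t" "- z"] by (simp add: norm_mult)
   then have "cmod (pw z 3 t) >= 1" using z by linarith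
   then show ?thesis using supp by (simp add: H_def)
  qed
  moreover have "H 0 t = h z" by (simp add: H_def)
  ultimately show ?thesis by (simp add: integral_unique)
 qed
 have It: "integral {0..2 * pi} (%t. D r t) = 0" if "r ~= 0" for r
 proof -
  have "((%t. of_real r * D r t) has_integral (H r (2 * pi) - H r 0)) {0..2 * pi}"
   by (rule fundamental_theorem_of_calculus) (auto intro: has_vector_derivative_at_within dt)
  then have "((%t. of_real r * D r t) has_integral 0) {0..2 * pi}" by (simp add: H_def cis_2pi)
  from has_integral_mult_right[OF this, of "inverse (of_real r)"] have "((%t. D r t) has_integral 0) {0..2 * pi}"
   using that by (simp add: mult.assoc[symmetric])
  then show ?thesis by (rule integral_unique)
 qed
 have "integral ?B (%x. Hr (fst x) (snd x)) = integral (cbox 0 3) (%r. integral (cbox 0 (2 * pi)) (%t. Hr r t))"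
  using integral_prod_continuous[of 0 0 3 "2 * pi", OF ci(1)] by simp
 also have "... = integral (cbox 0 (2 * pi)) (%t. integral (cbox 0 3) (%r. Hr r t))"
  by (rule integral_swap_continuous) (use ci(1) in \<open>simp add: split_beta\<close>)
 also have "... = - (of_real (2 * pi) * h z)" using Ir by (simp add: scaleR_conv_of_real)
 finally have 1: "integral ?B (%x. Hr (fst x) (snd x)) = - (of_real (2 * pi) * h z)" .
 have "integral ?B (%x. D (fst x) (snd x)) = integral (cbox 0 3) (%r. integral (cbox 0 (2 * pi)) (%t. D r t))"
  using integral_prod_continuous[of 0 0 3 "2 * pi", OF ci(2)] by simp
 also have "... = integral (cbox (0::real) 3) (%r. 0)"
  by (rule integral_spike[of "{0}"]) (use It in auto)
 finally have 2: "integral ?B (%x. D (fst x) (snd x)) = 0" by simp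
 have e: "(dbar h (pw z r t) - 2 * of_real (s\<^sup>2) * (of_real r * cis t) * h (pw z r t)) * ew z r t * cis (- t)
   = 1 / 2 * (Hr r t + \<i> * D r t)" for r t
 proof -
  have sw: "x * ew z r t * cis (- t) = (x * cis (- t)) * ew z r t" for x by (simp only: mult_ac)
  have "cis t * cis (- t) = 1" by (simp add: cis_mult)
  then have e0: "of_real r * (cis t * (h (pw z r t) * cis (- t))) = of_real r * h (pw z r t)"
   by (simp only: mult.left_commute[of "cis t"]) simp
  have e1: "(dbar h (pw z r t) - 2 * of_real (s\<^sup>2) * (of_real r * cis t) * h (pw z r t)) * cis (- t)
    = dbar h (pw z r t) * cis (- t) - 2 * of_real (s\<^sup>2) * (of_real r * h (pw z r t))"
   by (simp only: left_diff_distrib mult.assoc e0)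
  then have "(dbar h (pw z r t) - 2 * of_real (s\<^sup>2) * (of_real r * cis t) * h (pw z r t)) * ew z r t * cis (- t)
    = (dbar h (pw z r t) * cis (- t) - 2 * of_real (s\<^sup>2) * (of_real r * h (pw z r t))) * ew z r t"
   by (simp only: sw e1)
  also have "... = 1 / 2 * (Hr r t + \<i> * D r t)" unfolding Hr_def D_def by (simp add: algebra_simps)
  finally show ?thesis .
 qed
 have "integral ?B (%(r, t). (dbar h (pw z r t) - 2 * of_real (s\<^sup>2) * (of_real r * cis t) * h (pw z r t)) * ew z r t * cis (- t))
   = integral ?B (%x. 1 / 2 * (Hr (fst x) (snd x) + \<i> * D (fst x) (snd x)))"
  by (rule integral_cong) (simp only: e split_beta)
 also have "... = 1 / 2 * integral ?B (%x. Hr (fst x) (snd x) + \<i> * D (fst x) (snd x))" by (rule integral_mult_right)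
 also have "integral ?B (%x. Hr (fst x) (snd x) + \<i> * D (fst x) (snd x)) = - (of_real (2 * pi) * h z)"
  using integral_add[OF ints(1) integrable_on_mult_right[OF ints(2)]] 1 2 by simp
 finally show ?thesis
  using wirtingerI(2)[OF cop_derivative[of z]] by simp
qed

text \<open>In the exponents, |w|^2 - 2 Re(cnj(w) (w - z)) = |z|^2 - |w - z|^2: the weight of
  \<open>h\<close> at w and the kernel combine to the weight at \<open>z\<close> times exp(-s^2
  r^2), whose radial integral is of order 1/s.\<close>

lemma cop_bound:
 assumes M: "!!w. cmod (h w) <= M * exp (s\<^sup>2 * (cmod w)\<^sup>2)" and s: "s > 0"
 shows "cmod (cop s h z) <= pi * M / s * exp (s\<^sup>2 * (cmod z)\<^sup>2)"
proof -
 let ?B = "cbox (0, 0) (3, 2 * pi) :: (real \<times> real) set" and ?E = "M * exp (s\<^sup>2 * (cmod z)\<^sup>2)"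
 have M0: "M >= 0" using M[of 0] by (simp add: order_trans[OF norm_ge_zero])
 \<comment> \<open>The Gaussian is bounded by 1 / (1 + (s r)^2), which integrates to an arctangent;
   this is the source of the constant \<pi>.\<close>
 let ?k = "%(r, t). h (pw z r t) * ew z r t * cis (- t)" and ?g = "%x. ?E * inverse (1 + (s * fst x)\<^sup>2)"
 have kc: "continuous_on ?B ?k" unfolding split_beta by (intro continuous_intros pw_cont)
 have p: "1 + x\<^sup>2 ~= 0" for x :: real by (metis add_pos_nonneg less_irrefl zero_le_power2 zero_less_one)
 have gc: "continuous_on ?B ?g" by (intro continuous_intros ballI p)
 have le: "cmod (?k x) <= ?g x" for x
 proof -
  obtain r t where x: "x = (r, t)" by (cases x)
  let ?o = "of_real r * cis t"
  have "(cmod (z + ?o))\<^sup>2 = (cmod z)\<^sup>2 + 2 * Re (cnj z * ?o) + (cmod ?o)\<^sup>2"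
   unfolding cmod_power2 by (simp add: power2_eq_square algebra_simps)
  then have w: "(cmod (pw z r t))\<^sup>2 = (cmod z)\<^sup>2 + 2 * Re (cnj z * ?o) + r\<^sup>2" by (simp add: norm_mult)
  have "cmod (ew z r t) = exp (- 2 * s\<^sup>2 * (Re (cnj z * ?o) + r\<^sup>2))"
   unfolding norm_exp_eq_Re by (simp add: algebra_simps power2_eq_square)
  then have "cmod (?k x) = cmod (h (pw z r t)) * exp (- 2 * s\<^sup>2 * (Re (cnj z * ?o) + r\<^sup>2))"
   unfolding x by (simp add: norm_mult)
  also have "... <= (M * exp (s\<^sup>2 * (cmod (pw z r t))\<^sup>2)) * exp (- 2 * s\<^sup>2 * (Re (cnj z * ?o) + r\<^sup>2))"
   by (intro mult_right_mono M) simp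
  also have "... = M * exp (s\<^sup>2 * (cmod (pw z r t))\<^sup>2 + - 2 * s\<^sup>2 * (Re (cnj z * ?o) + r\<^sup>2))"
   by (simp only: exp_add mult.assoc)
  also have "s\<^sup>2 * (cmod (pw z r t))\<^sup>2 + - 2 * s\<^sup>2 * (Re (cnj z * ?o) + r\<^sup>2) = s\<^sup>2 * (cmod z)\<^sup>2 + - ((s * r)\<^sup>2)"
   unfolding w by (simp add: algebra_simps power_mult_distrib)
  also have "M * exp (s\<^sup>2 * (cmod z)\<^sup>2 + - ((s * r)\<^sup>2)) = ?E * inverse (exp ((s * r)\<^sup>2))" by (simp only: exp_add exp_minus mult.assoc)
  also have "... <= ?E * inverse (1 + (s * r)\<^sup>2)"
   using exp_ge_add_one_self[of "(s * r)\<^sup>2"] M0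
   by (intro mult_left_mono le_imp_inverse_le) (auto intro: add_pos_nonneg)
  finally show ?thesis by (simp add: x)
 qed
 have "integral ?B ?g = integral (cbox 0 3) (%r. integral (cbox 0 (2 * pi)) (%t. ?E * inverse (1 + (s * r)\<^sup>2)))"
  using integral_prod_continuous[of 0 0 3 "2 * pi", OF gc] by simp
 also have "... = integral {0..3} (%r. 2 * pi * ?E * inverse (1 + (s * r)\<^sup>2))" by (simp add: mult.assoc)
 also have "... = 2 * pi * ?E * (arctan (s * 3) / s)"
 proof (rule integral_unique)
  have d: "((%r. arctan (s * r) / s) has_vector_derivative inverse (1 + (s * r)\<^sup>2)) (at r within {0..3})" for r
   unfolding has_real_derivative_iff_has_vector_derivative[symmetric]
   using s by (auto intro!: derivative_eq_intros)
  have "((%r. inverse (1 + (s * r)\<^sup>2)) has_integral (arctan (s * 3) / s - arctan (s * 0) / s)) {0..3}"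
   by (rule fundamental_theorem_of_calculus) (auto intro: d)
  from has_integral_mult_right[OF this, of "2 * pi * ?E"]
  show "((%r. 2 * pi * ?E * inverse (1 + (s * r)\<^sup>2)) has_integral 2 * pi * ?E * (arctan (s * 3) / s)) {0..3}" by simp
 qed
 also have "... <= 2 * pi * ?E * ((pi / 2) / s)"
  using arctan_ubound[of "s * 3"] s M0 by (intro mult_left_mono divide_right_mono) auto
 finally have g: "integral ?B ?g <= pi * (pi * M / s * exp (s\<^sup>2 * (cmod z)\<^sup>2))" by (simp add: algebra_simps)
 have "norm (integral ?B ?k) <= integral ?B ?g"
  by (rule integral_norm_bound_integral[OF integrable_continuous[OF kc] integrable_continuous[OF gc]]) (rule le)
 with g have "norm (integral ?B ?k) / pi <= pi * M / s * exp (s\<^sup>2 * (cmod z)\<^sup>2)"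
  by (simp add: divide_le_eq mult.commute mult.left_commute)
 then show ?thesis by (simp add: cop_def norm_mult norm_divide)
qed

end

section \<open>Perturbing holomorphic discs\<close>

lemma c2_Un: "open S ==> open T ==> c2 S u ==> c2 T u ==> c2 (S \<union> T) u"
 unfolding c2_def using c1_Un by blast

lemma c2_diff: "open S ==> c2 S u ==> c2 S v ==> c2 S (%z. u z - v z)"
 using c2_add[OF _ _ c2_mult[OF _ holomorphic_c2[of S "%_. -1"], of v], of u] by (simp add: holomorphic_on_const)

lemma c1_diff:
 assumes "c1 S u" "c1 S v"
 shows "c1 S (%z. u z - v z)" "!!z. z \<in> S ==> dbar (%z. u z - v z) z = dbar u z - dbar v z"
proof -
 have m: "c1 S (%z. -1 * v z)" by (intro c1_mult c1_const assms)
 show "c1 S (%z. u z - v z)" using c1_add(1)[OF assms(1) m] by simp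
 show "dbar (%z. u z - v z) z = dbar u z - dbar v z" if "z \<in> S" for z
  using c1_add(2)[OF assms(1) m that] c1_mult(2)[OF c1_const(1)[of S "-1"] assms(2) that] c1_const(2)[of "-1" z] by simp
qed

lemma c1_cutoff:
 assumes S: "open S" and K: "closed K" "K \<subseteq> S" and f: "c1 S f" and z: "!!z. z \<in> S ==> z \<notin> K ==> f z = 0"
 shows "c1 UNIV (%z. if z \<in> S then f z else 0)"
proof -
 have "c1 (S \<union> - K) (%z. if z \<in> S then f z else 0)"
 proof (rule c1_Un[OF S])
  show "open (- K)" using K by blast
  show "c1 S (%z. if z \<in> S then f z else 0)" by (rule c1_cong[OF S _ f]) simp
  show "c1 (- K) (%z. if z \<in> S then f z else 0)"
   by (rule c1_cong[OF \<open>open (- K)\<close> _ c1_const(1)[of _ 0]]) (use z in auto)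
 qed
 moreover have "S \<union> - K = UNIV" using K by blast
 ultimately show ?thesis by simp
qed

text \<open>
 The points of \<open>J\<close> are centres of cells \<open>ball p (d p)\<close>; a map close to \<open>\<phi>\<close> sends \<open>ball p (3 * d p)\<close> into
 the chart domain \<open>V p\<close>.  Distances and \<open>\<partial>\<close>-bar errors measured in two such charts differ by a factor of at most \<open>L\<close>.
\<close>

locale gluing =
 fixes X :: "'a cmanifold" and \<phi> :: "complex => 'a" and J :: "complex set" and d :: "complex => real"
  and V :: "complex => 'a set" and \<psi> :: "complex => 'a => nat => complex" and e0 L \<delta> C :: real
  and \<omega> \<theta> :: "complex => complex => real"
 assumes X: "complex_manifold X" and J: "finite J" "0 \<in> J" and \<delta>: "\<delta> > 0" "!!p. p \<in> J ==> \<delta> <= d p"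
  and away: "!!p. p \<in> J ==> p ~= 0 ==> 8 * d p <= cmod p"
  and sub: "!!p. p \<in> J ==> ball p (3 * d p) \<subseteq> ball 0 1"
  and chart: "!!p. p \<in> J ==> (V p, \<psi> p) \<in> atlas X" and L: "L >= 1" and e0: "e0 > 0"
  and near: "!!p q z y. p \<in> J ==> q \<in> J ==> z \<in> ball p (3 * d p) ==> z \<in> ball q (3 * d q) ==> y \<in> CS (mdim X) ==>
   (!!i. i < mdim X ==> cmod (y i - \<psi> p (\<phi> z) i) <= e0) ==> y \<in> \<psi> p ` (V p Int V q)"
  and lip: "!!p q z y y' \<mu> i. p \<in> J ==> q \<in> J ==> z \<in> ball p (3 * d p) ==> z \<in> ball q (3 * d q) ==> y \<in> CS (mdim X) ==> y' \<in> CS (mdim X) ==>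
   (!!i. i < mdim X ==> cmod (y i - \<psi> p (\<phi> z) i) <= e0) ==> (!!i. i < mdim X ==> cmod (y' i - \<psi> p (\<phi> z) i) <= e0) ==>
   (!!i. i < mdim X ==> cmod (y i - y' i) <= \<mu>) ==> i < mdim X ==>
   cmod (\<psi> q (inv_into (V p) (\<psi> p) y) i - \<psi> q (inv_into (V p) (\<psi> p) y') i) <= L * \<mu>"
  and pdb: "!!p q z y g M i. p \<in> J ==> q \<in> J ==> z \<in> ball p (3 * d p) ==> z \<in> ball q (3 * d q) ==> y \<in> CS (mdim X) ==>
   (!!i. i < mdim X ==> cmod (y i - \<psi> p (\<phi> z) i) <= e0) ==> (!!j. j < mdim X ==> cmod (g j) <= M) ==> i < mdim X ==>
   cmod (\<Sum>j<mdim X. pd j (%y. \<psi> q (inv_into (V p) (\<psi> p) y) i) y * g j) <= L * M"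
  and chi: "!!p. p \<in> J ==> c2 UNIV (%z. of_real (\<omega> p z))" "!!p z. p \<in> J ==> 0 <= \<omega> p z & \<omega> p z <= 1"
   "!!p z. p \<in> J ==> cmod (z - p) <= d p ==> \<omega> p z = 1" "!!p z. p \<in> J ==> cmod (z - p) >= 3/2 * d p ==> \<omega> p z = 0"
  and theta: "!!p. p \<in> J ==> c2 UNIV (%z. of_real (\<theta> p z))" "!!p z. p \<in> J ==> 0 <= \<theta> p z & \<theta> p z <= 1"
   "!!p z. p \<in> J ==> cmod (z - p) <= 3/2 * d p ==> \<theta> p z = 1" "!!p z. p \<in> J ==> cmod (z - p) >= 5/2 * d p ==> \<theta> p z = 0"
  and C: "C > 0" "!!p z. p \<in> J ==> cmod z < 1 ==> cmod (dbar (%z. of_real (\<theta> p z)) z) <= C"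
begin

abbreviation "n \<equiv> mdim X"
abbreviation "co p u i \<equiv> (%z. \<psi> p (u z) i)"
abbreviation "iv p \<equiv> inv_into (V p) (\<psi> p)"

text \<open>The radius \<open>R\<close> is a parameter because every sweep of corrections gives up a
  collar of the disc.\<close>

definition T :: "complex => real => complex set" where "T p R = ball p (3 * d p) Int ball 0 R"

definition good :: "real => real => (complex => 'a) => bool" where
 "good e R u \<longleftrightarrow> (ALL p:J. (ALL z:T p R. u z \<in> V p & (ALL i<n. cmod (\<psi> p (u z) i - \<psi> p (\<phi> z) i) <= e)) &
   (ALL i<n. c2 (T p R) (co p u i)))"

text \<open>The error is weighted and measured in every chart whose cell contains \<open>z\<close>,
  so a repair made in one chart can be charged against the errors seen in all others.\<close>

definition er :: "real => real => (complex => 'a) => complex => real => bool" where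
 "er s R u z b \<longleftrightarrow> (ALL q:J. z \<in> T q R --> (ALL i<n. cmod (dbar (co q u i) z) <= b * exp (s\<^sup>2 * (cmod z)\<^sup>2)))"

lemma T_open: "open (T p R)" by (auto simp: T_def)

lemma dpos: "p \<in> J ==> d p > 0" using \<delta> by fastforce

lemma goodD:
 assumes "good e R u" "p \<in> J"
 shows "z \<in> T p R ==> u z \<in> V p" "z \<in> T p R ==> i < n ==> cmod (\<psi> p (u z) i - \<psi> p (\<phi> z) i) <= e"
  "i < n ==> c2 (T p R) (co p u i)" "i < n ==> c1 (T p R) (co p u i)"
  "z \<in> T p R ==> \<psi> p (u z) \<in> CS n" "z \<in> T p R ==> iv p (\<psi> p (u z)) = u z"
 using assms chart_CS[OF X chart] chart_inv[OF X chart] unfolding good_def by (auto simp: c2_def)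

lemma T_ball: "z \<in> T p R ==> z \<in> ball p (3 * d p)" "z \<in> T p R ==> cmod z < R"
 by (auto simp: T_def)

lemma T_mono: "R' <= R ==> T p R' \<subseteq> T p R" by (auto simp: T_def)

lemma good_mono:
 assumes "good e R u" "e <= e'" "R' <= R" shows "good e' R' u"
 unfolding good_def
proof (intro ballI conjI allI impI)
 fix p z i assume p: "p \<in> J"
 note g = goodD[OF assms(1) p]
 show "c2 (T p R') (co p u i)" if "i < n" by (rule c2_subset[OF g(3)[OF that] T_mono[OF assms(3)]])
 assume "z \<in> T p R'" then have z: "z \<in> T p R" using T_mono[OF assms(3)] by blast
 show "u z \<in> V p" by (rule g(1)[OF z])
 show "cmod (\<psi> p (u z) i - \<psi> p (\<phi> z) i) <= e'" if "i < n" using g(2)[OF z that] assms(2) by linarith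
qed

lemma er_mono: "er s R u z b ==> b <= b' ==> er s R u z b'"
 unfolding er_def by (meson exp_ge_zero mult_right_mono order_trans)

text \<open>The coordinate change is holomorphic, so by \<open>c1_chol\<close> the errors are
  related by its Jacobian, which \<open>pdb\<close> bounds as long as \<open>u\<close> stays within
  \<open>e0\<close> of \<open>\<phi>\<close>.\<close>

lemma error_transform:
 assumes g: "good e R u" "e <= e0" and p: "p \<in> J" "q \<in> J" "z \<in> T p R" "z \<in> T q R"
  and M: "!!j. j < n ==> cmod (dbar (co p u j) z) <= M" and i: "i < n"
 shows "cmod (dbar (co q u i) z) <= L * M"
proof -
 let ?S = "T p R Int T q R" and ?f = "%y. \<psi> q (iv p y) i"
 note gp = goodD[OF g(1) p(1)] and gq = goodD[OF g(1) p(2)]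
 have W: "\<psi> p (u z) \<in> \<psi> p ` (V p Int V q)" if "z \<in> ?S" for z using gp(1)[of z] gq(1)[of z] that by blast
 have cg: "c1 ?S (%z. \<psi> p (u z) j)" if "j < n" for j by (rule c1_subset[OF gp(4)[OF that]]) simp
 have o: "open ?S" using T_open by blast
 have "dbar (%z. ?f (\<psi> p (u z))) z = (\<Sum>j<n. pd j ?f (\<psi> p (u z)) * dbar (co p u j) z)"
  by (rule c1_chol(2)[OF transition_chol[OF X chart[OF p(1)] chart[OF p(2)]] o W cg]) (use i p in auto)
 moreover have "dbar (%z. ?f (\<psi> p (u z))) z = dbar (co q u i) z"
  by (rule wirtinger_cong(1)[OF o]) (use p gp(6) in auto)
 moreover have "cmod (\<Sum>j<n. pd j ?f (\<psi> p (u z)) * dbar (co p u j) z) <= L * M"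
  by (rule pdb[OF p(1,2) T_ball(1)[OF p(3)] T_ball(1)[OF p(4)] gp(5)[OF p(3)] _ M i]) (use gp(2)[OF p(3)] g(2) in force)
 ultimately show ?thesis by simp
qed

text \<open>Adds \<open>\<sigma>\<close> in the coordinates of one chart. \<open>near\<close> keeps
  the moved point in all charts that see it, and \<open>lip\<close> bounds the displacement in those
  charts by \<open>L * \<mu>\<close>; outside the support of \<open>\<sigma>\<close> nothing
  changes.\<close>

lemma modify:
 assumes g: "good e R u" and p: "p \<in> J" and \<sigma>: "!!i. i < n ==> c2 (T p R) (\<sigma> i)"
  "!!i z. i < n ==> z \<in> T p R ==> cmod (\<sigma> i z) <= \<mu>"
  "!!i z. i < n ==> z \<in> T p R ==> cmod (z - p) >= 5/2 * d p ==> \<sigma> i z = 0"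
  and \<mu>: "\<mu> >= 0" "e + L * \<mu> <= e0"
 obtains u' where "good (e + L * \<mu>) R u'" "!!z i. z \<in> T p R ==> i < n ==> \<psi> p (u' z) i = \<psi> p (u z) i + \<sigma> i z"
  "!!z. z \<notin> cball p (5/2 * d p) ==> u' z = u z"
  "!!q z i. q \<in> J ==> z \<in> T q R ==> i < n ==> cmod (\<psi> q (u' z) i - \<psi> q (u z) i) <= L * \<mu>"
proof -
 define y where "y z = (%i. if i < n then \<psi> p (u z) i + \<sigma> i z else 0)" for z
 define u' where "u' z = (if z \<in> T p R & z \<in> cball p (5/2 * d p) then iv p (y z) else u z)" for z
 note gp = goodD[OF g p]
 have Lm: "\<mu> <= L * \<mu>" using mult_right_mono[OF L \<mu>(1)] by simp
 have y1: "y z \<in> CS n" "!!i. i < n ==> cmod (y z i - \<psi> p (\<phi> z) i) <= e0" if z: "z \<in> T p R" for z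
 proof -
  show "y z \<in> CS n" by (simp add: y_def CS_def)
  fix i assume i: "i < n"
  have "cmod (y z i - \<psi> p (\<phi> z) i) <= cmod (\<psi> p (u z) i - \<psi> p (\<phi> z) i) + cmod (\<sigma> i z)"
   using norm_triangle_ineq[of "\<psi> p (u z) i - \<psi> p (\<phi> z) i" "\<sigma> i z"] i by (simp add: y_def algebra_simps)
  then show "cmod (y z i - \<psi> p (\<phi> z) i) <= e0" using gp(2)[OF z i] \<sigma>(2)[OF i z] Lm \<mu>(2) by linarith
 qed
 have x1: "cmod (\<psi> p (u z) i - \<psi> p (\<phi> z) i) <= e0" if "z \<in> T p R" "i < n" for z i
  using gp(2)[OF that] \<mu> Lm by linarith
 have yV: "y z \<in> \<psi> p ` (V p Int V q)" if "q \<in> J" "z \<in> T p R" "z \<in> T q R" for z q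
  by (rule near[OF p that(1) T_ball(1)[OF that(2)] T_ball(1)[OF that(3)]]) (use y1[OF that(2)] in auto)
 have u'T: "u' z = iv p (y z)" if z: "z \<in> T p R" for z
 proof (cases "z \<in> cball p (5/2 * d p)")
  case False
  then have "cmod (z - p) >= 5/2 * d p" by (simp add: dist_norm norm_minus_commute)
  then have "y z = \<psi> p (u z)" using \<sigma>(3)[OF _ z] gp(5)[OF z] by (auto simp: y_def fun_eq_iff CS_def)
  then show ?thesis using False gp(6)[OF z] by (simp add: u'_def)
 qed (simp add: u'_def z)
 have u'V: "u' z \<in> V q" "\<psi> p (u' z) = y z" if q: "q \<in> J" "z \<in> T p R" "z \<in> T q R" for z q
  using yV[OF that] u'T[OF that(2)] chart_inv[OF X chart[OF p]] by auto
 have disp: "u' z \<in> V q & (i < n --> cmod (\<psi> q (u' z) i - \<psi> q (u z) i) <= L * \<mu>)" if q: "q \<in> J" "z \<in> T q R" for q z i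
 proof (cases "z \<in> T p R")
  case True
  have "cmod (\<psi> q (iv p (y z)) i - \<psi> q (iv p (\<psi> p (u z))) i) <= L * \<mu>" if "i < n"
   by (rule lip[OF p q(1) T_ball(1)[OF True] T_ball(1)[OF q(2)] y1(1)[OF True] gp(5)[OF True] y1(2)[OF True] x1[OF True] _ that])
    (use \<sigma>(2)[OF _ True] in \<open>auto simp: y_def\<close>)
  then show ?thesis using u'T[OF True] gp(6)[OF True] u'V(1)[OF q(1) True q(2)] by simp
 next
  case False
  then show ?thesis using goodD(1)[OF g q] \<mu> L by (simp add: u'_def)
 qed
 have "good (e + L * \<mu>) R u'"
  unfolding good_def
 proof (intro ballI conjI allI impI)
  fix q assume q: "q \<in> J"
  note gq = goodD[OF g q]
  show "u' z \<in> V q" if "z \<in> T q R" for z using disp[OF q that] by blast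
  show "cmod (\<psi> q (u' z) i - \<psi> q (\<phi> z) i) <= e + L * \<mu>" if "z \<in> T q R" "i < n" for z i
   using norm_triangle_ineq[of "\<psi> q (u' z) i - \<psi> q (u z) i" "\<psi> q (u z) i - \<psi> q (\<phi> z) i"]
    disp[OF q that(1), of i] gq(2)[OF that] that(2) by simp
  fix i assume i: "i < n"
  let ?A = "T p R Int T q R" and ?B = "T q R - cball p (5/2 * d p)"
  \<comment> \<open>On \<open>?A\<close> the new map is read through the chart of \<open>p\<close>,
    on \<open>?B\<close> it is the old one. As 5/2 < 3, the two open sets cover
    \<open>T q R\<close>.\<close>
  have oA: "open ?A" and oB: "open ?B" using T_open by (auto intro: open_Diff)
  have "c2 (?A \<union> ?B) (co q u' i)"
  proof (rule c2_Un[OF oA oB])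
   have "c2 ?A (%z. \<psi> q (iv p (y z)) i)"
   proof (rule c2_chol[OF transition_chol[OF X chart[OF p] chart[OF q]] oA])
    show "i < n" by fact
    show "y z \<in> \<psi> p ` (V p Int V q)" if "z \<in> ?A" for z using yV[OF q] that by blast
    fix j assume j: "j < n"
    show "c2 ?A (%z. y z j)" unfolding y_def using j
     by (auto intro!: c2_add[OF oA] c2_subset[OF gp(3)[OF j]] c2_subset[OF \<sigma>(1)[OF j]])
   qed
   then show "c2 ?A (co q u' i)" by (rule c2_cong[OF oA, rotated]) (use u'T in auto)
   show "c2 ?B (co q u' i)"
    by (rule c2_cong[OF oB _ c2_subset[OF gq(3)[OF i]]]) (auto simp: u'_def)
  qed
  moreover have "?A \<union> ?B = T q R" using dpos[OF p] by (auto simp: T_def)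
  ultimately show "c2 (T q R) (co q u' i)" by simp
 qed
 then show thesis
 proof (rule that)
  show "\<psi> p (u' z) i = \<psi> p (u z) i + \<sigma> i z" if "z \<in> T p R" "i < n" for z i
   using u'V(2)[OF p that(1,1)] that(2) by (simp add: y_def)
  show "u' z = u z" if "z \<notin> cball p (5/2 * d p)" for z using that by (simp add: u'_def)
 qed (use disp in blast)
qed

text \<open>Near the origin the cutoff of the central cell is constantly 1 and the others are
  constantly 0, because \<open>away\<close> keeps their supports off the disc of radius
  \<open>\<delta>\<close>. Corrections therefore create no error there.\<close>

lemma theta_dbar_zero:
 assumes p: "p \<in> J" and z: "cmod z < \<delta>"
 shows "dbar (%z. complex_of_real (\<theta> p z)) z = 0"
proof -
 have dp: "\<delta> <= d p" "d p > 0" using \<delta>(2)[OF p] dpos[OF p] by auto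
 show ?thesis
 proof (cases "p = 0")
  case True
  have "dbar (%z. complex_of_real (\<theta> p z)) z = dbar (%_. 1) z"
   by (rule wirtinger_cong(1)[of "ball 0 \<delta>"]) (use z dp theta(3)[OF p] True in auto)
  then show ?thesis by (simp add: c1_const)
 next
  case False
  have "dbar (%z. complex_of_real (\<theta> p z)) z = dbar (%_. 0) z"
  proof (rule wirtinger_cong(1)[of "ball 0 \<delta>"])
   fix w assume "w \<in> ball (0::complex) \<delta>"
   then have "cmod (w - p) >= 5/2 * d p"
    using away[OF p False] norm_triangle_ineq2[of p w] dp by (simp add: norm_minus_commute)
   then show "complex_of_real (\<theta> p w) = 0" using theta(4)[OF p] by simp
  qed (use z in auto)
  then show ?thesis by (simp add: c1_const)
 qed
qed

text \<open>The derivative is taken as \<open>dpar\<close> since the maps are not holomorphic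
  everywhere; for maps satisfying \<open>van\<close> it is the complex derivative at 0.\<close>

definition jet0 :: "(complex => 'a) => (nat => complex) => (nat => complex) => bool" where
 "jet0 u a b \<longleftrightarrow> (ALL i<n. \<psi> 0 (u 0) i = a i & dpar (co 0 u i) 0 = b i)"

definition van :: "real => (complex => 'a) => bool" where
 "van R u \<longleftrightarrow> (ALL q:J. ALL z:T q R. cmod z < \<delta> --> (ALL i<n. dbar (co q u i) z = 0))"

lemma off_origin:
 assumes "p \<in> J" "p ~= 0" shows "0 \<notin> cball p (5/2 * d p)"
 using away[OF assms] dpos[OF assms(1)] by (simp add: dist_norm)

text \<open>
 The factor \<open>z\<^sup>2\<close> leaves the 1-jet at the origin unchanged; dividing by it is harmless because the error
 vanishes near the origin.
\<close>

lemma step: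
 assumes g: "good e R u" and v: "van R u" and M: "!!z. er s R u z M" "M >= 0" and s: "s > 0"
  and p: "p \<in> J" and R: "0 < R'" "R' < R" "R <= 1" and j: "jet0 u a b"
  and \<kappa>: "\<kappa> = pi / (\<delta>\<^sup>2 * s)" and small: "e + L * (\<kappa> * exp (s\<^sup>2) * M) <= e0"
 obtains u' where "good (e + L * (\<kappa> * exp (s\<^sup>2) * M)) R u'" "van R u'" "jet0 u' a b"
  "!!z b. b >= 0 ==> er s R u z b ==> er s R u' z (L * (b + C * \<kappa> * M))"
  "!!z. cmod z <= R' ==> cmod (z - p) <= d p ==> er s R u' z (L * (C * \<kappa> * M))"
  "!!q z i. q \<in> J ==> z \<in> T q R ==> i < n ==> cmod (\<psi> q (u' z) i - \<psi> q (u z) i) <= L * (\<kappa> * exp (s\<^sup>2) * M)"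
proof -
 note gp = goodD[OF g p]
 let ?S = "T p R" and ?R = "(R + R') / 2"
 \<comment> \<open>A radial cutoff that makes the right-hand side compactly supported inside the
   disc of radius \<open>R\<close>; full repair is obtained only up to \<open>R'\<close>.\<close>
 obtain \<eta> where \<eta>: "c2 UNIV (%z. complex_of_real (\<eta> z))" "!!z. 0 <= \<eta> z & \<eta> z <= 1"
  "!!z. cmod (z - 0) <= R' ==> \<eta> z = 1" "!!z. cmod (z - 0) >= ?R ==> \<eta> z = 0"
  by (rule bump_exists[of R' ?R 0]) (use R in auto)
 \<comment> \<open>The part of the error to be removed: localised to the cell by
   \<open>\<omega>\<close> and away from the boundary by \<open>\<eta>\<close>, then divided by
   z^2.\<close>
 define f where "f i z = of_real (\<omega> p z) * of_real (\<eta> z) * dbar (co p u i) z * inverse (z\<^sup>2)" for i z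
 define h where "h i z = (if z \<in> ?S then f i z else 0)" for i z
 have fz: "f i z = 0" if "z \<in> ?S" "cmod z < \<delta>" "i < n" for i z
  using v p that by (simp add: f_def van_def)
 have hc: "c1 UNIV (h i)" if i: "i < n" for i
  unfolding h_def
 proof (rule c1_cutoff[OF T_open])
  have "c1 ((?S - {0}) \<union> (?S Int ball 0 \<delta>)) (f i)"
  proof (rule c1_Un)
   have o: "open (?S - {0})" using T_open by (simp add: open_Diff)
   then show "open (?S - {0})" .
   show "c1 (?S - {0}) (f i)"
   proof -
    have "c1 (?S - {0}) (%z. of_real (\<omega> p z))" "c1 (?S - {0}) (%z. of_real (\<eta> z))" "c1 (?S - {0}) (dbar (co p u i))"
     using chi(1)[OF p] \<eta>(1) gp(3)[OF i] by (auto simp: c2_def intro: c1_subset)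
    moreover have "c1 (?S - {0}) (%z. inverse (z\<^sup>2))"
     using o by (intro holomorphic_c1(1) holomorphic_intros) auto
    ultimately show ?thesis unfolding f_def by (intro c1_mult(1))
   qed
   show o: "open (?S Int ball 0 \<delta>)" using T_open by blast
   show "c1 (?S Int ball 0 \<delta>) (f i)"
    by (rule c1_cong[OF o _ c1_const(1)[of _ 0]]) (use fz i in auto)
  qed
  moreover have "(?S - {0}) \<union> (?S Int ball 0 \<delta>) = ?S" using \<delta> by auto
  ultimately show "c1 ?S (f i)" by simp
  show "closed (cball p (3/2 * d p) Int cball 0 ?R)" by blast
  show "cball p (3/2 * d p) Int cball 0 ?R \<subseteq> ?S" using dpos[OF p] R by (auto simp: T_def)
  show "f i z = 0" if "z \<in> ?S" "z \<notin> cball p (3/2 * d p) Int cball 0 ?R" for z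
   using that chi(4)[OF p, of z] \<eta>(4)[of z] by (auto simp: f_def dist_norm norm_minus_commute)
 qed
 \<comment> \<open>\<open>h i\<close> vanishes for \<open>cmod w < \<delta>\<close>, so division by
   the square costs 1 / \<delta>^2. This and the factor \<pi> / s of \<open>cop_bound\<close> make
   up \<open>\<kappa>\<close>.\<close>
 have hb: "cmod (h i w) <= M / \<delta>\<^sup>2 * exp (s\<^sup>2 * (cmod w)\<^sup>2)" if i: "i < n" for i w
 proof (cases "w \<in> ?S & cmod w >= \<delta>")
  case True
  have 1: "cmod (dbar (co p u i) w) <= M * exp (s\<^sup>2 * (cmod w)\<^sup>2)"
   using M(1)[of w] True p i by (simp add: er_def)
  have 2: "cmod (inverse (w\<^sup>2)) <= inverse (\<delta>\<^sup>2)"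
   unfolding norm_inverse norm_power using True \<delta>(1) by (intro le_imp_inverse_le power_mono) auto
  have "\<omega> p w * \<eta> w <= 1 * 1" using chi(2)[OF p, of w] \<eta>(2)[of w] by (intro mult_mono) auto
  then have 3: "cmod (of_real (\<omega> p w) * of_real (\<eta> w)) <= 1"
   using chi(2)[OF p, of w] \<eta>(2)[of w] by (simp add: norm_mult)
  have "cmod (h i w) = cmod (of_real (\<omega> p w) * of_real (\<eta> w)) * (cmod (dbar (co p u i) w) * cmod (inverse (w\<^sup>2)))"
   using True by (simp only: h_def f_def norm_mult mult.assoc if_True)
  also have "... <= 1 * ((M * exp (s\<^sup>2 * (cmod w)\<^sup>2)) * inverse (\<delta>\<^sup>2))"
   by (intro mult_mono 1 2 3) (use M(2) in auto)
  finally show ?thesis by (simp add: field_simps)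
 next
  case False
  then have "h i w = 0" using fz i by (auto simp: h_def)
  then show ?thesis using M(2) by simp
 qed
 have hs: "h i w = 0" if "cmod w >= 1" for i w using that R by (auto simp: h_def T_def)
 \<comment> \<open>Restores the factor z^2, so that \<open>k i\<close> vanishes to second order at 0
   and its \<open>dbar\<close>-derivative is exactly the localised error.\<close>
 define k where "k i z = z\<^sup>2 * cop s (h i) z" for i z
 have kc: "c2 (ball 0 1) (k i)" and kd: "!!z. cmod z < 1 ==> dbar (k i) z = z\<^sup>2 * h i z" if i: "i < n" for i
 proof -
  have o: "open (ball (0::complex) 1)" by simp
  have cc: "c1 (ball 0 1) (cop s (h i))" by (rule c1_subset[OF cop_c1[OF hc[OF i]]]) simp
  have "c2 (ball 0 1) (cop s (h i))"
   by (rule c2I[OF o cc]) (use dbar_cop[OF hc[OF i] hs] c1_subset[OF hc[OF i]] in auto)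
  moreover have z2: "(%z::complex. z\<^sup>2) holomorphic_on ball 0 1" by (intro holomorphic_intros)
  ultimately show "c2 (ball 0 1) (k i)" unfolding k_def by (intro c2_mult[OF o holomorphic_c2[OF o z2]])
  show "dbar (k i) z = z\<^sup>2 * h i z" if "cmod z < 1" for z
   unfolding k_def using c1_mult(2)[OF holomorphic_c1(1)[OF o z2] cc, of z] holomorphic_c1(2)[OF o z2, of z]
    dbar_cop[OF hc[OF i] hs that] that by simp
 qed
 have kb: "cmod (k i z) <= \<kappa> * M * exp (s\<^sup>2 * (cmod z)\<^sup>2)" if i: "i < n" and z: "cmod z < 1" for i z
 proof -
  have "cmod (k i z) = (cmod z)\<^sup>2 * cmod (cop s (h i) z)" by (simp add: k_def norm_mult norm_power)
  also have "... <= 1 * (pi * (M / \<delta>\<^sup>2) / s * exp (s\<^sup>2 * (cmod z)\<^sup>2))"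
   by (intro mult_mono cop_bound[OF hc[OF i] hb[OF i] s]) (use z in \<open>auto simp: power_le_one\<close>)
  also have "... = \<kappa> * M * exp (s\<^sup>2 * (cmod z)\<^sup>2)" by (simp add: \<kappa> field_simps)
  finally show ?thesis .
 qed
 have kdp: "dpar (k i) 0 = 0" if i: "i < n" for i
 proof -
  have o: "open (ball (0::complex) 1)" by simp
  have z2: "(%z::complex. z\<^sup>2) holomorphic_on ball 0 1" by (intro holomorphic_intros)
  have "deriv (%z::complex. z\<^sup>2) 0 = 0" by (rule DERIV_imp_deriv) (auto intro!: derivative_eq_intros)
  then show ?thesis unfolding k_def
   using c1_mult(3)[OF holomorphic_c1(1)[OF o z2] c1_subset[OF cop_c1[OF hc[OF i]]], of 0] holomorphic_c1(3)[OF o z2, of 0] by simp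
 qed
 \<comment> \<open>The solution does not have support in the cell and must be cut off by
   \<open>\<theta>\<close>. The new error term \<open>dbar\<close> \<theta> times \<open>k i\<close>
   is of order \<open>C * \<kappa> * M\<close>, hence small for large \<open>s\<close>.\<close>
 define \<sigma> where "\<sigma> i z = - of_real (\<theta> p z) * k i z" for i z
 let ?\<mu> = "\<kappa> * exp (s\<^sup>2) * M"
 have \<kappa>0: "\<kappa> > 0" using \<kappa> s \<delta> by simp
 have B1: "z \<in> ball 0 1" if "z \<in> ?S" for z using that R by (auto simp: T_def)
 have tc: "c2 ?S (%z. - complex_of_real (\<theta> p z))"
  using c2_diff[OF T_open holomorphic_c2[OF T_open, of "%_. 0"] c2_subset[OF theta(1)[OF p]]] by (simp add: holomorphic_on_const)
 have kS: "c2 ?S (k i)" if "i < n" for i by (rule c2_subset[OF kc[OF that]]) (use B1 in blast)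
 have \<sigma>c: "c2 ?S (\<sigma> i)" if "i < n" for i unfolding \<sigma>_def by (rule c2_mult[OF T_open tc kS[OF that]])
 have \<sigma>b: "cmod (\<sigma> i z) <= ?\<mu>" if "i < n" "z \<in> ?S" for i z
 proof -
  have z: "cmod z < 1" using B1[OF that(2)] by simp
  have "cmod (\<sigma> i z) = \<theta> p z * cmod (k i z)" using theta(2)[OF p, of z] by (simp add: \<sigma>_def norm_mult)
  also have "... <= 1 * (\<kappa> * M * exp (s\<^sup>2 * (cmod z)\<^sup>2))"
   by (intro mult_mono kb that z) (use theta(2)[OF p, of z] in auto)
  also have "... <= \<kappa> * M * exp (s\<^sup>2 * 1)"
   using z M(2) \<kappa>0 by (simp add: power_le_one mult_left_le mult_left_mono)
  finally show ?thesis by (simp add: mult_ac)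
 qed
 obtain u' where u': "good (e + L * ?\<mu>) R u'" "!!z i. z \<in> ?S ==> i < n ==> \<psi> p (u' z) i = \<psi> p (u z) i + \<sigma> i z"
  "!!z. z \<notin> cball p (5/2 * d p) ==> u' z = u z"
  "!!q z i. q \<in> J ==> z \<in> T q R ==> i < n ==> cmod (\<psi> q (u' z) i - \<psi> q (u z) i) <= L * ?\<mu>"
 proof (rule modify[OF g p \<sigma>c \<sigma>b])
  show "\<sigma> i z = 0" if "cmod (z - p) >= 5/2 * d p" for i z using theta(4)[OF p that] by (simp add: \<sigma>_def)
  show "0 <= ?\<mu>" using \<kappa>0 M(2) by simp
 qed (use small in auto)
 have ed: "dbar (co p u' i) z = (1 - of_real (\<omega> p z) * of_real (\<eta> z)) * dbar (co p u i) z
   - dbar (%z. of_real (\<theta> p z)) z * k i z" if i: "i < n" and z: "z \<in> ?S" for i z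
 proof -
  have z1: "cmod z < 1" using B1[OF z] by simp
  have t1: "c1 ?S (%z. complex_of_real (\<theta> p z))" using theta(1)[OF p] by (auto simp: c2_def intro: c1_subset)
  have k1: "c1 ?S (k i)" using kS[OF i] by (simp add: c2_def)
  have zz: "z\<^sup>2 * h i z = of_real (\<omega> p z) * of_real (\<eta> z) * dbar (co p u i) z"
  proof (cases "cmod z < \<delta>")
   case True
   then show ?thesis using v p z i by (simp add: h_def f_def van_def)
  next
   case False
   then have "z ~= 0" using \<delta>(1) by auto
   then show ?thesis using z by (simp add: h_def f_def)
  qed
  \<comment> \<open>The cutoff \<theta> is 1 on the whole support of \<omega>, so cutting off does
    not weaken the repair.\<close>
  have tx: "complex_of_real (\<theta> p z) * of_real (\<omega> p z) = of_real (\<omega> p z)"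
   using theta(3)[OF p, of z] chi(4)[OF p, of z] by (cases "cmod (z - p) <= 3/2 * d p") auto
  have "dbar (co p u' i) z = dbar (%z. \<psi> p (u z) i - of_real (\<theta> p z) * k i z) z"
   by (rule wirtinger_cong(1)[OF T_open z]) (use u'(2) i in \<open>simp add: \<sigma>_def\<close>)
  also have "... = dbar (co p u i) z - (dbar (%z. of_real (\<theta> p z)) z * k i z + of_real (\<theta> p z) * dbar (k i) z)"
   using c1_diff(2)[OF gp(4)[OF i] c1_mult(1)[OF t1 k1] z] c1_mult(2)[OF t1 k1 z] by simp
  also have "of_real (\<theta> p z) * dbar (k i) z = (of_real (\<theta> p z) * of_real (\<omega> p z)) * of_real (\<eta> z) * dbar (co p u i) z"
   unfolding kd[OF i z1] zz by (simp only: mult.assoc)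
  finally show ?thesis unfolding tx by (simp add: algebra_simps)
 qed
 have same: "dbar (co q u' i) z = dbar (co q u i) z" if "z \<notin> cball p (5/2 * d p)" for q i z
  by (rule wirtinger_cong(1)[of "- cball p (5/2 * d p)"]) (use u'(3) that in auto)
 have tk: "cmod (dbar (%z. of_real (\<theta> p z)) z * k i z) <= C * \<kappa> * M * exp (s\<^sup>2 * (cmod z)\<^sup>2)" if i: "i < n" and z: "z \<in> ?S" for i z
 proof -
  have z1: "cmod z < 1" using B1[OF z] by simp
  have "cmod (dbar (%z. of_real (\<theta> p z)) z * k i z) <= C * (\<kappa> * M * exp (s\<^sup>2 * (cmod z)\<^sup>2))"
   unfolding norm_mult by (intro mult_mono C(2)[OF p z1] kb[OF i z1]) (use C(1) in auto)
  then show ?thesis by (simp add: mult.assoc)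
 qed
 \<comment> \<open>A bound in the chart of \<open>p\<close> becomes a bound in all charts at the
   cost of a factor \<open>L\<close>; off the cell the old error is unchanged.\<close>
 have erI: "er s R u' z (L * b')" if bb: "!!i. i < n ==> z \<in> ?S ==> cmod (dbar (co p u' i) z) <= b' * exp (s\<^sup>2 * (cmod z)\<^sup>2)"
  and c: "z \<in> ?S \<or> (EX b''<=L * b'. er s R u z b'')" for z b'
  unfolding er_def
 proof (intro ballI impI allI)
  fix q i assume q: "q \<in> J" "z \<in> T q R" and i: "i < n"
  show "cmod (dbar (co q u' i) z) <= L * b' * exp (s\<^sup>2 * (cmod z)\<^sup>2)"
  proof (cases "z \<in> ?S")
   case True
   show ?thesis using error_transform[OF u'(1) small p q(1) True q(2) bb[OF _ True] i] by (simp add: mult.assoc)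
  next
   case False
   then have e: "er s R u z (L * b')" using c er_mono by blast
   have "z \<notin> cball p (5/2 * d p)" using False q(2) dpos[OF p] by (auto simp: T_def)
   then show ?thesis using same e q i by (simp add: er_def)
  qed
 qed
 have r01: "0 <= \<omega> p z * \<eta> z & \<omega> p z * \<eta> z <= 1" for z
  using chi(2)[OF p, of z] \<eta>(2)[of z] by (simp add: mult_le_one)
 show thesis
 proof (rule that[OF u'(1)])
  show "van R u'"
   unfolding van_def
  proof (intro ballI impI allI)
   fix q z i assume q: "q \<in> J" "z \<in> T q R" "cmod z < \<delta>" and i: "i < n"
   show "dbar (co q u' i) z = 0"
   proof (cases "z \<in> ?S")
    case True
    have "cmod (dbar (co p u' i) z) <= 0" if "i < n" for i
     using ed[OF that True] theta_dbar_zero[OF p q(3)] v p True q(3) that by (simp add: van_def)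
    from error_transform[OF u'(1) small p q(1) True q(2) this i] show ?thesis by simp
   next
    case False
    then have "z \<notin> cball p (5/2 * d p)" using q(2) dpos[OF p] by (auto simp: T_def)
    then show ?thesis using same v q i by (simp add: van_def)
   qed
  qed
  show "jet0 u' a b"
  proof (cases "p = 0")
   case True
   have 0: "0 \<in> ?S" using dpos[OF p] R True by (simp add: T_def)
   show ?thesis unfolding jet0_def
   proof (intro allI impI conjI)
    fix i assume i: "i < n"
    have ji: "\<psi> 0 (u 0) i = a i" "dpar (co 0 u i) 0 = b i" using j i by (auto simp: jet0_def)
    show "\<psi> 0 (u' 0) i = a i" using u'(2)[OF 0 i] ji(1) by (simp add: \<sigma>_def k_def True)
    have t1: "c1 ?S (%z. - complex_of_real (\<theta> p z))" and k1: "c1 ?S (k i)"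
     and s1: "c1 ?S (\<sigma> i)" using tc kS[OF i] \<sigma>c[OF i] by (simp_all add: c2_def)
    have "dpar (co p u' i) 0 = dpar (%z. \<psi> p (u z) i + \<sigma> i z) 0"
     by (rule wirtinger_cong(2)[OF T_open 0]) (use u'(2) i in auto)
    also have "... = dpar (co p u i) 0 + dpar (\<sigma> i) 0" by (rule c1_add(3)[OF gp(4)[OF i] s1 0])
    also have "dpar (\<sigma> i) 0 = 0" unfolding \<sigma>_def using c1_mult(3)[OF t1 k1 0] kdp[OF i] by (simp add: k_def)
    finally show "dpar (co 0 u' i) 0 = b i" using ji(2) True by simp
   qed
  next
   case False
   have z: "0 \<in> - cball p (5/2 * d p)" using off_origin[OF p False] by simp
   have "dpar (co 0 u' i) 0 = dpar (co 0 u i) 0" for i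
    by (rule wirtinger_cong(2)[OF _ z]) (use u'(3) in auto)
   then show ?thesis using j u'(3) z by (simp add: jet0_def)
  qed
  show "er s R u' z (L * (b + C * \<kappa> * M))" if b: "b >= 0" "er s R u z b" for z b
  proof (rule erI)
   have "b <= L * (b + C * \<kappa> * M)"
   proof -
    have "0 <= C * \<kappa> * M" using C(1) \<kappa>0 M(2) by simp
    then show ?thesis using mult_right_mono[OF L, of "b + C * \<kappa> * M"] b(1) by simp
   qed
   then show "z \<in> ?S \<or> (EX b''<=L * (b + C * \<kappa> * M). er s R u z b'')" using b(2) by blast
   fix i assume i: "i < n" "z \<in> ?S"
   have "cmod (1 - of_real (\<omega> p z) * of_real (\<eta> z)) <= 1"
   proof -
    have "1 - complex_of_real (\<omega> p z) * of_real (\<eta> z) = of_real (1 - \<omega> p z * \<eta> z)" by simp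
    then show ?thesis using r01[of z] by (simp only: norm_of_real) linarith
   qed
   then have "cmod ((1 - of_real (\<omega> p z) * of_real (\<eta> z)) * dbar (co p u i) z) <= 1 * (b * exp (s\<^sup>2 * (cmod z)\<^sup>2))"
    unfolding norm_mult by (intro mult_mono) (use b(2) p i in \<open>auto simp: er_def\<close>)
   then show "cmod (dbar (co p u' i) z) <= (b + C * \<kappa> * M) * exp (s\<^sup>2 * (cmod z)\<^sup>2)"
    using ed[OF i] tk[OF i] norm_triangle_ineq4[of "(1 - of_real (\<omega> p z) * of_real (\<eta> z)) * dbar (co p u i) z" "dbar (%z. of_real (\<theta> p z)) z * k i z"]
    by (simp add: distrib_right)
  qed
  show "er s R u' z (L * (C * \<kappa> * M))" if z: "cmod z <= R'" "cmod (z - p) <= d p" for z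
  proof (rule erI)
   have "z \<in> ?S" using z dpos[OF p] R by (auto simp: T_def dist_norm norm_minus_commute)
   then show "z \<in> ?S \<or> (EX b''<=L * (C * \<kappa> * M). er s R u z b'')" by blast
   fix i assume i: "i < n" "z \<in> ?S"
   show "cmod (dbar (co p u' i) z) <= C * \<kappa> * M * exp (s\<^sup>2 * (cmod z)\<^sup>2)"
    using ed[OF i] tk[OF i] chi(3)[OF p z(2)] \<eta>(3)[of z] z(1) by simp
  qed
 qed (use u'(4) in blast)
qed

text \<open>Repairs the cells of \<open>K\<close> one after another. Each step may multiply existing
  errors by up to \<open>2 * L\<close>, but in a repaired cell every remaining contribution carries
  the small factor \<open>C * \<kappa>\<close>. \<open>D\<close> bounds the displacement of a single
  step, for any number of steps up to \<open>card J\<close>.\<close>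

lemma sweep:
 fixes D :: real
 assumes g: "good e R u" and v: "van R u" and M: "!!z. er s R u z M" "M >= 0" and s: "s > 0"
  and R: "0 < R'" "R' < R" "R <= 1" and j: "jet0 u a b"
  and \<kappa>: "\<kappa> = pi / (\<delta>\<^sup>2 * s)" "C * \<kappa> <= 1" and D: "D = L * (\<kappa> * exp (s\<^sup>2) * (2 * L) ^ card J)"
  and small: "e + card J * D * M <= e0" and K: "K \<subseteq> J"
 shows "EX u'. good (e + card K * D * M) R u' & van R u' & jet0 u' a b &
  (ALL z. er s R u' z ((2 * L) ^ card K * M)) &
  (ALL z. cmod z <= R' --> (EX p:K. cmod (z - p) <= d p) --> er s R u' z (C * \<kappa> * (2 * L) ^ (2 * card K) * M)) &
  (ALL q:J. ALL z:T q R. ALL i<n. cmod (\<psi> q (u' z) i - \<psi> q (u z) i) <= card K * D * M)"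
proof -
 have fK: "finite K" using K J(1) finite_subset by blast
 then show ?thesis using K
 proof (induction K rule: finite_induct)
  case empty
  show ?case using g v j M(1) by (intro exI[of _ u]) simp
 next
  case (insert p K)
  let ?\<Lambda> = "2 * L" let ?k = "card K" let ?M = "?\<Lambda> ^ ?k * M"
  have ck: "card (insert p K) = Suc ?k" using insert.hyps by simp
  have kJ: "Suc ?k <= card J" using card_mono[OF J(1) insert.prems] ck by simp
  have \<kappa>0: "\<kappa> > 0" using \<kappa>(1) s \<delta> by simp
  have D0: "D >= 0" using D \<kappa>0 L by simp
  obtain u1 where u1: "good (e + ?k * D * M) R u1" "van R u1" "jet0 u1 a b" "!!z. er s R u1 z ?M"
   "!!z. cmod z <= R' ==> EX p:K. cmod (z - p) <= d p ==> er s R u1 z (C * \<kappa> * ?\<Lambda> ^ (2 * ?k) * M)"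
   "!!q z i. q \<in> J ==> z \<in> T q R ==> i < n ==> cmod (\<psi> q (u1 z) i - \<psi> q (u z) i) <= ?k * D * M"
   using insert.IH insert.prems by auto
  have M1: "?M >= 0" using M(2) L by simp
  have dM: "L * (\<kappa> * exp (s\<^sup>2) * ?M) <= D * M"
  proof -
   have "?\<Lambda> ^ ?k <= ?\<Lambda> ^ card J" using L kJ by (intro power_increasing) auto
   then have "L * (\<kappa> * exp (s\<^sup>2) * ?\<Lambda> ^ ?k) <= D"
    unfolding D using L \<kappa>0 by (intro mult_left_mono) auto
   from mult_right_mono[OF this M(2)] show ?thesis by (simp add: mult.assoc)
  qed
  have kD: "(e + ?k * D * M) + D * M = e + Suc ?k * D * M" by (simp add: algebra_simps)
  have "real (Suc ?k) * (D * M) <= card J * (D * M)"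
   using kJ D0 M(2) by (intro mult_right_mono) (simp_all only: of_nat_le_iff mult_nonneg_nonneg)
  then have sm: "(e + ?k * D * M) + D * M <= e0" using small kD by (simp add: mult.assoc)
  have p: "p \<in> J" using insert.prems by simp
  obtain u2 where u2: "good (e + ?k * D * M + L * (\<kappa> * exp (s\<^sup>2) * ?M)) R u2" "van R u2" "jet0 u2 a b"
   "!!z b. b >= 0 ==> er s R u1 z b ==> er s R u2 z (L * (b + C * \<kappa> * ?M))"
   "!!z. cmod z <= R' ==> cmod (z - p) <= d p ==> er s R u2 z (L * (C * \<kappa> * ?M))"
   "!!q z i. q \<in> J ==> z \<in> T q R ==> i < n ==> cmod (\<psi> q (u2 z) i - \<psi> q (u1 z) i) <= L * (\<kappa> * exp (s\<^sup>2) * ?M)"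
   by (rule step[OF u1(1,2,4) M1 s p R u1(3) \<kappa>(1)]) (use dM sm in linarith, rule that, assumption+)
  have \<Lambda>1: "?\<Lambda> ^ m >= 1" for m using L by (intro one_le_power) simp
  show ?case
   unfolding ck
  proof (intro exI[of _ u2] conjI allI impI ballI)
   show "good (e + Suc ?k * D * M) R u2" by (rule good_mono[OF u2(1)]) (use dM kD in linarith)+
   show "van R u2" "jet0 u2 a b" by fact+
   show "er s R u2 z (?\<Lambda> ^ Suc ?k * M)" for z
   proof (rule er_mono[OF u2(4)[OF M1 u1(4)]])
    \<comment> \<open>The growth factor \<open>2 * L\<close> is the factor \<open>L\<close> of a
      chart change times 2 for old plus new error, the latter being no larger by
      \<open>C * \<kappa> <= 1\<close>.\<close>
    have "C * \<kappa> * ?M <= 1 * ?M" by (rule mult_right_mono[OF \<kappa>(2) M1])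
    then have "L * (?M + C * \<kappa> * ?M) <= L * (2 * ?M)" using L by (intro mult_left_mono) auto
    then show "L * (?M + C * \<kappa> * ?M) <= ?\<Lambda> ^ Suc ?k * M" by simp
   qed
   fix z assume z: "cmod z <= R'" "EX p':insert p K. cmod (z - p') <= d p'"
   let ?b = "C * \<kappa> * ?\<Lambda> ^ (2 * ?k) * M"
   have c0: "C * \<kappa> * M >= 0" using C(1) \<kappa>0 M(2) by simp
   have e1: "?\<Lambda> ^ ?k * (C * \<kappa> * M) <= ?\<Lambda> ^ (2 * ?k) * (C * \<kappa> * M)"
    using L by (intro mult_right_mono c0 power_increasing) auto
   have e3: "1 * (?\<Lambda> ^ (2 * ?k) * (C * \<kappa> * M)) <= ?\<Lambda> * (?\<Lambda> ^ (2 * ?k) * (C * \<kappa> * M))"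
    using L c0 by (intro mult_right_mono) auto
   have e2: "L * (?b + C * \<kappa> * ?M) <= C * \<kappa> * ?\<Lambda> ^ (2 * Suc ?k) * M"
   proof -
    have "L * (?b + C * \<kappa> * ?M) <= L * (2 * (?\<Lambda> ^ (2 * ?k) * (C * \<kappa> * M)))"
     using e1 L by (intro mult_left_mono) (auto simp: mult_ac)
    also have "... = ?\<Lambda> * (?\<Lambda> ^ (2 * ?k) * (C * \<kappa> * M))" by simp
    also have "... <= ?\<Lambda> * (?\<Lambda> * (?\<Lambda> ^ (2 * ?k) * (C * \<kappa> * M)))" using e3 L by (intro mult_left_mono) auto
    finally show ?thesis by (simp add: mult_ac)
   qed
   show "er s R u2 z (C * \<kappa> * ?\<Lambda> ^ (2 * Suc ?k) * M)"
   proof (cases "cmod (z - p) <= d p")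
    case True
    have b0: "0 <= ?b" using C(1) \<kappa>0 M(2) L by simp
    have "L * (C * \<kappa> * ?M) <= L * (?b + C * \<kappa> * ?M)" using b0 L by (intro mult_left_mono) auto
    then show ?thesis by (intro er_mono[OF u2(5)[OF z(1) True]] order_trans[OF _ e2])
   next
    case False
    have b0: "0 <= ?b" using C(1) \<kappa>0 M(2) L by simp
    show ?thesis by (rule er_mono[OF u2(4)[OF b0 u1(5)[OF z(1)]] e2]) (use z(2) False in auto)
   qed
  next
   fix q z i assume q: "q \<in> J" "z \<in> T q R" "i < n"
   show "cmod (\<psi> q (u2 z) i - \<psi> q (u z) i) <= Suc ?k * D * M"
    using norm_triangle_ineq[of "\<psi> q (u2 z) i - \<psi> q (u1 z) i" "\<psi> q (u1 z) i - \<psi> q (u z) i"] u1(6)[OF q] u2(6)[OF q] dM kD by simp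
  qed
 qed
qed

text \<open>A sweep through all cells halves the error on a slightly smaller disc, and the
  displacements form a geometric series. \<open>E\<close> and \<open>s\<close> are fixed before
  \<open>u\<close> and \<open>M\<close>: \<open>E\<close> contains exp(s^2) and may be large, and it
  is compensated by a small initial \<open>M\<close>.\<close>

lemma sweeps:
 assumes cover: "ball 0 R1 \<subseteq> (\<Union>p\<in>J. cball p (d p))" and R1: "0 < r" "r < R1" "R1 <= 1"
 shows "EX E>=0. EX s>0. ALL e u M a b. good e R1 u --> van R1 u --> (ALL z. er s R1 u z M) --> M >= 0 --> jet0 u a b --> e + E * M <= e0 -->
  (EX w. ALL k::nat. good e0 r (w k) & van r (w k) & jet0 (w k) a b & (ALL z. er s r (w k) z (M / 2 ^ k)) &
   (ALL q:J. ALL z:T q r. ALL i<n. cmod (\<psi> q (w (Suc k) z) i - \<psi> q (w k z) i) <= E * M / 2 ^ k))"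
proof -
 let ?\<Lambda> = "2 * L" let ?m = "card J"
 \<comment> \<open>Solves \<open>C * \<kappa> * (2 * L) ^ (2 * card J) = 1/2\<close>, the factor
   left by a complete sweep.\<close>
 define s where "s = 2 * C * pi * ?\<Lambda> ^ (2 * ?m) / \<delta>\<^sup>2"
 have \<Lambda>1: "?\<Lambda> ^ m >= 1" for m using L by (intro one_le_power) simp
 have s: "s > 0" unfolding s_def using C(1) \<delta>(1) \<Lambda>1[of "2 * ?m"] by simp
 define \<kappa> where "\<kappa> = pi / (\<delta>\<^sup>2 * s)"
 have \<kappa>0: "\<kappa> > 0" using s \<delta> by (simp add: \<kappa>_def)
 have \<Lambda>0: "?\<Lambda> ^ (2 * ?m) > 0" using \<Lambda>1[of "2 * ?m"] by linarith
 have C\<kappa>: "C * \<kappa> * ?\<Lambda> ^ (2 * ?m) = 1 / 2"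
 proof -
  have "C * (pi / (\<delta>\<^sup>2 * (2 * C * pi * x / \<delta>\<^sup>2))) * x = 1 / 2" if "x > 0" for x :: real
   using C(1) \<delta>(1) that by (simp add: field_simps)
  from this[OF \<Lambda>0] show ?thesis unfolding \<kappa>_def s_def .
 qed
 have "C * \<kappa> * 1 <= C * \<kappa> * ?\<Lambda> ^ (2 * ?m)" using \<Lambda>1 C(1) \<kappa>0 by (intro mult_left_mono) auto
 then have C\<kappa>1: "C * \<kappa> <= 1" using C\<kappa> by simp
 define D where "D = L * (\<kappa> * exp (s\<^sup>2) * ?\<Lambda> ^ ?m)"
 have D0: "D >= 0" unfolding D_def using L \<kappa>0 by simp
 \<comment> \<open>A sweep moves points by at most \<open>card J * D\<close> times the current
   error; the factor 2 is the sum of the geometric series of errors.\<close>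
 define E where "E = 2 * (?m * D)"
 have one: "EX u'. good (e + E / 2 * M) R' u' & van R' u' & jet0 u' a b & (ALL z. er s R' u' z (M / 2)) &
   (ALL q:J. ALL z:T q R'. ALL i<n. cmod (\<psi> q (u' z) i - \<psi> q (u z) i) <= E / 2 * M)"
  if h: "good e R u" "van R u" "!!z. er s R u z M" "M >= 0" "jet0 u a b" "e + E / 2 * M <= e0" "0 < R'" "R' < R" "R <= R1" for e R u M a b R'
 proof -
  have R: "R <= 1" using h R1 by simp
  have sm: "e + ?m * D * M <= e0" using h(6) by (simp add: E_def)
  from sweep[OF h(1-4) s h(7,8) R h(5) \<kappa>_def C\<kappa>1 D_def sm subset_refl]
  obtain u' where u': "good (e + ?m * D * M) R u'" "van R u'" "jet0 u' a b"
   "!!z. cmod z <= R' ==> EX p:J. cmod (z - p) <= d p ==> er s R u' z (C * \<kappa> * ?\<Lambda> ^ (2 * ?m) * M)"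
   "!!q z i. q \<in> J ==> z \<in> T q R ==> i < n ==> cmod (\<psi> q (u' z) i - \<psi> q (u z) i) <= ?m * D * M" by auto
  have TT: "z \<in> T q R" if "z \<in> T q R'" for q z using T_mono[of R' R q] h(8) that by auto
  show ?thesis
  proof (intro exI[of _ u'] conjI ballI allI impI)
   show "good (e + E / 2 * M) R' u'" by (rule good_mono[OF u'(1)]) (use h(8) in \<open>auto simp: E_def\<close>)
   show "van R' u'" using u'(2) TT unfolding van_def by blast
   show "jet0 u' a b" by fact
   show "er s R' u' z (M / 2)" for z
   proof (cases "cmod z < R'")
    case True
    then have "z \<in> ball 0 R1" using h by simp
    then have "EX p:J. cmod (z - p) <= d p" using cover by (force simp: dist_norm norm_minus_commute)
    from u'(4)[OF _ this] True have "er s R u' z (M / 2)" unfolding C\<kappa> by simp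
    then show ?thesis using TT unfolding er_def by blast
   next
    case False
    then show ?thesis by (auto simp: er_def T_def)
   qed
   show "cmod (\<psi> q (u' z) i - \<psi> q (u z) i) <= E / 2 * M" if "q \<in> J" "z \<in> T q R'" "i < n" for q z i
    using u'(5)[OF that(1) TT[OF that(2)] that(3)] by (simp add: E_def)
  qed
 qed
 \<comment> \<open>The collars shrink geometrically from \<open>R1\<close> to \<open>r\<close>, so
   infinitely many sweeps leave the disc of radius \<open>r\<close>.\<close>
 define R where "R k = r + (R1 - r) / 2 ^ k" for k :: nat
 have R: "0 < R k" "R (Suc k) < R k" "R k <= R1" "r <= R k" for k
 proof -
  define t where "t = (R1 - r) / 2 ^ k"
  have "R k = r + t" "R (Suc k) = r + t / 2" by (simp_all add: R_def t_def)
  moreover have "t > 0" using R1 by (simp add: t_def)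
  moreover have "t <= R1 - r"
   unfolding t_def using R1 by (simp add: divide_le_eq mult_le_cancel_left1)
  ultimately show "0 < R k" "R (Suc k) < R k" "R k <= R1" "r <= R k" using R1 by linarith+
 qed
 have "EX w. ALL k::nat. good e0 r (w k) & van r (w k) & jet0 (w k) a b & (ALL z. er s r (w k) z (M / 2 ^ k)) &
   (ALL q:J. ALL z:T q r. ALL i<n. cmod (\<psi> q (w (Suc k) z) i - \<psi> q (w k z) i) <= E * M / 2 ^ k)"
  if h: "good e R1 u" "van R1 u" "!!z. er s R1 u z M" "M >= 0" "jet0 u a b" "e + E * M <= e0" for e u M a b
 proof -
  \<comment> \<open>The partial sums of the displacements; they never exceed
    \<open>e + E * M\<close>, so the maps stay within the admissible distance \<open>e0\<close> of
    \<open>\<phi>\<close>.\<close>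
  let ?\<epsilon> = "%k::nat. e + E * M * (1 - 1 / 2 ^ k)"
  have EM: "E * M >= 0" using D0 h(4) by (simp add: E_def)
  have \<epsilon>: "?\<epsilon> k <= e0" for k :: nat
  proof -
   have "E * M * (1 - 1 / 2 ^ k) <= E * M * 1" by (rule mult_left_mono) (use EM in auto)
   then show ?thesis using h(6) by simp
  qed
  let ?P = "%k u. good (?\<epsilon> k) (R k) u & van (R k) u & jet0 u a b & (ALL z. er s (R k) u z (M / 2 ^ k))"
  let ?Q = "%k u u'. ALL q:J. ALL z:T q r. ALL i<n. cmod (\<psi> q (u' z) i - \<psi> q (u z) i) <= E * M / 2 ^ k"
  have "EX w. ALL k. ?P k (w k) & ?Q k (w k) (w (Suc k))"
  proof (rule dependent_nat_choice)
   show "EX u. ?P 0 u" using h by (intro exI[of _ u]) (simp add: R_def)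
   fix u k assume P: "?P k u"
   have e2: "?\<epsilon> k + E / 2 * (M / 2 ^ k) = ?\<epsilon> (Suc k)" by (simp add: field_simps)
   have "EX u'. good (?\<epsilon> k + E / 2 * (M / 2 ^ k)) (R (Suc k)) u' & van (R (Suc k)) u' & jet0 u' a b & (ALL z. er s (R (Suc k)) u' z (M / 2 ^ k / 2)) &
     (ALL q:J. ALL z:T q (R (Suc k)). ALL i<n. cmod (\<psi> q (u' z) i - \<psi> q (u z) i) <= E / 2 * (M / 2 ^ k))"
    by (rule one[of _ "R k"]) (use P R \<epsilon>[of "Suc k"] e2 h(4) in auto)
   then obtain u' where u': "good (?\<epsilon> (Suc k)) (R (Suc k)) u'" "van (R (Suc k)) u'" "jet0 u' a b" "!!z. er s (R (Suc k)) u' z (M / 2 ^ k / 2)"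
     "!!q z i. q \<in> J ==> z \<in> T q (R (Suc k)) ==> i < n ==> cmod (\<psi> q (u' z) i - \<psi> q (u z) i) <= E / 2 * (M / 2 ^ k)"
    unfolding e2 by blast
   have "E / 2 * (M / 2 ^ k) <= E * M / 2 ^ k" using EM by (simp add: field_simps)
   moreover have "z \<in> T q (R (Suc k))" if "z \<in> T q r" for q z using T_mono[OF R(4)] that by blast
   ultimately have "?Q k u u'" using u'(5) order_trans by meson
   then show "EX u'. ?P (Suc k) u' & ?Q k u u'" using u'(1-4) by (intro exI[of _ u']) (simp add: mult.commute)
  qed
  then obtain w where w: "!!k. ?P k (w k)" "!!k. ?Q k (w k) (w (Suc k))" by blast
  show ?thesis
  proof (intro exI[of _ w] allI conjI)
   fix k
   show "good e0 r (w k)" by (rule good_mono[OF conjunct1[OF w(1)] \<epsilon> R(4)])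
   have TT: "z \<in> T q (R k)" if "z \<in> T q r" for q z using T_mono[OF R(4)] that by blast
   show "van r (w k)" using w(1)[of k] TT unfolding van_def by blast
   show "jet0 (w k) a b" using w(1)[of k] by blast
   show "er s r (w k) z (M / 2 ^ k)" for z using w(1)[of k] TT unfolding er_def by blast
  qed (use w(2) in blast)
 qed
 then show ?thesis using D0 s by (intro exI[of _ E] conjI exI[of _ s]) (auto simp: E_def)
qed

end

section \<open>Limits of almost holomorphic maps\<close>

text \<open>Uniform limits do not control \<open>dbar\<close>-derivatives directly. Locally,
  subtracting the solution of the \<open>dbar\<close>-equation for the error leaves a holomorphic
  function, and the subtracted part tends uniformly to 0 by \<open>cop_bound\<close>; so
  \<open>w\<close> is a uniform limit of holomorphic functions.\<close>

lemma limit_holomorphic: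
 assumes B: "open B" "B \<subseteq> ball 0 1" and v: "!!k. c2 B (v k)" and e: "!!k z. z \<in> B ==> cmod (dbar (v k) z) <= e k" "e \<longlonglongrightarrow> 0"
  and lim: "uniform_limit B v w sequentially"
 shows "w holomorphic_on B"
proof -
 have "EX S. open S & z0 \<in> S & S \<subseteq> B & w holomorphic_on S" if z0: "z0 \<in> B" for z0
 proof -
  obtain \<rho> where \<rho>: "\<rho> > 0" "cball z0 \<rho> \<subseteq> B" using open_contains_cball_eq[OF B(1)] z0 by blast
  obtain \<eta> where \<eta>: "c2 UNIV (%z. complex_of_real (\<eta> z))" "!!z. 0 <= \<eta> z & \<eta> z <= 1"
   "!!z. cmod (z - z0) <= \<rho> / 2 ==> \<eta> z = 1" "!!z. cmod (z - z0) >= \<rho> ==> \<eta> z = 0"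
   by (rule bump_exists[of "\<rho>/2" \<rho> z0]) (use \<rho> in auto)
  define f where "f k z = (if z \<in> B then of_real (\<eta> z) * dbar (v k) z else 0)" for k z
  have fc: "c1 UNIV (f k)" for k
   unfolding f_def
  proof (rule c1_cutoff[OF B(1) closed_cball \<rho>(2)])
   show "c1 B (%z. of_real (\<eta> z) * dbar (v k) z)"
    using \<eta>(1) v[of k] by (intro c1_mult(1)) (auto simp: c2_def intro: c1_subset)
   show "of_real (\<eta> z) * dbar (v k) z = 0" if "z \<notin> cball z0 \<rho>" for z
    using \<eta>(4)[of z] that by (simp add: dist_norm norm_minus_commute)
  qed
  have e0: "e k >= 0" for k using e(1)[OF z0, of k] norm_ge_zero order_trans by blast
  have fb: "cmod (f k z) <= e k * exp (1\<^sup>2 * (cmod z)\<^sup>2)" for k z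
  proof -
   have "cmod (f k z) <= 1 * e k"
   proof (cases "z \<in> B")
    case True
    have "\<eta> z * cmod (dbar (v k) z) <= 1 * e k" by (intro mult_mono e(1) True) (use \<eta>(2)[of z] in auto)
    then show ?thesis using True \<eta>(2)[of z] by (simp add: f_def norm_mult)
   qed (simp add: f_def e0)
   also have "... <= e k * exp (1\<^sup>2 * (cmod z)\<^sup>2)" using e0[of k] by (simp add: mult_left_le mult_le_cancel_left1)
   finally show ?thesis .
  qed
  have f0: "f k z = 0" if "cmod z >= 1" for k z using B(2) that by (auto simp: f_def)
  \<comment> \<open>The error was multiplied by a cutoff that is 1 on the half disc, so
    \<open>g k\<close> is holomorphic precisely there.\<close>
  define g where "g k z = v k z - cop 1 (f k) z" for k z
  let ?S = "ball z0 (\<rho> / 2)"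
  have S: "?S \<subseteq> B" using \<rho> by force
  have gh: "g k holomorphic_on ?S" for k
  proof (rule dbar_zero_holomorphic[OF open_ball])
   have v1: "c1 ?S (v k)" using v[of k] S by (auto simp: c2_def intro: c1_subset)
   have c: "c1 ?S (cop 1 (f k))" by (rule c1_subset[OF cop_c1[OF fc]]) simp
   show "c1 ?S (g k)" unfolding g_def by (rule c1_diff(1)[OF v1 c])
   fix z assume z: "z \<in> ?S"
   have "z \<in> ball 0 1" using z S B(2) by blast
   then have "dbar (cop 1 (f k)) z = f k z" by (intro dbar_cop[OF fc f0]) simp_all
   moreover have "f k z = dbar (v k) z" using \<eta>(3)[of z] z S by (auto simp: f_def dist_norm norm_minus_commute)
   ultimately show "dbar (g k) z = 0" unfolding g_def using c1_diff(2)[OF v1 c z] by simp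
  qed
  have "uniform_limit ?S (%k. cop 1 (f k)) (%_. 0) sequentially"
  proof (rule uniform_limitI)
   fix \<epsilon> :: real assume \<epsilon>: "\<epsilon> > 0"
   have "(%k. pi * e k * exp 1) \<longlonglongrightarrow> 0" by (auto intro!: tendsto_eq_intros e(2))
   then have "\<forall>\<^sub>F k in sequentially. pi * e k * exp 1 < \<epsilon>" by (rule order_tendstoD(2)[OF _ \<epsilon>])
   then show "\<forall>\<^sub>F k in sequentially. ALL z:?S. dist (cop 1 (f k) z) 0 < \<epsilon>"
   proof eventually_elim
    case (elim k)
    show ?case
    proof
     fix z assume "z \<in> ?S"
     then have "z \<in> ball 0 1" using S B(2) by blast
     then have z: "cmod z < 1" by simp
     have "cmod (cop 1 (f k) z) <= pi * e k / 1 * exp (1\<^sup>2 * (cmod z)\<^sup>2)" by (rule cop_bound[OF fc fb]) simp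
     also have "... <= pi * e k * exp 1" using z e0[of k] by (simp add: mult_left_mono power_le_one)
     finally show "dist (cop 1 (f k) z) 0 < \<epsilon>" using elim by simp
    qed
   qed
  qed
  from uniform_limit_minus[OF uniform_limit_on_subset[OF lim S] this]
  have gl: "uniform_limit ?S g w sequentially" unfolding g_def by simp
  have "w holomorphic_on ?S"
  proof (rule holomorphic_uniform_sequence[OF open_ball gh])
   fix x assume "x \<in> ?S"
   then obtain t where "t > 0" "cball x t \<subseteq> ?S" using open_contains_cball_eq[OF open_ball] by blast
   then show "EX d>0. cball x d \<subseteq> ?S & uniform_limit (cball x d) g w sequentially"
    using uniform_limit_on_subset[OF gl] by blast
  qed
  then show ?thesis using S z0 \<rho> by (intro exI[of _ ?S]) auto
 qed
 then show ?thesis using B(1) by (meson holomorphic_on_open holomorphic_on_subset subsetD)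
qed

lemma geometric_limit:
 fixes x :: "nat => complex"
 assumes "!!k. cmod (x (Suc k) - x k) <= c / 2 ^ k"
 shows "EX l. x \<longlonglongrightarrow> l & (ALL k. cmod (x k - l) <= 2 * c / 2 ^ k)"
proof -
 have c: "c >= 0" using order_trans[OF norm_ge_zero assms[of 0]] by simp
 \<comment> \<open>The subtracted remainder of the geometric series is what lets the induction
   close.\<close>
 have b: "cmod (x (k + m) - x k) <= 2 * c / 2 ^ k - 2 * c / 2 ^ (k + m)" for k m
 proof (induction m)
  case (Suc m)
  define A where "A = c / 2 ^ (k + m)"
  have "2 * c / 2 ^ (k + Suc m) = A" "2 * c / 2 ^ (k + m) = 2 * A" by (simp_all add: A_def)
  moreover have "cmod (x (Suc (k + m)) - x k) <= cmod (x (Suc (k + m)) - x (k + m)) + cmod (x (k + m) - x k)"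
   using norm_triangle_ineq[of "x (Suc (k + m)) - x (k + m)" "x (k + m) - x k"] by simp
  ultimately show ?case
   using Suc assms[of "k + m", folded A_def] unfolding add_Suc_right by linarith
 qed simp
 have b': "cmod (x m - x k) <= 2 * c / 2 ^ k" if "k <= m" for k m
 proof -
  have "2 * c / 2 ^ (k + (m - k)) >= 0" using c by simp
  then show ?thesis using b[of k "m - k"] that by simp
 qed
 have e: "(%k. 2 * c / 2 ^ k) \<longlonglongrightarrow> 0" by real_asymp
 have "Cauchy x"
 proof (rule CauchyI')
  fix \<epsilon> :: real assume "\<epsilon> > 0"
  then obtain k where k: "2 * c / 2 ^ k < \<epsilon> / 2" using order_tendstoD(2)[OF e, of "\<epsilon> / 2"] eventually_happens by fastforce
  show "EX M. ALL m>=M. ALL n>m. dist (x m) (x n) < \<epsilon>"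
  proof (intro exI[of _ k] allI impI)
   fix m n assume "m >= k" "n > m"
   then have "dist (x m) (x k) < \<epsilon> / 2" "dist (x n) (x k) < \<epsilon> / 2" using b'[of k m] b'[of k n] k by (auto simp: dist_norm)
   then show "dist (x m) (x n) < \<epsilon>" by (rule dist_triangle_half_l)
  qed
 qed
 then obtain l where l: "x \<longlonglongrightarrow> l" using Cauchy_convergent_iff convergent_def by blast
 have "cmod (x k - l) <= 2 * c / 2 ^ k" for k
 proof (rule tendsto_le[OF sequentially_bot tendsto_const])
  show "(%m. cmod (x k - x m)) \<longlonglongrightarrow> cmod (x k - l)" by (intro tendsto_intros l)
  show "\<forall>\<^sub>F m in sequentially. cmod (x k - x m) <= 2 * c / 2 ^ k"
   using eventually_ge_at_top[of k]
  proof eventually_elim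
   case (elim m)
   then show ?case using b'[of k m] norm_minus_commute[of "x m" "x k"] by simp
  qed
 qed
 then show ?thesis using l by blast
qed

context gluing begin

text \<open>The limits are taken separately in the coordinates of each chart and then glued. The
  1-jet passes to the limit because all \<open>w k\<close> are holomorphic near 0, where uniform
  convergence carries over to derivatives.\<close>

lemma limit_disc:
 assumes cover: "ball 0 r \<subseteq> (\<Union>p\<in>J. cball p (d p))" and r: "0 < r" "r <= 1" and M: "M >= 0"
  and w: "!!k::nat. good e0 r (w k)" "!!k. van r (w k)" "!!k. jet0 (w k) a b" "!!k z. er s r (w k) z (M / 2 ^ k)"
   "!!q z i k. q \<in> J ==> z \<in> T q r ==> i < n ==> cmod (\<psi> q (w (Suc k) z) i - \<psi> q (w k z) i) <= c / 2 ^ k"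
 shows "EX u. (ALL p:J. ALL z:T p r. u z \<in> V p) & (ALL p:J. ALL i<n. co p u i holomorphic_on T p r) &
  (ALL i<n. \<psi> 0 (u 0) i = a i & deriv (co 0 u i) 0 = b i)"
proof -
 have "ALL q z i. EX l. q \<in> J --> z \<in> T q r --> i < n -->
   (%k. \<psi> q (w k z) i) \<longlonglongrightarrow> l & (ALL k. cmod (\<psi> q (w k z) i - l) <= 2 * c / 2 ^ k)"
 proof (intro allI)
  fix q z i
  show "EX l. q \<in> J --> z \<in> T q r --> i < n -->
   (%k. \<psi> q (w k z) i) \<longlonglongrightarrow> l & (ALL k. cmod (\<psi> q (w k z) i - l) <= 2 * c / 2 ^ k)"
  proof (cases "q \<in> J & z \<in> T q r & i < n")
   case True
   then show ?thesis using geometric_limit[of "%k. \<psi> q (w k z) i" c] w(5)[of q z i] by blast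
  qed blast
 qed
 then obtain y where y: "!!q z i. q \<in> J ==> z \<in> T q r ==> i < n ==> (%k. \<psi> q (w k z) i) \<longlonglongrightarrow> y q z i"
  "!!q z i k. q \<in> J ==> z \<in> T q r ==> i < n ==> cmod (\<psi> q (w k z) i - y q z i) <= 2 * c / 2 ^ k" by metis
 define Y where "Y q z = (%i. if i < n then y q z i else 0)" for q z
 note g = goodD[OF w(1)]
 have YC: "Y q z \<in> CS n" for q z by (simp add: Y_def CS_def)
 have Yn: "cmod (Y q z i - \<psi> q (\<phi> z) i) <= e0" if q: "q \<in> J" "z \<in> T q r" and i: "i < n" for q z i
 proof (rule tendsto_le[OF sequentially_bot tendsto_const])
  show "(%k. cmod (\<psi> q (w k z) i - \<psi> q (\<phi> z) i)) \<longlonglongrightarrow> cmod (Y q z i - \<psi> q (\<phi> z) i)"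
   unfolding Y_def using i by (auto intro!: tendsto_intros y(1)[OF q])
 qed (use g(2)[OF q i] in simp)
 have YV: "Y p z \<in> \<psi> p ` (V p Int V q)" if "p \<in> J" "q \<in> J" "z \<in> T p r" "z \<in> T q r" for p q z
  by (rule near[OF that(1,2) T_ball(1)[OF that(3)] T_ball(1)[OF that(4)] YC Yn[OF that(1,3)]])
 \<comment> \<open>Limits formed in two charts name the same point: by \<open>lip\<close> coordinate
   changes are uniformly Lipschitz along the sequence. Hence \<open>u\<close> below does not depend
   on the cell chosen by \<open>P\<close>.\<close>
 have Yt: "Y q z = \<psi> q (iv p (Y p z))" if pq: "p \<in> J" "q \<in> J" "z \<in> T p r" "z \<in> T q r" for p q z
 proof
  fix i
  have inV: "iv p (Y p z) \<in> V q" using YV[OF pq] chart_inv[OF X chart[OF pq(1)]] by auto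
  show "Y q z i = \<psi> q (iv p (Y p z)) i"
  proof (cases "i < n")
   case False
   then show ?thesis using chart_CS[OF X chart[OF pq(2)] inV] by (simp add: Y_def CS_def)
  next
   case i: True
   have bd: "cmod (\<psi> q (w k z) i - \<psi> q (iv p (Y p z)) i) <= L * (2 * c / 2 ^ k)" for k
   proof -
    have "cmod (\<psi> q (iv p (\<psi> p (w k z))) i - \<psi> q (iv p (Y p z)) i) <= L * (2 * c / 2 ^ k)"
     by (rule lip[OF pq(1,2) T_ball(1)[OF pq(3)] T_ball(1)[OF pq(4)] g(5)[OF pq(1,3)] YC g(2)[OF pq(1,3)] Yn[OF pq(1,3)] _ i])
      (use y(2)[OF pq(1,3)] in \<open>auto simp: Y_def\<close>)
    then show ?thesis using g(6)[OF pq(1,3)] by simp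
   qed
   have "(%k. L * (2 * c / 2 ^ k)) \<longlonglongrightarrow> 0" by real_asymp
   then have "(%k. \<psi> q (w k z) i - \<psi> q (iv p (Y p z)) i) \<longlonglongrightarrow> 0"
    by (rule Lim_null_comparison[rotated]) (use bd in auto)
   then have "(%k. \<psi> q (w k z) i) \<longlonglongrightarrow> \<psi> q (iv p (Y p z)) i" by (simp add: LIM_zero_iff)
   then show ?thesis using LIMSEQ_unique[OF y(1)[OF pq(2,4) i]] i by (simp add: Y_def)
  qed
 qed
 define P where "P z = (SOME p. p \<in> J & z \<in> T p r)" for z
 have P: "P z \<in> J & z \<in> T (P z) r" if z: "z \<in> ball 0 r" for z
 proof -
  obtain p where p: "p \<in> J" "z \<in> cball p (d p)" using cover z by blast
  then have "z \<in> T p r" using z dpos[OF p(1)] by (auto simp: T_def)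
  then show ?thesis unfolding P_def using p(1) by (intro someI_ex[of "%p. p \<in> J & z \<in> T p r"]) blast
 qed
 define u where "u z = iv (P z) (Y (P z) z)" for z
 have u: "u z \<in> V q" "\<psi> q (u z) = Y q z" if q: "q \<in> J" "z \<in> T q r" for q z
 proof -
  have Pz: "P z \<in> J" "z \<in> T (P z) r" using P[of z] q by (auto simp: T_def)
  show "u z \<in> V q" unfolding u_def using YV[OF Pz(1) q(1) Pz(2) q(2)] chart_inv[OF X chart[OF Pz(1)]] by auto
  show "\<psi> q (u z) = Y q z" unfolding u_def using Yt[OF Pz(1) q(1) Pz(2) q(2)] by simp
 qed
 have ul: "uniform_limit (T q r) (%k. co q (w k) i) (co q u i) sequentially" if q: "q \<in> J" and i: "i < n" for q i
 proof (rule uniform_limitI)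
  fix \<epsilon> :: real assume "\<epsilon> > 0"
  have "(%k. 2 * c / 2 ^ k) \<longlonglongrightarrow> 0" by real_asymp
  from order_tendstoD(2)[OF this \<open>\<epsilon> > 0\<close>]
  show "\<forall>\<^sub>F k in sequentially. ALL z:T q r. dist (co q (w k) i z) (co q u i z) < \<epsilon>"
  proof eventually_elim
   case (elim k)
   then show ?case using y(2)[OF q _ i, of _ k] u(2)[OF q] i by (force simp: Y_def dist_norm)
  qed
 qed
 have hol: "co q u i holomorphic_on T q r" if q: "q \<in> J" and i: "i < n" for q i
 proof (rule limit_holomorphic[OF T_open _ g(3)[OF q i] _ _ ul[OF q i]])
  show "T q r \<subseteq> ball 0 1" using r by (auto simp: T_def)
  show "(%k. M / 2 ^ k * exp (s\<^sup>2)) \<longlonglongrightarrow> 0" by real_asymp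
  fix k z assume z: "z \<in> T q r"
  then have "cmod z < 1" using r by (simp add: T_def)
  then have "exp (s\<^sup>2 * (cmod z)\<^sup>2) <= exp (s\<^sup>2)" by (simp add: mult_left_le power_le_one)
  then have "M / 2 ^ k * exp (s\<^sup>2 * (cmod z)\<^sup>2) <= M / 2 ^ k * exp (s\<^sup>2)" using M by (intro mult_left_mono) auto
  then show "cmod (dbar (co q (w k) i) z) <= M / 2 ^ k * exp (s\<^sup>2)"
   using w(4)[of k z] q z i unfolding er_def by fastforce
 qed
 have z0: "0 \<in> T 0 r" using r dpos[OF J(2)] by (simp add: T_def)
 have "\<psi> 0 (u 0) i = a i & deriv (co 0 u i) 0 = b i" if i: "i < n" for i
 proof
  have j: "\<psi> 0 (w k 0) i = a i" "dpar (co 0 (w k) i) 0 = b i" for k using w(3)[of k] i by (auto simp: jet0_def)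
  have "(%k. \<psi> 0 (w k 0) i) \<longlonglongrightarrow> y 0 0 i" by (rule y(1)[OF J(2) z0 i])
  then have "y 0 0 i = a i" unfolding j by (simp add: LIMSEQ_const_iff)
  then show "\<psi> 0 (u 0) i = a i" using u(2)[OF J(2) z0] i by (simp add: Y_def)
  let ?B = "T 0 r Int ball 0 \<delta>"
  have oB: "open ?B" using T_open by blast
  have h: "co 0 (w k) i holomorphic_on ?B" for k
   by (rule dbar_zero_holomorphic[OF oB c1_subset[OF g(4)[OF J(2) i]]]) (use w(2)[of k] J(2) i in \<open>auto simp: van_def\<close>)
  have zB: "0 \<in> ?B" using z0 \<delta>(1) by simp
  have "(%k. deriv (co 0 (w k) i) 0) \<longlonglongrightarrow> deriv (co 0 u i) 0"
   by (rule deriv_complex_uniform_limit[OF uniform_limit_on_subset[OF ul[OF J(2) i]] _ sequentially_bot oB zB])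
    (use h in auto)
  moreover have "deriv (co 0 (w k) i) 0 = b i" for k using holomorphic_c1(3)[OF oB h zB] j(2) by simp
  ultimately show "deriv (co 0 u i) 0 = b i" by (simp add: LIMSEQ_const_iff)
 qed
 then show ?thesis using u(1) hol by (intro exI[of _ u]) blast
qed

text \<open>The prescribed 1-jet is first produced by adding an affine function in the central
  chart, cut off by \<open>\<theta> 0\<close>. Its only \<open>dbar\<close> error comes from the
  cutoff and is proportional to \<epsilon>; the sweeps remove it without touching the jet.\<close>

lemma perturb:
 assumes hd: "hdisc X \<phi>" and \<phi>V: "!!p z. p \<in> J ==> z \<in> ball p (3 * d p) ==> \<phi> z \<in> V p"
  and cover: "ball 0 R1 \<subseteq> (\<Union>p\<in>J. cball p (d p))" and R1: "0 < r" "r < R1" "R1 <= 1"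
 shows "EX \<epsilon>>0. ALL a b. (ALL i<n. cmod (a i - \<psi> 0 (\<phi> 0) i) <= \<epsilon> & cmod (b i - deriv (co 0 \<phi> i) 0) <= \<epsilon>) -->
  (EX u. (ALL p:J. ALL z:T p r. u z \<in> V p) & (ALL p:J. ALL i<n. co p u i holomorphic_on T p r) &
  (ALL i<n. \<psi> 0 (u 0) i = a i & deriv (co 0 u i) 0 = b i))"
proof -
 have h\<phi>: "co p \<phi> i holomorphic_on T p R1" if "p \<in> J" "i < n" for p i
  by (rule holomorphic_on_subset[OF disc_mapD(2)[OF X hd chart[OF that(1)] that(2)]])
   (use \<phi>V[OF that(1)] sub[OF that(1)] in \<open>auto simp: T_def\<close>)
 have g0: "good 0 R1 \<phi>" unfolding good_def
  using \<phi>V h\<phi> holomorphic_c2[OF T_open] by (auto simp: T_def)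
 obtain E s where E: "E >= 0" "s > 0" and sw: "!!e u M a b. good e R1 u ==> van R1 u ==> (!!z. er s R1 u z M) ==> M >= 0 ==> jet0 u a b ==> e + E * M <= e0 ==>
  EX w. ALL k::nat. good e0 r (w k) & van r (w k) & jet0 (w k) a b & (ALL z. er s r (w k) z (M / 2 ^ k)) &
   (ALL q:J. ALL z:T q r. ALL i<n. cmod (\<psi> q (w (Suc k) z) i - \<psi> q (w k z) i) <= E * M / 2 ^ k)"
  using sweeps[OF cover R1] by blast
 \<comment> \<open>Makes the initial displacement \<open>L * (2 * \<epsilon>)\<close> and the total
   displacement \<open>E * (L * (C * (2 * \<epsilon>)))\<close> of all sweeps add up to exactly
   \<open>e0\<close>.\<close>
 define \<epsilon> where "\<epsilon> = e0 / (2 * L * (1 + E * C))"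
 have EC: "1 + E * C > 0" using E C(1) by (simp add: add_pos_nonneg)
 have \<epsilon>0: "\<epsilon> > 0" unfolding \<epsilon>_def using e0 L EC by simp
 have \<epsilon>e: "L * (2 * \<epsilon>) + E * (L * (C * (2 * \<epsilon>))) = e0"
 proof -
  have "L * (2 * \<epsilon>) + E * (L * (C * (2 * \<epsilon>))) = \<epsilon> * (2 * L * (1 + E * C))" by (simp add: algebra_simps)
  also have "... = e0" unfolding \<epsilon>_def using L EC by (intro nonzero_eq_divide_eq[THEN iffD1]) auto
  finally show ?thesis .
 qed
 show ?thesis
 proof (intro exI[of _ \<epsilon>] conjI allI impI \<epsilon>0)
  fix a b assume ab: "ALL i<n. cmod (a i - \<psi> 0 (\<phi> 0) i) <= \<epsilon> & cmod (b i - deriv (co 0 \<phi> i) 0) <= \<epsilon>"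
  \<comment> \<open>The affine function whose value and derivative at 0 are the differences between
    the wanted and the given jet.\<close>
  define l where "l i z = (a i - \<psi> 0 (\<phi> 0) i) + (b i - deriv (co 0 \<phi> i) 0) * z" for i z
  define \<sigma> where "\<sigma> i z = of_real (\<theta> 0 z) * l i z" for i z
  let ?S = "T 0 R1"
  have lh: "l i holomorphic_on S" for i S unfolding l_def by (intro holomorphic_intros)
  have lb: "cmod (l i z) <= 2 * \<epsilon>" if i: "i < n" and z: "cmod z < 1" for i z
  proof -
   have "cmod (l i z) <= cmod (a i - \<psi> 0 (\<phi> 0) i) + cmod (b i - deriv (co 0 \<phi> i) 0) * cmod z"
    unfolding l_def using norm_triangle_ineq norm_mult by metis
   also have "... <= \<epsilon> + \<epsilon> * 1" by (intro add_mono mult_mono) (use ab i z \<epsilon>0 in auto)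
   finally show ?thesis by simp
  qed
  have S1: "cmod z < 1" if "z \<in> T p R1" for p z using that R1 by (simp add: T_def)
  have t2: "c2 ?S (%z. of_real (\<theta> 0 z))" by (rule c2_subset[OF theta(1)[OF J(2)]]) simp
  have t1: "c1 ?S (%z. of_real (\<theta> 0 z))" using t2 by (simp add: c2_def)
  have \<sigma>c: "c2 ?S (\<sigma> i)" for i unfolding \<sigma>_def by (rule c2_mult[OF T_open t2 holomorphic_c2[OF T_open lh]])
  have \<sigma>b: "cmod (\<sigma> i z) <= 2 * \<epsilon>" if "i < n" "z \<in> ?S" for i z
  proof -
   have "cmod (\<sigma> i z) <= 1 * (2 * \<epsilon>)"
    unfolding \<sigma>_def norm_mult by (intro mult_mono lb that S1[OF that(2)]) (use theta(2)[OF J(2), of z] in auto)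
   then show ?thesis by simp
  qed
  have EM: "E * (L * (C * (2 * \<epsilon>))) >= 0" using E L C(1) \<epsilon>0 by simp
  obtain u where u: "good (0 + L * (2 * \<epsilon>)) R1 u" "!!z i. z \<in> ?S ==> i < n ==> \<psi> 0 (u z) i = \<psi> 0 (\<phi> z) i + \<sigma> i z"
   "!!z. z \<notin> cball 0 (5/2 * d 0) ==> u z = \<phi> z"
  proof (rule modify[OF g0 J(2) \<sigma>c \<sigma>b])
   show "\<sigma> i z = 0" if "cmod (z - 0) >= 5/2 * d 0" for i z using theta(4)[OF J(2) that] by (simp add: \<sigma>_def)
   show "0 + L * (2 * \<epsilon>) <= e0" using \<epsilon>e EM by linarith
  qed (use \<epsilon>0 in auto)
  have small: "0 + L * (2 * \<epsilon>) <= e0" using \<epsilon>e EM by linarith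
  have ed: "dbar (co 0 u i) z = dbar (%z. of_real (\<theta> 0 z)) z * l i z" if i: "i < n" and z: "z \<in> ?S" for i z
  proof -
   have "dbar (co 0 u i) z = dbar (%z. \<psi> 0 (\<phi> z) i + of_real (\<theta> 0 z) * l i z) z"
    by (rule wirtinger_cong(1)[OF T_open z]) (use u(2) i in \<open>simp add: \<sigma>_def\<close>)
   also have "... = dbar (co 0 \<phi> i) z + (dbar (%z. of_real (\<theta> 0 z)) z * l i z + of_real (\<theta> 0 z) * dbar (l i) z)"
    using c1_add(2)[OF holomorphic_c1(1)[OF T_open h\<phi>[OF J(2) i]] c1_mult(1)[OF t1 holomorphic_c1(1)[OF T_open lh]] z]
     c1_mult(2)[OF t1 holomorphic_c1(1)[OF T_open lh] z] by simp
   also have "... = dbar (%z. of_real (\<theta> 0 z)) z * l i z"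
    using holomorphic_c1(2)[OF T_open h\<phi>[OF J(2) i] z] holomorphic_c1(2)[OF T_open lh z] by simp
   finally show ?thesis .
  qed
  have off: "dbar (co q u i) z = 0" if q: "q \<in> J" "z \<in> T q R1" "z \<notin> ?S" and i: "i < n" for q z i
  proof -
   have z: "z \<in> - cball 0 (5/2 * d 0)" using q dpos[OF J(2)] by (auto simp: T_def)
   have "dbar (co q u i) z = dbar (co q \<phi> i) z"
    by (rule wirtinger_cong(1)[OF _ z]) (use u(3) in auto)
   then show ?thesis using holomorphic_c1(2)[OF T_open h\<phi>[OF q(1) i] q(2)] by simp
  qed
  have vn: "van R1 u" unfolding van_def
  proof (intro ballI allI impI)
   fix q z i assume q: "q \<in> J" "z \<in> T q R1" "cmod z < \<delta>" and i: "i < n"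
   show "dbar (co q u i) z = 0"
   proof (cases "z \<in> ?S")
    case True
    have "cmod (dbar (co 0 u i) z) <= 0" if "i < n" for i using ed[OF that True] theta_dbar_zero[OF J(2) q(3)] by simp
    from error_transform[OF u(1) small J(2) q(1) True q(2) this i] show ?thesis by simp
   qed (use off q i in auto)
  qed
  let ?M = "L * (C * (2 * \<epsilon>))"
  have M0: "?M >= 0" using L C(1) \<epsilon>0 by simp
  have er: "er s R1 u z ?M" for z unfolding er_def
  proof (intro ballI allI impI)
   fix q i assume q: "q \<in> J" "z \<in> T q R1" and i: "i < n"
   have "cmod (dbar (co q u i) z) <= ?M"
   proof (cases "z \<in> ?S")
    case True
    have "cmod (dbar (co 0 u i) z) <= C * (2 * \<epsilon>)" if "i < n" for i
     unfolding ed[OF that True] norm_mult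
     by (intro mult_mono C(2)[OF J(2)] lb that S1[OF True]) (use C(1) in auto)
    from error_transform[OF u(1) small J(2) q(1) True q(2) this i] show ?thesis .
   qed (use off q i M0 in auto)
   also have "?M <= ?M * exp (s\<^sup>2 * (cmod z)\<^sup>2)" using mult_left_mono[OF _ M0, of 1 "exp (s\<^sup>2 * (cmod z)\<^sup>2)"] by simp
   finally show "cmod (dbar (co q u i) z) <= ?M * exp (s\<^sup>2 * (cmod z)\<^sup>2)" .
  qed
  have jt: "jet0 u a b" unfolding jet0_def
  proof (intro allI impI conjI)
   fix i assume i: "i < n"
   have 0: "0 \<in> ?S" using R1 dpos[OF J(2)] by (simp add: T_def)
   let ?B = "?S Int ball 0 (d 0)"
   have oB: "open ?B" using T_open by blast
   have zB: "0 \<in> ?B" using 0 dpos[OF J(2)] by simp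
   have eq: "\<psi> 0 (u z) i = \<psi> 0 (\<phi> z) i + l i z" if "z \<in> ?B" for z
    using u(2)[of z i] i that theta(3)[OF J(2), of z] dpos[OF J(2)] by (simp add: \<sigma>_def)
   show "\<psi> 0 (u 0) i = a i" using eq[OF zB] by (simp add: l_def)
   have hB: "co 0 \<phi> i holomorphic_on ?B" by (rule holomorphic_on_subset[OF h\<phi>[OF J(2) i]]) blast
   have "deriv (l i) 0 = b i - deriv (co 0 \<phi> i) 0"
    unfolding l_def by (rule DERIV_imp_deriv) (auto intro!: derivative_eq_intros)
   then show "dpar (co 0 u i) 0 = b i"
    using wirtinger_cong(2)[OF oB zB eq] c1_add(3)[OF holomorphic_c1(1)[OF oB hB] holomorphic_c1(1)[OF oB lh] zB]
     holomorphic_c1(3)[OF oB hB zB] holomorphic_c1(3)[OF oB lh zB] by simp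
  qed
  have "0 + L * (2 * \<epsilon>) + E * ?M <= e0" using \<epsilon>e by simp
  from sw[OF u(1) vn er M0 jt this] obtain w where w: "!!k::nat. good e0 r (w k)" "!!k. van r (w k)" "!!k. jet0 (w k) a b"
   "!!k z. er s r (w k) z (?M / 2 ^ k)"
   "!!q z i k. q \<in> J ==> z \<in> T q r ==> i < n ==> cmod (\<psi> q (w (Suc k) z) i - \<psi> q (w k z) i) <= E * ?M / 2 ^ k" by blast
  show "EX u. (ALL p:J. ALL z:T p r. u z \<in> V p) & (ALL p:J. ALL i<n. co p u i holomorphic_on T p r) &
   (ALL i<n. \<psi> 0 (u 0) i = a i & deriv (co 0 u i) 0 = b i)"
   by (rule limit_disc[OF _ R1(1) _ M0 w]) (use cover R1 in \<open>auto simp: subset_iff\<close>)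
 qed
qed

end

section \<open>Uniform chart data along a disc\<close>

text \<open>A threshold that works near each point of a compact set works everywhere after taking a
  finite minimum, because \<open>P\<close> is inherited by smaller thresholds.\<close>

lemma compact_uniform_threshold:
 fixes P :: "'a::topological_space => real => bool"
 assumes K: "compact K" and loc: "!!z. z \<in> K ==> EX e>0. EX N. open N & z \<in> N & (ALL z':N Int K. P z' e)"
  and mono: "!!z e e'. P z e ==> 0 < e' ==> e' <= e ==> P z e'"
 shows "EX e>0. ALL z:K. P z e"
proof -
 have "ALL z:K. EX Q. fst Q > 0 & open (snd Q) & z \<in> snd Q & (ALL z':snd Q Int K. P z' (fst Q))"
 proof
  fix z assume "z \<in> K"
  from loc[OF this] obtain e N where "e > 0" "open N" "z \<in> N" "ALL z':N Int K. P z' e" by auto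
  then show "EX Q. fst Q > 0 & open (snd Q) & z \<in> snd Q & (ALL z':snd Q Int K. P z' (fst Q))"
   by (intro exI[of _ "(e, N)"]) simp
 qed
 from bchoice[OF this] obtain Q where Q: "!!z. z \<in> K ==> fst (Q z) > 0 & open (snd (Q z)) & z \<in> snd (Q z) &
   (ALL z':snd (Q z) Int K. P z' (fst (Q z)))" by auto
 define e where "e z = fst (Q z)" for z
 define N where "N z = snd (Q z)" for z
 have e: "e z > 0" and N: "open (N z)" "z \<in> N z" "!!z'. z' \<in> N z ==> z' \<in> K ==> P z' (e z)" if "z \<in> K" for z
  using Q[OF that] by (auto simp: e_def N_def)
 obtain D where D: "D \<subseteq> K" "finite D" "K \<subseteq> (\<Union>z\<in>D. N z)"
  by (rule compactE_image[OF K, of K N]) (use N in auto)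
 define m where "m = Min (insert 1 (e ` D))"
 have m: "m > 0" "!!z. z \<in> D ==> m <= e z" using D e by (auto simp: m_def subset_iff)
 have "P z m" if z: "z \<in> K" for z
 proof -
  obtain w where w: "w \<in> D" "z \<in> N w" using D(3) z by blast
  then have "P z (e w)" using N(3)[of w z] D(1) z by auto
  then show ?thesis by (rule mono) (use m(1) m(2)[OF w(1)] in auto)
 qed
 then show ?thesis using m(1) by blast
qed

text \<open>The same number \<open>e\<close> bounds the admissible distance and, through 1 / e, the
  Lipschitz and derivative constants. All three requirements thus become weaker as \<open>e\<close>
  decreases, and a single minimum suffices for all pairs of charts.\<close>

definition transition_bounded :: "nat => ('a set \<times> ('a => nat => complex)) => ('a set \<times> ('a => nat => complex)) => 'a => real => bool" where
 "transition_bounded n c c' x e \<longleftrightarrow> (case (c, c') of ((U, \<phi>), (V, \<psi>)) => ALL y:CS n. (ALL i<n. cmod (y i - \<phi> x i) <= e) -->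
   y \<in> \<phi> ` (U Int V) &
   (ALL y':CS n. ALL \<mu>. (ALL i<n. cmod (y' i - \<phi> x i) <= e) --> (ALL i<n. cmod (y i - y' i) <= \<mu>) -->
    (ALL i<n. cmod (\<psi> (inv_into U \<phi> y) i - \<psi> (inv_into U \<phi> y') i) <= \<mu> / e)) &
   (ALL g M. (ALL j<n. cmod (g j) <= M) -->
    (ALL i<n. cmod (\<Sum>j<n. pd j (%y. \<psi> (inv_into U \<phi> y) i) y * g j) <= M / e)))"

lemma transition_bounded_mono:
 assumes P: "transition_bounded n (U, \<phi>) (V, \<psi>) x e" and e: "0 < e'" "e' <= e"
 shows "transition_bounded n (U, \<phi>) (V, \<psi>) x e'"
proof -
 have q: "a <= M / e'" if "a <= M / e" "0 <= M" for a M :: real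
  using that(1) divide_left_mono[OF e(2) that(2)] e by (smt (verit) mult_pos_pos)
 have nn: "0 <= M" if "ALL j<n. cmod (g j) <= M" "i < n" for M i and g :: "nat => complex"
  using that norm_ge_zero order_trans by blast
 note P' = P[unfolded transition_bounded_def prod.case, rule_format]
 show ?thesis
  unfolding transition_bounded_def prod.case
 proof (intro ballI impI conjI allI)
  fix y assume y: "y \<in> CS n" "ALL i<n. cmod (y i - \<phi> x i) <= e'"
  have ye: "cmod (y i - \<phi> x i) <= e" if "i < n" for i using y(2) that e by force
  note Py = P'[OF y(1) ye]
  show "y \<in> \<phi> ` (U Int V)" using Py by blast
  fix i assume i: "i < n"
  show "cmod (\<psi> (inv_into U \<phi> y) i - \<psi> (inv_into U \<phi> y') i) <= \<mu> / e'"
   if y': "y' \<in> CS n" "ALL i<n. cmod (y' i - \<phi> x i) <= e'" "ALL i<n. cmod (y i - y' i) <= \<mu>" for y' \<mu>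
  proof (rule q)
   have "cmod (y' i - \<phi> x i) <= e" if "i < n" for i using y'(2) that e by force
   then show "cmod (\<psi> (inv_into U \<phi> y) i - \<psi> (inv_into U \<phi> y') i) <= \<mu> / e" using Py y' i by blast
   show "0 <= \<mu>" using nn[OF y'(3) i] .
  qed
  show "cmod (\<Sum>j<n. pd j (%y. \<psi> (inv_into U \<phi> y) i) y * g j) <= M / e'"
   if g: "ALL j<n. cmod (g j) <= M" for g M
   by (rule q) (use Py g i nn[OF g i] in blast)+
 qed
qed

text \<open>The coordinate change is bounded by \<open>B\<close> on a polydisc of radius
  \<open>\<rho>\<close>; Cauchy estimates on the half polydisc give both constants, with
  \<open>q\<close> collecting the \<open>n\<close> coordinates.\<close>

lemma transition_bounded_exists:
 assumes X: "complex_manifold X" and c: "(U, \<phi>) \<in> atlas X" "(V, \<psi>) \<in> atlas X" and x: "x \<in> U Int V"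
 shows "EX e>0. EX N. openin (mtop X) N & x \<in> N & N \<subseteq> U Int V & (ALL x':N. transition_bounded (mdim X) (U, \<phi>) (V, \<psi>) x' e)"
proof -
 let ?n = "mdim X" and ?t = "%i y. \<psi> (inv_into U \<phi> y) i" and ?W = "\<phi> ` (U Int V)"
 have W: "copen ?n ?W" and ch: "!!i. i < ?n ==> chol ?n (?t i) ?W"
  using transition_chol[OF X c] by auto
 define B where "B = 1 + (\<Sum>i<?n. cmod (?t i (\<phi> x)))"
 have B: "B > 0" "!!i. i < ?n ==> cmod (?t i (\<phi> x)) < B"
 proof -
  show "B > 0" unfolding B_def by (intro add_pos_nonneg sum_nonneg) auto
  show "cmod (?t i (\<phi> x)) < B" if "i < ?n" for i
   unfolding B_def using member_le_sum[of i "{..<?n}" "%i. cmod (?t i (\<phi> x))"] that by simp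
 qed
 have xW: "\<phi> x \<in> ?W" using x by blast
 have ct: "continuous_on ?W (?t i)" if "i < ?n" for i using ch[OF that] by (simp add: chol_def)
 have "EX e>0. ALL y:pdisc ?n (\<phi> x) e. y \<in> ?W & cmod (?t i y) < B" if i: "i < ?n" for i
 proof -
  have "openin (top_of_set ?W) (?W Int ?t i -` ball 0 B)" by (rule continuous_openin_preimage_gen[OF ct[OF i] open_ball])
  then have "copen ?n (?W Int ?t i -` ball 0 B)" using W openin_trans by blast
  then obtain e where "e > 0" "pdisc ?n (\<phi> x) e \<subseteq> ?W Int ?t i -` ball 0 B"
   by (rule openin_contains_pdisc) (use xW B(2)[OF i] in auto)
  then show ?thesis by (intro exI[of _ e]) auto
 qed
 then obtain e where e: "!!i. i < ?n ==> e i > 0 & (ALL y:pdisc ?n (\<phi> x) (e i). y \<in> ?W & cmod (?t i y) < B)" by metis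
 obtain e' where e': "e' > 0" "pdisc ?n (\<phi> x) e' \<subseteq> ?W" using openin_contains_pdisc[OF W xW] by blast
 define \<rho> where "\<rho> = Min (insert e' (e ` {..<?n}))"
 have \<rho>: "\<rho> > 0" "\<rho> <= e'" "!!i. i < ?n ==> \<rho> <= e i" using e e' by (auto simp: \<rho>_def)
 have \<rho>W: "pdisc ?n (\<phi> x) \<rho> \<subseteq> ?W" using pdisc_mono[OF \<rho>(2)] e'(2) by blast
 have \<rho>B: "cmod (?t i y) <= B" if "i < ?n" "y \<in> pdisc ?n (\<phi> x) \<rho>" for i y
  using e[OF that(1)] pdisc_mono[OF \<rho>(3)[OF that(1)]] that(2) by fastforce
 have ch\<rho>: "chol ?n (?t i) (pdisc ?n (\<phi> x) \<rho>)" if "i < ?n" for i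
  by (rule chol_subset[OF ch[OF that] \<rho>W])
 define q where "q = 4 * B / \<rho> * real ?n"
 have q0: "q >= 0" using B \<rho> by (simp add: q_def)
 \<comment> \<open>The bound by 1 / (q + 1) makes \<open>q * M <= M / \<epsilon>\<close>. The bound
   by \<open>\<rho> / 8\<close>, with the radius \<open>\<rho> / 4\<close> of \<open>N\<close>,
   keeps the points inside the half polydisc.\<close>
 define \<epsilon> where "\<epsilon> = min (\<rho> / 8) (1 / (q + 1))"
 have \<epsilon>: "\<epsilon> > 0" "\<epsilon> <= \<rho> / 8" "\<epsilon> <= 1 / (q + 1)" using \<rho> q0 by (auto simp: \<epsilon>_def)
 have q\<epsilon>: "q * M <= M / \<epsilon>" if "M >= 0" for M
 proof -
  have "q * \<epsilon> <= (q + 1) * (1 / (q + 1))" using \<epsilon> q0 by (intro mult_mono) auto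
  then have "q * \<epsilon> <= 1" using q0 by simp
  then have "(q * \<epsilon>) * M <= 1 * M" using that by (rule mult_right_mono)
  then show ?thesis using \<epsilon>(1) by (simp add: le_divide_eq mult_ac)
 qed
 define N where "N = {x' \<in> U. \<phi> x' \<in> pdisc ?n (\<phi> x) (\<rho> / 4)}"
 have N: "openin (mtop X) N" unfolding N_def by (rule chart_preimage_open[OF X c(1) openin_pdisc])
 have "x \<in> N" using x \<rho>(1) chart_CS[OF X c(1)] by (auto simp: N_def intro!: pdisc_center)
 moreover have "N \<subseteq> U Int V"
 proof
  fix x' assume x': "x' \<in> N"
  then have "\<phi> x' \<in> pdisc ?n (\<phi> x) \<rho>" using pdisc_mono[of "\<rho>/4" \<rho> ?n "\<phi> x"] \<rho>(1) by (auto simp: N_def)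
  then have "\<phi> x' \<in> ?W" using \<rho>W by blast
  then obtain x'' where "x'' \<in> U Int V" "\<phi> x' = \<phi> x''" by blast
  then show "x' \<in> U Int V" using chart_inv[OF X c(1), of x'] chart_inv[OF X c(1), of x''] x' by (auto simp: N_def)
 qed
 moreover have "transition_bounded ?n (U, \<phi>) (V, \<psi>) x' \<epsilon>" if x': "x' \<in> N" for x'
 proof -
  have half: "y \<in> pdisc ?n (\<phi> x) (\<rho> / 2)" if y: "y \<in> CS ?n" "ALL i<?n. cmod (y i - \<phi> x' i) <= \<epsilon>" for y
   unfolding pdisc_def
  proof (intro CollectI conjI allI impI y(1))
   fix i assume i: "i < ?n"
   have "dist (\<phi> x' i) (\<phi> x i) < \<rho> / 4" using x' i by (simp add: N_def pdisc_def)
   moreover have "dist (y i) (\<phi> x' i) <= \<rho> / 8" using y(2) i \<epsilon>(2) by (force simp: dist_norm)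
   ultimately show "dist (y i) (\<phi> x i) < \<rho> / 2" using dist_triangle[of "y i" "\<phi> x i" "\<phi> x' i"] \<rho>(1) by linarith
  qed
  show ?thesis
   unfolding transition_bounded_def prod.case
  proof (intro ballI impI conjI allI)
   fix y assume y: "y \<in> CS ?n" "ALL i<?n. cmod (y i - \<phi> x' i) <= \<epsilon>"
   note yh = half[OF y]
   have "y \<in> pdisc ?n (\<phi> x) \<rho>" using yh pdisc_mono[of "\<rho>/2" \<rho> ?n "\<phi> x"] \<rho>(1) by auto
   then show "y \<in> ?W" using \<rho>W by blast
   fix i assume i: "i < ?n"
   show "cmod (?t i y - ?t i y') <= \<mu> / \<epsilon>"
    if y': "y' \<in> CS ?n" "ALL i<?n. cmod (y' i - \<phi> x' i) <= \<epsilon>" "ALL i<?n. cmod (y i - y' i) <= \<mu>" for y' \<mu>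
   proof -
    have \<mu>: "\<mu> >= 0" using y'(3) i norm_ge_zero order_trans by blast
    have "cmod (?t i y - ?t i y') <= 4 * B / \<rho> * (\<Sum>j<?n. cmod (y j - y' j))"
     by (rule chol_pdisc_lipschitz[OF ch\<rho>[OF i] \<rho>B[OF i] yh half[OF y'(1,2)] \<rho>(1)])
    also have "... <= 4 * B / \<rho> * (\<Sum>j<?n. \<mu>)"
     using B \<rho> y'(3) by (intro mult_left_mono sum_mono) auto
    also have "... = q * \<mu>" by (simp add: q_def)
    finally show ?thesis using q\<epsilon>[OF \<mu>] by linarith
   qed
   show "cmod (\<Sum>j<?n. pd j (?t i) y * g j) <= M / \<epsilon>" if g: "ALL j<?n. cmod (g j) <= M" for g M
   proof -
    have M: "M >= 0" using g i norm_ge_zero order_trans by blast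
    have "cmod (\<Sum>j<?n. pd j (?t i) y * g j) <= (\<Sum>j<?n. 4 * B / \<rho> * M)"
    proof (rule sum_norm_le)
     fix j assume j: "j \<in> {..<?n}"
     have "cmod (pd j (?t i) y) <= 4 * B / \<rho>"
      by (rule chol_pdisc_pd_bound[OF ch\<rho>[OF i] \<rho>B[OF i] yh]) (use j in auto)
     then show "cmod (pd j (?t i) y * g j) <= 4 * B / \<rho> * M"
      unfolding norm_mult using g j B \<rho> by (intro mult_mono) auto
    qed
    also have "... = q * M" by (simp add: q_def)
    finally show ?thesis using q\<epsilon>[OF M] by linarith
   qed
  qed
 qed
 ultimately show ?thesis using \<epsilon>(1) N by blast
qed

text \<open>Covers a closed disc of radius \<open>R1 < 1\<close> by finitely many cells and supplies
  the constants of \<open>gluing\<close> by compactness. The perturbed map exists only on the disc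
  of radius \<open>r\<close>; rescaling it to the unit disc causes the factor \<open>r\<close> in
  the derivative.\<close>

lemma disc_perturbation:
 fixes r :: real
 assumes X: "complex_manifold X" and hd: "hdisc X \<phi>" and c0: "(V0, \<psi>0) \<in> atlas X" "\<phi> 0 \<in> V0" and r: "0 < r" "r < 1"
 shows "EX \<epsilon>>0. ALL a b. (ALL i<mdim X. cmod (a i - \<psi>0 (\<phi> 0) i) <= \<epsilon> & cmod (b i - deriv (%t. \<psi>0 (\<phi> t) i) 0) <= \<epsilon>) -->
  (EX g. hdisc X g & g 0 \<in> V0 & (ALL i<mdim X. \<psi>0 (g 0) i = a i & deriv (%t. \<psi>0 (g t) i) 0 = of_real r * b i))"
proof -
 define R1 where "R1 = (1 + r) / 2"
 have R1: "r < R1" "R1 < 1" "0 < R1" using r by (auto simp: R1_def)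
 have \<phi>X: "\<phi> z \<in> pts X" if "z \<in> ball 0 1" for z using hol_pts[OF hd] that by simp
 \<comment> \<open>A cell away from 0 has radius at most an eighth of its distance from 0, and the
   cell at 0 uses the given chart; so near 0 only that chart is active.\<close>
 define cell where "cell p Q \<longleftrightarrow> (case Q of (V, \<psi>, d) => (V, \<psi>) \<in> atlas X & d > 0 & cball p (3 * d) \<subseteq> {t \<in> ball 0 1. \<phi> t \<in> V} &
   (p ~= 0 --> 8 * d <= cmod p) & (p = 0 --> (V, \<psi>) = (V0, \<psi>0)))" for p Q
 have "EX Q. cell p Q" if p: "p \<in> cball 0 R1" for p
 proof -
  have p1: "p \<in> ball 0 1" using p R1 by simp
  obtain V \<psi> where c: "(V, \<psi>) \<in> atlas X" "\<phi> p \<in> V" "p = 0 --> (V, \<psi>) = (V0, \<psi>0)"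
  proof (cases "p = 0")
   case True
   then show ?thesis using that[of V0 \<psi>0] c0 by blast
  next
   case False
   obtain V \<psi> where "(V, \<psi>) \<in> atlas X" "\<phi> p \<in> V" using chart_exists[OF X \<phi>X[OF p1]] by blast
   then show ?thesis using that False by blast
  qed
  \<comment> \<open>\<open>disc_mapD\<close> asks for a coordinate index, so dimension 0 is settled
    by continuity alone.\<close>
  have o: "open {t \<in> ball 0 1. \<phi> t \<in> V}"
  proof (cases "mdim X")
   case (Suc m)
   show ?thesis by (rule disc_mapD(1)[OF X hd c(1), of 0]) (simp add: Suc)
  next
   case 0
   have "openin (top_of_set (ball 0 1)) {t \<in> topspace (top_of_set (ball 0 1)). \<phi> t \<in> V}"
    using openin_continuous_map_preimage[OF hol_continuous[OF hd] chart_open(1)[OF X c(1)]] by simp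
   then show ?thesis using openin_open_trans[OF _ open_ball] by simp
  qed
  then obtain e where e: "e > 0" "cball p e \<subseteq> {t \<in> ball 0 1. \<phi> t \<in> V}"
   using o p1 c(2) unfolding open_contains_cball by blast
  define d where "d = (if p = 0 then e / 3 else min (e / 3) (cmod p / 8))"
  have "d > 0" "3 * d <= e" "p ~= 0 --> 8 * d <= cmod p" using e(1) by (auto simp: d_def)
  moreover have "cball p (3 * d) \<subseteq> cball p e" using \<open>3 * d <= e\<close> by auto
  ultimately show ?thesis using c e(2) unfolding cell_def by (intro exI[of _ "(V, \<psi>, d)"]) auto
 qed
 then have "ALL p:cball 0 R1. EX Q. cell p Q" by blast
 from bchoice[OF this] obtain Q where Q: "ALL p:cball 0 R1. cell p (Q p)" ..
 define V where "V p = fst (Q p)" for p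
 define \<psi> where "\<psi> p = fst (snd (Q p))" for p
 define d where "d p = snd (snd (Q p))" for p
 have VQ: "(V p, \<psi> p) \<in> atlas X" "d p > 0" "cball p (3 * d p) \<subseteq> {t \<in> ball 0 1. \<phi> t \<in> V p}" "p ~= 0 ==> 8 * d p <= cmod p"
   "p = 0 ==> V p = V0 & \<psi> p = \<psi>0" if "p \<in> cball 0 R1" for p
  using Q[rule_format, OF that] unfolding cell_def V_def \<psi>_def d_def by (auto split: prod.splits)
 obtain J where J: "J \<subseteq> cball 0 R1" "finite J" "cball 0 R1 \<subseteq> (\<Union>p\<in>J. ball p (d p))"
  by (rule compactE_image[OF compact_cball, of "cball 0 R1" "%p. ball p (d p)" 0 R1]) (use VQ(2) in \<open>auto simp: centre_in_ball\<close>)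
 \<comment> \<open>No cell with another centre contains 0, so any subcover must use the central
   one.\<close>
 have J0: "0 \<in> J"
 proof -
  have "(0::complex) \<in> cball 0 R1" using R1 by simp
  then obtain p where p: "p \<in> J" "0 \<in> ball p (d p)" using J(3) by blast
  then have "p = 0" using VQ(2,4)[of p] J(1) by (force simp: dist_norm)
  then show ?thesis using p by simp
 qed
 note VJ = VQ[OF subsetD[OF J(1)]]
 define \<delta> where "\<delta> = Min (d ` J)"
 have \<delta>: "\<delta> > 0" "!!p. p \<in> J ==> \<delta> <= d p"
 proof -
  have "finite (d ` J)" "d ` J ~= {}" using J(2) J0 by auto
  then show "\<delta> > 0" unfolding \<delta>_def using VJ(2) by (simp add: Min_gr_iff)
  show "\<delta> <= d p" if "p \<in> J" for p unfolding \<delta>_def using J(2) that by simp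
 qed
 have "EX e>0. ALL z:cball p (3 * d p) Int cball q (3 * d q). transition_bounded (mdim X) (V p, \<psi> p) (V q, \<psi> q) (\<phi> z) e"
  if pq: "p \<in> J" "q \<in> J" for p q
 proof (rule compact_uniform_threshold)
  let ?K = "cball p (3 * d p) Int cball q (3 * d q)"
  show "compact ?K" by (intro compact_Int_closed compact_cball closed_cball)
  show "transition_bounded (mdim X) (V p, \<psi> p) (V q, \<psi> q) (\<phi> z) e'"
   if "transition_bounded (mdim X) (V p, \<psi> p) (V q, \<psi> q) (\<phi> z) e" "0 < e'" "e' <= e" for z e e'
   by (rule transition_bounded_mono[OF that])
  fix z assume z: "z \<in> ?K"
  have "z \<in> ball 0 1" "\<phi> z \<in> V p Int V q" using z VJ(3)[OF pq(1)] VJ(3)[OF pq(2)] by blast+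
  from transition_bounded_exists[OF X VJ(1)[OF pq(1)] VJ(1)[OF pq(2)] this(2)]
  obtain e N where e: "e > 0" and N: "openin (mtop X) N" "\<phi> z \<in> N"
   "ALL x':N. transition_bounded (mdim X) (V p, \<psi> p) (V q, \<psi> q) x' e" by blast
  have "openin (top_of_set (ball 0 1)) {t \<in> topspace (top_of_set (ball 0 1)). \<phi> t \<in> N}"
   using openin_continuous_map_preimage[OF hol_continuous[OF hd] N(1)] by simp
  then have "open {t \<in> ball 0 1. \<phi> t \<in> N}" using openin_open_trans[OF _ open_ball] by simp
  then show "EX e>0. EX N. open N & z \<in> N & (ALL z':N Int ?K. transition_bounded (mdim X) (V p, \<psi> p) (V q, \<psi> q) (\<phi> z') e)"
   using e N \<open>z \<in> ball 0 1\<close> by (intro exI[of _ e] conjI exI[of _ "{t \<in> ball 0 1. \<phi> t \<in> N}"]) auto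
 qed
 then obtain e where e: "!!p q. p \<in> J ==> q \<in> J ==> e p q > 0 &
   (ALL z:cball p (3 * d p) Int cball q (3 * d q). transition_bounded (mdim X) (V p, \<psi> p) (V q, \<psi> q) (\<phi> z) (e p q))" by metis
 \<comment> \<open>The inserted 1 guarantees that the constant \<open>L = 1 / e0\<close> of
   \<open>gluing\<close> is at least 1.\<close>
 define e0 where "e0 = Min (insert 1 ((%(p, q). e p q) ` (J \<times> J)))"
 have e0: "e0 > 0" "e0 <= 1" "!!p q. p \<in> J ==> q \<in> J ==> e0 <= e p q"
 proof -
  have f: "finite (insert 1 ((%(p, q). e p q) ` (J \<times> J)))" using J(2) by simp
  then show "e0 > 0" unfolding e0_def using e by (subst Min_gr_iff) auto
  show "e0 <= 1" unfolding e0_def using f by (intro Min_le) auto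
  show "e0 <= e p q" if "p \<in> J" "q \<in> J" for p q unfolding e0_def using f that by (intro Min_le) auto
 qed
 have tb: "transition_bounded (mdim X) (V p, \<psi> p) (V q, \<psi> q) (\<phi> z) e0"
  if "p \<in> J" "q \<in> J" "z \<in> ball p (3 * d p)" "z \<in> ball q (3 * d q)" for p q z
  by (rule transition_bounded_mono[OF _ e0(1) e0(3)[OF that(1,2)]]) (use e[OF that(1,2)] that(3,4) in auto)
 note tbD = tb[unfolded transition_bounded_def prod.case, rule_format]
 define cut where "cut p s t \<theta> \<longleftrightarrow> c2 UNIV (%z. complex_of_real (\<theta> z)) & (ALL z. 0 <= \<theta> z & \<theta> z <= 1) &
  (ALL z. cmod (z - p) <= s * d p --> \<theta> z = 1) & (ALL z. cmod (z - p) >= t * d p --> \<theta> z = 0)" for p s t \<theta>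
 have bump: "EX \<theta>. cut p s t \<theta>" if "p \<in> J" "0 <= s" "s < t" for p s t
 proof -
  have "0 <= s * d p" "s * d p < t * d p" using VJ(2)[OF that(1)] that by auto
  from bump_exists[OF this, of p] show ?thesis unfolding cut_def by metis
 qed
 have "ALL p:J. EX \<theta>. cut p 1 (3/2) \<theta>" "ALL p:J. EX \<theta>. cut p (3/2) (5/2) \<theta>" by (auto intro: bump)
 from bchoice[OF this(1)] bchoice[OF this(2)] obtain \<omega> \<theta> where
  \<omega>: "!!p. p \<in> J ==> cut p 1 (3/2) (\<omega> p)" and \<theta>: "!!p. p \<in> J ==> cut p (3/2) (5/2) (\<theta> p)" by metis
 note \<omega> = \<omega>[unfolded cut_def] and \<theta> = \<theta>[unfolded cut_def]
 have "EX C. ALL z:cball 0 1. cmod (dbar (%z. complex_of_real (\<theta> p z)) z) <= C" if "p \<in> J" for p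
 proof -
  have "continuous_on (cball 0 1) (dbar (%z. complex_of_real (\<theta> p z)))"
   by (rule c1_continuous) (use \<theta>[OF that] in \<open>auto simp: c2_def intro: c1_subset\<close>)
  then have "bounded (dbar (%z. complex_of_real (\<theta> p z)) ` cball 0 1)"
   by (intro compact_imp_bounded compact_continuous_image compact_cball)
  then show ?thesis unfolding bounded_iff by auto
 qed
 then obtain c where c: "!!p z. p \<in> J ==> z \<in> cball 0 1 ==> cmod (dbar (%z. complex_of_real (\<theta> p z)) z) <= c p" by metis
 define C where "C = Max (insert 1 (c ` J))"
 have C: "C > 0" "!!p. p \<in> J ==> c p <= C"
 proof -
  have "1 <= C" unfolding C_def using J(2) by (intro Max_ge) auto
  then show "C > 0" by simp
  show "c p <= C" if "p \<in> J" for p unfolding C_def using J(2) that by (intro Max_ge) auto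
 qed
 have cov: "ball 0 R1 \<subseteq> (\<Union>p\<in>J. cball p (d p))"
 proof
  fix z :: complex assume "z \<in> ball 0 R1"
  then have "z \<in> cball 0 R1" by simp
  then obtain p where "p \<in> J" "z \<in> ball p (d p)" using J(3) by blast
  then show "z \<in> (\<Union>p\<in>J. cball p (d p))" by (intro UN_I[of p]) auto
 qed
 interpret gluing X \<phi> J d V \<psi> e0 "1 / e0" \<delta> C \<omega> \<theta>
 proof
  show "8 * d p <= cmod p" if "p \<in> J" "p ~= 0" for p by (rule VJ(4)[OF that])
  show "ball p (3 * d p) \<subseteq> ball 0 1" if "p \<in> J" for p using VJ(3)[OF that] ball_subset_cball[of p "3 * d p"] by blast
  show "1 <= 1 / e0" using e0 by simp
  show "y \<in> \<psi> p ` (V p Int V q)" if "p \<in> J" "q \<in> J" "z \<in> ball p (3 * d p)" "z \<in> ball q (3 * d q)" "y \<in> CS (mdim X)"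
   "!!i. i < mdim X ==> cmod (y i - \<psi> p (\<phi> z) i) <= e0" for p q z y
   using tbD[OF that(1-4), OF that(5,6)] by blast
  show "cmod (\<psi> q (inv_into (V p) (\<psi> p) y) i - \<psi> q (inv_into (V p) (\<psi> p) y') i) <= 1 / e0 * \<mu>"
   if h: "p \<in> J" "q \<in> J" "z \<in> ball p (3 * d p)" "z \<in> ball q (3 * d q)" "y \<in> CS (mdim X)" "y' \<in> CS (mdim X)"
    "!!i. i < mdim X ==> cmod (y i - \<psi> p (\<phi> z) i) <= e0" "!!i. i < mdim X ==> cmod (y' i - \<psi> p (\<phi> z) i) <= e0"
    "!!i. i < mdim X ==> cmod (y i - y' i) <= \<mu>" "i < mdim X" for p q z y y' \<mu> i
   using tbD[OF h(1-4), OF h(5,7)] h(6,8,9,10) by simp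
  show "cmod (\<Sum>j<mdim X. pd j (%y. \<psi> q (inv_into (V p) (\<psi> p) y) i) y * g j) <= 1 / e0 * M"
   if h: "p \<in> J" "q \<in> J" "z \<in> ball p (3 * d p)" "z \<in> ball q (3 * d q)" "y \<in> CS (mdim X)"
    "!!i. i < mdim X ==> cmod (y i - \<psi> p (\<phi> z) i) <= e0" "!!j. j < mdim X ==> cmod (g j) <= M" "i < mdim X" for p q z y g M i
   using tbD[OF h(1-4), OF h(5,6)] h(7,8) by simp
  show "cmod (dbar (%z. complex_of_real (\<theta> p z)) z) <= C" if "p \<in> J" "cmod z < 1" for p z
   using c[OF that(1), of z] C(2)[OF that(1)] that(2) by simp
 qed (use X J J0 \<delta> VJ(1) e0 \<omega> \<theta> C in auto)
 have \<phi>V: "\<phi> z \<in> V p" if "p \<in> J" "z \<in> ball p (3 * d p)" for p z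
  using VJ(3)[OF that(1)] that(2) ball_subset_cball[of p "3 * d p"] by blast
 have c00: "V 0 = V0" "\<psi> 0 = \<psi>0" using VJ(5)[OF J0] by auto
 from perturb[OF hd \<phi>V cov r(1) R1(1) less_imp_le[OF R1(2)]]
 obtain \<epsilon> where \<epsilon>: "\<epsilon> > 0" and pert: "!!a b. (!!i. i < n ==> cmod (a i - \<psi>0 (\<phi> 0) i) <= \<epsilon> & cmod (b i - deriv (%t. \<psi>0 (\<phi> t) i) 0) <= \<epsilon>) ==>
  EX u. (ALL p:J. ALL z:T p r. u z \<in> V p) & (ALL p:J. ALL i<n. co p u i holomorphic_on T p r) &
  (ALL i<n. \<psi>0 (u 0) i = a i & deriv (%t. \<psi>0 (u t) i) 0 = b i)" unfolding c00 by blast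
 show ?thesis
 proof (intro exI[of _ \<epsilon>] conjI \<epsilon> allI impI)
  fix a b assume "ALL i<n. cmod (a i - \<psi>0 (\<phi> 0) i) <= \<epsilon> & cmod (b i - deriv (%t. \<psi>0 (\<phi> t) i) 0) <= \<epsilon>"
  then obtain u where u: "!!p z. p \<in> J ==> z \<in> T p r ==> u z \<in> V p" "!!p i. p \<in> J ==> i < n ==> co p u i holomorphic_on T p r"
   "!!i. i < n ==> \<psi>0 (u 0) i = a i & deriv (%t. \<psi>0 (u t) i) 0 = b i" using pert[of a b] by blast
  let ?g = "%t. u (of_real r * t)"
  have "hdisc X ?g"
  proof (rule disc_mapI[OF X])
   fix t :: complex assume t: "t \<in> ball 0 1"
   have rt: "of_real r * t \<in> ball 0 r" using t r by (simp add: norm_mult)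
   then obtain p where p: "p \<in> J" "of_real r * t \<in> cball p (d p)" using cov R1 by (force simp: subset_iff)
   let ?S = "(%t. of_real r * t) -` T p r"
   have "open ?S" by (intro open_vimage T_open continuous_intros)
   moreover have "t \<in> ?S" using p rt dpos[OF p(1)] by (auto simp: T_def)
   moreover have "?S \<subseteq> ball 0 1" using r by (auto simp: T_def norm_mult)
   moreover have "?g ` ?S \<subseteq> V p" using u(1)[OF p(1)] by auto
   moreover have "(%s. \<psi> p (?g s) i) holomorphic_on ?S" if "i < n" for i
    using holomorphic_on_compose_gen[of "%t. of_real r * t" ?S "co p u i" "T p r"] u(2)[OF p(1) that]
    by (auto simp: o_def intro!: holomorphic_intros)
   ultimately show "EX V \<psi> S. (V, \<psi>) \<in> atlas X & open S & t \<in> S & S \<subseteq> ball 0 1 & ?g ` S \<subseteq> V & (ALL i<n. (%s. \<psi> (?g s) i) holomorphic_on S)"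
    using VJ(1)[OF p(1)] by (intro exI[of _ "V p"] exI[of _ "\<psi> p"] exI[of _ ?S]) simp
  qed
  moreover have z0: "0 \<in> T 0 r" using r VJ(2)[OF J0] by (simp add: T_def)
  then have "?g 0 \<in> V0" using u(1)[OF J0] c00 by simp
  moreover have "\<psi>0 (?g 0) i = a i" "deriv (%t. \<psi>0 (?g t) i) 0 = of_real r * b i" if i: "i < n" for i
  proof -
   show "\<psi>0 (?g 0) i = a i" using u(3)[OF i] by simp
   have "((%t. \<psi>0 (u t) i) has_field_derivative b i) (at (of_real r * 0))"
    using holomorphic_derivI[OF u(2)[OF J0 i] T_open z0] u(3)[OF i] c00 by simp
   moreover have "((%t. of_real r * t) has_field_derivative of_real r) (at 0)" by (auto intro!: derivative_eq_intros)
   ultimately have "((%t. \<psi>0 (u (of_real r * t)) i) has_field_derivative b i * of_real r) (at 0)" by (rule DERIV_chain2)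
   then show "deriv (%t. \<psi>0 (?g t) i) 0 = of_real r * b i" by (simp add: DERIV_imp_deriv mult.commute)
  qed
  ultimately show "EX g. hdisc X g & g 0 \<in> V0 & (ALL i<n. \<psi>0 (g 0) i = a i & deriv (%t. \<psi>0 (g t) i) 0 = of_real r * b i)"
   by (intro exI[of _ ?g]) simp
 qed
qed

section \<open>The Kobayashi pseudometric\<close>

abbreviation km :: "'a cmanifold => 'a => 'a tangent_vector => real" where
 "km \<equiv> kobayashi_metric"

lemma km_le:
 assumes "hdisc X \<phi>" "\<phi> 0 = x" "differential unit_disc X \<phi> 0 (disc_vector \<xi>) = v"
 shows "km X x v <= cmod \<xi>"
 unfolding kobayashi_metric_def
 by (rule cInf_lower) (use assms in \<open>auto intro!: bdd_belowI[of _ 0]\<close>)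

lemma differential_discI:
 assumes X: "complex_manifold X" and f: "hdisc X f" and c: "(V, \<psi>) \<in> charts_at X (f 0)" and v: "v \<in> tangent_space X (f 0)"
  and eq: "!!i. i < mdim X ==> deriv (%t. \<psi> (f t) i) 0 * \<xi> = v (V, \<psi>) i"
 shows "differential unit_disc X f 0 (disc_vector \<xi>) = v"
proof -
 have d: "differential unit_disc X f 0 (disc_vector \<xi>) \<in> tangent_space X (f 0)"
  by (rule differential_tangent[OF complex_manifold_unit_disc X f _ disc_vector_tangent]) simp
 show ?thesis
 proof (rule tangent_eqI[OF d v c])
  show "differential unit_disc X f 0 (disc_vector \<xi>) (V, \<psi>) = v (V, \<psi>)"
  proof
   fix i
   show "differential unit_disc X f 0 (disc_vector \<xi>) (V, \<psi>) i = v (V, \<psi>) i"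
    using tangent_spaceD(1)[OF d c] tangent_spaceD(1)[OF v c] differential_disc[OF X f c, of i \<xi>] eq[of i]
    by (cases "i < mdim X") (auto simp: CS_def)
  qed
 qed
qed

text \<open>A complex line in a chart, run slowly enough to stay inside, has the given tangent
  direction. So the infimum defining the metric is over a nonempty set.\<close>

lemma km_competitor:
 assumes X: "complex_manifold X" and x: "x \<in> pts X" and v: "v \<in> tangent_space X x"
 obtains \<xi> \<phi> where "hdisc X \<phi>" "\<phi> 0 = x" "differential unit_disc X \<phi> 0 (disc_vector \<xi>) = v"
proof -
 obtain U \<psi> where c: "(U, \<psi>) \<in> atlas X" "x \<in> U" using chart_exists[OF X x] .
 let ?n = "mdim X" and ?z = "\<psi> x" and ?c = "v (U, \<psi>)"
 have cx: "(U, \<psi>) \<in> charts_at X x" using c by (simp add: charts_at_iff)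
 have zC: "?z \<in> CS ?n" by (rule chart_CS[OF X c])
 have cC: "?c \<in> CS ?n" by (rule tangent_spaceD(1)[OF v cx])
 obtain e where e: "e > 0" "pdisc ?n ?z e \<subseteq> \<psi> ` U" using openin_contains_pdisc[OF chart_open(2)[OF X c(1)], of ?z] c by blast
 \<comment> \<open>The scale that fits all coordinates of the line into the polydisc of radius
   \<open>e\<close>; the added 1 makes the bound strict and covers the zero vector.\<close>
 define s where "s = e / (1 + (\<Sum>i<?n. cmod (?c i)))"
 have S: "1 + (\<Sum>i<?n. cmod (?c i)) > 0" by (intro add_pos_nonneg sum_nonneg) auto
 have s: "s > 0" using e S by (simp add: s_def)
 have sc: "s * cmod (?c i) < e" if "i < ?n" for i
 proof -
  have "cmod (?c i) < 1 + (\<Sum>i<?n. cmod (?c i))"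
   using member_le_sum[of i "{..<?n}" "%i. cmod (?c i)"] that by simp
  then have "s * cmod (?c i) < s * (1 + (\<Sum>i<?n. cmod (?c i)))" using s by simp
  also have "... = e" using S by (simp add: s_def)
  finally show ?thesis .
 qed
 define y where "y t = (%i. ?z i + t * (of_real s * ?c i))" for t
 have y: "y t \<in> \<psi> ` U" if "t \<in> ball 0 1" for t
 proof -
  have "y t \<in> pdisc ?n ?z e"
   unfolding pdisc_def
  proof (intro CollectI conjI allI impI)
   show "y t \<in> CS ?n" using zC cC by (simp add: y_def CS_def)
   fix i assume i: "i < ?n"
   have "cmod t * (s * cmod (?c i)) <= 1 * (s * cmod (?c i))" using that s by (intro mult_right_mono) auto
   moreover have "dist (y t i) (?z i) = cmod t * (s * cmod (?c i))" using s by (simp add: y_def dist_norm norm_mult)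
   ultimately show "dist (y t i) (?z i) < e" using sc[OF i] by linarith
  qed
  then show ?thesis using e(2) by blast
 qed
 define \<phi> where "\<phi> t = inv_into U \<psi> (y t)" for t
 have \<phi>: "\<phi> t \<in> U" "\<psi> (\<phi> t) = y t" if "t \<in> ball 0 1" for t
  using y[OF that] by (auto simp: \<phi>_def inv_into_into f_inv_into_f)
 have h: "hdisc X \<phi>"
 proof (rule disc_mapI[OF X])
  fix t :: complex assume t: "t \<in> ball 0 1"
  have "(%s. \<psi> (\<phi> s) i) holomorphic_on ball 0 1" for i
   by (rule holomorphic_transform[of "%s. y s i"]) (use \<phi>(2) in \<open>auto simp: y_def intro!: holomorphic_intros\<close>)
  then show "EX V \<psi> S. (V, \<psi>) \<in> atlas X & open S & t \<in> S & S \<subseteq> ball 0 1 & \<phi> ` S \<subseteq> V & (ALL i<?n. (%s. \<psi> (\<phi> s) i) holomorphic_on S)"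
   using c(1) t \<phi>(1) by (intro exI[of _ U] exI[of _ \<psi>] exI[of _ "ball 0 1"]) auto
 qed
 have y0: "y 0 = ?z" by (simp add: y_def)
 have \<phi>0: "\<phi> 0 = x" unfolding \<phi>_def y0 by (rule chart_inv[OF X c])
 have "differential unit_disc X \<phi> 0 (disc_vector (of_real (1 / s))) = v"
 proof (rule differential_discI[OF X h])
  show "(U, \<psi>) \<in> charts_at X (\<phi> 0)" "v \<in> tangent_space X (\<phi> 0)" using cx v \<phi>0 by simp_all
  fix i
  have "((%t. y t i) has_field_derivative of_real s * ?c i) (at 0)" unfolding y_def by (auto intro!: derivative_eq_intros)
  then have "((%t. \<psi> (\<phi> t) i) has_field_derivative of_real s * ?c i) (at 0)"
   by (rule has_field_derivative_transform_within_open[of _ _ _ "ball 0 1"]) (use \<phi>(2) in auto)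
  then show "deriv (%t. \<psi> (\<phi> t) i) 0 * of_real (1 / s) = ?c i" using s by (simp add: DERIV_imp_deriv)
 qed
 then show thesis using that h \<phi>0 by blast
qed

lemma km_lessD:
 assumes X: "complex_manifold X" and x: "x \<in> pts X" and v: "v \<in> tangent_space X x" and c: "km X x v < c"
 obtains \<xi> \<phi> where "hdisc X \<phi>" "\<phi> 0 = x" "differential unit_disc X \<phi> 0 (disc_vector \<xi>) = v" "cmod \<xi> < c"
proof -
 obtain \<xi>0 \<phi>0 where "hdisc X \<phi>0" "\<phi>0 0 = x" "differential unit_disc X \<phi>0 0 (disc_vector \<xi>0) = v"
  using km_competitor[OF X x v] .
 then have "{cmod \<xi> | \<xi> \<phi>. hdisc X \<phi> & \<phi> 0 = x & differential unit_disc X \<phi> 0 (disc_vector \<xi>) = v} ~= {}" by blast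
 from cInf_lessD[OF this c[unfolded kobayashi_metric_def]] show thesis using that by blast
qed

lemma km_contract:
 assumes X: "complex_manifold X" and Y: "complex_manifold Y" and f: "holomorphic_map X Y f"
  and x: "x \<in> pts X" and v: "v \<in> tangent_space X x"
 shows "km Y (f x) (differential X Y f x v) <= km X x v"
proof (rule dense_ge)
 fix c assume "km X x v < c"
 from km_lessD[OF X x v this] obtain \<xi> \<phi> where \<phi>: "hdisc X \<phi>" "\<phi> 0 = x" "differential unit_disc X \<phi> 0 (disc_vector \<xi>) = v" "cmod \<xi> < c" .
 have "differential unit_disc Y (%t. f (\<phi> t)) 0 (disc_vector \<xi>) = differential X Y f x v"
  using differential_compose[OF complex_manifold_unit_disc X Y \<phi>(1) f _ disc_vector_tangent, of \<xi>] \<phi>(2,3) by simp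
 from km_le[OF holomorphic_map_compose[OF complex_manifold_unit_disc X Y \<phi>(1) f] _ this, of "f x"]
 show "km Y (f x) (differential X Y f x v) <= c" using \<phi>(2,4) by simp
qed

lemma km_aut:
 assumes X: "complex_manifold X" and g: "automorphism X g" and x: "x \<in> pts X" and v: "v \<in> tangent_space X x"
 shows "km X (g x) (differential X X g x v) = km X x v"
proof (rule antisym[OF km_contract[OF X X aut_hol[OF g] x v]])
 let ?i = "inv_into (pts X) g" and ?w = "differential X X g x v"
 have w: "?w \<in> tangent_space X (g x)" by (rule differential_tangent[OF X X aut_hol[OF g] x v])
 have "differential X X ?i (g x) ?w = differential X X (%x. ?i (g x)) x v"
  by (rule differential_compose[OF X X X aut_hol[OF g] aut_hol[OF aut_inv[OF X g]] x v, symmetric])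
 also have "... = v" by (rule differential_id[OF X x v aut_inv_simps(2)[OF g]])
 finally show "km X x v <= km X (g x) ?w"
  using km_contract[OF X X aut_hol[OF aut_inv[OF X g]] aut_inv_simps(4)[OF g x] w] aut_inv_simps(2)[OF g x] by simp
qed

text \<open>Royden's theorem: after a slight shrinking, a competing disc can be moved to every nearby 1-jet.\<close>

lemma km_upper_semicontinuous:
 assumes X: "complex_manifold X" and c: "(V, \<psi>) \<in> atlas X" "x \<in> V" and v: "v \<in> tangent_space X x" and b: "km X x v < b"
 shows "EX \<epsilon>>0. ALL y:V. ALL w:tangent_space X y.
  (ALL i<mdim X. cmod (\<psi> y i - \<psi> x i) <= \<epsilon> & cmod (w (V, \<psi>) i - v (V, \<psi>) i) <= \<epsilon>) --> km X y w < b"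
proof -
 have x: "x \<in> pts X" using c chart_subset[OF X c(1)] by blast
 have cx: "(V, \<psi>) \<in> charts_at X x" using c by (simp add: charts_at_iff)
 \<comment> \<open>A nonzero \<xi> is needed for division. If the competitor has \<xi> = 0, then
   \<open>v\<close> is 0, and the constant disc with \<xi> = b/2 competes as well.\<close>
 have "EX \<xi> \<phi>. hdisc X \<phi> & \<phi> 0 = x & (ALL i<mdim X. deriv (%t. \<psi> (\<phi> t) i) 0 * \<xi> = v (V, \<psi>) i) & \<xi> ~= 0 & cmod \<xi> < b"
 proof -
  obtain \<xi> \<phi> where \<phi>: "hdisc X \<phi>" "\<phi> 0 = x" "differential unit_disc X \<phi> 0 (disc_vector \<xi>) = v" "cmod \<xi> < b"
   using km_lessD[OF X x v b] .
  have d: "deriv (%t. \<psi> (\<phi> t) i) 0 * \<xi> = v (V, \<psi>) i" if "i < mdim X" for i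
   using differential_disc[OF X \<phi>(1), of V \<psi> i \<xi>] \<phi>(2,3) cx that by simp
  show ?thesis
  proof (cases "\<xi> = 0")
   case False
   then show ?thesis using \<phi> d by blast
  next
   case True
   have h: "hdisc X (%_. x)"
    by (rule disc_mapI[OF X], rule exI[of _ V], rule exI[of _ \<psi>], rule exI[of _ "ball 0 1"]) (use c in \<open>auto intro: holomorphic_intros\<close>)
   have "b > 0" using \<phi>(4) True by simp
   then show ?thesis using h d True
    by (intro exI[of _ "of_real (b / 2)"] exI[of _ "%_. x"]) auto
  qed
 qed
 then obtain \<xi> \<phi> where \<phi>: "hdisc X \<phi>" "\<phi> 0 = x" "!!i. i < mdim X ==> deriv (%t. \<psi> (\<phi> t) i) 0 * \<xi> = v (V, \<psi>) i"
  and \<xi>: "\<xi> ~= 0" "cmod \<xi> < b" by blast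
 have b0: "b > 0" using \<xi>(2) norm_ge_zero[of \<xi>] by linarith
 \<comment> \<open>Rescaling will replace \<xi> by \<xi> / r; this choice keeps its modulus below
   \<open>b\<close>.\<close>
 obtain r where r: "cmod \<xi> / b < r" "r < 1" using dense[of "cmod \<xi> / b" 1] \<xi>(2) b0 by auto
 have r0: "r > 0" using r(1) b0 by (meson divide_nonneg_pos le_less_trans norm_ge_zero)
 have \<phi>V: "\<phi> 0 \<in> V" using \<phi>(2) c by simp
 from disc_perturbation[OF X \<phi>(1) c(1) \<phi>V r0 r(2)] obtain \<epsilon> where \<epsilon>: "\<epsilon> > 0" and
  P: "!!a b. (!!i. i < mdim X ==> cmod (a i - \<psi> (\<phi> 0) i) <= \<epsilon> & cmod (b i - deriv (%t. \<psi> (\<phi> t) i) 0) <= \<epsilon>) ==>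
  EX g. hdisc X g & g 0 \<in> V & (ALL i<mdim X. \<psi> (g 0) i = a i & deriv (%t. \<psi> (g t) i) 0 = of_real r * b i)" by blast
 \<comment> \<open>The second term accounts for dividing the difference of the tangent vectors by
   \<xi>.\<close>
 let ?e = "min \<epsilon> (\<epsilon> * cmod \<xi>)"
 have "km X y w < b" if y: "y \<in> V" and w: "w \<in> tangent_space X y"
  and near: "ALL i<mdim X. cmod (\<psi> y i - \<psi> x i) <= ?e & cmod (w (V, \<psi>) i - v (V, \<psi>) i) <= ?e" for y w
 proof -
  have "EX g. hdisc X g & g 0 \<in> V & (ALL i<mdim X. \<psi> (g 0) i = \<psi> y i & deriv (%t. \<psi> (g t) i) 0 = of_real r * (w (V, \<psi>) i / \<xi>))"
  proof (rule P)
   fix i assume i: "i < mdim X"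
   have n: "cmod (\<psi> y i - \<psi> x i) <= \<epsilon>" "cmod (w (V, \<psi>) i - v (V, \<psi>) i) <= \<epsilon> * cmod \<xi>" using near i by auto
   have "w (V, \<psi>) i / \<xi> - deriv (%t. \<psi> (\<phi> t) i) 0 = (w (V, \<psi>) i - v (V, \<psi>) i) / \<xi>"
    using \<phi>(3)[OF i] \<xi>(1) by (simp add: field_simps)
   then have "cmod (w (V, \<psi>) i / \<xi> - deriv (%t. \<psi> (\<phi> t) i) 0) <= \<epsilon>"
    using n(2) \<xi>(1) by (simp add: norm_divide divide_le_eq)
   then show "cmod (\<psi> y i - \<psi> (\<phi> 0) i) <= \<epsilon> & cmod (w (V, \<psi>) i / \<xi> - deriv (%t. \<psi> (\<phi> t) i) 0) <= \<epsilon>" using n(1) \<phi>(2) by simp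
  qed
  then obtain g where g: "hdisc X g" "g 0 \<in> V" "!!i. i < mdim X ==> \<psi> (g 0) i = \<psi> y i"
   "!!i. i < mdim X ==> deriv (%t. \<psi> (g t) i) 0 = of_real r * (w (V, \<psi>) i / \<xi>)" by blast
  have "\<psi> (g 0) = \<psi> y"
  proof
   fix i show "\<psi> (g 0) i = \<psi> y i"
    using g(3) chart_CS[OF X c(1) g(2)] chart_CS[OF X c(1) y] by (cases "i < mdim X") (auto simp: CS_def)
  qed
  from arg_cong[OF this, of "inv_into V \<psi>"] have g0: "g 0 = y"
   unfolding chart_inv[OF X c(1) g(2)] chart_inv[OF X c(1) y] .
  have "differential unit_disc X g 0 (disc_vector (\<xi> / of_real r)) = w"
   by (rule differential_discI[OF X g(1), of V \<psi>]) (use g0 y c w g(4) \<xi>(1) r0 in \<open>auto simp: charts_at_iff\<close>)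
  from km_le[OF g(1) g0 this] have "km X y w <= cmod \<xi> / r" using r0 by (simp add: norm_divide)
  also have "... < b" using r(1) r0 b0 by (simp add: divide_less_eq mult.commute)
  finally show ?thesis .
 qed
 then show ?thesis using \<epsilon> \<xi>(1) by (intro exI[of _ ?e]) auto
qed

text \<open>By \<open>holomorphic_limit\<close> the partial derivatives converge along with the
  values, so the image vectors converge in a chart and upper semicontinuity at the limit vector
  gives the bound.\<close>

lemma km_limit:
 assumes X: "complex_manifold X" and h: "kobayashi_hyperbolic X" and U: "U ~= bot"
  and hol: "\<forall>\<^sub>F k in U. holomorphic_map X X (g k)" and lim: "!!y. y \<in> pts X ==> klim X (%k. g k y) (G y) U"
  and x: "x \<in> pts X" and v: "v \<in> tangent_space X x" and b: "km X (G x) (differential X X G x v) < b"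
 shows "\<forall>\<^sub>F k in U. km X (g k x) (differential X X (g k) x v) < b"
proof -
 let ?n = "mdim X"
 have G: "holomorphic_map X X G" by (rule holomorphic_limit(1)[OF X X h U hol lim])
 obtain A \<alpha> where A: "(A, \<alpha>) \<in> atlas X" "x \<in> A" using chart_exists[OF X x] .
 obtain V \<psi> where V: "(V, \<psi>) \<in> atlas X" "G x \<in> V" using chart_exists[OF X hol_pts[OF G x]] .
 have Ax: "(A, \<alpha>) \<in> charts_at X x" using A by (simp add: charts_at_iff)
 have wt: "differential X X G x v \<in> tangent_space X (G x)" by (rule differential_tangent[OF X X G x v])
 obtain \<epsilon> where \<epsilon>: "\<epsilon> > 0" and us: "!!y w. y \<in> V ==> w \<in> tangent_space X y ==>
  (!!i. i < ?n ==> cmod (\<psi> y i - \<psi> (G x) i) <= \<epsilon> & cmod (w (V, \<psi>) i - differential X X G x v (V, \<psi>) i) <= \<epsilon>) ==> km X y w < b"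
  using km_upper_semicontinuous[OF X V wt b] by blast
 have df: "differential X X f x v (V, \<psi>) i = (\<Sum>j<?n. pd j (%z. \<psi> (f (inv_into A \<alpha> z)) i) (\<alpha> x) * v (A, \<alpha>) j)"
  if "holomorphic_map X X f" "f x \<in> V" for f i
  using differential_chart[OF X X that(1) x v Ax, of V \<psi>] that(2) V(1) by (simp add: charts_at_iff jacobian_mult_pd)
 have evV: "\<forall>\<^sub>F k in U. g k x \<in> V" by (rule klim_chart(1)[OF X h lim[OF x] V])
 have e1: "\<forall>\<^sub>F k in U. ALL i:{..<?n}. dist (\<psi> (g k x) i) (\<psi> (G x) i) < \<epsilon>"
  by (rule eventually_ball_finite[OF finite_lessThan]) (use tendstoD[OF klim_chart(2)[OF X h lim[OF x] V] \<epsilon>] in auto)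
 have e2: "\<forall>\<^sub>F k in U. ALL i:{..<?n}. dist (\<Sum>j<?n. pd j (%z. \<psi> (g k (inv_into A \<alpha> z)) i) (\<alpha> x) * v (A, \<alpha>) j)
   (\<Sum>j<?n. pd j (%z. \<psi> (G (inv_into A \<alpha> z)) i) (\<alpha> x) * v (A, \<alpha>) j) < \<epsilon>"
 proof (rule eventually_ball_finite[OF finite_lessThan], rule ballI, rule tendstoD[OF _ \<epsilon>])
  fix i assume i: "i \<in> {..<?n}"
  show "((%k. \<Sum>j<?n. pd j (%z. \<psi> (g k (inv_into A \<alpha> z)) i) (\<alpha> x) * v (A, \<alpha>) j) \<longlongrightarrow>
    (\<Sum>j<?n. pd j (%z. \<psi> (G (inv_into A \<alpha> z)) i) (\<alpha> x) * v (A, \<alpha>) j)) U"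
   by (intro tendsto_sum tendsto_mult tendsto_const holomorphic_limit(2)[OF X X h U hol lim x A V]) (use i in auto)
 qed
 show ?thesis
  using evV e1 e2 hol
 proof eventually_elim
  case (elim k)
  show ?case
  proof (rule us[OF elim(1) differential_tangent[OF X X elim(4) x v]])
   fix i assume i: "i < ?n"
   then show "cmod (\<psi> (g k x) i - \<psi> (G x) i) <= \<epsilon> &
     cmod (differential X X (g k) x v (V, \<psi>) i - differential X X G x v (V, \<psi>) i) <= \<epsilon>"
    using elim(2,3) df[OF elim(4,1)] df[OF G V(2)] by (force simp: dist_norm)
  qed
 qed
qed

context iteration begin

text \<open>The scheme of \<open>dist_limit\<close>, with differentials composed by the chain rule.
  Here the upper bound comes from semicontinuity instead of continuity, which suffices because the
  lower bound holds for every \<open>M\<close>.\<close>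

lemma metric_limit:
 assumes N: "N \<in> MI" and x: "x \<in> pts X" and v: "v \<in> tangent_space X x"
 shows "((%M. km X (F M x) (differential X X (F M) x v)) \<longlongrightarrow> km Z (\<beta> N x) (differential X Z (\<beta> N) x v)) (multi_at_top k)"
proof (rule multi_at_top_limit)
 fix M assume M: "M \<in> MI"
 note bh = \<beta>_hol_Z[OF mplus_indices[OF N M]]
 have "differential X Z (\<beta> N) x v = differential X Z (%x. \<beta> (mplus N M) (F M x)) x v"
  by (rule fun_cong[OF differential_cong[OF X x]]) (rule \<beta>_shift[OF N M, symmetric])
 also have "... = differential X Z (\<beta> (mplus N M)) (F M x) (differential X X (F M) x v)"
  by (rule differential_compose[OF X X Z Fhol bh x v])
 finally show "km Z (\<beta> N x) (differential X Z (\<beta> N) x v) <= km X (F M x) (differential X X (F M) x v)"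
  using km_contract[OF X Z bh FX[OF x, of M] differential_tangent[OF X X Fhol x v]] \<beta>_shift[OF N M x] by simp
next
 fix M M' :: "nat => nat" assume "M <= M'"
 then have e: "mplus (mminus M' M) M = M'" using mplus_mminus[of M M'] by (simp add: add.commute)
 have FF: "F M' u = F (mminus M' M) (F M u)" if "u \<in> pts X" for u
  using Fadd[OF that, of "mminus M' M" M] e by simp
 have "differential X X (F M') x v = differential X X (%x. F (mminus M' M) (F M x)) x v"
  by (rule fun_cong[OF differential_cong[OF X x]]) (rule FF)
 also have "... = differential X X (F (mminus M' M)) (F M x) (differential X X (F M) x v)"
  by (rule differential_compose[OF X X X Fhol Fhol x v])
 finally show "km X (F M' x) (differential X X (F M') x v) <= km X (F M x) (differential X X (F M) x v)"
  using km_contract[OF X X Fhol FX[OF x, of M] differential_tangent[OF X X Fhol x v]] FF[OF x] by simp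
next
 fix e :: real assume e: "e > 0"
 let ?c = "km Z (\<beta> N x) (differential X Z (\<beta> N) x v)"
 have bZ: "\<beta> N x \<in> pts Z" by (rule hol_pts[OF \<beta>_hol_Z[OF N] x])
 have "differential X X (\<beta> N) x v = differential Z X (%z. z) (\<beta> N x) (differential X Z (\<beta> N) x v)"
  using differential_compose[OF X Z X \<beta>_hol_Z[OF N] Z_inc x v] by simp
 then have "km X (\<beta> N x) (differential X X (\<beta> N) x v) <= ?c"
  using km_contract[OF Z X Z_inc bZ differential_tangent[OF X Z \<beta>_hol_Z[OF N] x v]] by simp
 then have b: "km X (\<beta> N x) (differential X X (\<beta> N) x v) < ?c + e" using e by linarith
 have gh: "holomorphic_map X X (%x. a M (F (mminus M N) x))" for M
  by (rule holomorphic_map_compose[OF X X X Fhol aut_hol[OF aut]])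
 have "\<forall>\<^sub>F M in U. km X (a M (F (mminus M N) x)) (differential X X (%x. a M (F (mminus M N) x)) x v) < ?c + e"
  by (rule km_limit[where g="%M x. a M (F (mminus M N) x)", OF X hyp Ubot always_eventually \<beta>_lim[OF N] x v b]) (use gh in auto)
 moreover have "km X (a M (F (mminus M N) x)) (differential X X (%x. a M (F (mminus M N) x)) x v) =
   km X (F (mminus M N) x) (differential X X (F (mminus M N)) x v)" for M
  using km_aut[OF X aut FX[OF x] differential_tangent[OF X X Fhol x v]]
   differential_compose[OF X X X Fhol aut_hol[OF aut] x v] by simp
 ultimately have "\<forall>\<^sub>F M in U. km X (F (mminus M N) x) (differential X X (F (mminus M N)) x v) < ?c + e" by simp
 with ev_MI have "\<forall>\<^sub>F M in U. M \<in> MI & km X (F (mminus M N) x) (differential X X (F (mminus M N)) x v) < ?c + e"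
  by eventually_elim simp
 from eventually_happens'[OF Ubot this]
 show "EX M:MI. km X (F M x) (differential X X (F M) x v) < ?c + e" using mminus_indices by blast
qed

end

theorem theorem2p17:
  fixes X :: "'a cmanifold" and k :: nat and f :: "nat \<Rightarrow> 'a \<Rightarrow> 'a"
  assumes "complex_manifold X" and "cocompact X" and "kobayashi_hyperbolic X"
    and "k \<ge> 1"
    and "\<forall>j<k. holomorphic_map X X (f j)"
    and "commuting_on (pts X) k f"
  shows "\<exists>(Z :: 'a cmanifold) (l :: 'a \<Rightarrow> 'a) (T :: nat \<Rightarrow> 'a \<Rightarrow> 'a).
    csm TYPE('c) X k f Z l T \<and> holomorphic_retract Z X \<and>
    (\<forall>N\<in>multi_indices k.
       (\<forall>x\<in>pts X. \<forall>y\<in>pts X.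
          ((\<lambda>M. kobayashi_dist X (tuple_pow f M k x) (tuple_pow f M k y)) \<longlongrightarrow>
             kobayashi_dist Z (tuple_pow_inv Z T N k (l x)) (tuple_pow_inv Z T N k (l y)))
          (multi_at_top k)) \<and>
       (\<forall>x\<in>pts X. \<forall>v\<in>tangent_space X x.
          ((\<lambda>M. kobayashi_metric X (tuple_pow f M k x)
                  (differential X X (tuple_pow f M k) x v)) \<longlongrightarrow>
             kobayashi_metric Z (tuple_pow_inv Z T N k (l x))
               (differential X Z (tuple_pow_inv Z T N k \<circ> l) x v))
          (multi_at_top k)))"
proof -
 have "pts X ~= {}" using assms(1) by (simp add: complex_manifold_def)
 then obtain x0 where x0: "x0 \<in> pts X" by blast
 obtain U where U: "ultra U" "U <= multi_at_top k" using ultra_exists[OF multi_at_top_nontrivial] .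
 obtain K0 \<delta> where K: "compactin (mtop X) K0" "!!x. x \<in> pts X ==> EX g. automorphism X g & g x \<in> K0" "\<delta> > 0"
  "!!x. x \<in> pts X ==> EX K. compactin (mtop X) K & {y \<in> pts X. kd X x y < \<delta>} \<subseteq> K"
  by (rule cocompact_uniform[OF assms(1,2,3)]) (rule that, assumption+)
 have "tuple_pow f M k x0 \<in> pts X" for M
  by (rule hol_pts[OF tuple_pow_holomorphic[OF assms(1)] x0]) (use assms(5) in blast)
 then have "ALL M. EX g. automorphism X g & g (tuple_pow f M k x0) \<in> K0" using K(2) by blast
 from choice[OF this] obtain a where a: "!!M. automorphism X (a M)" "!!M. a M (tuple_pow f M k x0) \<in> K0" by blast
 interpret iteration X k f U a \<delta> x0 K0
  by unfold_locales (use assms x0 U K a in auto)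
 \<comment> \<open>The composite and \<open>\<beta> N\<close> agree on the points of
   \<open>X\<close> only, so the congruence rule for differentials is needed.\<close>
 have eq: "differential X Z (tuple_pow_inv Z T N k \<circ> l) x = differential X Z (\<beta> N) x" if "N \<in> MI" "x \<in> pts X" for N x
  by (rule differential_cong[OF X that(2)]) (use T_inv_l[OF that(1)] in simp)
 show ?thesis
  by (intro exI[of _ Z] exI[of _ l] exI[of _ T] conjI ballI csm_Z Z_retract)
   (use dist_limit metric_limit T_inv_l eq in simp_all)
qed

end
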